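(* Let $(a,b)\subset\mathbb{R}$ be a finite interval and let $p,q,r$ be Lebesgue measurable functions on $(a,b)$ with $r>0$ a.e., $r\in L^1((a,b);dx)$; $p>0$ a.e., $1/p\in L^1((a,b);dx)$; $q$ real-valued a.e., $q\in L^1((a,b);dx)$. Let $\alpha,\beta\in[0,\pi)$, consider the self-adjoint operator $T_{\alpha,\beta}$ with separated boundary conditions, and let $m_0\in\{0,1\}$ denote the multiplicity of zero as an eigenvalue of $T_{\alpha,\beta}$. For $k\in\mathbb{N}_0$ put $$a_k=\cos\alpha\,\big[\cos\beta\,\phi_k(b)-\sin\beta\,\phi_k^{[1]}(b)\big]-\sin\alpha\,\big[\cos\beta\,\theta_k(b)-\sin\beta\,\theta_k^{[1]}(b)\big].$$ Then for all $n\in\mathbb{N}$, $$\zeta(n;T_{\alpha,\beta})=-\operatorname{Res}\left[z^{-n}\frac{d}{dz}\ln(F_{\alpha,\beta}(z));\ z=0\right]=-n\,b_n,$$ where $$b_1=\frac{a_{1+m_0}}{a_{m_0}},\qquad b_j=\frac{a_{j+m_0}}{a_{m_0}}-\sum_{\ell=1}^{j-1}\frac{\ell}{j}\,\frac{a_{j-\ell+m_0}}{a_{m_0}}\,b_\ell,\quad j\in\mathbb{N},\ j\ge2.$$ In particular, if zero is not an eigenvalue of $T_{\alpha,\beta}$, then $$\operatorname{tr}_{L^2((a,b);r\,dx)}\big(T_{\alpha,\beta}^{-1}\big)=\zeta(1;T_{\alpha,\beta})=-\frac{\cos\alpha\,[\cos\beta\,\phi_1(b)-\sin\beta\,\ph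i_1^{[1]}(b)]-\sin\alpha\,[\cos\beta\,\theta_1(b)-\sin\beta\,\theta_1^{[1]}(b)]}{\cos\alpha\,[\cos\beta\,\phi_0(b)-\sin\beta\,\phi_0^{[1]}(b)]-\sin\alpha\,[\cos\beta\,\theta_0(b)-\sin\beta\,\theta_0^{[1]}(b)]}.$$
   Context: The differential expression is $\tau=\frac{1}{r(x)}\left[-\frac{d}{dx}p(x)\frac{d}{dx}+q(x)\right]$ on $(a,b)$; $y^{[1]}=py'$. In $L^2((a,b);r\,dx)$, $T_{max}f=\tau f$ with $\mathrm{dom}(T_{max})=\{g\in L^2((a,b);r\,dx)\mid g,g^{[1]}\in AC([a,b]),\ \tau g\in L^2((a,b);r\,dx)\}$. $T_{\alpha,\beta}$ is the restriction of $T_{max}$ to those $g$ with $g(a)\cos\alpha+g^{[1]}(a)\sin\alpha=0$ and $g(b)\cos\beta-g^{[1]}(b)\sin\beta=0$; it is self-adjoint, bounded from below, with purely discrete spectrum. $\theta(z,x,a),\phi(z,x,a)$ are the solutions of $\tau y=zy$ with $\theta(z,a,a)=\phi^{[1]}(z,a,a)=1$, $\theta^{[1]}(z,a,a)=\phi(z,a,a)=0$, and $$F_{\alpha,\beta}(z)=\cos\alpha\,[-\sin\beta\,\phi^{[1]}(z,b,a)+\cos\beta\,\phi(z,b,a)]-\sin\alpha\,[-\sin\beta\,\theta^{[1]}(z,b,a)+\cos\beta\,\theta(z,b,a)].$$ Coefficients: let $g(0,x,x')=\theta(0,x,a)\phi(0,x',a)-\theta(0,x',a)\phi(0,x,a)$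 and $g^{[1]}(0,x,x')=\theta^{[1]}(0,x,a)\phi(0,x',a)-\theta(0,x',a)\phi^{[1]}(0,x,a)$. Set $\phi_0(x)=\phi(0,x,a)$, $\phi_0^{[1]}(x)=\phi^{[1]}(0,x,a)$ and, for $k\ge1$, $\phi_k(x)=\int_a^x r(t)\,g(0,x,t)\,\phi_{k-1}(t)\,dt$, $\phi_k^{[1]}(x)=\int_a^x r(t)\,g^{[1]}(0,x,t)\,\phi_{k-1}(t)\,dt$; define $\theta_k,\theta_k^{[1]}$ in the same way with $\theta$ in place of $\phi$ (i.e. $\theta_0(x)=\theta(0,x,a)$, $\theta_0^{[1]}(x)=\theta^{[1]}(0,x,a)$, $\theta_k(x)=\int_a^x r(t)g(0,x,t)\theta_{k-1}(t)dt$, $\theta_k^{[1]}(x)=\int_a^x r(t)g^{[1]}(0,x,t)\theta_{k-1}(t)dt$). These are the coefficients in the power series $\phi(z,x,a)=\sum_m z^m\phi_m(x)$, etc., in $z$. $\zeta(s;T)=\sum_{\lambda_j\ne0}\lambda_j^{-s}$, the sum over all nonzero eigenvalues of $T$ counted with multiplicity ($\mathrm{Re}(s)>1/2$). $\frac{d}{dz}\ln F$ means $F'/F$. *)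

theory Defs
  imports "HOL-Complex_Analysis.Complex_Analysis" "HOL-Library.Function_Algebras"
begin

section \<open>The Hilbert space \<open>L\<^sup>2(M)\<close>\<close>

text \<open>Elements are represented by functions; equality in \<open>L\<^sup>2(M)\<close> is equality almost everywhere.\<close>

definition L2 :: "'a measure \<Rightarrow> ('a \<Rightarrow> complex) set" where
  "L2 M = {f \<in> borel_measurable M. integrable M (\<lambda>x. (cmod (f x))\<^sup>2)}"

definition L2_inner :: "'a measure \<Rightarrow> ('a \<Rightarrow> complex) \<Rightarrow> ('a \<Rightarrow> complex) \<Rightarrow> complex" where
  "L2_inner M f g = (LINT x|M. cnj (f x) * g x)"

definition L2_norm :: "'a measure \<Rightarrow> ('a \<Rightarrow> complex) \<Rightarrow> real" where
  "L2_norm M f = sqrt (LINT x|M. (cmod (f x))\<^sup>2)"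

definition orthonormal_basis :: "'a measure \<Rightarrow> ('a \<Rightarrow> complex) set \<Rightarrow> bool" where
  "orthonormal_basis M E \<longleftrightarrow>
     E \<subseteq> L2 M \<and>
     (\<forall>e\<in>E. \<forall>e'\<in>E. L2_inner M e e' = (if e = e' then 1 else 0)) \<and>
     (\<forall>f\<in>L2 M. (\<forall>e\<in>E. L2_inner M e f = 0) \<longrightarrow> (AE x in M. f x = 0))"

definition bounded_operator ::
    "'a measure \<Rightarrow> (('a \<Rightarrow> complex) \<Rightarrow> ('a \<Rightarrow> complex)) \<Rightarrow> bool" where
  "bounded_operator M A \<longleftrightarrow>
     (\<forall>f\<in>L2 M. A f \<in> L2 M) \<and>
     (\<forall>f\<in>L2 M. \<forall>g\<in>L2 M. \<forall>c. AE x in M. A (\<lambda>t. c * f t + g t) x = c * A f x + A g x) \<and>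
     (\<exists>C. \<forall>f\<in>L2 M. L2_norm M (A f) \<le> C * L2_norm M f)"

definition positive_operator ::
    "'a measure \<Rightarrow> (('a \<Rightarrow> complex) \<Rightarrow> ('a \<Rightarrow> complex)) \<Rightarrow> bool" where
  "positive_operator M B \<longleftrightarrow> bounded_operator M B \<and>
     (\<forall>f\<in>L2 M. Im (L2_inner M f (B f)) = 0 \<and> 0 \<le> Re (L2_inner M f (B f)))"

text \<open>\<open>B = |A| = (A\<^sup>*A)\<^sup>1\<^sup>/\<^sup>2\<close>: the positive operator with \<open>B\<^sup>2 = A\<^sup>*A\<close>, where the
  latter is written without adjoints as \<open>\<langle>Bf, Bg\<rangle> = \<langle>Af, Ag\<rangle>\<close> (recall that \<open>B\<close> is symmetric).\<close>

definition is_operator_abs ::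
    "'a measure \<Rightarrow> (('a \<Rightarrow> complex) \<Rightarrow> ('a \<Rightarrow> complex)) \<Rightarrow> (('a \<Rightarrow> complex) \<Rightarrow> ('a \<Rightarrow> complex)) \<Rightarrow> bool"
  where
  "is_operator_abs M A B \<longleftrightarrow> positive_operator M B \<and>
     (\<forall>f\<in>L2 M. \<forall>g\<in>L2 M. L2_inner M (B f) (B g) = L2_inner M (A f) (A g))"

definition trace_class ::
    "'a measure \<Rightarrow> (('a \<Rightarrow> complex) \<Rightarrow> ('a \<Rightarrow> complex)) \<Rightarrow> bool" where
  "trace_class M A \<longleftrightarrow> bounded_operator M A \<and>
     (\<exists>B E. is_operator_abs M A B \<and> orthonormal_basis M E \<and>
        (\<lambda>e. L2_inner M e (B e)) summable_on E)"

definition has_trace ::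
    "'a measure \<Rightarrow> (('a \<Rightarrow> complex) \<Rightarrow> ('a \<Rightarrow> complex)) \<Rightarrow> complex \<Rightarrow> bool" where
  "has_trace M A t \<longleftrightarrow> trace_class M A \<and>
     (\<forall>E. orthonormal_basis M E \<longrightarrow> ((\<lambda>e. L2_inner M e (A e)) has_sum t) E)"


section \<open>Sturm--Liouville operators\<close>

definition abs_continuous_on :: "real \<Rightarrow> real \<Rightarrow> (real \<Rightarrow> complex) \<Rightarrow> bool" where
  "abs_continuous_on a b f \<longleftrightarrow>
     (\<forall>\<epsilon>>0. \<exists>\<delta>>0. \<forall>(n::nat) u v.
        (\<forall>i<n. a \<le> u i \<and> u i \<le> v i \<and> v i \<le> b) \<and>
        disjoint_family_on (\<lambda>i. {u i<..<v i}) {..<n} \<and>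
        (\<Sum>i<n. v i - u i) < \<delta>
        \<longrightarrow> (\<Sum>i<n. cmod (f (v i) - f (u i))) < \<epsilon>)"

text \<open>\<open>y1\<close> is the quasi-derivative \<open>y\<^sup>[\<^sup>1\<^sup>] = p y'\<close>, with \<open>y, y1 \<in> AC([a,b])\<close>. Since \<open>p y'\<close> is only
  determined almost everywhere, \<open>y1\<close> is its absolutely continuous representative, which is unique
  on \<open>[a,b]\<close>; in particular the boundary values \<open>y1 a\<close> and \<open>y1 b\<close> are determined by \<open>y\<close>.\<close>

definition has_quasi_deriv ::
    "(real \<Rightarrow> real) \<Rightarrow> real \<Rightarrow> real \<Rightarrow> (real \<Rightarrow> complex) \<Rightarrow> (real \<Rightarrow> complex) \<Rightarrow> bool" where
  "has_quasi_deriv p a b y y1 \<longleftrightarrow>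
     abs_continuous_on a b y \<and> abs_continuous_on a b y1 \<and>
     (AE x in lebesgue_on {a<..<b}. y1 x = complex_of_real (p x) * vector_derivative y (at x))"

definition sl_tau ::
    "(real \<Rightarrow> real) \<Rightarrow> (real \<Rightarrow> real) \<Rightarrow> (real \<Rightarrow> complex) \<Rightarrow> (real \<Rightarrow> complex) \<Rightarrow> real \<Rightarrow> complex" where
  "sl_tau q r y y1 x =
     (1 / complex_of_real (r x)) * (- vector_derivative y1 (at x) + complex_of_real (q x) * y x)"

definition sl_solution ::
    "(real \<Rightarrow> real) \<Rightarrow> (real \<Rightarrow> real) \<Rightarrow> (real \<Rightarrow> real) \<Rightarrow> real \<Rightarrow> real \<Rightarrow> complex
      \<Rightarrow> (real \<Rightarrow> complex) \<Rightarrow> (real \<Rightarrow> complex) \<Rightarrow> bool" where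
  "sl_solution p q r a b z y y1 \<longleftrightarrow> has_quasi_deriv p a b y y1 \<and>
     (AE x in lebesgue_on {a<..<b}. sl_tau q r y y1 x = z * y x)"

definition weight_measure :: "(real \<Rightarrow> real) \<Rightarrow> real \<Rightarrow> real \<Rightarrow> real measure" where
  "weight_measure r a b = density (lebesgue_on {a<..<b}) (\<lambda>x. ennreal (r x))"

text \<open>Operators are given by their graphs. An element \<open>g\<close> of the domain is represented by its
  continuous representative on \<open>[a,b]\<close>, extended by zero to all of \<open>\<real>\<close>, so that distinct
  functions in the domain are distinct elements of \<open>L\<^sup>2\<close>; the image \<open>f\<close> ranges over all
  representatives of \<open>\<tau> g\<close>.\<close>

definition sl_Tmax ::
    "(real \<Rightarrow> real) \<Rightarrow> (real \<Rightarrow> real) \<Rightarrow> (real \<Rightarrow> real) \<Rightarrow> real \<Rightarrow> real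
      \<Rightarrow> ((real \<Rightarrow> complex) \<times> (real \<Rightarrow> complex)) set" where
  "sl_Tmax p q r a b = {(g, f).
     g \<in> L2 (weight_measure r a b) \<and> (\<forall>x. x \<notin> {a..b} \<longrightarrow> g x = 0) \<and>
     f \<in> L2 (weight_measure r a b) \<and>
     (\<exists>g1. has_quasi_deriv p a b g g1 \<and> (AE x in lebesgue_on {a<..<b}. f x = sl_tau q r g g1 x))}"

definition sl_T ::
    "(real \<Rightarrow> real) \<Rightarrow> (real \<Rightarrow> real) \<Rightarrow> (real \<Rightarrow> real) \<Rightarrow> real \<Rightarrow> real \<Rightarrow> real \<Rightarrow> real
      \<Rightarrow> ((real \<Rightarrow> complex) \<times> (real \<Rightarrow> complex)) set" where
  "sl_T p q r a b \<alpha> \<beta> = {(g, f) \<in> sl_Tmax p q r a b.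
     \<exists>g1. has_quasi_deriv p a b g g1 \<and>
       g a * complex_of_real (cos \<alpha>) + g1 a * complex_of_real (sin \<alpha>) = 0 \<and>
       g b * complex_of_real (cos \<beta>) - g1 b * complex_of_real (sin \<beta>) = 0}"


section \<open>Eigenvalues, spectral zeta function, inverse\<close>

definition eigenspace ::
    "(('a \<Rightarrow> complex) \<times> ('a \<Rightarrow> complex)) set \<Rightarrow> complex \<Rightarrow> ('a \<Rightarrow> complex) set" where
  "eigenspace T \<mu> = {g. (g, \<lambda>x. \<mu> * g x) \<in> T}"

definition eigenvalues :: "(('a \<Rightarrow> complex) \<times> ('a \<Rightarrow> complex)) set \<Rightarrow> complex set" where
  "eigenvalues T = {\<mu>. \<exists>g \<in> eigenspace T \<mu>. g \<noteq> (\<lambda>_. 0)}"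

definition multiplicity_of ::
    "(('a \<Rightarrow> complex) \<times> ('a \<Rightarrow> complex)) set \<Rightarrow> complex \<Rightarrow> nat" where
  "multiplicity_of T \<mu> =
     vector_space.dim (\<lambda>(c::complex) (g::'a \<Rightarrow> complex) x. c * g x) (eigenspace T \<mu>)"

text \<open>The general term of \<open>\<zeta>(s;T)\<close>: each eigenvalue is taken once and weighted by its multiplicity.
  For integer \<open>s\<close> the branch of the complex power is immaterial.\<close>

definition zeta_term ::
    "complex \<Rightarrow> (('a \<Rightarrow> complex) \<times> ('a \<Rightarrow> complex)) set \<Rightarrow> complex \<Rightarrow> complex" where
  "zeta_term s T \<mu> = of_nat (multiplicity_of T \<mu>) * \<mu> powr (- s)"

definition spectral_zeta ::
    "complex \<Rightarrow> (('a \<Rightarrow> complex) \<times> ('a \<Rightarrow> complex)) set \<Rightarrow> complex" where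
  "spectral_zeta s T = infsum (zeta_term s T) (eigenvalues T - {0})"

definition op_inverse ::
    "(('a \<Rightarrow> complex) \<times> ('a \<Rightarrow> complex)) set \<Rightarrow> ('a \<Rightarrow> complex) \<Rightarrow> ('a \<Rightarrow> complex)" where
  "op_inverse T f = (THE g. (g, f) \<in> T)"


section \<open>The coefficients\<close>

text \<open>With \<open>\<theta>, \<phi>\<close> the fundamental system at \<open>z = 0\<close>, the kernel \<open>g(0,x,t)\<close> is
  \<open>sl_kernel \<theta> \<phi> \<theta> \<phi> x t\<close> and \<open>g\<^sup>[\<^sup>1\<^sup>](0,x,t)\<close> is \<open>sl_kernel \<theta> \<phi> \<theta>\<^sup>[\<^sup>1\<^sup>] \<phi>\<^sup>[\<^sup>1\<^sup>] x t\<close>.\<close>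

definition sl_kernel ::
    "(real \<Rightarrow> complex) \<Rightarrow> (real \<Rightarrow> complex) \<Rightarrow> (real \<Rightarrow> complex) \<Rightarrow> (real \<Rightarrow> complex)
      \<Rightarrow> real \<Rightarrow> real \<Rightarrow> complex" where
  "sl_kernel \<theta> \<phi> u v x t = u x * \<phi> t - \<theta> t * v x"

definition weighted_volterra ::
    "(real \<Rightarrow> real) \<Rightarrow> real \<Rightarrow> (real \<Rightarrow> real \<Rightarrow> complex) \<Rightarrow> (real \<Rightarrow> complex) \<Rightarrow> real \<Rightarrow> complex" where
  "weighted_volterra r a K y x = (LINT t:{a<..<x}|lebesgue. complex_of_real (r t) * K x t * y t)"

text \<open>\<open>y\<^sub>k\<close> and \<open>y\<^sub>k\<^sup>[\<^sup>1\<^sup>]\<close> for \<open>y\<^sub>0 = y\<close>, \<open>y\<^sub>0\<^sup>[\<^sup>1\<^sup>] = y1\<close>, with \<open>K = g(0,\<cdot>,\<cdot>)\<close> and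
  \<open>K1 = g\<^sup>[\<^sup>1\<^sup>](0,\<cdot>,\<cdot>)\<close>.\<close>

primrec sl_iter ::
    "(real \<Rightarrow> real) \<Rightarrow> real \<Rightarrow> (real \<Rightarrow> real \<Rightarrow> complex) \<Rightarrow> (real \<Rightarrow> complex) \<Rightarrow> nat \<Rightarrow> real \<Rightarrow> complex"
  where
  "sl_iter r a K y 0 = y"
| "sl_iter r a K y (Suc k) = weighted_volterra r a K (sl_iter r a K y k)"

primrec sl_iter1 ::
    "(real \<Rightarrow> real) \<Rightarrow> real \<Rightarrow> (real \<Rightarrow> real \<Rightarrow> complex) \<Rightarrow> (real \<Rightarrow> real \<Rightarrow> complex)
      \<Rightarrow> (real \<Rightarrow> complex) \<Rightarrow> (real \<Rightarrow> complex) \<Rightarrow> nat \<Rightarrow> real \<Rightarrow> complex"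
  where
  "sl_iter1 r a K K1 y y1 0 = y1"
| "sl_iter1 r a K K1 y y1 (Suc k) = weighted_volterra r a K1 (sl_iter r a K y k)"

end

theory Submission
  imports Defs
begin

text \<open>With \<open>u(z,x) = cos \<alpha> \<phi>(z,x,a) - sin \<alpha> \<theta>(z,x,a)\<close>, the solution satisfying the boundary condition at \<open>a\<close>,
  the eigenvalues are the zeros of \<open>F(z) = cos \<beta> u(z,b) - sin \<beta> u\<^sup>[\<^sup>1\<^sup>](z,b)\<close>; Lagrange's identity shows that they
  are real and simple. An energy estimate gives \<open>|F(z)| \<le> C exp (K |z|\<^sup>1\<^sup>/\<^sup>2)\<close>, so \<open>F\<close> has order at most
  \<open>1/2\<close> and genus zero, \<open>\<Sum> 1/|\<lambda>\<^sub>j|\<close> converges, and \<open>F'/F\<close> is \<open>m\<^sub>0/z\<close> plus \<open>\<Sum> 1/(z - \<lambda>\<^sub>j)\<close>. Its Taylor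
  coefficients are on the one hand the negative power sums of the eigenvalues and on the other hand given
  by Newton's recursion in terms of the coefficients \<open>a\<^sub>k\<close> of \<open>F\<close>, which come from iterating the
  variation of constants formula at \<open>z = 0\<close>.

  If \<open>F(0) \<noteq> 0\<close>, the eigenfunctions form an orthonormal basis: for \<open>f\<close> orthogonal to all of them the
  resolvent applied to \<open>f\<close> is entire and bounded in \<open>z\<close>. The inverse is then diagonal with summable
  eigenvalues \<open>1/\<lambda>\<^sub>j\<close>, hence trace class, and its trace is \<open>\<zeta>(1)\<close>.\<close>

text \<open>The coefficients are merely integrable, so solutions are differentiable only almost
  everywhere, while the definitions speak of absolute continuity in epsilon-delta form and of
  \<open>vector_derivative\<close>. Everything rests on translating this into the integral
  identities \<open>AC_deriv\<close>: Lebesgue differentiation gives one direction, Radon-Nikodym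
  for the positive and negative variation the other. From then on the product rule and Lagrange's
  identity carry the analysis. The bound on the order is what makes n = 1 work: O(sqrt t) zeros of
  modulus at most t force the j-th modulus to grow like j^2, and no exponential factor enters the
  logarithmic derivative. An infinite product is avoided: finitely many zeros are divided out, and
  the logarithm of the quotient is controlled on growing discs. Since zeros are simple, an
  eigenvalue 0 contributes exactly one factor z to F, which is the origin of the index shift by
  \<open>m0\<close>. Completeness comes from Liouville's theorem, applied to the resolvent at each
  fixed point x, instead of compactness; it therefore needs a pointwise bound on the resolvent
  besides the usual one in L2.\<close>

section \<open>Absolutely continuous functions\<close>

text \<open>Inside an open \<open>U\<close> containing \<open>A\<close> with
  \<open>\<nu>\<close>-measure below \<open>\<eta> * e\<close>, the short intervals carrying more
  than \<open>\<eta>\<close> times their length form a Vitali cover of the exceptional points.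
  Disjoint ones among them have total length at most \<open>\<nu> U\<close> divided by
  \<open>\<eta>\<close>, hence at most \<open>e\<close>.\<close>

lemma null_set_density_zero:
  fixes \<nu> :: "real measure"
  assumes "finite_measure \<nu>" and sets: "sets \<nu> = sets borel"
    and A: "A \<in> sets borel" and \<nu>A: "emeasure \<nu> A = 0" and \<eta>: "\<eta> > (0::real)"
  shows "negligible {x\<in>A. \<forall>d>0. \<exists>s t. s \<le> x \<and> x \<le> t \<and> s < t \<and> t - s < d \<and> measure \<nu> {s..t} > \<eta> * (t - s)}"
    (is "negligible ?N")
  unfolding negligible_outer_le
proof (intro allI impI)
  fix e :: real assume "e > 0"
  interpret finite_measure \<nu> by fact
  have "emeasure \<nu> (space \<nu>) \<noteq> \<infinity>" by (simp add: emeasure_finite)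
  then have "emeasure \<nu> A = (INF U\<in>{U. A \<subseteq> U \<and> open U}. emeasure \<nu> U)"
    by (intro outer_regular) (use sets A in auto)
  then have "(INF U\<in>{U. A \<subseteq> U \<and> open U}. emeasure \<nu> U) < ennreal (\<eta> * e)"
    using \<nu>A \<eta> \<open>e > 0\<close> by simp
  then obtain U where U: "A \<subseteq> U" "open U" "emeasure \<nu> U < ennreal (\<eta> * e)"
    by (auto simp: INF_less_iff)
  have Um: "measure \<nu> U \<le> \<eta> * e"
    using U(3) \<eta> \<open>e > 0\<close> by (simp add: emeasure_eq_measure ennreal_less_iff)
  define K where "K = {(s,t). s < t \<and> {s..t} \<subseteq> U \<and> measure \<nu> {s..t} > \<eta> * (t - s)}"
  \<comment> \<open>Centre and half-length present the intervals as closed balls, the form in which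
    the Vitali covering theorem is stated.\<close>
  define c where "c = (\<lambda>(s,t). (s + t) / 2 :: real)"
  define h where "h = (\<lambda>(s,t). (t - s) / 2 :: real)"
  have ball: "cball (c i) (h i) = {fst i..snd i}" for i
    by (cases i) (auto simp: c_def h_def dist_real_def field_simps abs_le_iff)
  have "\<exists>i. i \<in> K \<and> x \<in> cball (c i) (h i) \<and> h i < d" if "x \<in> ?N" "0 < d" for x d
  proof -
    from that U obtain d0 where d0: "d0 > 0" "ball x d0 \<subseteq> U"
      by (metis (no_types, lifting) mem_Collect_eq open_contains_ball subsetD)
    from that d0(1) obtain s t where st: "s \<le> x" "x \<le> t" "s < t" "t - s < min d d0" "measure \<nu> {s..t} > \<eta> * (t - s)"
      by (smt (verit, best) mem_Collect_eq)
    have "{s..t} \<subseteq> ball x d0" using st by (auto simp: dist_real_def)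
    then have "(s,t) \<in> K" using st d0 by (auto simp: K_def)
    moreover have "x \<in> cball (c (s,t)) (h (s,t))" unfolding ball using st by simp
    moreover have "h (s,t) < d" using st by (simp add: h_def)
    ultimately show ?thesis by blast
  qed
  moreover have "0 < h i" if "i \<in> K" for i using that by (auto simp: K_def h_def)
  ultimately obtain C where C: "countable C" "C \<subseteq> K"
     "pairwise (\<lambda>i j. disjnt (cball (c i) (h i)) (cball (c j) (h j))) C"
     "negligible (?N - (\<Union>i \<in> C. cball (c i) (h i)))"
    by (metis (no_types, lifting) Vitali_covering_theorem_cballs[of K h ?N c])
  define W where "W = (\<Union>i \<in> C. {fst i..snd i})"
  have Wm: "W \<in> sets borel" unfolding W_def using C(1) by (intro sets.countable_UN') auto
  have dis: "disjoint_family_on (\<lambda>i. {fst i..snd i}) C"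
    using C(3) unfolding ball by (simp add: pairwise_def disjoint_family_on_def disjnt_def)
  have "emeasure lborel W = (\<integral>\<^sup>+ i. emeasure lborel {fst i..snd i} \<partial>count_space C)"
    unfolding W_def by (rule emeasure_UN_countable) (use C dis in auto)
  also have "\<dots> \<le> (\<integral>\<^sup>+ i. ennreal (1/\<eta>) * emeasure \<nu> {fst i..snd i} \<partial>count_space C)"
  proof (rule nn_integral_mono)
    fix i assume "i \<in> space (count_space C)"
    then have "i \<in> K" using C by auto
    then have "snd i - fst i \<le> 1/\<eta> * measure \<nu> {fst i..snd i}" "fst i < snd i"
      using \<eta> by (auto simp: K_def field_simps)
    then show "emeasure lborel {fst i..snd i} \<le> ennreal (1/\<eta>) * emeasure \<nu> {fst i..snd i}"
      using \<eta> by (simp add: emeasure_eq_measure ennreal_mult[symmetric])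
  qed
  also have "\<dots> = ennreal (1/\<eta>) * emeasure \<nu> W"
    unfolding W_def by (subst emeasure_UN_countable) (use C dis sets in \<open>auto simp: nn_integral_cmult\<close>)
  also have "\<dots> \<le> ennreal (1/\<eta>) * emeasure \<nu> U"
    by (intro mult_left_mono emeasure_mono) (use C U sets in \<open>auto simp: W_def K_def subset_iff\<close>)
  also have "\<dots> \<le> ennreal e"
    using Um \<eta> by (simp add: emeasure_eq_measure ennreal_mult[symmetric] ennreal_leI divide_le_eq mult.commute)
  finally have We: "emeasure lborel W \<le> ennreal e" .
  have Wl: "W \<in> lmeasurable" "measure lebesgue W \<le> e"
  proof -
    have "emeasure lebesgue W \<le> ennreal e" using We Wm by simp
    then show "W \<in> lmeasurable" using Wm
      by (intro fmeasurableI) (auto intro: le_less_trans simp: less_top[symmetric] top_unique)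
    show "measure lebesgue W \<le> e" using \<open>emeasure lebesgue W \<le> ennreal e\<close> \<open>e > 0\<close>
      by (simp add: measure_def enn2real_leI)
  qed
  let ?T = "W \<union> (?N - W)"
  have neg: "negligible (?N - W)" using C(4) unfolding ball W_def .
  have "?T \<in> lmeasurable" by (rule fmeasurable.Un[OF Wl(1) negligible_imp_measurable[OF neg]])
  moreover have "measure lebesgue ?T \<le> e"
    using measure_Un_le[of W lebesgue "?N - W"] Wl(2) fmeasurableD[OF Wl(1)]
      negligible_imp_measure0[OF neg] fmeasurableD[OF negligible_imp_measurable[OF neg]] by linarith
  ultimately show "\<exists>T. ?N \<subseteq> T \<and> T \<in> lmeasurable \<and> measure lebesgue T \<le> e"
    by (intro exI[of _ ?T]) auto
qed

text \<open>For a rational \<open>c\<close> slightly above \<open>f x\<close>, the measure with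
  density max (f - c) 0 does not charge the set where f is at most \<open>c\<close>, so almost
  everywhere on that set its averages become small. Since f is at most \<open>c\<close> plus this
  density, the averages of f stay close to \<open>c\<close>.\<close>

lemma AE_average_le:
  fixes f :: "real \<Rightarrow> real"
  assumes f: "integrable lborel f"
  shows "AE x in lebesgue. \<forall>\<eta>>0. \<exists>d>0. \<forall>s t. s \<le> x \<and> x \<le> t \<and> s < t \<and> t - s < d \<longrightarrow>
    (LINT u:{s..t}|lborel. f u) \<le> (f x + \<eta>) * (t - s)"
proof -
  have [measurable]: "f \<in> borel_measurable borel" using f by auto
  \<comment> \<open>Cut off to a bounded interval, because for negative \<open>c\<close> the
    positive part of f - c need not be integrable over the whole line.\<close>
  define g where "g = (\<lambda>(c::real) (n::nat) x. indicator {-real n..real n} x * max (f x - c) 0)"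
  have gi: "integrable lborel (g c n)" for c n
  proof (rule Bochner_Integration.integrable_bound)
    show "integrable lborel (\<lambda>x. \<bar>f x\<bar> + indicator {-real n..real n} x * \<bar>c\<bar>)"
      using f by (intro Bochner_Integration.integrable_add integrable_abs integrable_mult_left) (auto intro!: integrable_real_indicator)
  qed (auto simp: g_def indicator_def max_def)
  have g0: "g c n x \<ge> 0" for c n x by (auto simp: g_def indicator_def)
  define \<nu> where "\<nu> c n = density lborel (\<lambda>x. ennreal (g c n x))" for c n
  have fin: "finite_measure (\<nu> c n)" for c n
    unfolding \<nu>_def using gi[of c n] g0
    by (intro finite_measureI) (simp add: emeasure_density nn_integral_eq_integral)
  have sgi: "set_integrable lborel {s..t} (g c n)" for c n s t
    unfolding set_integrable_def using gi by (intro integrable_mult_indicator) auto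
  have \<nu>meas: "measure (\<nu> c n) {s..t} = (LINT u:{s..t}|lborel. g c n u)" for c n s t
  proof -
    have "emeasure (\<nu> c n) {s..t} = (\<integral>\<^sup>+u. ennreal (indicator {s..t} u *\<^sub>R g c n u) \<partial>lborel)"
      unfolding \<nu>_def using gi[of c n]
      by (subst emeasure_density) (auto intro!: nn_integral_cong simp: indicator_def)
    also have "\<dots> = ennreal (LINT u:{s..t}|lborel. g c n u)"
      unfolding set_lebesgue_integral_def using gi[of c n] g0
      by (intro nn_integral_eq_integral integrable_mult_indicator) auto
    finally show ?thesis
      unfolding set_lebesgue_integral_def using g0 by (simp add: measure_def integral_nonneg_AE)
  qed
  define A where "A c n = {x \<in> {-real n<..<real n}. f x \<le> c}" for c n
  have Am: "A c n \<in> sets borel" for c n unfolding A_def by measurable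
  have "emeasure (\<nu> c n) (A c n) = 0" for c n
  proof -
    have "emeasure (\<nu> c n) (A c n) = (\<integral>\<^sup>+x. ennreal (g c n x) * indicator (A c n) x \<partial>lborel)"
      unfolding \<nu>_def by (rule emeasure_density) (use gi Am in auto)
    also have "\<dots> = (\<integral>\<^sup>+x. 0 \<partial>(lborel::real measure))"
      by (intro nn_integral_cong) (auto simp: A_def g_def indicator_def)
    finally show ?thesis by simp
  qed
  then have neg: "negligible {x\<in>A c n. \<forall>d>0. \<exists>s t. s \<le> x \<and> x \<le> t \<and> s < t \<and> t - s < d \<and> measure (\<nu> c n) {s..t} > (1 / Suc k) * (t - s)}" for c n k
    by (intro null_set_density_zero fin Am) (simp_all add: \<nu>_def)
  define N where "N c n k = {x\<in>A c n. \<forall>d>0. \<exists>s t. s \<le> x \<and> x \<le> t \<and> s < t \<and> t - s < d \<and> measure (\<nu> c n) {s..t} > (1 / Suc k) * (t - s)}" for c n k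
  have "AE x in lebesgue. x \<notin> N c n k" for c n k
    using neg[of c n k] unfolding N_def[symmetric] by (intro AE_not_in) (simp only: negligible_iff_null_sets)
  then have "AE x in lebesgue. \<forall>n k. x \<notin> N c n k" for c
    by (intro iffD2[OF AE_all_countable] allI)
  then have "AE x in lebesgue. \<forall>c\<in>\<rat>. \<forall>n k. x \<notin> N c n k"
    by (intro AE_ball_countable'[OF _ countable_rat])
  then show ?thesis
  proof eventually_elim
    case (elim x)
    show "\<forall>\<eta>>0. \<exists>d>0. \<forall>s t. s \<le> x \<and> x \<le> t \<and> s < t \<and> t - s < d \<longrightarrow> (LINT u:{s..t}|lborel. f u) \<le> (f x + \<eta>) * (t - s)"
    proof (intro allI impI)
      fix \<eta> :: real assume "\<eta> > 0"
      obtain c where c: "c \<in> \<rat>" "f x < c" "c < f x + \<eta>/2"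
        using Rats_dense_in_real[of "f x" "f x + \<eta>/2"] \<open>\<eta> > 0\<close> by auto
      obtain n where n: "\<bar>x\<bar> < real n" using reals_Archimedean2 by blast
      obtain k where k: "1 / real (Suc k) < \<eta>/2" using \<open>\<eta> > 0\<close> nat_approx_posE[of "\<eta>/2"] by auto
      have "x \<in> A c n" using c n by (auto simp: A_def)
      moreover have "x \<notin> N c n k" using elim c(1) by blast
      ultimately have "\<not> (\<forall>d>0. \<exists>s t. s \<le> x \<and> x \<le> t \<and> s < t \<and> t - s < d \<and> measure (\<nu> c n) {s..t} > (1 / Suc k) * (t - s))"
        unfolding N_def by blast
      then obtain d where d: "d > 0" "\<And>s t. s \<le> x \<Longrightarrow> x \<le> t \<Longrightarrow> s < t \<Longrightarrow> t - s < d \<Longrightarrow> measure (\<nu> c n) {s..t} \<le> (1 / Suc k) * (t - s)"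
        by (meson not_less)
      \<comment> \<open>The bound by \<open>real n - \<bar>x\<bar>\<close> keeps [s,t] inside the
        cut-off region, where \<open>g c n\<close> is the full positive part.\<close>
      show "\<exists>d>0. \<forall>s t. s \<le> x \<and> x \<le> t \<and> s < t \<and> t - s < d \<longrightarrow> (LINT u:{s..t}|lborel. f u) \<le> (f x + \<eta>) * (t - s)"
      proof (intro exI[of _ "min d (real n - \<bar>x\<bar>)"] conjI allI impI)
        show "min d (real n - \<bar>x\<bar>) > 0" using d n by auto
        fix s t assume st: "s \<le> x \<and> x \<le> t \<and> s < t \<and> t - s < min d (real n - \<bar>x\<bar>)"
        have ci: "set_integrable lborel {s..t} (\<lambda>u. c)"
          unfolding set_integrable_def using st by (auto intro!: integrable_real_indicator)
        have "(LINT u:{s..t}|lborel. f u) \<le> (LINT u:{s..t}|lborel. g c n u + c)"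
        proof (rule set_integral_mono)
          show "set_integrable lborel {s..t} f" unfolding set_integrable_def
            using f by (intro integrable_mult_indicator) auto
          show "set_integrable lborel {s..t} (\<lambda>u. g c n u + c)"
            by (intro set_integral_add sgi ci)
          fix u assume "u \<in> {s..t}"
          with st have "u \<in> {-real n..real n}" by auto
          then show "f u \<le> g c n u + c" by (auto simp: g_def)
        qed
        also have "\<dots> = (LINT u:{s..t}|lborel. g c n u) + (LINT u:{s..t}|lborel. c)"
          by (intro set_integral_add sgi ci)
        also have "(LINT u:{s..t}|lborel. c) = c * (t - s)"
          using st by (simp add: set_lebesgue_integral_def)
        also have "(LINT u:{s..t}|lborel. g c n u) \<le> (1 / Suc k) * (t - s)"
          using d(2)[of s t] st by (simp add: \<nu>meas)
        also have "(1 / Suc k) * (t - s) + c * (t - s) \<le> (f x + \<eta>) * (t - s)"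
          unfolding distrib_right[symmetric] using st c k by (intro mult_right_mono) auto
        finally show "(LINT u:{s..t}|lborel. f u) \<le> (f x + \<eta>) * (t - s)" by simp
      qed
    qed
  qed
qed

lemma AE_average:
  fixes f :: "real \<Rightarrow> real"
  assumes f: "integrable lborel f"
  shows "AE x in lebesgue. \<forall>\<eta>>0. \<exists>d>0. \<forall>s t. s \<le> x \<and> x \<le> t \<and> s < t \<and> t - s < d \<longrightarrow>
    \<bar>(LINT u:{s..t}|lborel. f u) - f x * (t - s)\<bar> \<le> \<eta> * (t - s)"
  using AE_average_le[OF f] AE_average_le[OF integrable_minus[OF f]]
proof eventually_elim
  case (elim x)
  show ?case
  proof (intro allI impI)
    fix \<eta> :: real assume "\<eta> > 0"
    obtain d1 where d1: "d1 > 0" "\<And>s t. s \<le> x \<Longrightarrow> x \<le> t \<Longrightarrow> s < t \<Longrightarrow> t - s < d1 \<Longrightarrow> (LINT u:{s..t}|lborel. f u) \<le> (f x + \<eta>) * (t - s)"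
      using elim(1) \<open>\<eta> > 0\<close> by meson
    obtain d2 where d2: "d2 > 0" "\<And>s t. s \<le> x \<Longrightarrow> x \<le> t \<Longrightarrow> s < t \<Longrightarrow> t - s < d2 \<Longrightarrow> (LINT u:{s..t}|lborel. - f u) \<le> (- f x + \<eta>) * (t - s)"
      using elim(2) \<open>\<eta> > 0\<close> by meson
    show "\<exists>d>0. \<forall>s t. s \<le> x \<and> x \<le> t \<and> s < t \<and> t - s < d \<longrightarrow>
      \<bar>(LINT u:{s..t}|lborel. f u) - f x * (t - s)\<bar> \<le> \<eta> * (t - s)"
    proof (intro exI[of _ "min d1 d2"] conjI allI impI)
      fix s t assume st: "s \<le> x \<and> x \<le> t \<and> s < t \<and> t - s < min d1 d2"
      have "(LINT u:{s..t}|lborel. - f u) = - (LINT u:{s..t}|lborel. f u)"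
        by (simp add: set_lebesgue_integral_def)
      then show "\<bar>(LINT u:{s..t}|lborel. f u) - f x * (t - s)\<bar> \<le> \<eta> * (t - s)"
        using d1(2)[of s t] d2(2)[of s t] st by (auto simp: abs_le_iff algebra_simps)
    qed (use d1 d2 in auto)
  qed
qed

text \<open>The representation \<open>y(x) = y(a) + \<integral>\<^sub>a\<^sup>x f\<close> characterises absolutely continuous functions;
  \<open>f\<close> is determined up to null sets.\<close>

definition AC_deriv :: "real \<Rightarrow> real \<Rightarrow> (real \<Rightarrow> 'a::euclidean_space) \<Rightarrow> (real \<Rightarrow> 'a) \<Rightarrow> bool" where
  "AC_deriv a b y f \<longleftrightarrow> f absolutely_integrable_on {a..b} \<and> (\<forall>x\<in>{a..b}. y x = y a + integral {a..x} f)"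

lemma AC_deriv_diff:
  assumes "AC_deriv a b y f" "a \<le> s" "s \<le> t" "t \<le> b"
  shows "y t - y s = integral {s..t} f"
proof -
  have i: "f integrable_on {a..b}" using assms set_lebesgue_integral_eq_integral(1) by (auto simp: AC_deriv_def)
  have "integral {a..t} f = integral {a..s} f + integral {s..t} f"
    by (rule Henstock_Kurzweil_Integration.integral_combine[symmetric]) (use assms integrable_subinterval_real[OF i] in auto)
  moreover have "y s = y a + integral {a..s} f" "y t = y a + integral {a..t} f"
    using assms unfolding AC_deriv_def by (meson atLeastAtMost_iff order.trans)+
  ultimately show ?thesis by simp
qed

section \<open>Indefinite integrals: differentiability and absolute continuity\<close>

text \<open>A difference quotient at \<open>x\<close> is the average of the density over an interval
  with endpoint \<open>x\<close>, and the averages theorem covers all intervals containing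
  \<open>x\<close>; so it yields the two-sided derivative.\<close>

lemma AC_deriv_AE_real:
  fixes y f :: "real \<Rightarrow> real"
  assumes "AC_deriv a b y f"
  shows "AE x in lebesgue. x \<in> {a<..<b} \<longrightarrow> (y has_vector_derivative f x) (at x)"
proof -
  have fi: "integrable lebesgue (\<lambda>x. indicator {a..b} x *\<^sub>R f x)"
    using assms by (simp add: AC_deriv_def set_integrable_def)
  \<comment> \<open>The density is only Lebesgue measurable, whereas the averages are taken over
    \<open>lborel\<close>; a Borel function equal to it almost everywhere bridges the gap.\<close>
  then obtain g where g: "g \<in> borel_measurable lborel" "AE x in lborel. indicator {a..b} x *\<^sub>R f x = g x"
    using completion_ex_borel_measurable_real[of "(\<lambda>x. indicator {a..b} x *\<^sub>R f x)" lborel] by auto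
  have gAE: "AE x in lebesgue. indicator {a..b} x *\<^sub>R f x = g x"
    using g(2) by (rule AE_completion)
  have gi: "integrable lebesgue g"
    using integrable_cong_AE[of "\<lambda>x. indicator {a..b} x *\<^sub>R f x" lebesgue g] fi gAE g(1) by (auto simp: measurable_completion)
  then have gl: "integrable lborel g" using g(1) by (simp add: integrable_completion)
  have eq: "(LINT u:{s..t}|lborel. g u) = y t - y s" if "a \<le> s" "s \<le> t" "t \<le> b" for s t
  proof -
    have "(LINT u:{s..t}|lborel. g u) = (LINT u:{s..t}|lebesgue. g u)"
      unfolding set_lebesgue_integral_def using g(1) by (subst integral_completion) auto
    also have "\<dots> = (LINT u:{s..t}|lebesgue. f u)"
      unfolding set_lebesgue_integral_def
    proof (rule integral_cong_AE)
      have "f absolutely_integrable_on {s..t}"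
        using assms that unfolding AC_deriv_def by (meson absolutely_integrable_on_subinterval atLeastatMost_subset_iff)
      then show "(\<lambda>x. indicat_real {s..t} x *\<^sub>R f x) \<in> borel_measurable lebesgue"
        by (auto simp: set_integrable_def)
      show "AE x in lebesgue. indicat_real {s..t} x *\<^sub>R g x = indicat_real {s..t} x *\<^sub>R f x"
        using gAE by eventually_elim (use that in \<open>auto simp: indicator_def split: if_splits\<close>)
    qed (use g(1) in \<open>auto intro: measurable_completion\<close>)
    also have "\<dots> = integral {s..t} f"
      using assms that unfolding AC_deriv_def
      by (intro set_lebesgue_integral_eq_integral) (meson absolutely_integrable_on_subinterval atLeastatMost_subset_iff)
    finally show ?thesis using AC_deriv_diff[OF assms that] by simp
  qed
  show ?thesis using AE_average[OF gl] gAE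
  proof eventually_elim
    case (elim x)
    show ?case
    proof
      assume x: "x \<in> {a<..<b}"
      then have gx: "g x = f x" using elim(2) by (simp add: indicator_def)
      show "(y has_vector_derivative f x) (at x)"
        unfolding has_real_derivative_iff_has_vector_derivative[symmetric] has_field_derivative_iff LIM_eq
      proof (intro allI impI)
        fix r :: real assume "r > 0"
        then obtain d where d: "d > 0" "\<And>s t. s \<le> x \<Longrightarrow> x \<le> t \<Longrightarrow> s < t \<Longrightarrow> t - s < d \<Longrightarrow>
           \<bar>(LINT u:{s..t}|lborel. g u) - g x * (t - s)\<bar> \<le> r/2 * (t - s)"
          using elim(1) by (meson half_gt_zero)
        have key: "\<bar>(y z - y x) / (z - x) - f x\<bar> \<le> r/2" if "z \<noteq> x" "\<bar>z - x\<bar> < d" "a \<le> z" "z \<le> b" for z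
        proof (cases "z < x")
          case True
          have "\<bar>y x - y z - f x * (x - z)\<bar> \<le> r/2 * (x - z)"
            using d(2)[of z x] eq[of z x] that x True gx by auto
          moreover have "(y z - y x) / (z - x) - f x = (y x - y z - f x * (x - z)) / (x - z)"
            using True by (simp add: field_simps)
          ultimately show ?thesis using True by (simp add: pos_divide_le_eq)
        next
          case False
          have "\<bar>y z - y x - f x * (z - x)\<bar> \<le> r/2 * (z - x)"
            using d(2)[of x z] eq[of x z] that x False gx by auto
          moreover have "(y z - y x) / (z - x) - f x = (y z - y x - f x * (z - x)) / (z - x)"
            using that by (simp add: field_simps)
          ultimately show ?thesis using that False by (simp add: pos_divide_le_eq)
        qed
        show "\<exists>s>0. \<forall>z. z \<noteq> x \<and> norm (z - x) < s \<longrightarrow> norm ((y z - y x) / (z - x) - f x) < r"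
        proof (intro exI[of _ "min d (min (x - a) (b - x))"] conjI allI impI)
          fix z assume "z \<noteq> x \<and> norm (z - x) < min d (min (x - a) (b - x))"
          moreover from this have "a \<le> z" "z \<le> b" by (auto simp: abs_if split: if_splits)
          ultimately show "norm ((y z - y x) / (z - x) - f x) < r"
            using key[of z] \<open>r > 0\<close> by auto
        qed (use d x in auto)
      qed
    qed
  qed
qed

text \<open>Carries densities between real and complex functions and through conjugation: it is
  applied to \<open>Re\<close>, \<open>Im\<close>, \<open>cnj\<close>, constant multiples and the
  embedding of the reals.\<close>

lemma AC_deriv_linear:
  assumes "bounded_linear h" "AC_deriv a b y f"
  shows "AC_deriv a b (\<lambda>x. h (y x)) (\<lambda>x. h (f x))"
proof -
  interpret bounded_linear h by fact
  have f: "f absolutely_integrable_on {a..b}" using assms(2) by (simp add: AC_deriv_def)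
  have "(h \<circ> f) absolutely_integrable_on {a..b}"
    by (rule absolutely_integrable_linear[OF f assms(1)])
  moreover have "h (y x) = h (y a) + integral {a..x} (\<lambda>x. h (f x))" if x: "x \<in> {a..b}" for x
  proof -
    have "f absolutely_integrable_on {a..x}"
      using absolutely_integrable_on_subinterval[OF f, of a x] x by auto
    then have "integral {a..x} (h \<circ> f) = h (integral {a..x} f)"
      by (intro integral_linear[OF _ assms(1)] set_lebesgue_integral_eq_integral(1))
    moreover have "y x = y a + integral {a..x} f"
      using assms(2) x unfolding AC_deriv_def by blast
    ultimately show ?thesis by (simp add: add o_def)
  qed
  ultimately show ?thesis unfolding AC_deriv_def o_def by blast
qed

lemma AC_deriv_AE:
  fixes y f :: "real \<Rightarrow> complex"
  assumes "AC_deriv a b y f"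
  shows "AE x in lebesgue. x \<in> {a<..<b} \<longrightarrow> (y has_vector_derivative f x) (at x)"
  using AC_deriv_AE_real[OF AC_deriv_linear[OF bounded_linear_Re assms]]
    AC_deriv_AE_real[OF AC_deriv_linear[OF bounded_linear_Im assms]]
  by eventually_elim (auto simp: has_vector_derivative_complex_iff has_real_derivative_iff_has_vector_derivative)

lemma sum_integral_disjoint_le:
  fixes h :: "real \<Rightarrow> real"
  assumes "finite I" "disjoint_family_on (\<lambda>i. {u i<..<v i}) I"
    and sub: "\<And>i. i \<in> I \<Longrightarrow> {u i<..<v i} \<subseteq> S"
    and h: "integrable lebesgue h" "\<And>x. 0 \<le> h x" and S: "\<And>x. x \<notin> S \<Longrightarrow> h x = 0"
  shows "(\<Sum>i\<in>I. LINT x:{u i<..<v i}|lebesgue. h x) \<le> (LINT x|lebesgue. h x)"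
proof -
  have int: "integrable lebesgue (\<lambda>x. indicator {u i<..<v i} x *\<^sub>R h x)" for i
    using h by (intro integrable_mult_indicator) auto
  have "(\<Sum>i\<in>I. LINT x:{u i<..<v i}|lebesgue. h x) = (LINT x|lebesgue. (\<Sum>i\<in>I. indicator {u i<..<v i} x *\<^sub>R h x))"
    unfolding set_lebesgue_integral_def using int by simp
  also have "\<dots> \<le> (LINT x|lebesgue. h x)"
  proof (rule integral_mono)
    fix x
    have "(\<Sum>i\<in>I. indicator {u i<..<v i} x *\<^sub>R h x) = indicator (\<Union>i\<in>I. {u i<..<v i}) x * h x"
      using assms(1,2) by (simp add: indicator_UN_disjoint sum_distrib_right)
    then show "(\<Sum>i\<in>I. indicator {u i<..<v i} x *\<^sub>R h x) \<le> h x"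
      using h(2) by (simp add: indicator_def)
  qed (use int h in auto)
  finally show ?thesis .
qed

lemma sum_length_disjoint_le:
  fixes u v :: "'i \<Rightarrow> real"
  assumes "finite I" "disjoint_family_on (\<lambda>i. {u i<..<v i}) I" "c \<le> d"
    and sub: "\<And>i. i \<in> I \<Longrightarrow> c \<le> u i \<and> u i \<le> v i \<and> v i \<le> d"
  shows "(\<Sum>i\<in>I. v i - u i) \<le> d - c"
proof -
  have "v i - u i = (LINT x:{u i<..<v i}|lebesgue. indicator {c<..<d} x)" if "i \<in> I" for i
  proof -
    have "(LINT x:{u i<..<v i}|lebesgue. indicator {c<..<d} x) = (LINT x:{u i<..<v i}|lebesgue. (1::real))"
      unfolding set_lebesgue_integral_def using sub[OF that] by (intro Bochner_Integration.integral_cong) (auto simp: indicator_def)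
    then show ?thesis using sub[OF that] by (simp add: set_lebesgue_integral_def)
  qed
  then have "(\<Sum>i\<in>I. v i - u i) = (\<Sum>i\<in>I. LINT x:{u i<..<v i}|lebesgue. indicator {c<..<d} x)"
    by (intro sum.cong) auto
  also have "\<dots> \<le> (LINT x|lebesgue. indicator {c<..<d} x)"
  proof (rule sum_integral_disjoint_le[where S="{c<..<d}"])
    fix i assume "i \<in> I"
    then show "{u i<..<v i} \<subseteq> {c<..<d}" using sub[of i] by auto
  qed (use assms in \<open>auto intro!: integrable_real_indicator\<close>)
  also have "\<dots> = d - c" using assms by simp
  finally show ?thesis .
qed

text \<open>Uniform integrability of a single function: its modulus is split at a level
  \<open>n\<close> into a tail with integral below \<epsilon>/2 and a part bounded by
  \<open>n\<close>, which contributes at most \<open>n\<close> times the total length of the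
  intervals.\<close>

lemma AC_deriv_abs_continuous_on:
  fixes y :: "real \<Rightarrow> complex"
  assumes y: "AC_deriv a b y f" and "a \<le> b"
  shows "abs_continuous_on a b y"
  unfolding abs_continuous_on_def
proof (intro allI impI)
  fix \<epsilon> :: real assume "\<epsilon> > 0"
  have f: "f absolutely_integrable_on {a..b}" using y by (simp add: AC_deriv_def)
  define g where "g x = indicator {a..b} x * norm (f x)" for x
  have gi: "integrable lebesgue g"
    using integrable_norm[OF f[unfolded set_integrable_def]] by (simp add: g_def[abs_def] abs_mult)
  have "(\<lambda>n. LINT x|lebesgue. g x - min (g x) (real n)) \<longlonglongrightarrow> (LINT x|(lebesgue::real measure). 0)"
  proof (rule integral_dominated_convergence[where w=g])
    show "AE x in lebesgue. (\<lambda>n. g x - min (g x) (real n)) \<longlonglongrightarrow> 0"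
    proof (rule AE_I2)
      fix x
      have "\<forall>\<^sub>F n in sequentially. g x - min (g x) (real n) = 0"
      proof -
        obtain N where "g x < real N" using reals_Archimedean2 by blast
        then show ?thesis by (intro eventually_sequentiallyI[of N]) auto
      qed
      then show "(\<lambda>n. g x - min (g x) (real n)) \<longlonglongrightarrow> 0" by (rule tendsto_eventually)
    qed
    show "\<And>n. AE x in lebesgue. norm (g x - min (g x) (real n)) \<le> g x" by (auto simp: g_def)
  qed (use gi in auto)
  then have "\<forall>\<^sub>F n in sequentially. (LINT x|lebesgue. g x - min (g x) (real n)) < \<epsilon>/2"
    using \<open>\<epsilon> > 0\<close> by (intro order_tendstoD) auto
  then obtain n where n: "(LINT x|lebesgue. g x - min (g x) (real n)) < \<epsilon>/2"
    by (meson eventually_sequentially order_refl)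
  define m where "m x = g x - min (g x) (real n)" for x
  have [measurable]: "g \<in> borel_measurable lebesgue" using gi by auto
  have g0: "g x \<ge> 0" for x by (simp add: g_def)
  have mi: "integrable lebesgue m" unfolding m_def[abs_def]
    by (rule Bochner_Integration.integrable_bound[OF gi]) (use g0 in \<open>auto simp: min_def\<close>)
  show "\<exists>\<delta>>0. \<forall>(N::nat) u v. (\<forall>i<N. a \<le> u i \<and> u i \<le> v i \<and> v i \<le> b) \<and>
        disjoint_family_on (\<lambda>i. {u i<..<v i}) {..<N} \<and> (\<Sum>i<N. v i - u i) < \<delta>
        \<longrightarrow> (\<Sum>i<N. cmod (y (v i) - y (u i))) < \<epsilon>"
  proof (intro exI[of _ "\<epsilon> / (2 * (real n + 1))"] conjI allI impI)
    show "\<epsilon> / (2 * (real n + 1)) > 0" using \<open>\<epsilon> > 0\<close> by simp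
    fix N :: nat and u v :: "nat \<Rightarrow> real"
    assume A: "(\<forall>i<N. a \<le> u i \<and> u i \<le> v i \<and> v i \<le> b) \<and>
        disjoint_family_on (\<lambda>i. {u i<..<v i}) {..<N} \<and> (\<Sum>i<N. v i - u i) < \<epsilon> / (2 * (real n + 1))"
    have "cmod (y (v i) - y (u i)) \<le> (LINT x:{u i<..<v i}|lebesgue. m x) + real n * (v i - u i)" if "i < N" for i
    proof -
      have uv: "a \<le> u i" "u i \<le> v i" "v i \<le> b" using A that by auto
      have f': "f absolutely_integrable_on {u i..v i}"
        using absolutely_integrable_on_subinterval[OF f, of "u i" "v i"] uv by auto
      have nf: "(\<lambda>x. norm (f x)) absolutely_integrable_on {u i..v i}"
        using f' by (rule set_integrable_norm)
      have "y (v i) - y (u i) = integral {u i..v i} f" using AC_deriv_diff[OF y uv] .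
      also have "norm \<dots> \<le> integral {u i..v i} (\<lambda>x. norm (f x))"
        using f' nf by (intro integral_norm_bound_integral set_lebesgue_integral_eq_integral(1)) auto
      also have "\<dots> = (LINT x:{u i..v i}|lebesgue. norm (f x))"
        using nf by (simp add: set_lebesgue_integral_eq_integral(2))
      also have "\<dots> = (LINT x:{u i<..<v i}|lebesgue. g x)"
        unfolding set_lebesgue_integral_def
      proof (rule integral_cong_AE)
        have "AE x in lebesgue. x \<noteq> u i" "AE x in lebesgue. x \<noteq> v i"
          using AE_completion[OF AE_lborel_singleton] by auto
        then show "AE x in lebesgue. indicat_real {u i..v i} x *\<^sub>R norm (f x) = indicat_real {u i<..<v i} x *\<^sub>R g x"
          by eventually_elim (use uv in \<open>auto simp: indicator_def g_def\<close>)
        show "(\<lambda>x. indicat_real {u i..v i} x *\<^sub>R norm (f x)) \<in> borel_measurable lebesgue"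
          using nf by (auto simp: set_integrable_def)
        show "(\<lambda>x. indicat_real {u i<..<v i} x *\<^sub>R g x) \<in> borel_measurable lebesgue"
          using gi by (intro borel_measurable_scaleR borel_measurable_indicator) auto
      qed
      finally have y1: "cmod (y (v i) - y (u i)) \<le> (LINT x:{u i<..<v i}|lebesgue. g x)" .
      have msi: "set_integrable lebesgue {u i<..<v i} m" unfolding set_integrable_def
        using mi by (intro integrable_mult_indicator) auto
      have nsi: "set_integrable lebesgue {u i<..<v i} (\<lambda>x. real n)"
        unfolding set_integrable_def using uv by (auto intro!: integrable_real_indicator)
      have "(LINT x:{u i<..<v i}|lebesgue. g x) \<le> (LINT x:{u i<..<v i}|lebesgue. m x + real n)"
      proof (rule set_integral_mono)
        show "set_integrable lebesgue {u i<..<v i} g" unfolding set_integrable_def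
          using gi by (intro integrable_mult_indicator) auto
        show "set_integrable lebesgue {u i<..<v i} (\<lambda>x. m x + real n)"
          by (rule set_integral_add(1)[OF msi nsi])
      qed (auto simp: m_def)
      also have "(LINT x:{u i<..<v i}|lebesgue. m x + real n) = (LINT x:{u i<..<v i}|lebesgue. m x) + (LINT x:{u i<..<v i}|lebesgue. real n)"
        by (rule set_integral_add(2)[OF msi nsi])
      also have "(LINT x:{u i<..<v i}|lebesgue. real n) = real n * (v i - u i)"
        using uv by (simp add: set_lebesgue_integral_def)
      finally show ?thesis using y1 by simp
    qed
    then have "(\<Sum>i<N. cmod (y (v i) - y (u i))) \<le> (\<Sum>i<N. (LINT x:{u i<..<v i}|lebesgue. m x) + real n * (v i - u i))"
      by (intro sum_mono) auto
    also have "\<dots> = (\<Sum>i<N. (LINT x:{u i<..<v i}|lebesgue. m x)) + real n * (\<Sum>i<N. v i - u i)"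
      by (simp add: sum.distrib sum_distrib_left)
    also have "(\<Sum>i<N. (LINT x:{u i<..<v i}|lebesgue. m x)) \<le> (LINT x|lebesgue. m x)"
      by (rule sum_integral_disjoint_le[where S="{a..b}"]) (use A mi in \<open>force simp: m_def g_def\<close>)+
    also have "(LINT x|lebesgue. m x) < \<epsilon>/2" using n by (simp add: m_def)
    also have "real n * (\<Sum>i<N. v i - u i) \<le> (real n + 1) * (\<epsilon> / (2 * (real n + 1)))"
      using A by (intro mult_mono sum_nonneg) auto
    also have "\<dots> = \<epsilon>/2" by (simp add: field_simps)
    finally show "(\<Sum>i<N. cmod (y (v i) - y (u i))) < \<epsilon>" by simp
  qed
qed

section \<open>Absolutely continuous functions are indefinite integrals\<close>

text \<open>The inner clause of absolute continuity with \<epsilon> and \<delta> as parameters, so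
  that a pair of values can be obtained once and applied to many families of intervals.\<close>

definition ac_modulus :: "real \<Rightarrow> real \<Rightarrow> (real \<Rightarrow> complex) \<Rightarrow> real \<Rightarrow> real \<Rightarrow> bool" where
  "ac_modulus a b f \<epsilon> \<delta> \<longleftrightarrow> (\<forall>(n::nat) u v. (\<forall>i<n. a \<le> u i \<and> u i \<le> v i \<and> v i \<le> b) \<and>
        disjoint_family_on (\<lambda>i. {u i<..<v i}) {..<n} \<and> (\<Sum>i<n. v i - u i) < \<delta>
        \<longrightarrow> (\<Sum>i<n. cmod (f (v i) - f (u i))) < \<epsilon>)"

lemma abs_continuous_on_iff_modulus:
  "abs_continuous_on a b f \<longleftrightarrow> (\<forall>\<epsilon>>0. \<exists>\<delta>>0. ac_modulus a b f \<epsilon> \<delta>)"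
  unfolding abs_continuous_on_def ac_modulus_def ..

text \<open>The definition numbers intervals by naturals below \<open>n\<close>; later families are
  indexed by integers (cells of a grid) and by pairs (subdivisions of given intervals).\<close>

lemma abs_continuous_on_families:
  assumes mod: "ac_modulus a b f \<epsilon> \<delta>"
    and I: "finite I" "disjoint_family_on (\<lambda>i. {u i<..<v i}) I"
      "\<And>i. i \<in> I \<Longrightarrow> a \<le> u i \<and> u i \<le> v i \<and> v i \<le> b" "(\<Sum>i\<in>I. v i - u i) < \<delta>"
  shows "(\<Sum>i\<in>I. cmod (f (v i) - f (u i))) < \<epsilon>"
proof -
  obtain h where h: "bij_betw h {..<card I} I"
    using ex_bij_betw_nat_finite[OF I(1)] by (auto simp: atLeast0LessThan)
  have hI: "h i \<in> I" if "i < card I" for i using h that by (auto simp: bij_betw_def)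
  have inj: "inj_on h {..<card I}" using h by (simp add: bij_betw_def)
  have "(\<Sum>i<card I. cmod (f ((v \<circ> h) i) - f ((u \<circ> h) i))) < \<epsilon>"
  proof (rule mod[unfolded ac_modulus_def, rule_format], intro conjI allI impI)
    show "disjoint_family_on (\<lambda>i. {(u \<circ> h) i<..<(v \<circ> h) i}) {..<card I}"
      using I(2) hI inj unfolding disjoint_family_on_def inj_on_def by (metis comp_apply lessThan_iff)
    have "(\<Sum>i<card I. (v \<circ> h) i - (u \<circ> h) i) = (\<Sum>i\<in>I. v i - u i)"
      using sum.reindex_bij_betw[OF h, of "\<lambda>i. v i - u i"] by simp
    then show "(\<Sum>i<card I. (v \<circ> h) i - (u \<circ> h) i) < \<delta>" using I(4) by simp
  qed (use I(3) hI in auto)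
  moreover have "(\<Sum>i<card I. cmod (f ((v \<circ> h) i) - f ((u \<circ> h) i))) = (\<Sum>i\<in>I. cmod (f (v i) - f (u i)))"
    using sum.reindex_bij_betw[OF h, of "\<lambda>i. cmod (f (v i) - f (u i))"] by simp
  ultimately show ?thesis by simp
qed

lemma finite_measure_interval_measure:
  assumes mono: "\<And>x y. x \<le> y \<Longrightarrow> F x \<le> F y" and cont: "\<And>x. continuous (at_right x) F"
    and bnd: "\<And>x. l \<le> F x" "\<And>x. F x \<le> u"
  shows "finite_measure (interval_measure F)"
proof (rule finite_measureI)
  have "\<exists>n. x \<in> {-real n<..real n}" for x
  proof -
    obtain n where "\<bar>x\<bar> < real n" using reals_Archimedean2 by blast
    then show ?thesis by (intro exI[of _ n]) auto
  qed
  then have "space (interval_measure F) = (\<Union>n. {-real n<..real n})"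
    unfolding space_interval_measure by blast
  then have "emeasure (interval_measure F) (space (interval_measure F)) = emeasure (interval_measure F) (\<Union>n. {-real n<..real n})"
    by (rule arg_cong)
  also have "\<dots> = (SUP n. emeasure (interval_measure F) {-real n<..real n})"
    by (rule SUP_emeasure_incseq[symmetric]) (auto simp: incseq_def)
  also have "\<dots> \<le> ennreal (u - l)"
    using bnd by (intro SUP_least) (auto simp: emeasure_interval_measure_Ioc[OF _ mono cont] intro!: ennreal_leI diff_mono)
  finally show "emeasure (interval_measure F) (space (interval_measure F)) \<noteq> \<infinity>"
    by (auto simp: top_unique)
qed

text \<open>The Stieltjes measure of \<open>V\<close> is absolutely continuous with respect to
  Lebesgue measure, and its Radon-Nikodym density is the derivative. It suffices to look at compact
  null sets: finitely many grid cells of small total length cover them, and \<open>V\<close> grows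
  by less than \<epsilon> over these cells.\<close>

lemma AC_deriv_ex_mono:
  fixes V :: "real \<Rightarrow> real"
  assumes "a \<le> b" and mono: "\<And>x y. a \<le> x \<Longrightarrow> x \<le> y \<Longrightarrow> y \<le> b \<Longrightarrow> V x \<le> V y"
    and ac: "abs_continuous_on a b (\<lambda>x. complex_of_real (V x))"
  shows "\<exists>f. AC_deriv a b V f"
proof -
  \<comment> \<open>Clamping to [a,b] extends \<open>V\<close> to a monotone function on the whole
    line, as \<open>interval_measure\<close> expects.\<close>
  define c where "c x = max a (min b x)" for x
  define F where "F x = V (c x)" for x
  have c: "a \<le> c x" "c x \<le> b" "x \<le> y \<Longrightarrow> c x \<le> c y" for x y
    using \<open>a \<le> b\<close> by (auto simp: c_def)
  have cid: "x \<in> {a..b} \<Longrightarrow> c x = x" for x by (auto simp: c_def)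
  have c1: "c y - c x \<le> y - x" if "x \<le> y" for x y using that by (auto simp: c_def)
  have Fm: "x \<le> y \<Longrightarrow> F x \<le> F y" for x y unfolding F_def using c by (intro mono) auto
  \<comment> \<open>The index type is \<open>int\<close> because the covering cells below are
    numbered by their position in a grid.\<close>
  define fm where "fm \<epsilon> \<delta> \<longleftrightarrow> (\<forall>(I::int set) u v. finite I \<and> disjoint_family_on (\<lambda>i. {u i<..<v i}) I \<and> (\<forall>i\<in>I. u i \<le> v i) \<and> (\<Sum>i\<in>I. v i - u i) < \<delta>
    \<longrightarrow> (\<Sum>i\<in>I. F (v i) - F (u i)) < \<epsilon>)" for \<epsilon> \<delta> :: real
  have fmD: "fm \<epsilon> \<delta> \<Longrightarrow> finite I \<Longrightarrow> disjoint_family_on (\<lambda>i. {u i<..<v i}) I \<Longrightarrow> (\<forall>i\<in>I. u i \<le> v i) \<Longrightarrow> (\<Sum>i\<in>I. v i - u i) < \<delta>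
      \<Longrightarrow> (\<Sum>i\<in>I. F (v i) - F (u i)) < \<epsilon>" for \<epsilon> \<delta> :: real and I :: "int set" and u v
    unfolding fm_def by blast
  have fam: "\<exists>\<delta>>0. fm \<epsilon> \<delta>" if e0: "\<epsilon> > 0" for \<epsilon> :: real
  proof -
    obtain \<delta> where "\<delta> > 0" and \<delta>: "ac_modulus a b (\<lambda>x. complex_of_real (V x)) \<epsilon> \<delta>"
      using ac e0 unfolding abs_continuous_on_iff_modulus by blast
    have "fm \<epsilon> \<delta>" unfolding fm_def
    proof (intro allI impI)
      fix I :: "int set" and u v :: "int \<Rightarrow> real"
      assume A: "finite I \<and> disjoint_family_on (\<lambda>i. {u i<..<v i}) I \<and> (\<forall>i\<in>I. u i \<le> v i) \<and> (\<Sum>i\<in>I. v i - u i) < \<delta>"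
      have "(\<Sum>i\<in>I. cmod (complex_of_real (V (c (v i))) - complex_of_real (V (c (u i))))) < \<epsilon>"
      proof (rule abs_continuous_on_families[OF \<delta>])
        have "{c (u i)<..<c (v i)} \<subseteq> {u i<..<v i}" for i by (auto simp: c_def)
        then show "disjoint_family_on (\<lambda>i. {c (u i)<..<c (v i)}) I"
          using A unfolding disjoint_family_on_def by blast
        have "(\<Sum>i\<in>I. c (v i) - c (u i)) \<le> (\<Sum>i\<in>I. v i - u i)"
          using A by (intro sum_mono c1) auto
        then show "(\<Sum>i\<in>I. c (v i) - c (u i)) < \<delta>" using A by simp
      qed (use A c in auto)
      moreover have "F (v i) - F (u i) \<le> cmod (complex_of_real (V (c (v i))) - complex_of_real (V (c (u i))))" for i
        by (metis F_def abs_ge_self norm_of_real of_real_diff)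
      then have "(\<Sum>i\<in>I. F (v i) - F (u i)) \<le> (\<Sum>i\<in>I. cmod (complex_of_real (V (c (v i))) - complex_of_real (V (c (u i)))))"
        by (intro sum_mono) blast
      ultimately show "(\<Sum>i\<in>I. F (v i) - F (u i)) < \<epsilon>" by linarith
    qed
    then show ?thesis using \<open>\<delta> > 0\<close> by blast
  qed
  have Fc: "continuous (at_right x) F" for x
    unfolding continuous_within
  proof (rule tendstoI)
    fix e :: real assume "e > 0"
    then obtain \<delta> where \<delta>: "\<delta> > 0" "fm e \<delta>"
      using fam by blast
    have "dist (F y) (F x) < e" if "x < y" "y < x + \<delta>" for y
      using fmD[OF \<delta>(2), of "{0}" "\<lambda>_. x" "\<lambda>_. y"] that Fm[of x y] by (auto simp: dist_real_def disjoint_family_on_def)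
    then show "\<forall>\<^sub>F y in at_right x. dist (F y) (F x) < e"
      using \<open>\<delta> > 0\<close> by (auto simp: eventually_at_right_field intro!: exI[of _ "x + \<delta>"])
  qed
  define \<nu> where "\<nu> = interval_measure F"
  have \<nu>I: "emeasure \<nu> {s<..t} = ennreal (F t - F s)" if "s \<le> t" for s t
    unfolding \<nu>_def by (rule emeasure_interval_measure_Ioc[OF that Fm Fc])
  have \<nu>s: "sets \<nu> = sets borel" by (simp add: \<nu>_def)
  have Fb: "V a \<le> F x" "F x \<le> V b" for x
    unfolding F_def using c \<open>a \<le> b\<close> by (auto intro!: mono)
  have \<nu>fin: "finite_measure \<nu>" unfolding \<nu>_def
    by (rule finite_measure_interval_measure[where l="V a" and u="V b"]) (use Fm Fc Fb in blast)+
  then have \<nu>sp: "emeasure \<nu> (space \<nu>) \<noteq> \<infinity>" by (simp add: finite_measure.emeasure_finite)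
  have K0: "emeasure \<nu> K = 0" if K: "compact K" "emeasure lborel K = 0" for K
  proof -
    have "emeasure \<nu> K \<le> ennreal \<epsilon>" if e0: "\<epsilon> > 0" for \<epsilon> :: real
    proof -
      obtain \<delta> where \<delta>: "\<delta> > 0" "fm \<epsilon> \<delta>"
        using fam[OF e0] by blast
      have Kb: "K \<in> sets borel" using K(1) by (simp add: borel_closed compact_imp_closed)
      obtain U where U: "open U" "K \<subseteq> U" "emeasure lborel (U - K) < \<delta>"
        using outer_regular_lborel[OF Kb \<open>\<delta> > 0\<close>] by metis
      have U\<delta>: "emeasure lborel U < \<delta>"
        using emeasure_Un_null_set[of "U - K" lborel K] U K Kb
        by (simp add: null_sets_def Un_absorb2)
      obtain d where d: "d > 0" "(\<Union>x\<in>K. ball x d) \<subseteq> U"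
        using compact_subset_open_imp_ball_epsilon_subset[OF K(1) U(1,2)] by metis
      \<comment> \<open>With mesh d/2, a cell that meets \<open>K\<close> stays within distance d of
        a point of \<open>K\<close> and hence inside \<open>U\<close>.\<close>
      define h where "h = d / 2"
      have h: "h > 0" using d by (simp add: h_def)
      \<comment> \<open>Number i of the cell (i h, (i+1) h] containing \<open>x\<close>. The cells
        are half-open like the intervals whose Stieltjes measure is known.\<close>
      define k where "k x = \<lceil>x / h\<rceil> - 1" for x
      define u where "u = (\<lambda>i::int. of_int i * h)"
      define v where "v = (\<lambda>i::int. (of_int i + 1) * h)"
      have xk: "x \<in> {u (k x)<..v (k x)}" for x
      proof -
        have "of_int \<lceil>x/h\<rceil> - 1 < x/h" "x/h \<le> of_int \<lceil>x/h\<rceil>" by linarith+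
        then have "(of_int \<lceil>x/h\<rceil> - 1) * h < x" "x \<le> of_int \<lceil>x/h\<rceil> * h"
          using h by (simp_all only: pos_less_divide_eq pos_divide_le_eq)
        then show ?thesis by (simp add: u_def v_def k_def)
      qed
      have fink: "finite (k ` K)"
      proof -
        obtain B where B: "\<And>x. x \<in> K \<Longrightarrow> \<bar>x\<bar> \<le> B" using compact_imp_bounded[OF K(1)] by (auto simp: bounded_iff)
        have "k ` K \<subseteq> {\<lceil>-B/h\<rceil> - 1..\<lceil>B/h\<rceil> - 1}"
        proof (rule image_subsetI)
          fix x assume "x \<in> K"
          then have "-B \<le> x" "x \<le> B" using B[of x] by auto
          then have "-B/h \<le> x/h" "x/h \<le> B/h" using h divide_right_mono[of "-B" x h] divide_right_mono[of x B h] by simp_all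
          from ceiling_mono[OF this(1)] ceiling_mono[OF this(2)]
          show "k x \<in> {\<lceil>-B/h\<rceil> - 1..\<lceil>B/h\<rceil> - 1}"
            unfolding k_def by simp
        qed
        then show ?thesis by (rule finite_subset) simp
      qed
      have disj': "disjoint_family (\<lambda>i. {u i<..v i})"
      proof -
        have "i = j" if "x \<in> {u i<..v i}" "x \<in> {u j<..v j}" for i j x
        proof -
          have "of_int i * h < (of_int j + 1) * h" "of_int j * h < (of_int i + 1) * h" using that by (auto simp: u_def v_def)
          then have "of_int i < (of_int j + 1 :: real)" "of_int j < (of_int i + 1 :: real)" using h by auto
          then show ?thesis by linarith
        qed
        then show ?thesis unfolding disjoint_family_on_def by blast
      qed
      have sub: "{u i<..v i} \<subseteq> U" if "i \<in> k ` K" for i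
      proof -
        from that obtain x where x: "x \<in> K" "i = k x" by blast
        have "{u i<..v i} \<subseteq> ball x d"
        proof
          fix t assume t: "t \<in> {u i<..v i}"
          have "v i - u i = h" by (simp add: u_def v_def algebra_simps)
          then show "t \<in> ball x d" using t xk[of x] x(2) unfolding h_def by (auto simp: dist_real_def abs_if)
        qed
        then show ?thesis using d x by blast
      qed
      have uv: "u i \<le> v i" for i using h by (simp add: u_def v_def)
      have "ennreal (\<Sum>i\<in>k`K. v i - u i) = (\<Sum>i\<in>k`K. emeasure lborel {u i<..v i})"
        using uv by (subst sum_ennreal[symmetric]) auto
      also have "\<dots> = emeasure lborel (\<Union>i\<in>k`K. {u i<..v i})"
        using fink disj' by (intro sum_emeasure) (auto simp: disjoint_family_on_def)
      also have "\<dots> \<le> emeasure lborel U"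
        using sub U by (intro emeasure_mono) auto
      also have "\<dots> < ennreal \<delta>" by fact
      finally have "(\<Sum>i\<in>k`K. v i - u i) < \<delta>" by (simp add: ennreal_less_iff sum_nonneg uv)
      moreover have "disjoint_family_on (\<lambda>i. {u i<..<v i}) (k ` K)"
        using disj' unfolding disjoint_family_on_def by (fastforce simp: disjoint_iff)
      ultimately have F\<epsilon>: "(\<Sum>i\<in>k`K. F (v i) - F (u i)) < \<epsilon>" using uv fink by (intro fmD[OF \<delta>(2)]) auto
      have "emeasure \<nu> K \<le> emeasure \<nu> (\<Union>i\<in>k`K. {u i<..v i})"
        using xk \<nu>s fink by (intro emeasure_mono) (auto intro!: sets.finite_UN simp del: UN_simps)
      also have "\<dots> \<le> (\<Sum>i\<in>k`K. emeasure \<nu> {u i<..v i})"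
        by (rule emeasure_subadditive_finite[OF fink]) (simp add: \<nu>s image_subset_iff)
      also have "\<dots> = ennreal (\<Sum>i\<in>k`K. F (v i) - F (u i))"
        using uv by (subst sum_ennreal[symmetric]) (auto simp: \<nu>I Fm)
      also have "\<dots> \<le> ennreal \<epsilon>" using F\<epsilon> by (intro ennreal_leI) simp
      finally show ?thesis .
    qed
    then show ?thesis by (metis ennreal_le_epsilon le_zero_eq add_0)
  qed
  have ac': "absolutely_continuous lborel \<nu>"
    unfolding absolutely_continuous_def
  proof
    fix N assume N: "N \<in> null_sets (lborel::real measure)"
    then have Nb: "N \<in> sets borel" "emeasure lborel N = 0" by (auto simp: null_sets_def)
    \<comment> \<open>Inner regularity reduces a Borel null set to its compact subsets, which
      \<open>K0\<close> has dealt with.\<close>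
    have "emeasure \<nu> N = (SUP K\<in>{K. K \<subseteq> N \<and> compact K}. emeasure \<nu> K)"
      using inner_regular[OF \<nu>s \<nu>sp Nb(1)] .
    also have "\<dots> = 0"
    proof -
      have "emeasure \<nu> K = 0" if "K \<subseteq> N" "compact K" for K
        using K0[OF that(2)] emeasure_mono[OF that(1), of lborel] Nb by simp
      then show ?thesis by (intro antisym SUP_least) auto
    qed
    finally show "N \<in> null_sets \<nu>" using Nb \<nu>s by (auto simp: null_sets_def)
  qed
  then obtain f where f: "f \<in> borel_measurable lborel" "density lborel f = \<nu>"
    using sigma_finite_measure.Radon_Nikodym[OF sigma_finite_lborel ac'] \<nu>s by auto
  have fint: "(\<integral>\<^sup>+x. f x \<partial>lborel) = emeasure \<nu> UNIV"
    unfolding f(2)[symmetric] using f(1) by (subst emeasure_density) auto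
  also have "\<dots> < top" using \<nu>sp by (simp add: \<nu>_def less_top)
  finally have "AE x in lborel. f x \<noteq> \<infinity>"
    using f(1) by (intro nn_integral_PInf_AE) auto
  then have fg: "AE x in lborel. f x = ennreal (enn2real (f x))"
    by eventually_elim (simp add: less_top)
  define g where "g x = enn2real (f x)" for x
  have gm[measurable]: "g \<in> borel_measurable borel" using f(1) unfolding g_def[abs_def] by simp
  have "(\<integral>\<^sup>+x. ennreal (g x) \<partial>lborel) = (\<integral>\<^sup>+x. f x \<partial>lborel)"
    by (rule nn_integral_cong_AE) (use fg in \<open>auto simp: g_def\<close>)
  then have gi: "integrable lborel g"
    using fint \<nu>sp by (intro integrableI_nonneg) (auto simp: g_def \<nu>_def less_top)
  have "V x = V a + integral {a..x} g" if x: "x \<in> {a..b}" for x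
  proof -
    have si: "set_integrable lborel {a..x} g" unfolding set_integrable_def
      using gi by (intro integrable_mult_indicator) auto
    have "ennreal (V x - V a) = emeasure \<nu> {a<..x}"
      using x \<open>a \<le> b\<close> by (simp add: \<nu>I F_def cid)
    also have "\<dots> = (\<integral>\<^sup>+t. f t * indicator {a<..x} t \<partial>lborel)"
      unfolding f(2)[symmetric] using f(1) by (subst emeasure_density) auto
    also have "\<dots> = (\<integral>\<^sup>+t. ennreal (indicator {a..x} t *\<^sub>R g t) \<partial>lborel)"
      by (rule nn_integral_cong_AE) (use fg AE_lborel_singleton[of a] in eventually_elim, auto simp: indicator_def g_def)
    also have "\<dots> = ennreal (LINT t:{a..x}|lborel. g t)"
      unfolding set_lebesgue_integral_def
      using si by (intro nn_integral_eq_integral) (auto simp: set_integrable_def g_def)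
    finally have "V x - V a = (LINT t:{a..x}|lborel. g t)"
      using mono[of a x] x by (subst (asm) ennreal_inj) (auto simp: set_lebesgue_integral_def g_def intro!: integral_nonneg_AE)
    then show ?thesis using set_borel_integral_eq_integral(2)[OF si] by simp
  qed
  moreover have "g absolutely_integrable_on {a..b}"
    unfolding set_integrable_def using gi by (intro integrable_mult_indicator) (auto simp: integrable_completion)
  ultimately show ?thesis unfolding AC_deriv_def by blast
qed

lemma AC_derivD: "AC_deriv a b y f \<Longrightarrow> x \<in> {a..b} \<Longrightarrow> y x = y a + integral {a..x} f"
  unfolding AC_deriv_def by blast

lemma AC_deriv_combine:
  assumes y1: "AC_deriv a c y f" and y2: "AC_deriv c b y g" and "a \<le> c" "c \<le> b"
  shows "AC_deriv a b y (\<lambda>x. if x \<le> c then f x else g x)"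
    (is "AC_deriv a b y ?h")
proof -
  have f: "f absolutely_integrable_on {a..c}" and g: "g absolutely_integrable_on {c..b}"
    using assms unfolding AC_deriv_def by blast+
  have h1: "?h absolutely_integrable_on {a..c}"
    by (rule absolutely_integrable_spike[OF f, of "{}"]) auto
  have h2: "?h absolutely_integrable_on {c..b}"
    by (rule absolutely_integrable_spike[OF g, of "{c}"]) auto
  have i1: "integral {a..x} ?h = integral {a..x} f" if "x \<le> c" for x
    using that by (intro Henstock_Kurzweil_Integration.integral_cong) auto
  have i2: "integral {c..x} ?h = integral {c..x} g" for x
    by (rule integral_spike[of "{c}"]) auto
  have h: "?h absolutely_integrable_on {a..b}"
    using absolutely_integrable_Un[OF h1 h2] assms by (simp add: ivl_disj_un_two_touch)
  have "y x = y a + integral {a..x} ?h" if x: "x \<in> {a..b}" for x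
  proof (cases "x \<le> c")
    case True
    then show ?thesis using AC_derivD[OF y1, of x] x i1[OF True] by simp
  next
    case False
    have "?h integrable_on {a..x}"
      using absolutely_integrable_on_subinterval[OF h, of a x] x
      by (intro set_lebesgue_integral_eq_integral(1)) auto
    then have "integral {a..x} ?h = integral {a..c} ?h + integral {c..x} ?h"
      using False assms by (intro Henstock_Kurzweil_Integration.integral_combine[symmetric]) auto
    moreover have "y c = y a + integral {a..c} f"
      using y1 assms(3) unfolding AC_deriv_def by (meson atLeastAtMost_iff order_refl)
    moreover have "y x = y c + integral {c..x} g"
      using y2 x False unfolding AC_deriv_def by (meson atLeastAtMost_iff less_imp_le not_le)
    ultimately show ?thesis using i1[of c] i2[of x] by simp
  qed
  with h show ?thesis unfolding AC_deriv_def by blast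
qed

lemma AC_deriv_lincomb:
  assumes y: "AC_deriv a b y f" and w: "AC_deriv a b w g"
  shows "AC_deriv a b (\<lambda>x. y x + w x) (\<lambda>x. f x + g x)"
proof -
  have f: "f absolutely_integrable_on {a..b}" and g: "g absolutely_integrable_on {a..b}"
    using assms by (auto simp: AC_deriv_def)
  have "y x + w x = y a + w a + integral {a..x} (\<lambda>x. f x + g x)" if x: "x \<in> {a..b}" for x
  proof -
    have "f integrable_on {a..x}" "g integrable_on {a..x}"
      using absolutely_integrable_on_subinterval[OF f, of a x] absolutely_integrable_on_subinterval[OF g, of a x] x
      by (auto intro!: set_lebesgue_integral_eq_integral(1))
    then have "integral {a..x} (\<lambda>x. f x + g x) = integral {a..x} f + integral {a..x} g"
      by (rule Henstock_Kurzweil_Integration.integral_add)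
    moreover have "y x = y a + integral {a..x} f" "w x = w a + integral {a..x} g"
      using y w x unfolding AC_deriv_def by blast+
    ultimately show ?thesis by simp
  qed
  moreover have "(\<lambda>x. f x + g x) absolutely_integrable_on {a..b}"
    using f g by (rule set_integral_add(1))
  ultimately show ?thesis unfolding AC_deriv_def by blast
qed

text \<open>Absolute continuity concerns increments alone, so it passes to any function whose
  increments are dominated. This serves real and imaginary parts, differences, products and
  exponentials.\<close>

lemma abs_continuous_on_compare:
  assumes f: "abs_continuous_on a b f" and g: "abs_continuous_on a b g" and "C \<ge> 0"
    and le: "\<And>s t. a \<le> s \<Longrightarrow> s \<le> t \<Longrightarrow> t \<le> b \<Longrightarrow> cmod (h t - h s) \<le> C * (cmod (f t - f s) + cmod (g t - g s))"
  shows "abs_continuous_on a b h"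
  unfolding abs_continuous_on_iff_modulus
proof (intro allI impI)
  fix \<epsilon> :: real assume "\<epsilon> > 0"
  \<comment> \<open>C + 1 in place of C keeps \<open>e\<close> positive for C = 0 and makes the last
    inequality strict.\<close>
  define e where "e = \<epsilon> / (2 * (C + 1))"
  have e: "e > 0" using \<open>\<epsilon> > 0\<close> \<open>C \<ge> 0\<close> by (simp add: e_def)
  then obtain d1 d2 where d: "d1 > 0" "d2 > 0" "ac_modulus a b f e d1" "ac_modulus a b g e d2"
    using f g unfolding abs_continuous_on_iff_modulus by blast
  have "ac_modulus a b h \<epsilon> (min d1 d2)"
    unfolding ac_modulus_def
  proof (intro allI impI)
    fix n :: nat and u v
    assume A: "(\<forall>i<n. a \<le> u i \<and> u i \<le> v i \<and> v i \<le> b) \<and> disjoint_family_on (\<lambda>i. {u i<..<v i}) {..<n} \<and> (\<Sum>i<n. v i - u i) < min d1 d2"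
    have 1: "(\<Sum>i<n. cmod (f (v i) - f (u i))) < e" using A d(3)[unfolded ac_modulus_def] by simp
    have 2: "(\<Sum>i<n. cmod (g (v i) - g (u i))) < e" using A d(4)[unfolded ac_modulus_def] by simp
    have "(\<Sum>i<n. cmod (h (v i) - h (u i))) \<le> (\<Sum>i<n. C * (cmod (f (v i) - f (u i)) + cmod (g (v i) - g (u i))))"
      using A by (intro sum_mono le) auto
    also have "\<dots> = C * ((\<Sum>i<n. cmod (f (v i) - f (u i))) + (\<Sum>i<n. cmod (g (v i) - g (u i))))"
      by (simp only: sum.distrib[symmetric] sum_distrib_left)
    also have "\<dots> \<le> C * (e + e)" using 1 2 \<open>C \<ge> 0\<close> by (intro mult_left_mono) auto
    also have "\<dots> < (C + 1) * (e + e)" using e by simp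
    also have "(C + 1) * (e + e) = e * (2 * (C + 1))" by (simp add: algebra_simps)
    also have "\<dots> = \<epsilon>" using \<open>C \<ge> 0\<close> unfolding e_def by (intro nonzero_eq_divide_eq[THEN iffD1, OF _ refl]) auto
    finally show "(\<Sum>i<n. cmod (h (v i) - h (u i))) < \<epsilon>" .
  qed
  then show "\<exists>\<delta>>0. ac_modulus a b h \<epsilon> \<delta>" using d by (intro exI[of _ "min d1 d2"]) auto
qed

lemma abs_continuous_on_subinterval:
  assumes f: "abs_continuous_on a b f" and "a \<le> c" "d \<le> b"
  shows "abs_continuous_on c d f"
  unfolding abs_continuous_on_iff_modulus
proof (intro allI impI)
  fix \<epsilon> :: real assume "\<epsilon> > 0"
  then obtain \<delta> where "\<delta> > 0" "ac_modulus a b f \<epsilon> \<delta>"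
    using f unfolding abs_continuous_on_iff_modulus by blast
  moreover from this(2) have "ac_modulus c d f \<epsilon> \<delta>"
    using assms(2,3) unfolding ac_modulus_def by (meson order.trans)
  ultimately show "\<exists>\<delta>>0. ac_modulus c d f \<epsilon> \<delta>" by blast
qed

text \<open>Jordan decomposition: \<open>V\<close> in the proof is the positive variation of \<open>y\<close>.\<close>

lemma AC_deriv_ex_short_interval:
  fixes y :: "real \<Rightarrow> real"
  assumes "a \<le> b" and ac: "abs_continuous_on a b (\<lambda>x. complex_of_real (y x))"
    and mod: "ac_modulus a b (\<lambda>x. complex_of_real (y x)) 1 dd" and small: "b - a < dd"
  shows "\<exists>f. AC_deriv a b y f"
proof -
  define fam where "fam c d n u v \<longleftrightarrow> (\<forall>i<n. c \<le> u i \<and> u i \<le> v i \<and> v i \<le> d) \<and> disjoint_family_on (\<lambda>i. {u i<..<v i}) {..<n}"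
    for c d :: real and n :: nat and u v :: "nat \<Rightarrow> real"
  \<comment> \<open>The supremum of \<open>S a x\<close> is the positive variation of
    \<open>y\<close> over [a,x].\<close>
  define S where "S c d = {(\<Sum>i<n. y (v i) - y (u i)) | n u v. fam c d n u v}" for c d
  have SI: "fam c d n u v \<Longrightarrow> (\<Sum>i<n. y (v i) - y (u i)) \<in> S c d" for c d n u v
    unfolding S_def by blast
  have yle: "y t - y s \<le> cmod (complex_of_real (y t) - complex_of_real (y s))" for s t
    by (metis abs_ge_self norm_of_real of_real_diff)
  have S0: "0 \<in> S c d" for c d
    unfolding S_def fam_def by (rule CollectI, rule exI[of _ 0]) (auto simp: disjoint_family_on_def)
  have Smono: "S c d \<subseteq> S c' d'" if "c' \<le> c" "d \<le> d'" for c d c' d'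
  proof
    fix s assume "s \<in> S c d"
    then obtain n u v where "s = (\<Sum>i<n. y (v i) - y (u i))" "fam c d n u v" unfolding S_def by blast
    moreover from this(2) have "fam c' d' n u v" using that unfolding fam_def by fastforce
    ultimately show "s \<in> S c' d'" unfolding S_def by blast
  qed
  \<comment> \<open>Here the variation becomes finite: the whole interval is shorter than the
    modulus belonging to 1, so every sum is at most 1.\<close>
  have S1: "s \<le> 1" if sS: "s \<in> S c d" and cd: "a \<le> c" "d \<le> b" for s c d
  proof -
    have "s \<in> S a b" using Smono[OF cd] sS by blast
    then obtain n u v where s: "s = (\<Sum>i<n. y (v i) - y (u i))" and f: "fam a b n u v" unfolding S_def by blast
    have "(\<Sum>i<n. v i - u i) \<le> b - a"
      by (rule sum_length_disjoint_le) (use f \<open>a \<le> b\<close> in \<open>auto simp: fam_def\<close>)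
    then have "(\<Sum>i<n. cmod (complex_of_real (y (v i)) - complex_of_real (y (u i)))) < 1"
      using mod small f unfolding ac_modulus_def fam_def by simp
    moreover have "s \<le> (\<Sum>i<n. cmod (complex_of_real (y (v i)) - complex_of_real (y (u i))))"
      unfolding s by (intro sum_mono yle)
    ultimately show ?thesis by simp
  qed
  have Sext: "s + (y x' - y x) \<in> S c x'" if sS: "s \<in> S c x" and "c \<le> x" "x \<le> x'" for s c x x'
  proof -
    obtain n u v where s: "s = (\<Sum>i<n. y (v i) - y (u i))" and f: "fam c x n u v" using sS unfolding S_def by blast
    have uv: "c \<le> u i" "u i \<le> v i" "v i \<le> x" if "i < n" for i using f that unfolding fam_def by blast+
    have "fam c x' (Suc n) (u(n := x)) (v(n := x'))"
      unfolding fam_def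
    proof (intro conjI allI impI)
      fix i assume i: "i < Suc n"
      show "c \<le> (u(n := x)) i" "(u(n := x)) i \<le> (v(n := x')) i" "(v(n := x')) i \<le> x'"
        using uv[of i] i that(2,3) by (auto simp: less_Suc_eq)
    next
      show "disjoint_family_on (\<lambda>i. {(u(n := x)) i<..<(v(n := x')) i}) {..<Suc n}"
        unfolding disjoint_family_on_def
      proof (intro ballI impI)
        fix i j assume ij: "i \<in> {..<Suc n}" "j \<in> {..<Suc n}" "i \<noteq> j"
        have dj: "{u i<..<v i} \<inter> {u j<..<v j} = {}" if "i < n" "j < n"
          using f that ij(3) unfolding fam_def disjoint_family_on_def by blast
        have e: "{u k<..<v k} \<inter> {x<..<x'} = {}" if "k < n" for k using uv[OF that] by auto
        consider "i = n" "j < n" | "j = n" "i < n" | "i < n" "j < n" using ij by force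
        then show "{(u(n := x)) i<..<(v(n := x')) i} \<inter> {(u(n := x)) j<..<(v(n := x')) j} = {}"
          using dj e[of i] e[of j] by cases (simp_all add: Int_commute)
      qed
    qed
    moreover have "s + (y x' - y x) = (\<Sum>i<Suc n. y ((v(n := x')) i) - y ((u(n := x)) i))"
      by (simp add: s)
    ultimately show ?thesis using SI by metis
  qed
  \<comment> \<open>Cutting every interval at \<open>x\<close> shows that the variation over [c,d]
    is at most the sum of those over [c,x] and [x,d].\<close>
  have Ssplit: "\<exists>s1\<in>S c x. \<exists>s2\<in>S x d. s = s1 + s2" if sS: "s \<in> S c d" and "c \<le> x" "x \<le> d" for s c x d
  proof -
    obtain n u v where s: "s = (\<Sum>i<n. y (v i) - y (u i))" and f: "fam c d n u v" using sS unfolding S_def by blast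
    have sub: "{min (u i) x<..<min (v i) x} \<subseteq> {u i<..<v i}" "{max (u i) x<..<max (v i) x} \<subseteq> {u i<..<v i}" for i
      by auto
    have uv: "c \<le> u i" "u i \<le> v i" "v i \<le> d" if "i < n" for i using f that unfolding fam_def by blast+
    have dj: "{u i<..<v i} \<inter> {u j<..<v j} = {}" if "i < n" "j < n" "i \<noteq> j" for i j
      using f that unfolding fam_def disjoint_family_on_def by blast
    have f1: "fam c x n (\<lambda>i. min (u i) x) (\<lambda>i. min (v i) x)"
      unfolding fam_def
    proof (intro conjI allI impI)
      fix i assume "i < n"
      then show "c \<le> min (u i) x" "min (u i) x \<le> min (v i) x" "min (v i) x \<le> x"
        using uv[of i] that(2) by auto
    next
      show "disjoint_family_on (\<lambda>i. {min (u i) x<..<min (v i) x}) {..<n}"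
        unfolding disjoint_family_on_def
      proof (intro ballI impI)
        fix i j assume "i \<in> {..<n}" "j \<in> {..<n}" "i \<noteq> j"
        then show "{min (u i) x<..<min (v i) x} \<inter> {min (u j) x<..<min (v j) x} = {}"
          using dj[of i j] sub(1)[of i] sub(1)[of j] by blast
      qed
    qed
    have f2: "fam x d n (\<lambda>i. max (u i) x) (\<lambda>i. max (v i) x)"
      unfolding fam_def
    proof (intro conjI allI impI)
      fix i assume "i < n"
      then show "x \<le> max (u i) x" "max (u i) x \<le> max (v i) x" "max (v i) x \<le> d"
        using uv[of i] that(3) by auto
    next
      show "disjoint_family_on (\<lambda>i. {max (u i) x<..<max (v i) x}) {..<n}"
        unfolding disjoint_family_on_def
      proof (intro ballI impI)
        fix i j assume "i \<in> {..<n}" "j \<in> {..<n}" "i \<noteq> j"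
        then show "{max (u i) x<..<max (v i) x} \<inter> {max (u j) x<..<max (v j) x} = {}"
          using dj[of i j] sub(2)[of i] sub(2)[of j] by blast
      qed
    qed
    from SI[OF f1] SI[OF f2]
    have "(\<Sum>i<n. y (min (v i) x) - y (min (u i) x)) \<in> S c x" "(\<Sum>i<n. y (max (v i) x) - y (max (u i) x)) \<in> S x d"
      .
    moreover have "s = (\<Sum>i<n. y (min (v i) x) - y (min (u i) x)) + (\<Sum>i<n. y (max (v i) x) - y (max (u i) x))"
      unfolding s sum.distrib[symmetric] by (intro sum.cong) (auto simp: min_def max_def)
    ultimately show ?thesis by blast
  qed
  define V where "V x = Sup (S a x)" for x
  have bdd: "bdd_above (S c d)" if "a \<le> c" "d \<le> b" for c d
    using S1[OF _ that] by (auto simp: bdd_above_def)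
  \<comment> \<open>This comparison of increments makes V - y nondecreasing.\<close>
  have V1: "y x' - y x \<le> V x' - V x" if "a \<le> x" "x \<le> x'" "x' \<le> b" for x x'
  proof -
    have "V x \<le> V x' - (y x' - y x)" unfolding V_def
    proof (rule cSup_least)
      fix s assume "s \<in> S a x"
      then have "s + (y x' - y x) \<le> Sup (S a x')"
        using Sext[of s a x x'] that bdd[of a x'] by (intro cSup_upper) auto
      then show "s \<le> Sup (S a x') - (y x' - y x)" by simp
    qed (use S0 in auto)
    then show ?thesis by simp
  qed
  have V2: "V x \<le> V x'" if "a \<le> x" "x \<le> x'" "x' \<le> b" for x x'
    unfolding V_def using S0 that by (intro cSup_subset_mono bdd Smono) auto
  have V3: "V x' - V x \<le> Sup (S x x')" if V: "a \<le> x" "x \<le> x'" "x' \<le> b" for x x'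
  proof -
    have "V x' \<le> V x + Sup (S x x')" unfolding V_def
    proof (rule cSup_least)
      fix s assume "s \<in> S a x'"
      then obtain s1 s2 where "s1 \<in> S a x" "s2 \<in> S x x'" "s = s1 + s2" using Ssplit[OF _ V(1,2)] by blast
      then show "s \<le> Sup (S a x) + Sup (S x x')"
        using that bdd[of a x] bdd[of x x'] by (auto intro!: add_mono cSup_upper)
    qed (use S0 in auto)
    then show ?thesis by simp
  qed
  have Vac: "abs_continuous_on a b (\<lambda>x. complex_of_real (V x))"
    unfolding abs_continuous_on_iff_modulus
  proof (intro allI impI)
    fix \<epsilon> :: real assume \<epsilon>: "\<epsilon> > 0"
    then obtain \<delta> where \<delta>: "\<delta> > 0" "ac_modulus a b (\<lambda>x. complex_of_real (y x)) (\<epsilon>/2) \<delta>"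
      using ac unfolding abs_continuous_on_iff_modulus by (meson half_gt_zero)
    have "ac_modulus a b (\<lambda>x. complex_of_real (V x)) \<epsilon> \<delta>" unfolding ac_modulus_def
    proof (intro allI impI)
      fix N :: nat and u v
      assume A: "(\<forall>i<N. a \<le> u i \<and> u i \<le> v i \<and> v i \<le> b) \<and> disjoint_family_on (\<lambda>i. {u i<..<v i}) {..<N} \<and> (\<Sum>i<N. v i - u i) < \<delta>"
      \<comment> \<open>Near-optimal families inside the intervals [u i, v i], each with error
        \<epsilon>/(2(N+1)), are merged into one family for \<open>y\<close>, indexed by pairs; the
        N errors add up to at most \<epsilon>/2.\<close>
      have "\<exists>n U W. fam (u i) (v i) n U W \<and> Sup (S (u i) (v i)) - \<epsilon>/(2 * (real N + 1)) < (\<Sum>j<n. y (W j) - y (U j))" for i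
      proof -
        have "Sup (S (u i) (v i)) - \<epsilon>/(2 * (real N + 1)) < Sup (S (u i) (v i))" using \<epsilon> by simp
        then obtain s where "s \<in> S (u i) (v i)" "Sup (S (u i) (v i)) - \<epsilon>/(2 * (real N + 1)) < s"
          using less_cSupD[of "S (u i) (v i)"] S0 by blast
        then show ?thesis unfolding S_def by blast
      qed
      then obtain n U W where nUW: "\<And>i. fam (u i) (v i) (n i) (U i) (W i)"
         "\<And>i. Sup (S (u i) (v i)) - \<epsilon>/(2 * (real N + 1)) < (\<Sum>j<n i. y (W i j) - y (U i j))"
        by metis
      define I where "I = Sigma {..<N} (\<lambda>i. {..<n i})"
      have UW: "u i \<le> U i j" "U i j \<le> W i j" "W i j \<le> v i" if "j < n i" for i j
        using nUW(1)[of i] that unfolding fam_def by auto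
      have "(\<Sum>p\<in>I. cmod (complex_of_real (y (W (fst p) (snd p))) - complex_of_real (y (U (fst p) (snd p))))) < \<epsilon>/2"
      proof (rule abs_continuous_on_families[OF \<delta>(2)])
        show "finite I" by (simp add: I_def)
        show "disjoint_family_on (\<lambda>p. {U (fst p) (snd p)<..<W (fst p) (snd p)}) I"
          unfolding disjoint_family_on_def
        proof (intro ballI impI)
          fix p q assume pq: "p \<in> I" "q \<in> I" "p \<noteq> q"
          show "{U (fst p) (snd p)<..<W (fst p) (snd p)} \<inter> {U (fst q) (snd q)<..<W (fst q) (snd q)} = {}"
          proof (cases "fst p = fst q")
            case True
            then have "snd p \<noteq> snd q" "snd p < n (fst p)" "snd q < n (fst p)" using pq by (auto simp: I_def prod_eq_iff)
            then show ?thesis using nUW(1)[of "fst p"] True unfolding fam_def disjoint_family_on_def by (metis lessThan_iff)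
          next
            case False
            have "{u (fst p)<..<v (fst p)} \<inter> {u (fst q)<..<v (fst q)} = {}"
              using A False pq unfolding disjoint_family_on_def by (auto simp: I_def)
            moreover have "{U (fst p) (snd p)<..<W (fst p) (snd p)} \<subseteq> {u (fst p)<..<v (fst p)}"
               "{U (fst q) (snd q)<..<W (fst q) (snd q)} \<subseteq> {u (fst q)<..<v (fst q)}"
              using UW[of "snd p" "fst p"] UW[of "snd q" "fst q"] pq by (auto simp: I_def)
            ultimately show ?thesis by blast
          qed
        qed
        show "a \<le> U (fst p) (snd p) \<and> U (fst p) (snd p) \<le> W (fst p) (snd p) \<and> W (fst p) (snd p) \<le> b" if "p \<in> I" for p
          using UW[of "snd p" "fst p"] A that by (force simp: I_def)
        have "(\<Sum>p\<in>I. W (fst p) (snd p) - U (fst p) (snd p)) = (\<Sum>i<N. \<Sum>j<n i. W i j - U i j)"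
          unfolding I_def by (subst sum.Sigma) (auto simp: case_prod_beta)
        also have "\<dots> \<le> (\<Sum>i<N. v i - u i)"
        proof (rule sum_mono)
          fix i assume "i \<in> {..<N}"
          then show "(\<Sum>j<n i. W i j - U i j) \<le> v i - u i"
            using nUW(1)[of i] A by (intro sum_length_disjoint_le) (auto simp: fam_def)
        qed
        finally show "(\<Sum>p\<in>I. W (fst p) (snd p) - U (fst p) (snd p)) < \<delta>" using A by simp
      qed
      also have "(\<Sum>p\<in>I. cmod (complex_of_real (y (W (fst p) (snd p))) - complex_of_real (y (U (fst p) (snd p)))))
        = (\<Sum>i<N. \<Sum>j<n i. cmod (complex_of_real (y (W i j)) - complex_of_real (y (U i j))))"
        unfolding I_def by (subst sum.Sigma) (auto simp: case_prod_beta)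
      finally have *: "(\<Sum>i<N. \<Sum>j<n i. cmod (complex_of_real (y (W i j)) - complex_of_real (y (U i j)))) < \<epsilon>/2" .
      have "(\<Sum>i<N. cmod (complex_of_real (V (v i)) - complex_of_real (V (u i)))) \<le>
         (\<Sum>i<N. (\<Sum>j<n i. cmod (complex_of_real (y (W i j)) - complex_of_real (y (U i j)))) + \<epsilon>/(2 * (real N + 1)))"
      proof (rule sum_mono)
        fix i assume i: "i \<in> {..<N}"
        have "cmod (complex_of_real (V (v i)) - complex_of_real (V (u i))) = V (v i) - V (u i)"
          using V2[of "u i" "v i"] A i by (simp flip: of_real_diff)
        also have "\<dots> \<le> Sup (S (u i) (v i))" using V3[of "u i" "v i"] A i by simp
        also have "\<dots> \<le> (\<Sum>j<n i. y (W i j) - y (U i j)) + \<epsilon>/(2 * (real N + 1))"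
          using nUW(2)[of i] by simp
        also have "(\<Sum>j<n i. y (W i j) - y (U i j)) \<le> (\<Sum>j<n i. cmod (complex_of_real (y (W i j)) - complex_of_real (y (U i j))))"
          by (intro sum_mono yle)
        finally show "cmod (complex_of_real (V (v i)) - complex_of_real (V (u i))) \<le> (\<Sum>j<n i. cmod (complex_of_real (y (W i j)) - complex_of_real (y (U i j)))) + \<epsilon>/(2 * (real N + 1))"
          by simp
      qed
      also have "\<dots> = (\<Sum>i<N. \<Sum>j<n i. cmod (complex_of_real (y (W i j)) - complex_of_real (y (U i j)))) + real N * (\<epsilon>/(2 * (real N + 1)))"
        by (simp add: sum.distrib)
      also have "real N * (\<epsilon>/(2 * (real N + 1))) \<le> \<epsilon>/2"
        using \<epsilon> by (simp add: field_simps)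
      finally show "(\<Sum>i<N. cmod (complex_of_real (V (v i)) - complex_of_real (V (u i)))) < \<epsilon>" using * by simp
    qed
    then show "\<exists>\<delta>>0. ac_modulus a b (\<lambda>x. complex_of_real (V x)) \<epsilon> \<delta>" using \<delta> by blast
  qed
  \<comment> \<open>The negative variation: y = V - W is a difference of monotone absolutely
    continuous functions.\<close>
  define W where "W x = V x - y x" for x
  have Wac: "abs_continuous_on a b (\<lambda>x. complex_of_real (W x))"
  proof (rule abs_continuous_on_compare[OF Vac ac, of 1])
    fix s t
    have "complex_of_real (W t) - complex_of_real (W s) = (complex_of_real (V t) - complex_of_real (V s)) - (complex_of_real (y t) - complex_of_real (y s))"
      by (simp add: W_def)
    then show "cmod (complex_of_real (W t) - complex_of_real (W s)) \<le> 1 * (cmod (complex_of_real (V t) - complex_of_real (V s)) + cmod (complex_of_real (y t) - complex_of_real (y s)))"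
      by (metis mult_1 norm_triangle_ineq4)
  qed simp
  obtain f where f: "AC_deriv a b V f" using AC_deriv_ex_mono[OF \<open>a \<le> b\<close> V2 Vac] by blast
  have "W x \<le> W x'" if "a \<le> x" "x \<le> x'" "x' \<le> b" for x x'
    using V1[OF that] by (simp add: W_def)
  then obtain g where g: "AC_deriv a b W g" using AC_deriv_ex_mono[OF \<open>a \<le> b\<close> _ Wac] by blast
  have "AC_deriv a b (\<lambda>x. V x + - W x) (\<lambda>x. f x + - g x)"
    by (rule AC_deriv_lincomb[OF f AC_deriv_linear[OF bounded_linear_minus[OF bounded_linear_ident] g]])
  moreover have "(\<lambda>x. V x + - W x) = y" by (auto simp: W_def)
  ultimately show ?thesis by metis
qed

text \<open>Short intervals have a density and densities on adjacent intervals glue, so the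
  bisection principle \<open>Bolzano\<close> reaches the whole of [a,b].\<close>

lemma AC_deriv_ex_real:
  fixes y :: "real \<Rightarrow> real"
  assumes "a \<le> b" and ac: "abs_continuous_on a b (\<lambda>x. complex_of_real (y x))"
  shows "\<exists>f. AC_deriv a b y f"
proof -
  obtain \<delta> where \<delta>: "\<delta> > 0" "ac_modulus a b (\<lambda>x. complex_of_real (y x)) 1 \<delta>"
    using ac unfolding abs_continuous_on_iff_modulus by (meson zero_less_one)
  have "a \<le> a \<and> b \<le> b \<longrightarrow> (\<exists>f. AC_deriv a b y f)"
    using \<open>a \<le> b\<close>
  proof (induction rule: Bolzano[where P="\<lambda>c d. a \<le> c \<and> d \<le> b \<longrightarrow> (\<exists>f. AC_deriv c d y f)"])
    case (trans c d e)
    then show ?case using AC_deriv_combine[of c d y _ e] by fastforce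
  next
    case (local x)
    show ?case
    proof (intro exI[of _ \<delta>] conjI allI impI)
      fix c d assume A: "c \<le> x \<and> x \<le> d \<and> d - c < \<delta>" "a \<le> c \<and> d \<le> b"
      then have "ac_modulus c d (\<lambda>x. complex_of_real (y x)) 1 \<delta>"
        using \<delta>(2) unfolding ac_modulus_def by (meson order.trans)
      then show "\<exists>f. AC_deriv c d y f"
        using A abs_continuous_on_subinterval[OF ac] by (intro AC_deriv_ex_short_interval[where dd = \<delta>]) auto
    qed fact
  qed
  then show ?thesis by simp
qed

lemma AC_deriv_ex:
  fixes y :: "real \<Rightarrow> complex"
  assumes "a \<le> b" and ac: "abs_continuous_on a b y"
  shows "\<exists>f. AC_deriv a b y f"
proof -
  have "abs_continuous_on a b (\<lambda>x. complex_of_real (Re (y x)))"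
    by (rule abs_continuous_on_compare[OF ac ac, of 1]) (auto simp flip: of_real_diff minus_complex.sel intro: order.trans[OF abs_Re_le_cmod])
  then obtain f where f: "AC_deriv a b (\<lambda>x. Re (y x)) f" using AC_deriv_ex_real[of a b "\<lambda>x. Re (y x)"] assms(1) by blast
  have "abs_continuous_on a b (\<lambda>x. complex_of_real (Im (y x)))"
    by (rule abs_continuous_on_compare[OF ac ac, of 1]) (auto simp flip: of_real_diff minus_complex.sel intro: order.trans[OF abs_Im_le_cmod])
  then obtain g where g: "AC_deriv a b (\<lambda>x. Im (y x)) g" using AC_deriv_ex_real[of a b "\<lambda>x. Im (y x)"] assms(1) by blast
  have "AC_deriv a b (\<lambda>x. of_real (Re (y x)) + \<i> * of_real (Im (y x))) (\<lambda>x. of_real (f x) + \<i> * of_real (g x))"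
    by (intro AC_deriv_lincomb AC_deriv_linear[OF bounded_linear_of_real f]
      AC_deriv_linear[OF bounded_linear_compose[OF bounded_linear_mult_right bounded_linear_of_real] g])
  moreover have "(\<lambda>x. of_real (Re (y x)) + \<i> * of_real (Im (y x))) = y" by (auto simp: complex_eq[symmetric])
  ultimately show ?thesis by metis
qed

section \<open>Calculus with almost everywhere derivatives\<close>

lemma AE_lebesgue_on_iff:
  fixes a b :: real
  shows "(AE x in lebesgue_on {a<..<b}. P x) \<longleftrightarrow> (AE x in lebesgue. x \<in> {a<..<b} \<longrightarrow> P x)"
  by (subst AE_restrict_space_iff) auto

lemma AC_deriv_unique:
  fixes y :: "real \<Rightarrow> complex"
  assumes "AC_deriv a b y f" "AC_deriv a b y g"
  shows "AE x in lebesgue. x \<in> {a<..<b} \<longrightarrow> f x = g x"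
  using AC_deriv_AE[OF assms(1)] AC_deriv_AE[OF assms(2)]
  by eventually_elim (auto intro: vector_derivative_unique_at)

lemma absolutely_integrable_cong_AE:
  fixes f :: "real \<Rightarrow> complex"
  assumes f: "f absolutely_integrable_on {a..b}" and eq: "AE x in lebesgue. x \<in> {a<..<b} \<longrightarrow> f x = g x"
  shows "g absolutely_integrable_on {a..b}" "\<And>x. x \<le> b \<Longrightarrow> integral {a..x} g = integral {a..x} f"
proof -
  obtain N where N: "N \<in> null_sets lebesgue" "{x \<in> space lebesgue. \<not> (x \<in> {a<..<b} \<longrightarrow> f x = g x)} \<subseteq> N"
    using eq unfolding eventually_ae_filter by blast
  let ?N = "N \<union> {a,b}"
  have n: "negligible ?N" using N(1) by (auto simp: negligible_iff_null_sets[symmetric])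
  have e: "g x = f x" if "x \<in> {a..b} - ?N" for x
  proof (rule ccontr)
    assume "g x \<noteq> f x"
    with that have "x \<in> {x \<in> space lebesgue. \<not> (x \<in> {a<..<b} \<longrightarrow> f x = g x)}" by auto
    with N(2) have "x \<in> N" by blast
    with that show False by blast
  qed
  show "g absolutely_integrable_on {a..b}"
    by (rule absolutely_integrable_spike[OF f n]) (use e in auto)
  show "integral {a..x} g = integral {a..x} f" if "x \<le> b" for x
    by (rule integral_spike[OF n]) (use e that in auto)
qed

lemma AC_deriv_cong_AE:
  fixes y :: "real \<Rightarrow> complex"
  assumes y: "AC_deriv a b y f" and eq: "AE x in lebesgue. x \<in> {a<..<b} \<longrightarrow> f x = g x"
  shows "AC_deriv a b y g"
proof -
  have f: "f absolutely_integrable_on {a..b}" using y unfolding AC_deriv_def by blast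
  note g = absolutely_integrable_cong_AE[OF f eq]
  have "y x = y a + integral {a..x} g" if "x \<in> {a..b}" for x
    using AC_derivD[OF y that] g(2)[of x] that by simp
  with g(1) show ?thesis unfolding AC_deriv_def by blast
qed

lemma AC_deriv_cong:
  assumes y: "AC_deriv a b y f" and "a \<le> b" and eq: "\<And>x. x \<in> {a..b} \<Longrightarrow> y x = w x"
  shows "AC_deriv a b w f"
proof -
  have "w x = w a + integral {a..x} f" if "x \<in> {a..b}" for x
    using AC_derivD[OF y that] eq[OF that] eq[of a] \<open>a \<le> b\<close> by simp
  then show ?thesis using y unfolding AC_deriv_def by blast
qed

lemma AC_deriv_continuous_on:
  assumes y: "AC_deriv a b y f"
  shows "continuous_on {a..b} y"
proof -
  have "f integrable_on {a..b}"
    using y set_lebesgue_integral_eq_integral(1) unfolding AC_deriv_def by blast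
  then have "continuous_on {a..b} (\<lambda>x. y a + integral {a..x} f)"
    by (intro continuous_intros indefinite_integral_continuous_1)
  then show ?thesis using AC_derivD[OF y] by (metis (no_types, lifting) continuous_on_cong)
qed

lemma AC_deriv_integral:
  "f absolutely_integrable_on {a..b} \<Longrightarrow> AC_deriv a b (\<lambda>x. integral {a..x} f) f"
  unfolding AC_deriv_def by simp

lemma AC_deriv_const: "AC_deriv a b (\<lambda>_. c) (\<lambda>_. 0)"
  unfolding AC_deriv_def by (simp add: absolutely_integrable_on_def integrable_0)

lemma AC_deriv_cmult: "AC_deriv a b y f \<Longrightarrow> AC_deriv a b (\<lambda>x. (c::complex) * y x) (\<lambda>x. c * f x)"
  by (rule AC_deriv_linear[OF bounded_linear_mult_right])

lemma AC_deriv_diff':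
  fixes y :: "real \<Rightarrow> complex"
  assumes "AC_deriv a b y f" "AC_deriv a b w g"
  shows "AC_deriv a b (\<lambda>x. y x - w x) (\<lambda>x. f x - g x)"
  using AC_deriv_lincomb[OF assms(1) AC_deriv_cmult[OF assms(2), of "-1"]] by simp

lemma AC_deriv_zero:
  fixes y :: "real \<Rightarrow> complex"
  assumes y: "AC_deriv a b y f" and eq: "AE x in lebesgue. x \<in> {a<..<b} \<longrightarrow> f x = 0" and x: "x \<in> {a..b}"
  shows "y x = y a"
  using AC_derivD[OF AC_deriv_cong_AE[OF y eq] x] by simp

lemma absolutely_integrable_mult_bounded:
  fixes f g :: "real \<Rightarrow> complex"
  assumes f: "f absolutely_integrable_on {a..b}" and g: "continuous_on {a..b} g"
  shows "(\<lambda>x. g x * f x) absolutely_integrable_on {a..b}"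
proof (rule absolutely_integrable_bounded_measurable_product[of "\<lambda>x y. x * y"])
  show "bilinear (\<lambda>x y :: complex. x * y)"
    by (simp add: bilinear_conv_bounded_bilinear bounded_bilinear_mult)
  show "g \<in> borel_measurable (lebesgue_on {a..b})"
    using g by (intro continuous_imp_measurable_on_sets_lebesgue) auto
  show "bounded (g ` {a..b})"
    using g by (intro compact_imp_bounded compact_continuous_image) auto
qed (use f in auto)

lemma abs_continuous_on_mult:
  assumes f: "abs_continuous_on a b f" and g: "abs_continuous_on a b g"
    and "continuous_on {a..b} f" "continuous_on {a..b} g"
  shows "abs_continuous_on a b (\<lambda>x. f x * g x)"
proof -
  have "bounded (f ` {a..b})" "bounded (g ` {a..b})"
    using assms(3,4) by (auto intro!: compact_imp_bounded compact_continuous_image)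
  then obtain B C where B: "B > 0" "\<And>x. x \<in> {a..b} \<Longrightarrow> cmod (f x) \<le> B" and C: "C > 0" "\<And>x. x \<in> {a..b} \<Longrightarrow> cmod (g x) \<le> C"
    unfolding bounded_pos by auto
  show ?thesis
  proof (rule abs_continuous_on_compare[OF f g, of "B + C"])
    fix s t assume st: "a \<le> s" "s \<le> t" "t \<le> b"
    have "f t * g t - f s * g s = f t * (g t - g s) + (f t - f s) * g s" by (simp add: algebra_simps)
    also have "cmod \<dots> \<le> cmod (f t) * cmod (g t - g s) + cmod (f t - f s) * cmod (g s)"
      by (metis norm_mult norm_triangle_ineq)
    also have "\<dots> \<le> (B + C) * cmod (g t - g s) + cmod (f t - f s) * (B + C)"
      using B(2)[of t] C(2)[of s] st B(1) C(1) by (intro add_mono mult_right_mono mult_left_mono) auto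
    finally show "cmod (f t * g t - f s * g s) \<le> (B + C) * (cmod (f t - f s) + cmod (g t - g s))"
      by (simp add: algebra_simps)
  qed (use B C in auto)
qed

text \<open>The product is absolutely continuous and therefore has some density; differentiating at
  almost every point identifies it with the one of the product rule. \<open>AC_deriv_exp\<close>
  follows the same pattern.\<close>

lemma AC_deriv_mult:
  fixes y w :: "real \<Rightarrow> complex"
  assumes y: "AC_deriv a b y f" and w: "AC_deriv a b w g" and "a \<le> b"
  shows "AC_deriv a b (\<lambda>x. y x * w x) (\<lambda>x. f x * w x + y x * g x)"
proof -
  have "abs_continuous_on a b (\<lambda>x. y x * w x)"
    using assms by (intro abs_continuous_on_mult AC_deriv_abs_continuous_on AC_deriv_continuous_on)
  then obtain h where h: "AC_deriv a b (\<lambda>x. y x * w x) h" using AC_deriv_ex \<open>a \<le> b\<close> by blast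
  have "AE x in lebesgue. x \<in> {a<..<b} \<longrightarrow> h x = f x * w x + y x * g x"
    using AC_deriv_AE[OF h] AC_deriv_AE[OF y] AC_deriv_AE[OF w]
  proof eventually_elim
    case (elim x)
    show ?case
    proof
      assume "x \<in> {a<..<b}"
      then have "((\<lambda>x. y x * w x) has_vector_derivative h x) (at x)"
        "((\<lambda>x. y x * w x) has_vector_derivative (y x * g x + f x * w x)) (at x)"
        using elim by (auto intro!: has_vector_derivative_mult)
      then show "h x = f x * w x + y x * g x"
        by (metis add.commute vector_derivative_unique_at)
    qed
  qed
  with h show ?thesis by (rule AC_deriv_cong_AE)
qed

text \<open>On the nonnegative half line exp(-t) is Lipschitz with constant 1, so absolute
  continuity is preserved. This is the integrating factor of the energy estimate.\<close>

lemma AC_deriv_exp: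
  fixes W :: "real \<Rightarrow> real"
  assumes W: "AC_deriv a b W w" and "a \<le> b" and nn: "\<And>x. x \<in> {a..b} \<Longrightarrow> 0 \<le> W x"
  shows "AC_deriv a b (\<lambda>x. complex_of_real (exp (- W x))) (\<lambda>x. complex_of_real (- w x * exp (- W x)))"
proof -
  have Wc: "AC_deriv a b (\<lambda>x. complex_of_real (W x)) (\<lambda>x. complex_of_real (w x))"
    by (rule AC_deriv_linear[OF bounded_linear_of_real W])
  note Wac = AC_deriv_abs_continuous_on[OF Wc \<open>a \<le> b\<close>]
  have lip: "\<bar>exp (- s) - exp (- t)\<bar> \<le> \<bar>s - t\<bar>" if "0 \<le> s" "0 \<le> t" for s t :: real
  proof -
    have *: "exp (- s) - exp (- t) \<le> t - s" "exp (- s) - exp (- t) \<ge> 0" if "0 \<le> s" "s \<le> t" for s t :: real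
    proof -
      have "exp (- s) - exp (- t) = exp (- s) * (1 - exp (-(t - s)))" by (simp add: algebra_simps flip: exp_add)
      also have "\<dots> \<le> 1 * (t - s)"
      proof (rule mult_mono)
        show "1 - exp (- (t - s)) \<le> t - s" using exp_ge_add_one_self[of "- (t - s)"] by linarith
      qed (use that in auto)
      finally show "exp (- s) - exp (- t) \<le> t - s" by simp
    qed (use that in auto)
    show ?thesis using *[of s t] *[of t s] that by (cases "s \<le> t") auto
  qed
  have "abs_continuous_on a b (\<lambda>x. complex_of_real (exp (- W x)))"
  proof (rule abs_continuous_on_compare[OF Wac Wac, of 1])
    fix s t assume "a \<le> s" "s \<le> t" "t \<le> b"
    then have "\<bar>exp (- W t) - exp (- W s)\<bar> \<le> \<bar>W t - W s\<bar>" by (intro lip nn) auto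
    then show "cmod (complex_of_real (exp (- W t)) - complex_of_real (exp (- W s))) \<le> 1 * (cmod (complex_of_real (W t) - complex_of_real (W s)) + cmod (complex_of_real (W t) - complex_of_real (W s)))"
      unfolding of_real_diff[symmetric] norm_of_real
      by (rule order.trans) simp
  qed simp
  then obtain h where h: "AC_deriv a b (\<lambda>x. complex_of_real (exp (- W x))) h" using AC_deriv_ex \<open>a \<le> b\<close> by blast
  have "AE x in lebesgue. x \<in> {a<..<b} \<longrightarrow> h x = complex_of_real (- w x * exp (- W x))"
    using AC_deriv_AE[OF h] AC_deriv_AE_real[OF W]
  proof eventually_elim
    case (elim x)
    show ?case
    proof
      assume x: "x \<in> {a<..<b}"
      then have "(W has_real_derivative w x) (at x)"
        using elim by (simp add: has_real_derivative_iff_has_vector_derivative)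
      then have "((\<lambda>x. exp (- W x)) has_real_derivative (- w x * exp (- W x))) (at x)"
        by (auto intro!: derivative_eq_intros)
      then have "((\<lambda>x. complex_of_real (exp (- W x))) has_vector_derivative complex_of_real (- w x * exp (- W x))) (at x)"
        unfolding has_real_derivative_iff_has_vector_derivative
        by (rule bounded_linear.has_vector_derivative[OF bounded_linear_of_real])
      then show "h x = complex_of_real (- w x * exp (- W x))"
        using elim(1) x by (auto intro: vector_derivative_unique_at)
    qed
  qed
  with h show ?thesis by (rule AC_deriv_cong_AE)
qed

section \<open>Sturm--Liouville systems\<close>

locale sl_coeffs =
  fixes p q r :: "real \<Rightarrow> real" and a b :: real
  assumes ab: "a < b"
    and r_pos: "AE x in lebesgue_on {a<..<b}. r x > 0"
    and r_int: "integrable (lebesgue_on {a<..<b}) r"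
    and p_pos: "AE x in lebesgue_on {a<..<b}. p x > 0"
    and p_int: "integrable (lebesgue_on {a<..<b}) (\<lambda>x. 1 / p x)"
    and q_int: "integrable (lebesgue_on {a<..<b}) q"
begin

lemma abs_int_Icc:
  assumes "integrable (lebesgue_on {a<..<b}) (f :: real \<Rightarrow> real)"
  shows "f absolutely_integrable_on {a..b}"
proof -
  have "f absolutely_integrable_on {a<..<b}"
    using assms unfolding set_integrable_def by (subst (asm) integrable_restrict_space) auto
  moreover have n1: "negligible {x \<in> {a<..<b} - {a..b}. f x \<noteq> 0}"
    by (rule negligible_subset[of "{a,b}"]) auto
  have n2: "negligible {x \<in> {a..b} - {a<..<b}. f x \<noteq> 0}"
    by (rule negligible_subset[of "{a,b}"]) auto
  ultimately show ?thesis using iffD1[OF absolutely_integrable_spike_set_eq[OF n1 n2]] by blast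
qed

lemma r_abs: "r absolutely_integrable_on {a..b}"
  and q_abs: "q absolutely_integrable_on {a..b}"
  and p_abs: "(\<lambda>x. 1 / p x) absolutely_integrable_on {a..b}"
  by (intro abs_int_Icc r_int q_int p_int)+

lemma cabs:
  assumes "f absolutely_integrable_on {a..b}"
  shows "(\<lambda>x. complex_of_real (f x)) absolutely_integrable_on {a..b}"
proof -
  have "(complex_of_real \<circ> f) absolutely_integrable_on {a..b}"
    by (rule absolutely_integrable_linear[OF assms bounded_linear_of_real])
  then show ?thesis by (simp add: o_def)
qed

text \<open>The equation \<tau>y = z y + f in the form y' = y1/p, y1' = (q - z r) y - r f, read as
  integral identities. The source \<open>f\<close> makes one notion serve for solutions, resolvents
  and changes of the spectral parameter.\<close>

definition sl_sys :: "complex \<Rightarrow> (real \<Rightarrow> complex) \<Rightarrow> (real \<Rightarrow> complex) \<Rightarrow> (real \<Rightarrow> complex) \<Rightarrow> bool" where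
  "sl_sys z f y y1 \<longleftrightarrow> AC_deriv a b y (\<lambda>x. y1 x / of_real (p x)) \<and>
     AC_deriv a b y1 (\<lambda>x. (of_real (q x) - z * of_real (r x)) * y x - of_real (r x) * f x)"

text \<open>Since p > 0 almost everywhere, y1 = p y' can be solved for y', which then is a density
  of \<open>y\<close>.\<close>

lemma has_quasi_deriv_iff:
  "has_quasi_deriv p a b y y1 \<longleftrightarrow> AC_deriv a b y (\<lambda>x. y1 x / of_real (p x)) \<and> (\<exists>g. AC_deriv a b y1 g)"
proof
  assume "has_quasi_deriv p a b y y1"
  then have y: "abs_continuous_on a b y" and y1: "abs_continuous_on a b y1"
    and eq: "AE x in lebesgue. x \<in> {a<..<b} \<longrightarrow> y1 x = of_real (p x) * vector_derivative y (at x)"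
    unfolding has_quasi_deriv_def AE_lebesgue_on_iff by auto
  obtain f where f: "AC_deriv a b y f" using AC_deriv_ex[OF less_imp_le[OF ab] y] by blast
  have "AE x in lebesgue. x \<in> {a<..<b} \<longrightarrow> f x = y1 x / of_real (p x)"
    using AC_deriv_AE[OF f] eq p_pos[unfolded AE_lebesgue_on_iff]
    by eventually_elim (auto dest: vector_derivative_at)
  from AC_deriv_cong_AE[OF f this] AC_deriv_ex[OF less_imp_le[OF ab] y1]
  show "AC_deriv a b y (\<lambda>x. y1 x / of_real (p x)) \<and> (\<exists>g. AC_deriv a b y1 g)" ..
next
  assume A: "AC_deriv a b y (\<lambda>x. y1 x / of_real (p x)) \<and> (\<exists>g. AC_deriv a b y1 g)"
  then have y: "AC_deriv a b y (\<lambda>x. y1 x / of_real (p x))" by blast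
  have "AE x in lebesgue. x \<in> {a<..<b} \<longrightarrow> y1 x = of_real (p x) * vector_derivative y (at x)"
    using AC_deriv_AE[OF y] p_pos[unfolded AE_lebesgue_on_iff]
    by eventually_elim (auto simp: vector_derivative_at)
  with A show "has_quasi_deriv p a b y y1"
    unfolding has_quasi_deriv_def AE_lebesgue_on_iff
    using AC_deriv_abs_continuous_on ab by (meson less_imp_le)
qed

text \<open>Absolute continuity provides some density of \<open>y1\<close>; because r > 0 almost
  everywhere, the differential equation is equivalent to a formula for this density.\<close>

lemma sl_sys_iff:
  "sl_sys z f y y1 \<longleftrightarrow> has_quasi_deriv p a b y y1 \<and> (AE x in lebesgue_on {a<..<b}. sl_tau q r y y1 x = z * y x + f x)"
proof -
  have key: "AC_deriv a b y1 (\<lambda>x. (of_real (q x) - z * of_real (r x)) * y x - of_real (r x) * f x)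
    \<longleftrightarrow> (AE x in lebesgue. x \<in> {a<..<b} \<longrightarrow> sl_tau q r y y1 x = z * y x + f x)" if g: "AC_deriv a b y1 g" for g
  proof -
    have alg: "1 / R * (- G + Q * Y) = z * Y + F \<longleftrightarrow> G = (Q - z * R) * Y - R * F" if "R \<noteq> 0" for R G Q Y F :: complex
      using that by (simp add: field_simps) (auto simp: algebra_simps)
    have AE: "AE x in lebesgue. x \<in> {a<..<b} \<longrightarrow> (sl_tau q r y y1 x = z * y x + f x \<longleftrightarrow> g x = (of_real (q x) - z * of_real (r x)) * y x - of_real (r x) * f x)"
      using AC_deriv_AE[OF g] r_pos[unfolded AE_lebesgue_on_iff]
    proof eventually_elim
      case (elim x)
      show ?case
      proof
        assume x: "x \<in> {a<..<b}"
        then have "vector_derivative y1 (at x) = g x" "complex_of_real (r x) \<noteq> 0"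
          using elim by (auto simp: vector_derivative_at)
        then show "sl_tau q r y y1 x = z * y x + f x \<longleftrightarrow> g x = (of_real (q x) - z * of_real (r x)) * y x - of_real (r x) * f x"
          unfolding sl_tau_def using alg by metis
      qed
    qed
    show ?thesis
    proof
      assume "AC_deriv a b y1 (\<lambda>x. (of_real (q x) - z * of_real (r x)) * y x - of_real (r x) * f x)"
      from AC_deriv_unique[OF g this] AE
      show "AE x in lebesgue. x \<in> {a<..<b} \<longrightarrow> sl_tau q r y y1 x = z * y x + f x"
        by eventually_elim blast
    next
      assume "AE x in lebesgue. x \<in> {a<..<b} \<longrightarrow> sl_tau q r y y1 x = z * y x + f x"
      with AE have "AE x in lebesgue. x \<in> {a<..<b} \<longrightarrow> g x = (of_real (q x) - z * of_real (r x)) * y x - of_real (r x) * f x"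
        by eventually_elim blast
      with g show "AC_deriv a b y1 (\<lambda>x. (of_real (q x) - z * of_real (r x)) * y x - of_real (r x) * f x)"
        by (rule AC_deriv_cong_AE)
    qed
  qed
  show ?thesis
    unfolding sl_sys_def has_quasi_deriv_iff AE_lebesgue_on_iff using key by blast
qed

lemma sl_solution_iff: "sl_solution p q r a b z y y1 \<longleftrightarrow> sl_sys z (\<lambda>_. 0) y y1"
  unfolding sl_sys_iff sl_solution_def by simp

end

lemma continuous_AE_zero:
  fixes g :: "real \<Rightarrow> complex"
  assumes g: "continuous_on {a..b} g" and ae: "AE x in lebesgue. x \<in> {a<..<b} \<longrightarrow> g x = 0" and "a < b"
    and x: "x \<in> {a..b}"
  shows "g x = 0"
proof -
  obtain N where N: "N \<in> null_sets lebesgue" "{x \<in> space lebesgue. \<not> (x \<in> {a<..<b} \<longrightarrow> g x = 0)} \<subseteq> N"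
    using ae unfolding eventually_ae_filter by blast
  define U where "U = {x \<in> {a<..<b}. g x \<noteq> 0}"
  have "U = {a<..<b} \<inter> g -` (- {0})" by (auto simp: U_def)
  moreover have "continuous_on {a<..<b} g" using g by (rule continuous_on_subset) auto
  ultimately have "open U" by (metis continuous_on_open_vimage open_greaterThanLessThan open_Compl closed_singleton Int_commute)
  moreover have "negligible U"
    using N by (intro negligible_subset[of N U]) (auto simp: U_def negligible_iff_null_sets)
  ultimately have "U = {}" using open_not_negligible by blast
  then have z: "g t = 0" if "t \<in> {a<..<b}" for t using that by (auto simp: U_def)
  have "continuous_on (closure {a<..<b}) g" using g \<open>a < b\<close> by simp
  then show ?thesis
    using continuous_constant_on_closure[of "{a<..<b}" g 0 x] z x \<open>a < b\<close> by simp
qed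

lemma AC_deriv_pos:
  fixes y :: "real \<Rightarrow> real"
  assumes y: "AC_deriv a b y f" and le: "AE x in lebesgue. x \<in> {a<..<b} \<longrightarrow> f x \<le> 0" and x: "x \<in> {a..b}"
  shows "y x \<le> y a"
proof -
  have f0: "f absolutely_integrable_on {a..b}" using y unfolding AC_deriv_def by blast
  have f: "f absolutely_integrable_on {a..x}"
    using absolutely_integrable_on_subinterval[OF f0, of a x] x by auto
  have ne: "AE t in lebesgue. t \<noteq> a \<and> t \<noteq> b"
    using AE_completion[OF AE_lborel_singleton[of a]] AE_completion[OF AE_lborel_singleton[of b]] by eventually_elim auto
  have "integral {a..x} f = (LINT t:{a..x}|lebesgue. f t)"
    using set_lebesgue_integral_eq_integral(2)[OF f] by simp
  also have "\<dots> \<le> (LINT t:{a..x}|lebesgue. 0)"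
  proof (rule set_integral_mono_AE)
    show "AE t\<in>{a..x} in lebesgue. f t \<le> 0"
      using le ne by eventually_elim (use x in auto)
  qed (use f in \<open>auto simp: set_integrable_def\<close>)
  finally show ?thesis using AC_derivD[OF y x] by (simp add: set_lebesgue_integral_def)
qed

context sl_coeffs
begin

lemma sl_sys_continuous:
  assumes "sl_sys z f y y1" shows "continuous_on {a..b} y" "continuous_on {a..b} y1"
  using assms AC_deriv_continuous_on unfolding sl_sys_def by blast+

text \<open>Lagrange's identity; the contributions of 1/p and q cancel. Variation of constants,
  reality and simplicity of eigenvalues, orthogonality and the resolvent bound are all integrated
  forms of it.\<close>

lemma sl_wronskian:
  assumes y: "sl_sys z f y y1" and u: "sl_sys w g u u1"
  shows "AC_deriv a b (\<lambda>x. y x * u1 x - y1 x * u x)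
     (\<lambda>x. of_real (r x) * ((z - w) * (y x * u x) + f x * u x - g x * y x))"
proof -
  note Y = y[unfolded sl_sys_def] and U = u[unfolded sl_sys_def]
  have "AC_deriv a b (\<lambda>x. y x * u1 x - y1 x * u x)
    (\<lambda>x. (y1 x / of_real (p x) * u1 x + y x * ((of_real (q x) - w * of_real (r x)) * u x - of_real (r x) * g x))
       - (((of_real (q x) - z * of_real (r x)) * y x - of_real (r x) * f x) * u x + y1 x * (u1 x / of_real (p x))))"
    using Y U ab by (intro AC_deriv_diff' AC_deriv_mult) auto
  moreover have "(\<lambda>x. (y1 x / of_real (p x) * u1 x + y x * ((of_real (q x) - w * of_real (r x)) * u x - of_real (r x) * g x))
       - (((of_real (q x) - z * of_real (r x)) * y x - of_real (r x) * f x) * u x + y1 x * (u1 x / of_real (p x))))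
      = (\<lambda>x. complex_of_real (r x) * ((z - w) * (y x * u x) + f x * u x - g x * y x))"
    by (rule ext) (simp add: algebra_simps)
  ultimately show ?thesis by simp
qed

lemma sl_sys_lincomb:
  assumes y: "sl_sys z f y y1" and u: "sl_sys z g u u1"
  shows "sl_sys z (\<lambda>x. c * f x + g x) (\<lambda>x. c * y x + u x) (\<lambda>x. c * y1 x + u1 x)"
proof -
  note Y = y[unfolded sl_sys_def] and U = u[unfolded sl_sys_def]
  have 1: "AC_deriv a b (\<lambda>x. c * y x + u x) (\<lambda>x. c * (y1 x / of_real (p x)) + u1 x / of_real (p x))"
    using Y U by (intro AC_deriv_lincomb AC_deriv_cmult) auto
  have 2: "AC_deriv a b (\<lambda>x. c * y1 x + u1 x) (\<lambda>x. c * ((of_real (q x) - z * of_real (r x)) * y x - of_real (r x) * f x)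
       + ((of_real (q x) - z * of_real (r x)) * u x - of_real (r x) * g x))"
    using Y U by (intro AC_deriv_lincomb AC_deriv_cmult) auto
  have e1: "(\<lambda>x. c * (y1 x / of_real (p x)) + u1 x / of_real (p x)) = (\<lambda>x. (c * y1 x + u1 x) / of_real (p x))"
    by (rule ext) (simp add: add_divide_distrib)
  have e2: "(\<lambda>x. c * ((of_real (q x) - z * of_real (r x)) * y x - of_real (r x) * f x)
       + ((of_real (q x) - z * of_real (r x)) * u x - of_real (r x) * g x))
    = (\<lambda>x. (of_real (q x) - z * of_real (r x)) * (c * y x + u x) - of_real (r x) * (c * f x + g x))"
    by (rule ext) (simp add: algebra_simps)
  show ?thesis unfolding sl_sys_def using 1 2 unfolding e1 e2 ..
qed

lemma sl_sys_scale:
  assumes y: "sl_sys z f y y1"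
  shows "sl_sys z (\<lambda>x. c * f x) (\<lambda>x. c * y x) (\<lambda>x. c * y1 x)"
  using sl_sys_lincomb[OF y y, of "c - 1"] by (simp add: algebra_simps)

lemma sl_sys_cnj:
  assumes y: "sl_sys z f y y1"
  shows "sl_sys (cnj z) (\<lambda>x. cnj (f x)) (\<lambda>x. cnj (y x)) (\<lambda>x. cnj (y1 x))"
  using AC_deriv_linear[OF bounded_linear_cnj, of a b y] AC_deriv_linear[OF bounded_linear_cnj, of a b y1] y
  unfolding sl_sys_def by fastforce

text \<open>The spectral parameter is traded for a source term. With w = 0 this brings the
  eigenvalue equation into the form of the graph of the operator, and it yields the resolvent
  identity between z and 0.\<close>

lemma sl_sys_shift: "sl_sys z f y y1 \<longleftrightarrow> sl_sys w (\<lambda>x. (z - w) * y x + f x) y y1"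
proof -
  have "(\<lambda>x. (of_real (q x) - z * of_real (r x)) * y x - of_real (r x) * f x)
    = (\<lambda>x. (of_real (q x) - w * of_real (r x)) * y x - of_real (r x) * ((z - w) * y x + f x))"
    by (rule ext) (simp add: algebra_simps)
  then show ?thesis unfolding sl_sys_def by simp
qed

lemma sl_sys_cong:
  assumes y: "sl_sys z f y y1" and eq: "\<And>x. x \<in> {a..b} \<Longrightarrow> y x = u x" "\<And>x. x \<in> {a..b} \<Longrightarrow> y1 x = u1 x"
  shows "sl_sys z f u u1"
proof -
  have AE: "AE x in lebesgue. x \<in> {a<..<b} \<longrightarrow> P x" if "\<And>x. x \<in> {a..b} \<Longrightarrow> P x" for P :: "real \<Rightarrow> bool"
    using that by auto
  have 1: "AC_deriv a b u (\<lambda>x. y1 x / of_real (p x))"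
    by (rule AC_deriv_cong[OF y[unfolded sl_sys_def, THEN conjunct1] less_imp_le[OF ab]]) (simp add: eq)
  have 2: "AC_deriv a b u1 (\<lambda>x. (of_real (q x) - z * of_real (r x)) * y x - of_real (r x) * f x)"
    by (rule AC_deriv_cong[OF y[unfolded sl_sys_def, THEN conjunct2] less_imp_le[OF ab]]) (simp add: eq)
  show ?thesis unfolding sl_sys_def
  proof
    show "AC_deriv a b u (\<lambda>x. u1 x / of_real (p x))" by (rule AC_deriv_cong_AE[OF 1 AE]) (simp add: eq)
    show "AC_deriv a b u1 (\<lambda>x. (of_real (q x) - z * of_real (r x)) * u x - of_real (r x) * f x)"
      by (rule AC_deriv_cong_AE[OF 2 AE]) (simp add: eq)
  qed
qed

text \<open>If y vanishes, so does its density y1/p, and then r f is the only term left in the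
  second equation. Used to see that \<open>u\<close> is not trivial and, at the end of the
  completeness proof, that f = 0.\<close>

lemma sl_sys_zero_source:
  assumes y: "sl_sys z f y y1" and 0: "\<And>x. x \<in> {a..b} \<Longrightarrow> y x = 0"
  shows "\<And>x. x \<in> {a..b} \<Longrightarrow> y1 x = 0" "AE x in lebesgue. x \<in> {a<..<b} \<longrightarrow> f x = 0"
proof -
  have "AC_deriv a b (\<lambda>_. 0) (\<lambda>x. y1 x / of_real (p x))"
    by (rule AC_deriv_cong[OF y[unfolded sl_sys_def, THEN conjunct1] less_imp_le[OF ab]]) (simp add: 0)
  from AC_deriv_unique[OF this AC_deriv_const] p_pos[unfolded AE_lebesgue_on_iff]
  have "AE x in lebesgue. x \<in> {a<..<b} \<longrightarrow> y1 x = 0" by eventually_elim auto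
  then show y1: "y1 x = 0" if "x \<in> {a..b}" for x
    using continuous_AE_zero[OF sl_sys_continuous(2)[OF y] _ ab that] by blast
  have "AC_deriv a b (\<lambda>_. 0) (\<lambda>x. (of_real (q x) - z * of_real (r x)) * y x - of_real (r x) * f x)"
    by (rule AC_deriv_cong[OF y[unfolded sl_sys_def, THEN conjunct2] less_imp_le[OF ab]]) (simp add: y1)
  from AC_deriv_unique[OF this AC_deriv_const] r_pos[unfolded AE_lebesgue_on_iff]
  show "AE x in lebesgue. x \<in> {a<..<b} \<longrightarrow> f x = 0"
    by eventually_elim (use 0 in auto)
qed

lemma abs_int_r_mult:
  assumes "continuous_on {a..b} h"
  shows "(\<lambda>x. complex_of_real (r x) * h x) absolutely_integrable_on {a..b}"
  using absolutely_integrable_mult_bounded[OF cabs[OF r_abs] assms] by (simp add: mult.commute)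

lemma abs_int_sub:
  fixes f :: "real \<Rightarrow> complex"
  assumes "f absolutely_integrable_on {a..b}" "x \<in> {a..b}"
  shows "f absolutely_integrable_on {a..x}" "f integrable_on {a..x}"
proof -
  show "f absolutely_integrable_on {a..x}"
    using absolutely_integrable_on_subinterval[OF assms(1), of a x] assms(2) by auto
  then show "f integrable_on {a..x}" by (rule set_lebesgue_integral_eq_integral(1))
qed

end

section \<open>Fundamental system and variation of constants\<close>

locale sl_fund = sl_coeffs +
  fixes \<theta> \<theta>1 \<phi> \<phi>1 :: "complex \<Rightarrow> real \<Rightarrow> complex"
  assumes th: "\<And>z. sl_sys z (\<lambda>_. 0) (\<theta> z) (\<theta>1 z)" "\<And>z. \<theta> z a = 1" "\<And>z. \<theta>1 z a = 0"
    and ph: "\<And>z. sl_sys z (\<lambda>_. 0) (\<phi> z) (\<phi>1 z)" "\<And>z. \<phi> z a = 0" "\<And>z. \<phi>1 z a = 1"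
begin

lemma fund_cont: "continuous_on {a..b} (\<theta> z)" "continuous_on {a..b} (\<theta>1 z)"
  "continuous_on {a..b} (\<phi> z)" "continuous_on {a..b} (\<phi>1 z)"
  using sl_sys_continuous th(1) ph(1) by blast+

lemma wronskian_one: "x \<in> {a..b} \<Longrightarrow> \<theta> z x * \<phi>1 z x - \<theta>1 z x * \<phi> z x = 1"
  using AC_deriv_zero[OF sl_wronskian[OF th(1)[of z] ph(1)[of z]], of x] by (simp add: th ph)

text \<open>\<open>green w \<theta> \<phi> h\<close> is the solution operator \<open>\<integral>\<^sub>a\<^sup>x r(t) g(w,x,t) h(t) dt\<close>.\<close>

definition green :: "complex \<Rightarrow> (complex \<Rightarrow> real \<Rightarrow> complex) \<Rightarrow> (complex \<Rightarrow> real \<Rightarrow> complex) \<Rightarrow> (real \<Rightarrow> complex) \<Rightarrow> real \<Rightarrow> complex" where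
  "green w u v h x = u w x * integral {a..x} (\<lambda>t. of_real (r t) * (\<phi> w t * h t))
      - v w x * integral {a..x} (\<lambda>t. of_real (r t) * (\<theta> w t * h t))"

text \<open>Lagrange's identity against \<theta> and \<phi> at parameter \<open>w\<close> gives two
  linear equations for y and y1 whose determinant is the Wronskian 1. The reference parameter is
  free: w = z yields uniqueness, w = 0 the Volterra equation behind the power series.\<close>

lemma variation_of_constants:
  assumes y: "sl_sys z f y y1" and x: "x \<in> {a..b}"
  shows "y x = y a * \<theta> w x + y1 a * \<phi> w x + green w \<theta> \<phi> (\<lambda>t. (z - w) * y t + f t) x"
    and "y1 x = y a * \<theta>1 w x + y1 a * \<phi>1 w x + green w \<theta>1 \<phi>1 (\<lambda>t. (z - w) * y t + f t) x"
proof -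
  let ?h = "\<lambda>t. (z - w) * y t + f t"
  have gen: "u x * y1 x - u1 x * y x = u a * y1 a - u1 a * y a - integral {a..x} (\<lambda>t. of_real (r t) * (u t * ?h t))"
    if u: "sl_sys w (\<lambda>_. 0) u u1" for u u1
  proof -
    have "u x * y1 x - u1 x * y x = u a * y1 a - u1 a * y a + integral {a..x} (\<lambda>x. of_real (r x) * ((w - z) * (u x * y x) + 0 * y x - f x * u x))"
      using AC_derivD[OF sl_wronskian[OF u y] x] .
    also have "(\<lambda>x. of_real (r x) * ((w - z) * (u x * y x) + 0 * y x - f x * u x)) = (\<lambda>t. (- 1) * (of_real (r t) * (u t * ?h t)))"
      by (rule ext) (simp add: algebra_simps)
    also have "integral {a..x} \<dots> = - integral {a..x} (\<lambda>t. of_real (r t) * (u t * ?h t))"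
      by (subst integral_mult_right) simp
    finally show ?thesis by simp
  qed
  let ?T = "integral {a..x} (\<lambda>t. of_real (r t) * (\<theta> w t * ?h t))"
  let ?P = "integral {a..x} (\<lambda>t. of_real (r t) * (\<phi> w t * ?h t))"
  have T: "\<theta> w x * y1 x - \<theta>1 w x * y x = y1 a - ?T" using gen[OF th(1)] by (simp add: th)
  have P: "\<phi> w x * y1 x - \<phi>1 w x * y x = - y a - ?P" using gen[OF ph(1)] by (simp add: ph)
  have W: "\<theta> w x * \<phi>1 w x - \<theta>1 w x * \<phi> w x = 1" by (rule wronskian_one[OF x])
  have "y x = y x * (\<theta> w x * \<phi>1 w x - \<theta>1 w x * \<phi> w x)" using W by simp
  also have "\<dots> = \<phi> w x * (\<theta> w x * y1 x - \<theta>1 w x * y x) - \<theta> w x * (\<phi> w x * y1 x - \<phi>1 w x * y x)"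
    by (simp add: algebra_simps)
  also have "\<dots> = y a * \<theta> w x + y1 a * \<phi> w x + (\<theta> w x * ?P - \<phi> w x * ?T)"
    unfolding T P by (simp add: algebra_simps)
  finally show "y x = y a * \<theta> w x + y1 a * \<phi> w x + green w \<theta> \<phi> ?h x" by (simp add: green_def)
  have "y1 x = y1 x * (\<theta> w x * \<phi>1 w x - \<theta>1 w x * \<phi> w x)" using W by simp
  also have "\<dots> = \<phi>1 w x * (\<theta> w x * y1 x - \<theta>1 w x * y x) - \<theta>1 w x * (\<phi> w x * y1 x - \<phi>1 w x * y x)"
    by (simp add: algebra_simps)
  also have "\<dots> = y a * \<theta>1 w x + y1 a * \<phi>1 w x + (\<theta>1 w x * ?P - \<phi>1 w x * ?T)"
    unfolding T P by (simp add: algebra_simps)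
  finally show "y1 x = y a * \<theta>1 w x + y1 a * \<phi>1 w x + green w \<theta>1 \<phi>1 ?h x" by (simp add: green_def)
qed

lemma sl_sys_unique:
  assumes y: "sl_sys z f y y1" and u: "sl_sys z f u u1" and "y a = u a" "y1 a = u1 a" and x: "x \<in> {a..b}"
  shows "y x = u x" "y1 x = u1 x"
  using variation_of_constants[OF y x, of z] variation_of_constants[OF u x, of z] assms(3,4) by simp_all

text \<open>In the derivative of the first component the terms from differentiating the two
  integrals cancel; in the second they combine through the Wronskian to - r f.\<close>

lemma sl_sys_green:
  assumes f: "(\<lambda>x. of_real (r x) * f x) absolutely_integrable_on {a..b}"
  shows "sl_sys z f (green z \<theta> \<phi> f) (green z \<theta>1 \<phi>1 f)"
proof -
  have i: "(\<lambda>t. of_real (r t) * (u t * f t)) absolutely_integrable_on {a..b}" if "continuous_on {a..b} u" for u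
    using absolutely_integrable_mult_bounded[OF f that] by (simp add: mult.left_commute)
  define P where "P x = integral {a..x} (\<lambda>t. of_real (r t) * (\<phi> z t * f t))" for x
  define Q where "Q x = integral {a..x} (\<lambda>t. of_real (r t) * (\<theta> z t * f t))" for x
  have P: "AC_deriv a b P (\<lambda>t. of_real (r t) * (\<phi> z t * f t))" unfolding P_def
    by (rule AC_deriv_integral[OF i[OF fund_cont(3)]])
  have Q: "AC_deriv a b Q (\<lambda>t. of_real (r t) * (\<theta> z t * f t))" unfolding Q_def
    by (rule AC_deriv_integral[OF i[OF fund_cont(1)]])
  have g: "green z \<theta> \<phi> f = (\<lambda>x. \<theta> z x * P x - \<phi> z x * Q x)" "green z \<theta>1 \<phi>1 f = (\<lambda>x. \<theta>1 z x * P x - \<phi>1 z x * Q x)"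
    by (auto simp: green_def P_def Q_def)
  note T = th(1)[of z, unfolded sl_sys_def] and F = ph(1)[of z, unfolded sl_sys_def]
  have "AC_deriv a b (\<lambda>x. \<theta> z x * P x - \<phi> z x * Q x) (\<lambda>x. (\<theta>1 z x / of_real (p x) * P x + \<theta> z x * (of_real (r x) * (\<phi> z x * f x)))
     - (\<phi>1 z x / of_real (p x) * Q x + \<phi> z x * (of_real (r x) * (\<theta> z x * f x))))"
    using T F P Q ab by (intro AC_deriv_diff' AC_deriv_mult) auto
  moreover have "(\<lambda>x. (\<theta>1 z x / of_real (p x) * P x + \<theta> z x * (of_real (r x) * (\<phi> z x * f x)))
     - (\<phi>1 z x / of_real (p x) * Q x + \<phi> z x * (of_real (r x) * (\<theta> z x * f x)))) = (\<lambda>x. (\<theta>1 z x * P x - \<phi>1 z x * Q x) / of_real (p x))"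
    by (rule ext) (simp add: algebra_simps diff_divide_distrib)
  ultimately have 1: "AC_deriv a b (\<lambda>x. \<theta> z x * P x - \<phi> z x * Q x) (\<lambda>x. (\<theta>1 z x * P x - \<phi>1 z x * Q x) / of_real (p x))"
    by simp
  have 2: "AC_deriv a b (\<lambda>x. \<theta>1 z x * P x - \<phi>1 z x * Q x)
     (\<lambda>x. (((of_real (q x) - z * of_real (r x)) * \<theta> z x - of_real (r x) * 0) * P x + \<theta>1 z x * (of_real (r x) * (\<phi> z x * f x)))
     - (((of_real (q x) - z * of_real (r x)) * \<phi> z x - of_real (r x) * 0) * Q x + \<phi>1 z x * (of_real (r x) * (\<theta> z x * f x))))"
    using T F P Q ab by (intro AC_deriv_diff' AC_deriv_mult) auto
  have "AC_deriv a b (\<lambda>x. \<theta>1 z x * P x - \<phi>1 z x * Q x)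
     (\<lambda>x. (of_real (q x) - z * of_real (r x)) * (\<theta> z x * P x - \<phi> z x * Q x) - of_real (r x) * f x)"
  proof (rule AC_deriv_cong_AE[OF 2], rule AE_I2, intro impI)
    fix x assume "x \<in> {a<..<b}"
    then have W: "\<theta> z x * \<phi>1 z x - \<theta>1 z x * \<phi> z x = 1" by (intro wronskian_one) auto
    have "of_real (r x) * f x = of_real (r x) * f x * (\<theta> z x * \<phi>1 z x - \<theta>1 z x * \<phi> z x)" by (simp add: W)
    then show "(((of_real (q x) - z * of_real (r x)) * \<theta> z x - of_real (r x) * 0) * P x + \<theta>1 z x * (of_real (r x) * (\<phi> z x * f x)))
     - (((of_real (q x) - z * of_real (r x)) * \<phi> z x - of_real (r x) * 0) * Q x + \<phi>1 z x * (of_real (r x) * (\<theta> z x * f x)))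
      = (of_real (q x) - z * of_real (r x)) * (\<theta> z x * P x - \<phi> z x * Q x) - of_real (r x) * f x"
      by (simp add: algebra_simps)
  qed
  with 1 show ?thesis unfolding g sl_sys_def by blast
qed

lemma green_a: "green z u v f a = 0"
  by (simp add: green_def)

end

section \<open>Dependence on the spectral parameter\<close>

lemma integral_nonneg_all:
  fixes f :: "'a::euclidean_space \<Rightarrow> real"
  assumes "\<And>x. 0 \<le> f x"
  shows "0 \<le> integral S f"
  by (cases "f integrable_on S") (auto simp: not_integrable_integral assms intro: Henstock_Kurzweil_Integration.integral_nonneg)

section \<open>Growth of solutions in the spectral parameter\<close>

context sl_coeffs
begin

text \<open>The absolute value makes this cumulative weight nonnegative and monotone without
  reference to exceptional null sets. Its powers R^n/n! are the yardstick for all Volterra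
  iterates.\<close>

definition R :: "real \<Rightarrow> real" where "R x = integral {a..x} (\<lambda>t. \<bar>r t\<bar>)"

lemma abs_r_abs: "(\<lambda>t. \<bar>r t\<bar>) absolutely_integrable_on {a..b}"
  using set_integrable_norm[OF r_abs] by simp

lemma R_AC: "AC_deriv a b R (\<lambda>t. \<bar>r t\<bar>)"
  unfolding R_def using AC_deriv_integral[OF abs_r_abs] by simp

lemma R_nonneg: "0 \<le> R x"
  unfolding R_def by (rule integral_nonneg_all) auto

lemma R_mono: "a \<le> x \<Longrightarrow> x \<le> y \<Longrightarrow> y \<le> b \<Longrightarrow> R x \<le> R y"
proof -
  assume "a \<le> x" "x \<le> y" "y \<le> b"
  then have "R y - R x = integral {x..y} (\<lambda>t. \<bar>r t\<bar>)" by (rule AC_deriv_diff[OF R_AC])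
  also have "\<dots> \<ge> 0" by (rule integral_nonneg_all) auto
  finally show ?thesis by simp
qed

lemma R_power_AC: "AC_deriv a b (\<lambda>x. R x ^ n) (\<lambda>x. real n * R x ^ (n - 1) * \<bar>r x\<bar>)"
proof -
  have "AC_deriv a b (\<lambda>x. complex_of_real (R x ^ n)) (\<lambda>x. complex_of_real (real n * R x ^ (n - 1) * \<bar>r x\<bar>))"
  proof (induction n)
    case 0
    then show ?case using AC_deriv_const[of a b 1] by simp
  next
    case (Suc n)
    have "AC_deriv a b (\<lambda>x. complex_of_real (R x) * complex_of_real (R x ^ n))
       (\<lambda>x. complex_of_real \<bar>r x\<bar> * complex_of_real (R x ^ n) + complex_of_real (R x) * complex_of_real (real n * R x ^ (n - 1) * \<bar>r x\<bar>))"
      by (rule AC_deriv_mult[OF AC_deriv_linear[OF bounded_linear_of_real R_AC] Suc less_imp_le[OF ab]])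
    moreover have "complex_of_real \<bar>r x\<bar> * complex_of_real (R x ^ n) + complex_of_real (R x) * complex_of_real (real n * R x ^ (n - 1) * \<bar>r x\<bar>)
       = complex_of_real (real (Suc n) * R x ^ (Suc n - 1) * \<bar>r x\<bar>)" for x
      by (cases n) (simp_all add: algebra_simps)
    ultimately show ?case by simp
  qed
  from AC_deriv_linear[OF bounded_linear_Re this] show ?thesis by simp
qed

text \<open>Integrates the derivative of R^(m+1)/(m+1)!. Each Volterra integration thus raises the
  power by one and brings the factorial that makes the series in z converge everywhere.\<close>

lemma R_power_integral:
  assumes "x \<in> {a..b}"
  shows "(\<lambda>t. \<bar>r t\<bar> * (R t ^ m / fact m)) integrable_on {a..x}"
    and "integral {a..x} (\<lambda>t. \<bar>r t\<bar> * (R t ^ m / fact m)) = R x ^ Suc m / fact (Suc m)"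
proof -
  let ?g = "\<lambda>x. real (Suc m) * R x ^ (Suc m - 1) * \<bar>r x\<bar>"
  have eq: "(\<lambda>t. \<bar>r t\<bar> * (R t ^ m / fact m)) = (\<lambda>t. (1 / fact (Suc m)) * ?g t)"
    by (rule ext) (simp del: of_nat_Suc)
  have g0: "?g absolutely_integrable_on {a..b}" using R_power_AC[of "Suc m"] unfolding AC_deriv_def by blast
  have g: "?g integrable_on {a..x}"
    using absolutely_integrable_on_subinterval[OF g0, of a x] assms
    by (intro set_lebesgue_integral_eq_integral(1)) auto
  show "(\<lambda>t. \<bar>r t\<bar> * (R t ^ m / fact m)) integrable_on {a..x}"
    unfolding eq by (rule integrable_on_mult_right[OF g])
  have "R x ^ Suc m = R a ^ Suc m + integral {a..x} ?g"
    by (rule AC_derivD[OF R_power_AC assms])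
  moreover have "R a = 0" by (simp add: R_def)
  ultimately show "integral {a..x} (\<lambda>t. \<bar>r t\<bar> * (R t ^ m / fact m)) = R x ^ Suc m / fact (Suc m)"
    unfolding eq by (subst integral_mult_right) simp
qed

lemma integral_r_bound:
  assumes h: "continuous_on {a..b} h" and x: "x \<in> {a..b}"
    and le: "\<And>t. t \<in> {a..b} \<Longrightarrow> cmod (h t) \<le> c * (R t ^ m / fact m)"
  shows "cmod (integral {a..x} (\<lambda>t. of_real (r t) * h t)) \<le> c * (R x ^ Suc m / fact (Suc m))"
proof -
  have "cmod (integral {a..x} (\<lambda>t. of_real (r t) * h t)) \<le> integral {a..x} (\<lambda>t. c * (\<bar>r t\<bar> * (R t ^ m / fact m)))"
  proof (rule integral_norm_bound_integral)
    show "(\<lambda>t. of_real (r t) * h t) integrable_on {a..x}" by (rule abs_int_sub(2)[OF abs_int_r_mult[OF h] x])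
    show "(\<lambda>t. c * (\<bar>r t\<bar> * (R t ^ m / fact m))) integrable_on {a..x}"
      by (rule integrable_on_mult_right[OF R_power_integral(1)[OF x]])
    fix t assume "t \<in> {a..x}"
    then have "\<bar>r t\<bar> * cmod (h t) \<le> \<bar>r t\<bar> * (c * (R t ^ m / fact m))" using le x by (intro mult_left_mono) auto
    then show "cmod (of_real (r t) * h t) \<le> c * (\<bar>r t\<bar> * (R t ^ m / fact m))"
      by (simp add: norm_mult mult.left_commute)
  qed
  also have "\<dots> = c * integral {a..x} (\<lambda>t. \<bar>r t\<bar> * (R t ^ m / fact m))" by (rule integral_mult_right)
  finally show ?thesis unfolding R_power_integral(2)[OF x] .
qed

text \<open>Energy estimate for \<open>|z||y|\<^sup>2 + |y\<^sup>[\<^sup>1\<^sup>]|\<^sup>2\<close>; weighting \<open>|y|\<^sup>2\<close> by \<open>|z|\<close> gives the exponent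
  \<open>|z|\<^sup>1\<^sup>/\<^sup>2\<close>, so that solutions are entire of order less than one in \<open>z\<close>.\<close>

lemma sl_energy:
  assumes y: "sl_sys z (\<lambda>_. 0) y y1" and z: "cmod z \<ge> 1" and x: "x \<in> {a..b}"
  shows "cmod z * (cmod (y x))\<^sup>2 + (cmod (y1 x))\<^sup>2
    \<le> (cmod z * (cmod (y a))\<^sup>2 + (cmod (y1 a))\<^sup>2) * exp (sqrt (cmod z) * integral {a..b} (\<lambda>t. \<bar>1 / p t\<bar> + \<bar>q t\<bar> + \<bar>r t\<bar>))"
proof -
  define s where "s = sqrt (cmod z)"
  have s: "s \<ge> 1" "s^2 = cmod z" using z by (auto simp: s_def)
  define k where "k t = \<bar>1 / p t\<bar> + \<bar>q t\<bar> + \<bar>r t\<bar>" for t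
  have k_abs: "k absolutely_integrable_on {a..b}" unfolding k_def[abs_def]
    using set_integrable_norm[OF p_abs] set_integrable_norm[OF q_abs] abs_r_abs by (intro set_integral_add) auto
  have k0: "k t \<ge> 0" for t by (simp add: k_def)
  \<comment> \<open>exp(-W) is the integrating factor of a Gronwall argument: the energy grows at
    relative rate at most \<open>s * k t\<close>, so energy times exp(-W) does not increase.\<close>
  define W where "W x = s * integral {a..x} k" for x
  have W: "AC_deriv a b W (\<lambda>t. s * k t)" unfolding W_def[abs_def]
    by (rule AC_deriv_linear[OF bounded_linear_mult_right AC_deriv_integral[OF k_abs]])
  have W0: "0 \<le> W x" for x using s k0 by (auto simp: W_def intro!: mult_nonneg_nonneg integral_nonneg_all)
  have Wb: "W x \<le> s * integral {a..b} k"
  proof -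
    have "integral {a..x} k \<le> integral {a..b} k"
      using k_abs k0 x absolutely_integrable_on_subinterval[OF k_abs, of a x]
      by (intro integral_subset_le set_lebesgue_integral_eq_integral(1)) auto
    then show ?thesis using s by (simp add: W_def)
  qed
  note Y = y[unfolded sl_sys_def]
  note C = AC_deriv_linear[OF bounded_linear_cnj]
  define A where "A t = y1 t / of_real (p t)" for t
  define B where "B t = (of_real (q t) - z * of_real (r t)) * y t - of_real (r t) * 0" for t
  have yA: "AC_deriv a b y A" and yB: "AC_deriv a b y1 B"
    using Y unfolding A_def[abs_def] B_def[abs_def] by blast+
  define E where "E t = of_real (cmod z) * (y t * cnj (y t)) + y1 t * cnj (y1 t)" for t
  define E' where "E' t = of_real (cmod z) * (A t * cnj (y t) + y t * cnj (A t)) + (B t * cnj (y1 t) + y1 t * cnj (B t))" for t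
  have E: "AC_deriv a b E E'" unfolding E_def[abs_def] E'_def[abs_def]
    by (intro AC_deriv_lincomb AC_deriv_cmult AC_deriv_mult yA yB C less_imp_le[OF ab])
  have Er: "E t = of_real (cmod z * (cmod (y t))\<^sup>2 + (cmod (y1 t))\<^sup>2)" for t
    unfolding E_def of_real_add of_real_mult complex_norm_square ..
  have D: "AC_deriv a b (\<lambda>x. E x * of_real (exp (- W x))) (\<lambda>t. E' t * of_real (exp (- W t)) + E t * of_real (- (s * k t) * exp (- W t)))"
    by (rule AC_deriv_mult[OF E AC_deriv_exp[OF W less_imp_le[OF ab] W0] less_imp_le[OF ab]])
  have "AE t in lebesgue. t \<in> {a<..<b} \<longrightarrow> Re (E' t * of_real (exp (- W t)) + E t * of_real (- (s * k t) * exp (- W t))) \<le> 0"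
  proof (rule AE_I2, intro impI)
    fix t
    \<comment> \<open>In terms of u = s|y| and v = |y1| the energy is u^2 + v^2, and in its
      derivative the terms of 1/p and r each keep a single factor s = sqrt |z|. The term of q is
      smaller and is enlarged using s >= 1.\<close>
    define u where "u = s * cmod (y t)"
    define v where "v = cmod (y1 t)"
    have u0: "u \<ge> 0" "v \<ge> 0" using s by (auto simp: u_def v_def)
    have 1: "Re (A t * cnj (y t) + y t * cnj (A t)) \<le> 2 * (\<bar>1 / p t\<bar> * v * cmod (y t))"
    proof -
      have "Re (A t * cnj (y t) + y t * cnj (A t)) = 2 * Re (A t * cnj (y t))" by (simp add: algebra_simps)
      also have "\<dots> \<le> 2 * cmod (A t * cnj (y t))" using complex_Re_le_cmod[of "A t * cnj (y t)"] by linarith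
      also have "cmod (A t * cnj (y t)) = \<bar>1 / p t\<bar> * v * cmod (y t)" by (simp add: A_def v_def norm_mult norm_divide)
      finally show ?thesis .
    qed
    have 2: "Re (B t * cnj (y1 t) + y1 t * cnj (B t)) \<le> 2 * ((\<bar>q t\<bar> + s^2 * \<bar>r t\<bar>) * cmod (y t) * v)"
    proof -
      have "Re (B t * cnj (y1 t) + y1 t * cnj (B t)) = 2 * Re (B t * cnj (y1 t))" by (simp add: algebra_simps)
      also have "\<dots> \<le> 2 * cmod (B t * cnj (y1 t))" using complex_Re_le_cmod[of "B t * cnj (y1 t)"] by linarith
      also have "cmod (B t * cnj (y1 t)) = cmod (of_real (q t) - z * of_real (r t)) * cmod (y t) * v" by (simp add: B_def v_def norm_mult)
      also have "cmod (of_real (q t) - z * of_real (r t)) \<le> \<bar>q t\<bar> + s^2 * \<bar>r t\<bar>"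
        using norm_triangle_ineq4[of "complex_of_real (q t)" "z * of_real (r t)"] by (simp add: norm_mult s)
      finally show ?thesis by (simp add: mult_right_mono v_def)
    qed
    have "Re (E' t) = s^2 * Re (A t * cnj (y t) + y t * cnj (A t)) + Re (B t * cnj (y1 t) + y1 t * cnj (B t))"
      by (simp add: E'_def s)
    also have "\<dots> \<le> s^2 * (2 * (\<bar>1 / p t\<bar> * v * cmod (y t))) + 2 * ((\<bar>q t\<bar> + s^2 * \<bar>r t\<bar>) * cmod (y t) * v)"
      by (intro add_mono mult_left_mono 1 2) auto
    also have "\<dots> = 2 * u * v * (s * \<bar>1 / p t\<bar> + s * \<bar>r t\<bar>) + 2 * \<bar>q t\<bar> * cmod (y t) * v"
      by (simp add: u_def power2_eq_square algebra_simps)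
    also have "2 * \<bar>q t\<bar> * cmod (y t) * v \<le> 2 * u * v * (s * \<bar>q t\<bar>)"
    proof -
      have "cmod (y t) \<le> u * s"
        using s mult_mono[of 1 s 1 s] mult_right_mono[of 1 "s * s" "cmod (y t)"] by (simp add: u_def mult.commute mult.left_commute)
      then have "(2 * \<bar>q t\<bar> * v) * cmod (y t) \<le> (2 * \<bar>q t\<bar> * v) * (u * s)" using u0 by (intro mult_left_mono) auto
      then show ?thesis by (simp add: mult_ac)
    qed
    also have "2 * u * v * (s * \<bar>1 / p t\<bar> + s * \<bar>r t\<bar>) + 2 * u * v * (s * \<bar>q t\<bar>) = (2 * u * v) * (s * k t)"
      by (simp add: k_def algebra_simps)
    also have "\<dots> \<le> (u^2 + v^2) * (s * k t)"
      using sum_squares_bound[of u v] s k0[of t] by (intro mult_right_mono) auto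
    also have "u^2 + v^2 = Re (E t)" by (simp add: Er u_def v_def power_mult_distrib s)
    finally have "Re (E' t) \<le> Re (E t) * (s * k t)" by simp
    then have "Re (E' t) * exp (- W t) \<le> Re (E t) * (s * k t) * exp (- W t)" by (intro mult_right_mono) auto
    moreover have "Im (E t) = 0" by (simp add: Er)
    ultimately show "Re (E' t * of_real (exp (- W t)) + E t * of_real (- (s * k t) * exp (- W t))) \<le> 0"
      by (simp add: mult.assoc)
  qed
  from AC_deriv_pos[OF AC_deriv_linear[OF bounded_linear_Re D] this x]
  have "Re (E x) * exp (- W x) \<le> Re (E a)" by (simp add: W_def)
  then have "Re (E x) \<le> Re (E a) * exp (W x)" by (simp add: exp_minus field_simps)
  also have "\<dots> \<le> Re (E a) * exp (s * integral {a..b} k)"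
    using Wb by (intro mult_left_mono) (auto simp: Er)
  finally show ?thesis by (simp add: Er s_def k_def[abs_def])
qed

lemma sl_growth:
  "\<exists>K\<ge>0. \<forall>z y y1. sl_sys z (\<lambda>_. 0) y y1 \<longrightarrow> cmod (y a) \<le> 1 \<longrightarrow> cmod (y1 a) \<le> 1 \<longrightarrow> cmod z \<ge> 1 \<longrightarrow>
     (\<forall>x\<in>{a..b}. cmod (y x) \<le> exp (K * sqrt (cmod z)) \<and> cmod (y1 x) \<le> exp (K * sqrt (cmod z)))"
proof -
  define I where "I = integral {a..b} (\<lambda>t. \<bar>1 / p t\<bar> + \<bar>q t\<bar> + \<bar>r t\<bar>)"
  have I0: "I \<ge> 0" unfolding I_def by (rule integral_nonneg_all) auto
  show ?thesis
  \<comment> \<open>The summand 2 absorbs the initial energy, as 2 s^2 <= (2s)^2 <= exp(2s)^2.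
    Enlarging exp(s I) to its square makes the bound a perfect square, whose root is taken at the
    end.\<close>
  proof (intro exI[of _ "I + 2"] conjI allI impI ballI)
    show "0 \<le> I + 2" using I0 by simp
    fix z y y1 x
    assume y: "sl_sys z (\<lambda>_. 0) y y1" and in1: "cmod (y a) \<le> 1" "cmod (y1 a) \<le> 1" and z: "cmod z \<ge> 1" and x: "x \<in> {a..b}"
    define s where "s = sqrt (cmod z)"
    have s: "s \<ge> 1" "s^2 = cmod z" using z by (auto simp: s_def)
    have "cmod z * (cmod (y x))\<^sup>2 + (cmod (y1 x))\<^sup>2 \<le> (cmod z * (cmod (y a))\<^sup>2 + (cmod (y1 a))\<^sup>2) * exp (s * I)"
      using sl_energy[OF y z x] by (simp add: s_def I_def)
    also have "\<dots> \<le> (s^2 + s^2) * exp (s * I)"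
    proof (intro mult_right_mono add_mono)
      show "cmod z * (cmod (y a))\<^sup>2 \<le> s^2" using in1 s by (simp add: mult_left_le power_le_one)
      show "(cmod (y1 a))\<^sup>2 \<le> s^2" using in1 s by (intro power_mono) auto
    qed auto
    also have "s^2 + s^2 \<le> exp (s * 2) * exp (s * 2)"
    proof -
      have e: "s * 2 \<le> exp (s * 2)" using exp_ge_add_one_self[of "s * 2"] by linarith
      have "s^2 + s^2 \<le> (s * 2) * (s * 2)" using s by (simp add: power2_eq_square)
      also have "\<dots> \<le> exp (s * 2) * exp (s * 2)" using e s by (intro mult_mono) auto
      finally show ?thesis .
    qed
    then have "(s^2 + s^2) * exp (s * I) \<le> (exp (s * 2) * exp (s * 2)) * exp (s * I)" by (intro mult_right_mono) auto
    also have "\<dots> \<le> (exp (s * 2) * exp (s * 2)) * (exp (s * I) * exp (s * I))"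
      using s I0 by (intro mult_left_mono) (auto intro!: mult_nonneg_nonneg)
    also have "\<dots> = (exp ((I + 2) * s))^2"
      by (simp add: power2_eq_square algebra_simps flip: exp_add)
    finally have *: "cmod z * (cmod (y x))\<^sup>2 + (cmod (y1 x))\<^sup>2 \<le> (exp ((I + 2) * s))^2" .
    have "1 * (cmod (y x))\<^sup>2 \<le> cmod z * (cmod (y x))\<^sup>2" using z by (intro mult_right_mono) auto
    with * have "(cmod (y x))\<^sup>2 \<le> (exp ((I + 2) * s))^2" "(cmod (y1 x))\<^sup>2 \<le> (exp ((I + 2) * s))^2"
      using zero_le_power2[of "cmod (y x)"] zero_le_power2[of "cmod (y1 x)"] by linarith+
    then show "cmod (y x) \<le> exp ((I + 2) * sqrt (cmod z))" "cmod (y1 x) \<le> exp ((I + 2) * sqrt (cmod z))"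
      unfolding s_def by (auto intro: power2_le_imp_le)
  qed
qed

end

section \<open>Power series in the spectral parameter\<close>

context sl_fund
begin

definition G where "G = sl_kernel (\<theta> 0) (\<phi> 0) (\<theta> 0) (\<phi> 0)"
definition G1 where "G1 = sl_kernel (\<theta> 0) (\<phi> 0) (\<theta>1 0) (\<phi>1 0)"

lemma green_lin:
  assumes h: "continuous_on {a..b} h" and g: "continuous_on {a..b} g" and x: "x \<in> {a..b}"
  shows "green w u v (\<lambda>t. c * h t + g t) x = c * green w u v h x + green w u v g x"
proof -
  have i: "integral {a..x} (\<lambda>t. of_real (r t) * (k t * (c * h t + g t)))
    = c * integral {a..x} (\<lambda>t. of_real (r t) * (k t * h t)) + integral {a..x} (\<lambda>t. of_real (r t) * (k t * g t))"
    if k: "continuous_on {a..b} k" for k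
  proof -
    have 1: "(\<lambda>t. of_real (r t) * (k t * h t)) integrable_on {a..x}" "(\<lambda>t. of_real (r t) * (k t * g t)) integrable_on {a..x}"
      by (intro abs_int_sub(2)[OF abs_int_r_mult x] continuous_intros h g k)+
    have "(\<lambda>t. of_real (r t) * (k t * (c * h t + g t))) = (\<lambda>t. c * (of_real (r t) * (k t * h t)) + of_real (r t) * (k t * g t))"
      by (rule ext) (simp add: algebra_simps)
    then show ?thesis
      using 1 by (simp add: Henstock_Kurzweil_Integration.integral_add integrable_on_mult_right)
  qed
  show ?thesis unfolding green_def i[OF fund_cont(1)] i[OF fund_cont(3)] by (simp add: algebra_simps)
qed

lemma volterra_green:
  assumes h: "continuous_on {a..b} h" and x: "x \<in> {a..b}"
  shows "weighted_volterra r a (sl_kernel (\<theta> 0) (\<phi> 0) (u 0) (v 0)) h x = green 0 u v h x"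
proof -
  let ?f = "\<lambda>t. complex_of_real (r t) * sl_kernel (\<theta> 0) (\<phi> 0) (u 0) (v 0) x t * h t"
  have i: "(\<lambda>t. of_real (r t) * (k t * h t)) integrable_on {a..x}" if "continuous_on {a..b} k" for k
    by (intro abs_int_sub(2)[OF abs_int_r_mult x] continuous_intros h that)
  have eq: "?f = (\<lambda>t. of_real (r t) * ((u 0 x * \<phi> 0 t - \<theta> 0 t * v 0 x) * h t))"
    by (simp add: sl_kernel_def mult.assoc)
  have "?f absolutely_integrable_on {a..b}"
    unfolding eq by (intro abs_int_r_mult continuous_intros fund_cont h)
  then have "?f absolutely_integrable_on {a<..<x}" by (rule set_integrable_subset) (use x in auto)
  then have "weighted_volterra r a (sl_kernel (\<theta> 0) (\<phi> 0) (u 0) (v 0)) h x = integral {a<..<x} ?f"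
    unfolding weighted_volterra_def by (rule set_lebesgue_integral_eq_integral(2))
  also have "\<dots> = integral {a..x} ?f" by (rule integral_open_interval_real[symmetric])
  also have "?f = (\<lambda>t. u 0 x * (of_real (r t) * (\<phi> 0 t * h t)) - v 0 x * (of_real (r t) * (\<theta> 0 t * h t)))"
    unfolding eq by (rule ext) (simp add: algebra_simps)
  also have "integral {a..x} \<dots> = green 0 u v h x"
    unfolding green_def using i[OF fund_cont(1)] i[OF fund_cont(3)]
    by (simp add: Henstock_Kurzweil_Integration.integral_diff integrable_on_mult_right)
  finally show ?thesis .
qed

lemma green_continuous:
  assumes h: "continuous_on {a..b} h"
  shows "continuous_on {a..b} (green z \<theta> \<phi> h)"
  by (rule sl_sys_continuous(1)[OF sl_sys_green[OF abs_int_r_mult[OF h]]])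

lemma sl_iter_continuous:
  assumes "continuous_on {a..b} y0"
  shows "continuous_on {a..b} (sl_iter r a G y0 k)"
proof (induction k)
  case (Suc k)
  have "continuous_on {a..b} (green 0 \<theta> \<phi> (sl_iter r a G y0 k))" by (rule green_continuous[OF Suc])
  moreover have "continuous_on {a..b} (sl_iter r a G y0 (Suc k)) \<longleftrightarrow> continuous_on {a..b} (green 0 \<theta> \<phi> (sl_iter r a G y0 k))"
    by (rule continuous_on_cong[OF refl]) (simp add: G_def volterra_green[OF Suc[unfolded G_def]])
  ultimately show ?case by blast
qed (use assms in simp)

lemma fund_bound: "\<exists>M\<ge>0. \<forall>x\<in>{a..b}. cmod (\<theta> 0 x) \<le> M \<and> cmod (\<theta>1 0 x) \<le> M \<and> cmod (\<phi> 0 x) \<le> M \<and> cmod (\<phi>1 0 x) \<le> M"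
proof -
  have "bounded (f ` {a..b})" if "continuous_on {a..b} f" for f :: "real \<Rightarrow> complex"
    using that by (intro compact_imp_bounded compact_continuous_image) auto
  then have "\<exists>M\<ge>0. \<forall>x\<in>{a..b}. cmod (f x) \<le> M" if "continuous_on {a..b} f" for f :: "real \<Rightarrow> complex"
    using that unfolding bounded_pos by (meson image_eqI less_imp_le)
  then obtain M1 M2 M3 M4 where M: "M1 \<ge> 0" "\<forall>x\<in>{a..b}. cmod (\<theta> 0 x) \<le> M1" "M2 \<ge> 0" "\<forall>x\<in>{a..b}. cmod (\<theta>1 0 x) \<le> M2"
    "M3 \<ge> 0" "\<forall>x\<in>{a..b}. cmod (\<phi> 0 x) \<le> M3" "M4 \<ge> 0" "\<forall>x\<in>{a..b}. cmod (\<phi>1 0 x) \<le> M4"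
    using fund_cont[of 0] by metis
  then show ?thesis by (intro exI[of _ "M1 + M2 + M3 + M4"]) fastforce
qed

text \<open>Two factors M come from the kernel and the 2 from its two summands; the integration
  turns R^m/m! into R^(m+1)/(m+1)!.\<close>

lemma green_le:
  assumes M: "M \<ge> 0" "\<forall>x\<in>{a..b}. cmod (\<theta> 0 x) \<le> M \<and> cmod (\<theta>1 0 x) \<le> M \<and> cmod (\<phi> 0 x) \<le> M \<and> cmod (\<phi>1 0 x) \<le> M"
    and uv: "cmod (u 0 x) \<le> M" "cmod (v 0 x) \<le> M"
    and h: "continuous_on {a..b} h" and x: "x \<in> {a..b}" and "c \<ge> 0"
    and le: "\<And>t. t \<in> {a..b} \<Longrightarrow> cmod (h t) \<le> c * (R t ^ m / fact m)"
  shows "cmod (green 0 u v h x) \<le> (2 * M^2 * c) * (R x ^ Suc m / fact (Suc m))"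
proof -
  have le': "cmod (k t * h t) \<le> (M * c) * (R t ^ m / fact m)" if "t \<in> {a..b}" "cmod (k t) \<le> M" for t k
    unfolding norm_mult mult.assoc using le[OF that(1)] that(2) M(1) by (intro mult_mono) auto
  have I: "cmod (integral {a..x} (\<lambda>t. of_real (r t) * (\<phi> 0 t * h t))) \<le> (M * c) * (R x ^ Suc m / fact (Suc m))"
    "cmod (integral {a..x} (\<lambda>t. of_real (r t) * (\<theta> 0 t * h t))) \<le> (M * c) * (R x ^ Suc m / fact (Suc m))"
    using M by (intro integral_r_bound continuous_intros fund_cont h x le'; simp)+
  have "cmod (green 0 u v h x) \<le> cmod (u 0 x) * cmod (integral {a..x} (\<lambda>t. of_real (r t) * (\<phi> 0 t * h t)))
     + cmod (v 0 x) * cmod (integral {a..x} (\<lambda>t. of_real (r t) * (\<theta> 0 t * h t)))"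
    unfolding green_def by (rule order.trans[OF norm_triangle_ineq4]) (simp add: norm_mult)
  also have "\<dots> \<le> M * ((M * c) * (R x ^ Suc m / fact (Suc m))) + M * ((M * c) * (R x ^ Suc m / fact (Suc m)))"
    using I uv M(1) by (intro add_mono mult_mono) auto
  finally show ?thesis by (simp add: power2_eq_square algebra_simps)
qed

text \<open>The recursion is shared by the terms of the series (with z = 1) and by its remainders,
  so one induction gives both their factorial bounds.\<close>

lemma iterate_bound:
  assumes M: "M \<ge> 0" "\<forall>x\<in>{a..b}. cmod (\<theta> 0 x) \<le> M \<and> cmod (\<theta>1 0 x) \<le> M \<and> cmod (\<phi> 0 x) \<le> M \<and> cmod (\<phi>1 0 x) \<le> M"
    and c: "c \<ge> 0" and cont: "\<And>n. continuous_on {a..b} (\<rho> n)"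
    and 0: "\<And>t. t \<in> {a..b} \<Longrightarrow> cmod (\<rho> 0 t) \<le> c"
    and step: "\<And>n t. t \<in> {a..b} \<Longrightarrow> \<rho> (Suc n) t = z * green 0 \<theta> \<phi> (\<rho> n) t"
    and t: "t \<in> {a..b}"
  shows "cmod (\<rho> n t) \<le> (c * (cmod z * (2 * M^2)) ^ n) * (R t ^ n / fact n)"
  using t
proof (induction n arbitrary: t)
  case 0
  then show ?case using assms(5) by simp
next
  case (Suc n)
  have "cmod (\<rho> (Suc n) t) = cmod z * cmod (green 0 \<theta> \<phi> (\<rho> n) t)" by (simp add: step[OF Suc.prems] norm_mult)
  also have "\<dots> \<le> cmod z * ((2 * M^2 * (c * (cmod z * (2 * M^2)) ^ n)) * (R t ^ Suc n / fact (Suc n)))"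
    using M Suc c by (intro mult_left_mono green_le[where M=M] cont) auto
  also have "\<dots> = (c * (cmod z * (2 * M^2)) ^ Suc n) * (R t ^ Suc n / fact (Suc n))"
    by (simp add: mult_ac)
  finally show ?case .
qed

text \<open>Uniformity in t is what later allows the series in z to be integrated term by
  term.\<close>

lemma sl_iter_bound:
  assumes y0: "continuous_on {a..b} y0"
  shows "\<exists>C D. C \<ge> 0 \<and> D \<ge> 0 \<and> (\<forall>k. \<forall>t\<in>{a..b}. cmod (sl_iter r a G y0 k t) \<le> C * (D ^ k / fact k))"
proof -
  obtain M where M: "M \<ge> 0" "\<forall>x\<in>{a..b}. cmod (\<theta> 0 x) \<le> M \<and> cmod (\<theta>1 0 x) \<le> M \<and> cmod (\<phi> 0 x) \<le> M \<and> cmod (\<phi>1 0 x) \<le> M"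
    using fund_bound by blast
  have "bounded (y0 ` {a..b})" using y0 by (intro compact_imp_bounded compact_continuous_image) auto
  then obtain c where c: "c > 0" "\<And>t. t \<in> {a..b} \<Longrightarrow> cmod (y0 t) \<le> c" unfolding bounded_pos by auto
  show ?thesis
  proof (intro exI conjI allI ballI)
    fix k t assume t: "t \<in> {a..b}"
    have "cmod (sl_iter r a G y0 k t) \<le> (c * (cmod 1 * (2 * M^2)) ^ k) * (R t ^ k / fact k)"
      using c by (intro iterate_bound[OF M _ sl_iter_continuous[OF y0] _ _ t])
        (auto simp: G_def intro!: volterra_green sl_iter_continuous[OF y0, unfolded G_def])
    also have "\<dots> \<le> (c * (2 * M^2) ^ k) * (R b ^ k / fact k)"
      using c t M by (auto intro!: mult_left_mono divide_right_mono power_mono R_mono R_nonneg)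
    also have "\<dots> = c * ((2 * M^2 * R b) ^ k / fact k)" by (simp add: power_mult_distrib)
    finally show "cmod (sl_iter r a G y0 k t) \<le> c * ((2 * M^2 * R b) ^ k / fact k)" .
  qed (use c M R_nonneg[of b] in auto)
qed

text \<open>The remainder after n terms obeys the recursion of the terms themselves, starting from
  \<open>y\<close>, and the factorial bound sends it to 0. The quasi-derivative runs in parallel:
  its remainder is z times a Volterra integral of the previous remainder of
  \<open>y\<close>.\<close>

lemma sl_series:
  assumes y: "sl_sys z (\<lambda>_. 0) y y1" and y0: "sl_sys 0 (\<lambda>_. 0) y0 y01" and init: "y a = y0 a" "y1 a = y01 a"
    and x: "x \<in> {a..b}"
  shows "(\<lambda>k. z ^ k * sl_iter r a G y0 k x) sums y x"
    and "(\<lambda>k. z ^ k * sl_iter1 r a G G1 y0 y01 k x) sums y1 x"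
proof -
  obtain M where M: "M \<ge> 0" "\<forall>x\<in>{a..b}. cmod (\<theta> 0 x) \<le> M \<and> cmod (\<theta>1 0 x) \<le> M \<and> cmod (\<phi> 0 x) \<le> M \<and> cmod (\<phi>1 0 x) \<le> M"
    using fund_bound by blast
  note yc = sl_sys_continuous[OF y] and y0c = sl_sys_continuous[OF y0]
  have "bounded (y ` {a..b})" using yc by (intro compact_imp_bounded compact_continuous_image) auto
  then obtain c where c: "c > 0" "\<And>t. t \<in> {a..b} \<Longrightarrow> cmod (y t) \<le> c" unfolding bounded_pos by auto
  define it where "it = sl_iter r a G y0"
  define it1 where "it1 = sl_iter1 r a G G1 y0 y01"
  have itc: "continuous_on {a..b} (it k)" for k unfolding it_def by (rule sl_iter_continuous[OF y0c(1)])
  have itS: "it (Suc k) t = green 0 \<theta> \<phi> (it k) t" "it1 (Suc k) t = green 0 \<theta>1 \<phi>1 (it k) t" if "t \<in> {a..b}" for k t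
    using volterra_green[OF itc[of k] that, of \<theta> \<phi>] volterra_green[OF itc[of k] that, of \<theta>1 \<phi>1] by (simp_all add: it_def it1_def G_def G1_def)
  define \<rho> where "\<rho> n t = y t - (\<Sum>k<n. z ^ k * it k t)" for n t
  define \<rho>1 where "\<rho>1 n t = y1 t - (\<Sum>k<n. z ^ k * it1 k t)" for n t
  have \<rho>c: "continuous_on {a..b} (\<rho> n)" for n unfolding \<rho>_def by (intro continuous_intros yc itc)
  have zc: "continuous_on {a..b} (\<lambda>_. 0 :: complex)" by (intro continuous_intros)
  have g0: "green w u v (\<lambda>t. 0) t = 0" for w u v t by (simp add: green_def)
  \<comment> \<open>\<open>y\<close> and \<open>y0\<close> have the same initial values, so
    variation of constants at parameter 0 makes their difference z times the Volterra integral of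
    \<open>y\<close>.\<close>
  have base: "\<rho> 1 t = z * green 0 \<theta> \<phi> (\<rho> 0) t" "\<rho>1 1 t = z * green 0 \<theta>1 \<phi>1 (\<rho> 0) t" if t: "t \<in> {a..b}" for t
  proof -
    have e: "\<rho> 0 = y" by (auto simp: \<rho>_def)
    show "\<rho> 1 t = z * green 0 \<theta> \<phi> (\<rho> 0) t"
      using variation_of_constants(1)[OF y t, of 0] variation_of_constants(1)[OF y0 t, of 0] init green_lin[OF yc(1) zc t, of 0 \<theta> \<phi> z]
      by (simp add: e \<rho>_def it_def g0)
    show "\<rho>1 1 t = z * green 0 \<theta>1 \<phi>1 (\<rho> 0) t"
      using variation_of_constants(2)[OF y t, of 0] variation_of_constants(2)[OF y0 t, of 0] init green_lin[OF yc(1) zc t, of 0 \<theta>1 \<phi>1 z]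
      by (simp add: e \<rho>1_def it1_def g0)
  qed
  have split: "green 0 u v (\<rho> (Suc n)) t = green 0 u v (\<rho> n) t - z ^ n * green 0 u v (it n) t" if t: "t \<in> {a..b}" for n t u v
  proof -
    have "\<rho> (Suc n) = (\<lambda>t. (- (z ^ n)) * it n t + \<rho> n t)" by (auto simp: \<rho>_def)
    then show ?thesis using green_lin[OF itc \<rho>c t, of 0 u v "- (z ^ n)" n n] by simp
  qed
  have step: "\<rho> (Suc n) t = z * green 0 \<theta> \<phi> (\<rho> n) t \<and> \<rho>1 (Suc n) t = z * green 0 \<theta>1 \<phi>1 (\<rho> n) t" if t: "t \<in> {a..b}" for n t
  proof (induction n)
    case 0
    then show ?case using base[OF t] by simp
  next
    case (Suc n)
    have "\<rho> (Suc (Suc n)) t = \<rho> (Suc n) t - z ^ Suc n * it (Suc n) t" "\<rho>1 (Suc (Suc n)) t = \<rho>1 (Suc n) t - z ^ Suc n * it1 (Suc n) t"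
      by (simp_all add: \<rho>_def \<rho>1_def)
    then show ?case using Suc by (simp add: split[OF t] itS[OF t] algebra_simps)
  qed
  have b: "cmod (\<rho> n t) \<le> (c * (cmod z * (2 * M^2)) ^ n) * (R t ^ n / fact n)" if "t \<in> {a..b}" for n t
    by (rule iterate_bound[OF M _ \<rho>c _ _ that]) (use c step in \<open>auto simp: \<rho>_def\<close>)
  have b1: "cmod (\<rho>1 (Suc n) x) \<le> (c * (cmod z * (2 * M^2)) ^ Suc n) * (R x ^ Suc n / fact (Suc n))" for n
  proof -
    have "cmod (\<rho>1 (Suc n) x) = cmod z * cmod (green 0 \<theta>1 \<phi>1 (\<rho> n) x)" using step[OF x] by (simp add: norm_mult)
    also have "\<dots> \<le> cmod z * ((2 * M^2 * (c * (cmod z * (2 * M^2)) ^ n)) * (R x ^ Suc n / fact (Suc n)))"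
      using M b c x by (intro mult_left_mono green_le[where M=M] \<rho>c) auto
    also have "\<dots> = (c * (cmod z * (2 * M^2)) ^ Suc n) * (R x ^ Suc n / fact (Suc n))"
      by (simp add: mult_ac)
    finally show ?thesis .
  qed
  have lim: "(\<lambda>n. (c * (cmod z * (2 * M^2)) ^ n) * (R x ^ n / fact n)) \<longlonglongrightarrow> 0"
  proof -
    have "(\<lambda>n. c * ((cmod z * (2 * M^2) * R x) ^ n / fact n)) \<longlonglongrightarrow> c * 0"
      using summable_LIMSEQ_zero[OF summable_exp[of "cmod z * (2 * M^2) * R x"]]
      by (intro tendsto_mult tendsto_const) (simp add: divide_inverse mult.commute)
    then show ?thesis by (simp add: power_mult_distrib mult.assoc)
  qed
  have "(\<lambda>n. \<rho> n x) \<longlonglongrightarrow> 0" by (rule Lim_null_comparison[OF _ lim]) (use b x in auto)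
  then have "(\<lambda>n. y x - \<rho> n x) \<longlonglongrightarrow> y x - 0" by (intro tendsto_diff tendsto_const)
  then show "(\<lambda>k. z ^ k * sl_iter r a G y0 k x) sums y x" unfolding sums_def by (simp add: \<rho>_def it_def)
  \<comment> \<open>The bound \<open>b1\<close> starts at index 1, because a remainder of
    \<open>y1\<close> is estimated through one integration of a remainder of
    \<open>y\<close>.\<close>
  have "(\<lambda>n. \<rho>1 (Suc n) x) \<longlonglongrightarrow> 0" by (rule Lim_null_comparison[OF _ LIMSEQ_Suc[OF lim]]) (use b1 in auto)
  then have "(\<lambda>n. y1 x - \<rho>1 n x) \<longlonglongrightarrow> y1 x - 0" by (intro tendsto_diff tendsto_const) (rule LIMSEQ_imp_Suc)
  then show "(\<lambda>k. z ^ k * sl_iter1 r a G G1 y0 y01 k x) sums y1 x" unfolding sums_def by (simp add: \<rho>1_def it1_def)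
qed

end

section \<open>Entire functions of order at most one half\<close>

lemma entire_factor_zero:
  assumes f: "f holomorphic_on UNIV" and "f c = 0"
  obtains g where "g holomorphic_on UNIV" "\<And>z. f z = (z - c) * g z"
proof
  define g where "g z = (if z = c then deriv f c else f z / (z - c))" for z
  show "g holomorphic_on UNIV"
    by (rule pole_theorem_0[OF f, of c]) (use assms in \<open>auto simp: g_def\<close>)
  show "f z = (z - c) * g z" for z using assms by (auto simp: g_def)
qed

text \<open>At a simple zero of \<open>F\<close> the factor z - c divides numerator and denominator
  and cancels, so the singularity is removable; l'Hospital's rule gives the value there. The
  resolvent will be such a quotient.\<close>

lemma entire_quotient:
  assumes F: "F holomorphic_on UNIV" and N: "N holomorphic_on UNIV"
    and zero: "\<And>z. F z = 0 \<Longrightarrow> N z = 0 \<and> deriv F z \<noteq> 0"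
  obtains Y where "Y holomorphic_on UNIV" "\<And>z. N z = F z * Y z"
proof
  define Y where "Y z = (if F z = 0 then deriv N z / deriv F z else N z / F z)" for z
  have "\<exists>e>0. Y holomorphic_on ball c e" for c
  proof (cases "F c = 0")
    case False
    have "continuous_on UNIV F" using F by (rule holomorphic_on_imp_continuous_on)
    then obtain e where e: "e > 0" "\<And>z. dist c z < e \<Longrightarrow> F z \<noteq> 0"
      using continuous_on_avoid[of UNIV F c 0] False by auto
    have "(\<lambda>z. N z / F z) holomorphic_on ball c e"
      using e by (intro holomorphic_on_divide holomorphic_on_subset[OF N] holomorphic_on_subset[OF F]) auto
    then have "Y holomorphic_on ball c e"
      by (rule holomorphic_transform) (use e in \<open>auto simp: Y_def\<close>)
    then show ?thesis using e by blast
  next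
    case True
    obtain F2 where F2: "F2 holomorphic_on UNIV" "\<And>z. F z = (z - c) * F2 z" using entire_factor_zero[OF F True] by metis
    obtain N2 where N2: "N2 holomorphic_on UNIV" "\<And>z. N z = (z - c) * N2 z" using entire_factor_zero[OF N] zero[OF True] by metis
    have d: "deriv (\<lambda>z. (z - c) * g z) c = g c" if "g holomorphic_on UNIV" for g
    proof -
      have "(g has_field_derivative deriv g c) (at c)" using that by (intro holomorphic_derivI[of g UNIV]) auto
      then have "((\<lambda>z. (z - c) * g z) has_field_derivative g c) (at c)" by (auto intro!: derivative_eq_intros)
      then show ?thesis by (rule DERIV_imp_deriv)
    qed
    have dF: "deriv F c = F2 c" using d[OF F2(1)] F2(2) by presburger
    have dN: "deriv N c = N2 c" using d[OF N2(1)] N2(2) by presburger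
    have "F2 c \<noteq> 0" using zero[OF True] dF by simp
    moreover have "continuous_on UNIV F2" using F2(1) by (rule holomorphic_on_imp_continuous_on)
    ultimately obtain e where e: "e > 0" "\<And>z. dist c z < e \<Longrightarrow> F2 z \<noteq> 0"
      using continuous_on_avoid[of UNIV F2 c 0] by auto
    have "(\<lambda>z. N2 z / F2 z) holomorphic_on ball c e"
      using e by (intro holomorphic_on_divide holomorphic_on_subset[OF N2(1)] holomorphic_on_subset[OF F2(1)]) auto
    moreover have "N2 z / F2 z = Y z" if "z \<in> ball c e" for z
      using e(2)[of z] that dF dN by (cases "z = c") (auto simp: Y_def True F2(2) N2(2))
    ultimately have "Y holomorphic_on ball c e" by (rule holomorphic_transform)
    then show ?thesis using e by blast
  qed
  then show "Y holomorphic_on UNIV"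
    by (meson UNIV_I centre_in_ball holomorphic_on_def field_differentiable_at_within holomorphic_on_imp_differentiable_at open_ball)
  show "N z = F z * Y z" for z using zero[of z] by (auto simp: Y_def)
qed

lemma has_fps_expansion_sums:
  fixes f :: "complex \<Rightarrow> complex"
  assumes "\<rho> > 0" and sums: "\<And>z. cmod z < \<rho> \<Longrightarrow> (\<lambda>n. c n * z ^ n) sums f z"
  shows "f has_fps_expansion Abs_fps c"
  unfolding has_fps_expansion_def
proof
  have "summable (\<lambda>n. c n * of_real (\<rho>/2) ^ n)"
    using sums[of "of_real (\<rho>/2)"] \<open>\<rho> > 0\<close> by (auto simp: sums_iff)
  from conv_radius_geI[OF this] have "conv_radius c \<ge> ereal (\<rho>/2)" using \<open>\<rho> > 0\<close> by simp
  moreover have "ereal (\<rho>/2) > 0" using \<open>\<rho> > 0\<close> by simp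
  ultimately show "fps_conv_radius (Abs_fps c) > 0" unfolding fps_conv_radius_def by (metis fps_nth_Abs_fps less_le_trans ext)
  have "\<forall>\<^sub>F z in nhds 0. z \<in> ball (0::complex) \<rho>" using \<open>\<rho> > 0\<close> by (intro eventually_nhds_in_open) auto
  then show "\<forall>\<^sub>F z in nhds 0. eval_fps (Abs_fps c) z = f z"
    by eventually_elim (use sums in \<open>auto simp: eval_fps_def sums_iff\<close>)
qed

text \<open>Re g < A says that g is closer to 0 than to 2A, so g/(2A - g) maps the disc into the
  unit disc and fixes 0. Schwarz' lemma gives |g| <= (|z|/R) |2A - g|, which is solved for
  |g|.\<close>

lemma Borel_Caratheodory:
  assumes g: "g holomorphic_on ball 0 R" and "g 0 = 0" and A: "A > 0" "\<And>z. z \<in> ball 0 R \<Longrightarrow> Re (g z) < A"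
    and z: "cmod z < R"
  shows "cmod (g z) \<le> 2 * A * cmod z / (R - cmod z)"
proof -
  have R: "R > 0" using z by (smt (verit) norm_ge_zero)
  define \<psi> where "\<psi> w = g (of_real R * w) / (2 * of_real A - g (of_real R * w))" for w
  have in_ball: "of_real R * w \<in> ball 0 R" if "cmod w < 1" for w :: complex
    using that R by (simp add: norm_mult)
  have nz: "2 * of_real A - g u \<noteq> 0" if "u \<in> ball 0 R" for u
  proof
    assume "2 * of_real A - g u = 0"
    then have "g u = of_real (2 * A)" by simp
    then show False using A(2)[OF that] A(1) by simp
  qed
  have less: "cmod (g u) < cmod (2 * of_real A - g u)" if "u \<in> ball 0 R" for u
  proof -
    have "(cmod (2 * of_real A - g u))^2 - (cmod (g u))^2 = 4 * A * (A - Re (g u))"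
      unfolding cmod_power2 by (simp add: power2_eq_square algebra_simps)
    moreover have "\<dots> > 0" using A(1) A(2)[OF that] by simp
    ultimately have "(cmod (g u))^2 < (cmod (2 * of_real A - g u))^2" by linarith
    then show ?thesis by (rule power2_less_imp_less) simp
  qed
  have "(\<lambda>w. g (of_real R * w)) holomorphic_on ball 0 1"
  proof -
    have "(\<lambda>w. complex_of_real R * w) ` ball 0 1 \<subseteq> ball 0 R" by (intro image_subsetI in_ball) simp
    moreover have "(\<lambda>w. complex_of_real R * w) holomorphic_on ball 0 1" by (intro holomorphic_intros)
    ultimately show ?thesis using holomorphic_on_compose_gen[OF _ g] by (fastforce simp: o_def)
  qed
  then have \<psi>h: "\<psi> holomorphic_on ball 0 1" unfolding \<psi>_def
    by (intro holomorphic_on_divide holomorphic_on_diff holomorphic_on_const) (use nz in_ball in auto)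
  have \<psi>1: "cmod (\<psi> w) < 1" if "cmod w < 1" for w
    unfolding \<psi>_def norm_divide using less[OF in_ball[OF that]] nz[OF in_ball[OF that]] by simp
  define w where "w = z / of_real R"
  have w: "cmod w < 1" "of_real R * w = z" "cmod w = cmod z / R" using z R by (auto simp: w_def norm_divide)
  have "cmod (\<psi> w) \<le> cmod w"
    by (rule Schwarz_Lemma(1)[OF \<psi>h _ \<psi>1 w(1)]) (simp add: \<psi>_def \<open>g 0 = 0\<close>)
  then have 1: "cmod (g z) \<le> cmod z / R * cmod (2 * of_real A - g z)"
    using nz[of z] z unfolding \<psi>_def w norm_divide by (simp add: pos_divide_le_eq)
  also have "\<dots> \<le> cmod z / R * (2 * A + cmod (g z))"
    using norm_triangle_ineq4[of "2 * of_real A" "g z"] A R by (intro mult_left_mono) (auto simp: norm_mult)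
  finally have "R * cmod (g z) \<le> cmod z * (2 * A + cmod (g z))" using R by (simp add: field_simps)
  then have "cmod (g z) * (R - cmod z) \<le> 2 * A * cmod z" by (simp add: algebra_simps)
  then show ?thesis using z by (simp add: pos_le_divide_eq)
qed

text \<open>Ordered by modulus, the j-th element satisfies j <= C sqrt |x|, hence 1/|x| <= C^2/j^2.
  The induction removes an element of maximal modulus, for which the counting hypothesis sees the
  whole set.\<close>

lemma sum_inverse_card_bound:
  fixes S :: "complex set"
  assumes "finite S" and nz: "\<And>x. x \<in> S \<Longrightarrow> x \<noteq> 0"
    and cnt: "\<And>x. x \<in> S \<Longrightarrow> real (card {y \<in> S. cmod y \<le> cmod x}) \<le> C * sqrt (cmod x)"
  shows "(\<Sum>x\<in>S. 1 / cmod x) \<le> C^2 * (\<Sum>j<card S. 1 / real (Suc j) ^ 2)"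
  using assms
proof (induction "card S" arbitrary: S)
  case 0
  then show ?case by simp
next
  case (Suc n)
  have "S \<noteq> {}" using Suc.hyps(2) by auto
  have "Max (cmod ` S) \<in> cmod ` S" using \<open>finite S\<close> \<open>S \<noteq> {}\<close> by (intro Max_in) auto
  then obtain m where "m \<in> S" "Max (cmod ` S) = cmod m" by blast
  then have m: "m \<in> S" "\<And>x. x \<in> S \<Longrightarrow> cmod x \<le> cmod m"
    using \<open>finite S\<close> Max_ge[of "cmod ` S"] by auto
  let ?S = "S - {m}"
  have card: "card ?S = n" using Suc m by simp
  have "real (card {y \<in> ?S. cmod y \<le> cmod x}) \<le> C * sqrt (cmod x)" if "x \<in> ?S" for x
  proof -
    have "card {y \<in> ?S. cmod y \<le> cmod x} \<le> card {y \<in> S. cmod y \<le> cmod x}"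
      using Suc.prems(1) by (intro card_mono) auto
    then show ?thesis using Suc.prems(3)[of x] that by simp
  qed
  then have IH: "(\<Sum>x\<in>?S. 1 / cmod x) \<le> C^2 * (\<Sum>j<n. 1 / real (Suc j) ^ 2)"
    using Suc.hyps(1)[of ?S] Suc.prems card by auto
  have "{y \<in> S. cmod y \<le> cmod m} = S" using m by auto
  then have "real (Suc n) \<le> C * sqrt (cmod m)" using Suc.prems(3)[OF m(1)] Suc.hyps(2) by simp
  then have "real (Suc n) ^ 2 \<le> (C * sqrt (cmod m))^2" by (intro power_mono) auto
  then have "real (Suc n) ^ 2 \<le> C^2 * cmod m" by (simp add: power_mult_distrib)
  moreover have "cmod m > 0" using Suc.prems(2)[OF m(1)] by simp
  ultimately have "1 / cmod m \<le> C^2 * (1 / real (Suc n) ^ 2)" by (simp add: field_simps)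
  moreover have "(\<Sum>x\<in>S. 1 / cmod x) = 1 / cmod m + (\<Sum>x\<in>?S. 1 / cmod x)"
    using Suc.prems(1) m by (simp add: sum.remove)
  ultimately show ?case using IH Suc.hyps(2)[symmetric] by (simp add: distrib_left)
qed

lemma holomorphic_max_bound:
  assumes f: "f holomorphic_on UNIV" and "r > 0" and b: "\<And>z. cmod z = r \<Longrightarrow> cmod (f z) \<le> B" and z: "cmod z \<le> r"
  shows "cmod (f z) \<le> B"
proof (rule maximum_modulus_frontier[of f "cball 0 r"])
  show "f holomorphic_on interior (cball 0 r)" using f by (rule holomorphic_on_subset) auto
  show "continuous_on (closure (cball 0 r)) f" using f by (intro holomorphic_on_imp_continuous_on holomorphic_on_subset[OF f]) auto
qed (use assms in \<open>auto simp: dist_norm norm_minus_commute\<close>)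

text \<open>An entire function \<open>H\<close> of order at most \<open>1/2\<close>; since \<open>h\<close>, obtained by dividing out the zeros
  of modulus at most \<open>R\<close>, is bounded by \<open>exp (O(\<surd>R))\<close> on a disc of radius \<open>3R\<close>, the Taylor coefficients
  of \<open>h'/h\<close> vanish as \<open>R \<rightarrow> \<infinity>\<close>.\<close>

locale entire_simple =
  fixes H :: "complex \<Rightarrow> complex" and c \<kappa> :: real
  assumes hol: "H holomorphic_on UNIV" and H0: "H 0 \<noteq> 0"
    and simple: "\<And>z. H z = 0 \<Longrightarrow> deriv H z \<noteq> 0"
    and growth: "\<And>z. cmod (H z) \<le> c * exp (\<kappa> * sqrt (cmod z))" and \<kappa>: "\<kappa> \<ge> 0"
begin

definition Z where "Z = {z. H z = 0}"
definition ZR where "ZR t = {z \<in> Z. cmod z \<le> t}" for t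

lemma c_pos: "c > 0"
proof -
  have "cmod (H 0) \<le> c" using growth[of 0] by simp
  moreover have "cmod (H 0) > 0" using H0 by simp
  ultimately show ?thesis by linarith
qed

lemma finite_ZR: "finite (ZR t)"
proof (cases "H constant_on UNIV")
  case True
  then have "ZR t = {}" using H0 by (auto simp: ZR_def Z_def constant_on_def)
  then show ?thesis by simp
next
  case False
  have "finite {z \<in> cball 0 t. H z = 0}"
    by (rule holomorphic_compact_finite_zeros[OF hol]) (use False in auto)
  then show ?thesis by (rule rev_finite_subset) (auto simp: ZR_def Z_def)
qed

lemma Z_nz: "z \<in> Z \<Longrightarrow> z \<noteq> 0" using H0 by (auto simp: Z_def)

text \<open>Factors 1 - z/w instead of z - w leave the value at 0 unchanged, so h 0 = H 0 whatever
  \<open>S\<close> is. Simplicity of the zeros ensures that \<open>h\<close> does not vanish on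
  \<open>S\<close>.\<close>

lemma factor_zeros:
  assumes "finite S" "S \<subseteq> Z"
  shows "\<exists>h. h holomorphic_on UNIV \<and> (\<forall>z. H z = h z * (\<Prod>w\<in>S. 1 - z / w)) \<and> (\<forall>z. h z = 0 \<longrightarrow> z \<in> Z - S)"
proof -
  have "\<exists>h. h holomorphic_on UNIV \<and> (\<forall>z. H z = h z * (\<Prod>w\<in>S. 1 - z / w))"
    using assms
  proof (induction S rule: finite_induct)
    case empty
    then show ?case using hol by auto
  next
    case (insert w S)
    then obtain h where h: "h holomorphic_on UNIV" "\<And>z. H z = h z * (\<Prod>w\<in>S. 1 - z / w)" by auto
    have wS: "w \<in> Z" "S \<subseteq> Z" using insert.prems by auto
    have "w \<noteq> 0" using Z_nz wS(1) by blast
    have "H w = 0" using wS(1) by (simp add: Z_def)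
    have "v \<noteq> 0" if "v \<in> S" for v using that wS Z_nz by blast
    with \<open>w \<noteq> 0\<close> have "(\<Prod>v\<in>S. 1 - w / v) \<noteq> 0" using insert.hyps by (auto simp: field_simps)
    then have "h w = 0" using h(2)[of w] \<open>H w = 0\<close> by simp
    then obtain g where g: "g holomorphic_on UNIV" "\<And>z. h z = (z - w) * g z" using entire_factor_zero[OF h(1)] by metis
    have "H z = (- w * g z) * (\<Prod>v\<in>insert w S. 1 - z / v)" for z
    proof -
      have "z - w = - w * (1 - z / w)" using \<open>w \<noteq> 0\<close> by (simp add: field_simps)
      then show ?thesis unfolding h(2) g(2) using insert by simp
    qed
    moreover have "(\<lambda>z. - w * g z) holomorphic_on UNIV" using g(1) by (intro holomorphic_intros)
    ultimately show ?case by blast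
  qed
  then obtain h where h: "h holomorphic_on UNIV" "\<And>z. H z = h z * (\<Prod>w\<in>S. 1 - z / w)" by blast
  \<comment> \<open>Otherwise \<open>H\<close> would be a product of two functions vanishing at
    \<open>z\<close>, and its derivative would vanish there as well.\<close>
  have "h z \<noteq> 0" if "z \<in> S" for z
  proof
    assume "h z = 0"
    have "H z = 0" using that assms by (auto simp: Z_def)
    define P where "P = (\<lambda>z. \<Prod>w\<in>S. 1 - z / w)"
    have "P z = 0" unfolding P_def using that assms Z_nz by (subst prod_zero_iff) (auto intro!: bexI[of _ z])
    have Ph: "P holomorphic_on UNIV" unfolding P_def using assms Z_nz by (intro holomorphic_intros) auto
    have "(h has_field_derivative deriv h z) (at z)" "(P has_field_derivative deriv P z) (at z)"
      using h(1) Ph by (auto intro!: holomorphic_derivI[of _ UNIV])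
    then have "((\<lambda>z. h z * P z) has_field_derivative 0) (at z)"
      using \<open>h z = 0\<close> \<open>P z = 0\<close> by (auto intro!: derivative_eq_intros)
    moreover have "(\<lambda>z. h z * P z) = H" using h(2) by (auto simp: P_def)
    ultimately have "deriv H z = 0" using DERIV_imp_deriv by metis
    then show False using simple \<open>H z = 0\<close> by blast
  qed
  moreover have "z \<in> Z" if "h z = 0" for z using h(2)[of z] that by (simp add: Z_def)
  ultimately show ?thesis using h by blast
qed

text \<open>On the circle |u| = 3t every factor has |1 - u/w| >= 3 - 1 = 2, and the maximum
  principle carries the estimate inwards. At the origin the power of 2 counts zeros, as in Jensen's
  formula; elsewhere the quotient itself is bounded.\<close>

lemma factor_bound:
  assumes t: "t > 0" and h: "h holomorphic_on UNIV" "\<And>z. H z = h z * (\<Prod>w\<in>ZR t. 1 - z / w)" and z: "cmod z \<le> 3 * t"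
  shows "cmod (h z) * 2 ^ card (ZR t) \<le> c * exp (\<kappa> * sqrt (3 * t))"
proof -
  have "cmod (h z) \<le> c * exp (\<kappa> * sqrt (3 * t)) / 2 ^ card (ZR t)"
  proof (rule holomorphic_max_bound[OF h(1) _ _ z])
    fix u assume u: "cmod u = 3 * t"
    have "2 ^ card (ZR t) = (\<Prod>w\<in>ZR t. 2 :: real)" by simp
    also have "\<dots> \<le> (\<Prod>w\<in>ZR t. cmod (1 - u / w))"
    proof (rule prod_mono)
      fix w assume w: "w \<in> ZR t"
      then have "w \<noteq> 0" "cmod w \<le> t" using Z_nz by (auto simp: ZR_def)
      then have "3 \<le> cmod (u / w)" using t by (simp add: norm_divide u pos_le_divide_eq)
      then have "2 \<le> cmod (1 - u / w)" using norm_triangle_ineq2[of "u / w" 1] by (simp add: norm_minus_commute)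
      then show "0 \<le> (2::real) \<and> 2 \<le> cmod (1 - u / w)" by simp
    qed
    also have "\<dots> = cmod (\<Prod>w\<in>ZR t. 1 - u / w)" by (simp add: prod_norm)
    finally have "cmod (h u) * 2 ^ card (ZR t) \<le> cmod (h u) * cmod (\<Prod>w\<in>ZR t. 1 - u / w)" by (rule mult_left_mono) simp
    also have "\<dots> = cmod (H u)" by (simp only: h(2)[of u] norm_mult)
    also have "\<dots> \<le> c * exp (\<kappa> * sqrt (3 * t))" using growth[of u] by (simp add: u)
    finally show "cmod (h u) \<le> c * exp (\<kappa> * sqrt (3 * t)) / 2 ^ card (ZR t)" by (simp add: pos_le_divide_eq)
  qed (use t in simp)
  then show ?thesis by (simp add: pos_le_divide_eq)
qed

lemma zero_free_radius: "\<exists>\<rho>>0. \<forall>z\<in>Z. \<rho> \<le> cmod z"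
proof -
  have "continuous_on UNIV H" using hol by (rule holomorphic_on_imp_continuous_on)
  then obtain e where e: "e > 0" "\<And>z. dist 0 z < e \<Longrightarrow> H z \<noteq> 0"
    using continuous_on_avoid[of UNIV H 0 0] H0 by auto
  then show ?thesis by (intro exI[of _ e]) (force simp: Z_def not_le[symmetric])
qed

text \<open>Take logarithms in \<open>factor_bound\<close> at the origin, where the quotient has the
  fixed value H 0.\<close>

lemma card_ZR: "\<exists>C\<ge>0. \<forall>z\<in>Z. real (card (ZR (cmod z))) \<le> C * sqrt (cmod z)"
proof -
  obtain \<rho> where \<rho>: "\<rho> > 0" "\<And>z. z \<in> Z \<Longrightarrow> \<rho> \<le> cmod z" using zero_free_radius by blast
  define B where "B = \<bar>ln (c / cmod (H 0))\<bar>"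
  have B: "B \<ge> 0" by (simp add: B_def)
  have "real (card (ZR (cmod z))) \<le> (2 * (B / sqrt \<rho> + \<kappa> * sqrt 3)) * sqrt (cmod z)" if z: "z \<in> Z" for z
  proof -
    define t where "t = cmod z"
    have t: "t > 0" "\<rho> \<le> t" using \<rho> z by (force simp: t_def)+
    have "ZR t \<subseteq> Z" by (auto simp: ZR_def)
    then obtain h where h: "h holomorphic_on UNIV" "\<And>z. H z = h z * (\<Prod>w\<in>ZR t. 1 - z / w)"
      using factor_zeros[OF finite_ZR] by blast
    have "h 0 = H 0" using h(2)[of 0] by simp
    with factor_bound[OF t(1) h, of 0] t have "cmod (H 0) * 2 ^ card (ZR t) \<le> c * exp (\<kappa> * sqrt (3 * t))" by simp
    then have "2 ^ card (ZR t) \<le> (c / cmod (H 0)) * exp (\<kappa> * sqrt (3 * t))" using H0 by (simp add: field_simps)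
    then have "ln (2 ^ card (ZR t)) \<le> ln ((c / cmod (H 0)) * exp (\<kappa> * sqrt (3 * t)))" by (subst ln_le_cancel_iff) (use c_pos H0 in auto)
    also have "\<dots> = ln (c / cmod (H 0)) + \<kappa> * sqrt (3 * t)" using c_pos H0 by (subst ln_mult) auto
    also have "\<dots> \<le> B + \<kappa> * sqrt (3 * t)" by (simp add: B_def)
    finally have 1: "real (card (ZR t)) * ln 2 \<le> B + \<kappa> * sqrt (3 * t)" by (simp add: ln_realpow)
    have "1/2 \<le> ln (2::real)" using ln_ge_iff[of 2 "1/2"] exp_half_le2 by simp
    then have "real (card (ZR t)) * (1/2) \<le> real (card (ZR t)) * ln 2" by (intro mult_left_mono) auto
    with 1 have "real (card (ZR t)) \<le> 2 * (B + \<kappa> * sqrt (3 * t))" by simp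
    \<comment> \<open>The additive constant is absorbed into a multiple of sqrt t, because every
      zero has modulus at least \<rho>.\<close>
    also have "B \<le> B / sqrt \<rho> * sqrt t"
    proof -
      have "1 \<le> sqrt t / sqrt \<rho>" using \<rho> t by (simp add: pos_le_divide_eq)
      then have "B * 1 \<le> B * (sqrt t / sqrt \<rho>)" using B by (intro mult_left_mono)
      then show ?thesis by simp
    qed
    finally show ?thesis by (simp add: t_def real_sqrt_mult algebra_simps)
  qed
  moreover have "2 * (B / sqrt \<rho> + \<kappa> * sqrt 3) \<ge> 0" using B \<rho> \<kappa> by simp
  ultimately show ?thesis by blast
qed

lemma summable_inverse_zeros: "(\<lambda>z. 1 / cmod z) summable_on Z"
proof -
  obtain C where C: "C \<ge> 0" "\<And>z. z \<in> Z \<Longrightarrow> real (card (ZR (cmod z))) \<le> C * sqrt (cmod z)" using card_ZR by blast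
  have s: "summable (\<lambda>j. 1 / real (Suc j) ^ 2)"
    using inverse_power_summable[of 2, where 'a=real] summable_Suc_iff[of "\<lambda>n. inverse (real n ^ 2)"] by (simp add: inverse_eq_divide)
  show ?thesis
  proof (rule nonneg_bounded_partial_sums_imp_summable_on)
    show "\<forall>\<^sub>F S in finite_subsets_at_top Z. (\<Sum>z\<in>S. 1 / cmod z) \<le> C^2 * (\<Sum>j. 1 / real (Suc j) ^ 2)"
      unfolding eventually_finite_subsets_at_top
    proof (intro exI[of _ "{}"] conjI allI impI)
      fix S assume S: "finite S \<and> {} \<subseteq> S \<and> S \<subseteq> Z"
      have "(\<Sum>z\<in>S. 1 / cmod z) \<le> C^2 * (\<Sum>j<card S. 1 / real (Suc j) ^ 2)"
      proof (rule sum_inverse_card_bound)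
        fix x assume x: "x \<in> S"
        have "card {y \<in> S. cmod y \<le> cmod x} \<le> card (ZR (cmod x))"
          using S finite_ZR by (intro card_mono) (auto simp: ZR_def)
        then show "real (card {y \<in> S. cmod y \<le> cmod x}) \<le> C * sqrt (cmod x)" using C(2)[of x] S x by auto
      qed (use S Z_nz in auto)
      also have "\<dots> \<le> C^2 * (\<Sum>j. 1 / real (Suc j) ^ 2)"
        by (intro mult_left_mono sum_le_suminf s) auto
      finally show "(\<Sum>z\<in>S. 1 / cmod z) \<le> C^2 * (\<Sum>j. 1 / real (Suc j) ^ 2)" .
    qed auto
  qed simp
qed

definition l where "l n = (deriv ^^ n) (\<lambda>z. deriv H z / H z) 0 / fact n"

lemma logderiv_fps: "(\<lambda>z. deriv H z / H z) has_fps_expansion Abs_fps l"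
proof -
  obtain \<rho> where \<rho>: "\<rho> > 0" "\<And>z. z \<in> Z \<Longrightarrow> \<rho> \<le> cmod z" using zero_free_radius by blast
  have "(\<lambda>z. deriv H z / H z) holomorphic_on ball 0 \<rho>"
    using \<rho> by (intro holomorphic_on_divide holomorphic_deriv holomorphic_on_subset[OF hol]) (force simp: Z_def)+
  then have "(\<lambda>z. deriv H z / H z) has_fps_expansion fps_expansion (\<lambda>z. deriv H z / H z) 0"
    using \<rho> by (intro has_fps_expansion_fps_expansion[of "ball 0 \<rho>"]) auto
  moreover have "fps_expansion (\<lambda>z. deriv H z / H z) 0 = Abs_fps l"
    by (rule fps_ext) (simp add: fps_expansion_def l_def)
  ultimately show ?thesis by simp
qed

text \<open>The quotient \<open>h\<close> has a logarithm \<open>g\<close> on the disc of radius t,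
  with real part O(sqrt t). Borel-Caratheodory and Cauchy's inequality bound its Taylor
  coefficients, and g' = H'/H + \<Sum> 1/(w - z) has the left-hand side as its n-th
  coefficient.\<close>

lemma partial_sum_bound:
  assumes t: "t \<ge> 1"
  shows "cmod (l n + (\<Sum>w\<in>ZR t. 1 / w ^ Suc n)) \<le> real (Suc n) * 2 ^ Suc n * (2 * (\<bar>ln (c / cmod (H 0))\<bar> + 1 + \<kappa> * sqrt (3 * t))) / t ^ Suc n"
proof -
  have "ZR t \<subseteq> Z" by (auto simp: ZR_def)
  then obtain h where h: "h holomorphic_on UNIV" "\<And>z. H z = h z * (\<Prod>w\<in>ZR t. 1 - z / w)" "\<And>z. h z = 0 \<Longrightarrow> z \<in> Z - ZR t"
    using factor_zeros[OF finite_ZR] by metis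
  have h0: "h 0 = H 0" using h(2)[of 0] by simp
  have hb: "cmod (h z) \<le> c * exp (\<kappa> * sqrt (3 * t))" if "cmod z \<le> 3 * t" for z
  proof -
    have "cmod (h z) * 1 \<le> cmod (h z) * 2 ^ card (ZR t)" by (intro mult_left_mono) auto
    then show ?thesis using factor_bound[OF _ h(1,2) that] t by simp
  qed
  \<comment> \<open>The summand 1 makes \<open>A\<close> positive and the bound on Re g strict, as
    Borel-Caratheodory requires.\<close>
  define A where "A = \<bar>ln (c / cmod (H 0))\<bar> + 1 + \<kappa> * sqrt (3 * t)"
  have A: "A > 0" using \<kappa> t by (simp add: A_def add_pos_nonneg)
  have hnz: "h z \<noteq> 0" if "z \<in> ball 0 t" for z using h(3)[of z] that by (auto simp: ZR_def)
  have hh: "(\<lambda>z. h z / h 0) holomorphic_on ball 0 t"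
    using h(1) h0 H0 by (intro holomorphic_intros holomorphic_on_subset[OF h(1)]) auto
  obtain g1 where g1: "g1 holomorphic_on ball 0 t" "\<And>z. z \<in> ball 0 t \<Longrightarrow> exp (g1 z) = h z / h 0"
    by (rule holomorphic_logarithm_exists[OF _ _ hh, of 0]) (use hnz t h0 H0 in auto)
  \<comment> \<open>The normalisation g 0 = 0 required by Borel-Caratheodory; exp g is still h / h
    0, since exp (g1 0) = 1.\<close>
  define g where "g z = g1 z - g1 0" for z
  have gh: "g holomorphic_on ball 0 t" unfolding g_def by (intro holomorphic_intros g1)
  have g0: "g 0 = 0" by (simp add: g_def)
  have ge: "exp (g z) = h z / h 0" if "z \<in> ball 0 t" for z
    using g1(2)[OF that] g1(2)[of 0] t h0 H0 by (simp add: g_def exp_diff)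
  have ReA: "Re (g z) < A" if z: "z \<in> ball 0 t" for z
  proof -
    have "exp (Re (g z)) = cmod (h z / h 0)" using ge[OF z] by (metis norm_exp_eq_Re)
    also have "\<dots> \<le> (c / cmod (H 0)) * exp (\<kappa> * sqrt (3 * t))"
      using hb[of z] z t by (simp add: norm_divide h0 divide_right_mono)
    also have "c / cmod (H 0) = exp (ln (c / cmod (H 0)))" using c_pos H0 by simp
    finally have "exp (Re (g z)) \<le> exp (ln (c / cmod (H 0)) + \<kappa> * sqrt (3 * t))" by (simp add: exp_add)
    then have "Re (g z) \<le> ln (c / cmod (H 0)) + \<kappa> * sqrt (3 * t)" by simp
    then show ?thesis by (simp add: A_def abs_if)
  qed
  \<comment> \<open>At half the radius the factor |z|/(t - |z|) equals 1.\<close>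
  have gb: "cmod (g z) \<le> 2 * A" if z: "cmod z = t / 2" for z
    using Borel_Caratheodory[OF gh g0 A ReA, of z] z t by simp
  have gc: "cmod ((deriv ^^ Suc n) g 0) \<le> fact (Suc n) * (2 * A) / (t/2) ^ Suc n"
  proof (rule Cauchy_inequality)
    show "g holomorphic_on ball 0 (t/2)" by (rule holomorphic_on_subset[OF gh]) (use t in auto)
    show "continuous_on (cball 0 (t/2)) g"
      by (rule holomorphic_on_imp_continuous_on, rule holomorphic_on_subset[OF gh]) (use t in auto)
  qed (use gb t in auto)
  have gfps: "g has_fps_expansion fps_expansion g 0"
    using gh t by (intro has_fps_expansion_fps_expansion[of "ball 0 t"]) auto
  obtain \<rho> where \<rho>: "\<rho> > 0" "\<And>z. z \<in> Z \<Longrightarrow> \<rho> \<le> cmod z" using zero_free_radius by blast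
  have geo: "(\<lambda>z. 1 / (w - z)) has_fps_expansion Abs_fps (\<lambda>n. 1 / w ^ Suc n)" if "w \<noteq> 0" for w :: complex
  proof (rule has_fps_expansion_sums[of "cmod w"])
    fix z assume z: "cmod z < cmod w"
    then have "cmod (z / w) < 1" by (simp add: norm_divide divide_less_eq_1)
    then have "(\<lambda>n. (1 / w) * (z / w) ^ n) sums ((1 / w) * (1 / (1 - z / w)))"
      by (intro sums_mult geometric_sums)
    moreover have "(1 / w) * (1 / (1 - z / w)) = 1 / (w - z)" using that z by (auto simp: field_simps)
    ultimately show "(\<lambda>n. 1 / w ^ Suc n * z ^ n) sums (1 / (w - z))" by (simp add: power_divide)
  qed (use that in auto)
  have sumfps: "(\<lambda>z. deriv H z / H z + (\<Sum>w\<in>ZR t. 1 / (w - z))) has_fps_expansion Abs_fps l + (\<Sum>w\<in>ZR t. Abs_fps (\<lambda>n. 1 / w ^ Suc n))"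
    by (intro has_fps_expansion_add logderiv_fps has_fps_expansion_sum geo) (auto simp: ZR_def dest: Z_nz)
  have "\<forall>\<^sub>F z in nhds 0. z \<in> ball (0::complex) (min \<rho> t)" using \<rho> t by (intro eventually_nhds_in_open) auto
  then have ev: "\<forall>\<^sub>F z in nhds 0. deriv g z = deriv H z / H z + (\<Sum>w\<in>ZR t. 1 / (w - z))"
  proof eventually_elim
    case (elim z)
    then have z: "z \<in> ball 0 t" "cmod z < \<rho>" by auto
    have zZ: "z \<notin> Z" using \<rho>(2)[of z] z by auto
    then have Hz: "H z \<noteq> 0" by (auto simp: Z_def)
    have ww: "w \<noteq> 0" "w \<noteq> z" if "w \<in> ZR t" for w using that zZ Z_nz by (auto simp: ZR_def)
    define P where "P = (\<lambda>z. \<Prod>w\<in>ZR t. 1 - z / w)"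
    have Pz: "P z \<noteq> 0" using Hz h(2)[of z] by (auto simp: P_def)
    have hz: "h z \<noteq> 0" using hnz z by blast
    have dP: "(P has_field_derivative P z * (\<Sum>w\<in>ZR t. (- 1 / w) / (1 - z / w))) (at z)"
    proof -
      have "((\<lambda>z. 1 - z / w) has_field_derivative (- 1 / w)) (at z)" if "w \<in> ZR t" for w
        using ww[OF that] by (auto intro!: derivative_eq_intros)
      then have "(P has_field_derivative (\<Sum>w\<in>ZR t. (- 1 / w) * (\<Prod>v\<in>ZR t - {w}. 1 - z / v))) (at z)"
        unfolding P_def by (rule has_field_derivative_prod)
      moreover have "(\<Sum>w\<in>ZR t. (- 1 / w) * (\<Prod>v\<in>ZR t - {w}. 1 - z / v)) = P z * (\<Sum>w\<in>ZR t. (- 1 / w) / (1 - z / w))"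
        unfolding sum_distrib_left
      proof (rule sum.cong[OF refl])
        fix w assume w: "w \<in> ZR t"
        have "P z = (1 - z / w) * (\<Prod>v\<in>ZR t - {w}. 1 - z / v)" unfolding P_def using finite_ZR w by (rule prod.remove)
        moreover have "1 - z / w \<noteq> 0" using ww[OF w] by simp
        ultimately show "(- 1 / w) * (\<Prod>v\<in>ZR t - {w}. 1 - z / v) = P z * ((- 1 / w) / (1 - z / w))" by simp
      qed
      ultimately show ?thesis by simp
    qed
    have dh: "(h has_field_derivative deriv h z) (at z)" using h(1) by (auto intro!: holomorphic_derivI[of _ UNIV])
    have Heq: "H = (\<lambda>z. h z * P z)" using h(2) by (auto simp: P_def)
    define \<sigma> where "\<sigma> = (\<Sum>w\<in>ZR t. (- 1 / w) / (1 - z / w))"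
    have "((\<lambda>z. h z * P z) has_field_derivative (deriv h z * P z + h z * (P z * \<sigma>))) (at z)"
      using dh dP[folded \<sigma>_def] by (auto intro!: derivative_eq_intros)
    then have "deriv H z = deriv h z * P z + h z * (P z * \<sigma>)"
      using DERIV_imp_deriv Heq by metis
    moreover have "H z = h z * P z" using Heq by metis
    ultimately have "deriv H z / H z = deriv h z / h z + \<sigma>"
      using hz Pz by (simp add: field_simps)
    moreover have "\<sigma> = - (\<Sum>w\<in>ZR t. 1 / (w - z))"
      unfolding \<sigma>_def sum_negf[symmetric] using ww by (intro sum.cong) (auto simp: field_simps)
    moreover have "deriv g z = deriv h z / h z"
    proof -
      have dg: "(g has_field_derivative deriv g z) (at z)" using gh z by (intro holomorphic_derivI[of _ "ball 0 t"]) auto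
      then have "((\<lambda>z. exp (g z)) has_field_derivative exp (g z) * deriv g z) (at z)" by (auto intro!: derivative_eq_intros)
      then have "((\<lambda>z. h z / h 0) has_field_derivative exp (g z) * deriv g z) (at z)"
        by (rule has_field_derivative_transform_within_open[of _ _ _ "ball 0 t"]) (use ge z in auto)
      moreover have "((\<lambda>z. h z / h 0) has_field_derivative deriv h z / h 0) (at z)" using dh by (rule DERIV_cdivide)
      ultimately have "h z / h 0 * deriv g z = deriv h z / h 0" using ge[OF z(1)] DERIV_unique by metis
      then show ?thesis using hz h0 H0 by (simp add: field_simps)
    qed
    ultimately show ?case by simp
  qed
  have "deriv g has_fps_expansion Abs_fps l + (\<Sum>w\<in>ZR t. Abs_fps (\<lambda>n. 1 / w ^ Suc n))"
    using sumfps ev by (simp add: has_fps_expansion_def eventually_conj_iff) (auto elim: eventually_elim2)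
  from fps_nth_fps_expansion[OF this, of n]
  have "l n + (\<Sum>w\<in>ZR t. 1 / w ^ Suc n) = (deriv ^^ n) (deriv g) 0 / fact n"
    by (simp add: fps_sum_nth)
  also have "(deriv ^^ n) (deriv g) 0 = (deriv ^^ Suc n) g 0" by (simp add: funpow_swap1)
  finally have "cmod (l n + (\<Sum>w\<in>ZR t. 1 / w ^ Suc n)) = cmod ((deriv ^^ Suc n) g 0) / fact n" by (simp add: norm_divide)
  also have "\<dots> \<le> (fact (Suc n) * (2 * A) / (t/2) ^ Suc n) / fact n"
    using gc by (rule divide_right_mono) simp
  also have "\<dots> = real (Suc n) * 2 ^ Suc n * (2 * A) / t ^ Suc n"
    by (simp add: power_divide fact_Suc field_simps del: power_Suc of_nat_Suc)
  finally show ?thesis by (simp add: A_def)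
qed

text \<open>Absolute convergence allows the sum to be taken along the discs |w| <= k. The error
  there is O(sqrt k / k^(n+1)), which tends to 0 already for n = 0; this is where the order below
  one enters.\<close>

lemma has_sum_inverse_zeros: "((\<lambda>w. 1 / w ^ Suc n) has_sum (- l n)) Z"
proof -
  obtain \<rho> where \<rho>: "\<rho> > 0" "\<And>z. z \<in> Z \<Longrightarrow> \<rho> \<le> cmod z" using zero_free_radius by blast
  have "(\<lambda>w. (1 / \<rho> ^ n) * (1 / cmod w)) summable_on Z" by (rule summable_on_cmult_right[OF summable_inverse_zeros])
  then have "(\<lambda>w. norm (1 / w ^ Suc n)) summable_on Z"
  proof (rule summable_on_comparison_test)
    fix w assume w: "w \<in> Z"
    have "\<rho> ^ n \<le> cmod w ^ n" using \<rho> w by (intro power_mono) auto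
    moreover have "cmod w > 0" using Z_nz[OF w] by simp
    ultimately show "norm (1 / w ^ Suc n) \<le> (1 / \<rho> ^ n) * (1 / cmod w)"
      using \<rho> by (simp add: norm_divide norm_mult norm_power divide_simps)
  qed auto
  then have "(\<lambda>w. 1 / w ^ Suc n) summable_on Z" by (rule abs_summable_summable)
  then have s: "((\<lambda>w. 1 / w ^ Suc n) has_sum infsum (\<lambda>w. 1 / w ^ Suc n) Z) Z" by (rule has_sum_infsum)
  \<comment> \<open>The zeros in growing discs form finite sets that eventually contain any given
    finite set of zeros.\<close>
  have "filterlim (\<lambda>k. ZR (real k)) (finite_subsets_at_top Z) sequentially"
    unfolding filterlim_def le_filter_def eventually_filtermap
  proof (intro allI impI)
    fix P assume "eventually P (finite_subsets_at_top Z)"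
    then obtain X where X: "finite X" "X \<subseteq> Z" "\<And>Y. finite Y \<and> X \<subseteq> Y \<and> Y \<subseteq> Z \<Longrightarrow> P Y"
      unfolding eventually_finite_subsets_at_top by blast
    obtain N :: nat where N: "\<And>x. x \<in> X \<Longrightarrow> cmod x \<le> real N"
    proof -
      obtain B where "\<And>x. x \<in> X \<Longrightarrow> cmod x \<le> B" using finite_imp_bounded[OF X(1)] by (auto simp: bounded_iff)
      moreover obtain N where "B \<le> real N" using real_arch_simple by blast
      ultimately show ?thesis using that by (meson order.trans)
    qed
    show "\<forall>\<^sub>F k in sequentially. P (ZR (real k))"
    proof (rule eventually_sequentiallyI[of N])
      fix k assume "N \<le> k"
      then have "X \<subseteq> ZR (real k)" using N X(2) by (fastforce simp: ZR_def)
      then show "P (ZR (real k))" by (intro X(3)) (auto simp: finite_ZR, auto simp: ZR_def)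
    qed
  qed
  with s have lim1: "(\<lambda>k. \<Sum>w\<in>ZR (real k). 1 / w ^ Suc n) \<longlonglongrightarrow> infsum (\<lambda>w. 1 / w ^ Suc n) Z"
    unfolding has_sum_def by (rule filterlim_compose)
  define D where "D = \<bar>ln (c / cmod (H 0))\<bar> + 1"
  have "(\<lambda>k. real (Suc n) * 2 ^ Suc n * (2 * (D + \<kappa> * sqrt (3 * real k))) / real k ^ Suc n) \<longlonglongrightarrow> 0"
  proof -
    have "(\<lambda>k. real (Suc n) * 2 ^ Suc n * (2 * (D * (1 / real k) + \<kappa> * sqrt 3 * sqrt (1 / real k))) * (1 / real k) ^ n) \<longlonglongrightarrow> real (Suc n) * 2 ^ Suc n * (2 * (D * 0 + \<kappa> * sqrt 3 * sqrt 0)) * 0 ^ n"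
      by (intro tendsto_intros lim_1_over_n)
    moreover have "\<forall>\<^sub>F k in sequentially. real (Suc n) * 2 ^ Suc n * (2 * (D * (1 / real k) + \<kappa> * sqrt 3 * sqrt (1 / real k))) * (1 / real k) ^ n
       = real (Suc n) * 2 ^ Suc n * (2 * (D + \<kappa> * sqrt (3 * real k))) / real k ^ Suc n"
    proof (rule eventually_sequentiallyI[of 1])
      fix k :: nat assume "1 \<le> k"
      then have k: "sqrt (real k) > 0" "real k = sqrt (real k) ^ 2" by auto
      have "sqrt (1 / real k) = sqrt (real k) / real k"
        by (simp add: sqrt_divide_self_eq real_sqrt_divide inverse_eq_divide)
      then have "D * (1 / real k) + \<kappa> * sqrt 3 * sqrt (1 / real k) = (D + \<kappa> * sqrt (3 * real k)) / real k"
        by (simp add: real_sqrt_mult add_divide_distrib)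
      then show "real (Suc n) * 2 ^ Suc n * (2 * (D * (1 / real k) + \<kappa> * sqrt 3 * sqrt (1 / real k))) * (1 / real k) ^ n
       = real (Suc n) * 2 ^ Suc n * (2 * (D + \<kappa> * sqrt (3 * real k))) / real k ^ Suc n"
        by (simp only: power_Suc power_divide power_one) simp
    qed
    ultimately show ?thesis by (simp add: tendsto_cong)
  qed
  then have "(\<lambda>k. l n + (\<Sum>w\<in>ZR (real k). 1 / w ^ Suc n)) \<longlonglongrightarrow> 0"
  proof (rule Lim_null_comparison[rotated])
    show "\<forall>\<^sub>F k in sequentially. norm (l n + (\<Sum>w\<in>ZR (real k). 1 / w ^ Suc n)) \<le> real (Suc n) * 2 ^ Suc n * (2 * (D + \<kappa> * sqrt (3 * real k))) / real k ^ Suc n"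
      by (rule eventually_sequentiallyI[of 1]) (use partial_sum_bound in \<open>simp add: D_def\<close>)
  qed
  then have "(\<lambda>k. (l n + (\<Sum>w\<in>ZR (real k). 1 / w ^ Suc n)) - l n) \<longlonglongrightarrow> 0 - l n" by (intro tendsto_diff tendsto_const)
  then have "(\<lambda>k. (\<Sum>w\<in>ZR (real k). 1 / w ^ Suc n)) \<longlonglongrightarrow> - l n" by simp
  with lim1 have "infsum (\<lambda>w. 1 / w ^ Suc n) Z = - l n" by (rule LIMSEQ_unique)
  with s show ?thesis by simp
qed

end

section \<open>Power sums of the zeros from Taylor coefficients\<close>

text \<open>A zero at the origin is simple and is divided out, F = z^m H, which shifts the
  coefficients by \<open>m\<close>. Comparing coefficients in H' = (H'/H) H gives Newton's
  recursion, and n B(n) is the coefficient of H'/H of index n - 1. The term m/z of F'/F does not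
  reach the residues with n >= 1.\<close>

lemma entire_power_sums:
  fixes F :: "complex \<Rightarrow> complex" and A :: "nat \<Rightarrow> complex"
  assumes sums: "\<And>z. (\<lambda>k. A k * z ^ k) sums F z"
    and growth: "\<And>z. cmod z \<ge> 1 \<Longrightarrow> cmod (F z) \<le> c * exp (\<kappa> * sqrt (cmod z))" and \<kappa>: "\<kappa> \<ge> 0"
    and simple: "\<And>z. F z = 0 \<Longrightarrow> deriv F z \<noteq> 0"
    and m: "m = (if F 0 = 0 then 1 else 0)"
  shows "F holomorphic_on UNIV" and "A m \<noteq> 0"
    and "(\<lambda>w. 1 / cmod w) summable_on ({z. F z = 0} - {0})"
    and "\<And>n. n \<ge> 1 \<Longrightarrow> ((\<lambda>w. 1 / w ^ n) has_sum (- residue (\<lambda>z. z powi (- int n) * (deriv F z / F z)) 0)) ({z. F z = 0} - {0})"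
    and "\<And>B n. B 1 = A (1 + m) / A m \<Longrightarrow>
      (\<And>j. j \<ge> 2 \<Longrightarrow> B j = A (j + m) / A m - (\<Sum>l = 1..j - 1. of_nat l / of_nat j * (A (j - l + m) / A m) * B l)) \<Longrightarrow>
      n \<ge> 1 \<Longrightarrow> residue (\<lambda>z. z powi (- int n) * (deriv F z / F z)) 0 = of_nat n * B n"
proof -
  have "F holomorphic_on ball 0 r" for r
    using sums by (intro power_series_holomorphic[of 0 r A]) simp
  then have "F field_differentiable at z" for z
    by (rule holomorphic_on_imp_differentiable_at[of F "ball 0 (cmod z + 1)"]) auto
  then show Fh: "F holomorphic_on UNIV" by (simp add: holomorphic_on_def)
  have Ffps: "F has_fps_expansion Abs_fps A"
    by (rule has_fps_expansion_sums[of 1]) (use sums in auto)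
  have A1: "A 1 = deriv F 0" using fps_nth_fps_expansion[OF Ffps, of 1] by simp
  obtain H where H: "H holomorphic_on UNIV" "\<And>z. F z = z ^ m * H z"
  proof (cases "F 0 = 0")
    case True
    then show ?thesis using entire_factor_zero[OF Fh True] m that by auto
  next
    case False
    then show ?thesis using that[of F] Fh m by simp
  qed
  define fH where "fH = fps_expansion H 0"
  have Hfps: "H has_fps_expansion fH" unfolding fH_def using H(1) by (intro has_fps_expansion_fps_expansion[of UNIV]) auto
  have "(\<lambda>z. z ^ m * H z) has_fps_expansion fps_X ^ m * fH"
    by (intro has_fps_expansion_mult has_fps_expansion_fps_X_power Hfps)
  then have "F has_fps_expansion fps_X ^ m * fH" using H(2) by presburger
  \<comment> \<open>Uniqueness of the power series of F identifies the coefficients of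
    \<open>H\<close> as those of \<open>F\<close> shifted by \<open>m\<close>.\<close>
  from fps_expansion_unique_complex[OF Ffps this] have fA: "fps_nth fH k = A (k + m)" for k
    by (metis fps_nth_Abs_fps fps_X_power_mult_nth add_diff_cancel_right' not_add_less2)
  have H0A: "H 0 = A m" using fps_nth_fps_expansion[OF Hfps, of 0] fA[of 0] by simp
  have Hz: "deriv F z = z ^ m * deriv H z + of_nat m * z ^ (m - 1) * H z" for z
  proof -
    have "(H has_field_derivative deriv H z) (at z)" using H(1) by (auto intro!: holomorphic_derivI[of _ UNIV])
    then have "((\<lambda>z. z ^ m * H z) has_field_derivative (z ^ m * deriv H z + of_nat m * z ^ (m - 1) * H z)) (at z)"
      by (auto intro!: derivative_eq_intros)
    moreover have "F = (\<lambda>z. z ^ m * H z)" using H(2) by auto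
    ultimately show ?thesis using DERIV_imp_deriv by metis
  qed
  have H0: "H 0 \<noteq> 0"
  proof (cases "F 0 = 0")
    case True
    then show ?thesis using simple[OF True] Hz[of 0] m by simp
  next
    case False
    then have "m = 0" using m by simp
    then have "F 0 = H 0" using H(2)[of 0] by simp
    then show ?thesis using False by simp
  qed
  then show Am: "A m \<noteq> 0" by (simp add: H0A)
  have zeros: "{z. F z = 0} - {0} = {z. H z = 0}"
    using H0 by (auto simp: H(2))
  have Hs: "deriv H z \<noteq> 0" if "H z = 0" for z
  proof
    assume d: "deriv H z = 0"
    have "F z = 0" using that by (simp add: H(2))
    moreover have "deriv F z = 0" using that d by (simp add: Hz)
    ultimately show False using simple by blast
  qed
  obtain M where M: "M > 0" "\<And>z. z \<in> cball 0 1 \<Longrightarrow> cmod (H z) \<le> M"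
  proof -
    have "compact (H ` cball 0 1)"
      by (intro compact_continuous_image holomorphic_on_imp_continuous_on holomorphic_on_subset[OF H(1)]) auto
    then have "bounded (H ` cball 0 1)" by (rule compact_imp_bounded)
    then obtain M where "M > 0" "\<forall>x\<in>H ` cball 0 1. cmod x \<le> M" unfolding bounded_pos by blast
    then show ?thesis using that[of M] by blast
  qed
  have c0: "c \<ge> 0" using growth[of 1] by (smt (verit) exp_gt_zero mult_neg_pos norm_ge_zero norm_one)
  \<comment> \<open>Outside the unit disc the growth of F passes to H, since dividing by z^m does
    not enlarge it; inside, H is bounded by compactness.\<close>
  have Hg: "cmod (H z) \<le> (M + c) * exp (\<kappa> * sqrt (cmod z))" for z
  proof (cases "cmod z \<ge> 1")
    case True
    have "1 \<le> cmod z ^ m" using True by simp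
    then have "1 * cmod (H z) \<le> cmod z ^ m * cmod (H z)" by (intro mult_right_mono) auto
    also have "\<dots> = cmod (F z)" by (simp add: H(2) norm_mult norm_power)
    also have "\<dots> \<le> c * exp (\<kappa> * sqrt (cmod z))" by (rule growth[OF True])
    also have "\<dots> \<le> (M + c) * exp (\<kappa> * sqrt (cmod z))" using M by (intro mult_right_mono) auto
    finally show ?thesis by simp
  next
    case False
    then have "cmod (H z) \<le> M" using M by simp
    also have "\<dots> \<le> (M + c) * 1" using c0 by simp
    also have "\<dots> \<le> (M + c) * exp (\<kappa> * sqrt (cmod z))" using c0 M \<kappa> by (intro mult_left_mono) auto
    finally show ?thesis .
  qed
  interpret entire_simple H "M + c" \<kappa>
    by unfold_locales (use H(1) H0 Hs Hg \<kappa> in auto)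
  show "(\<lambda>w. 1 / cmod w) summable_on ({z. F z = 0} - {0})"
    unfolding zeros using summable_inverse_zeros by (simp add: Z_def)
  have res: "residue (\<lambda>z. z powi (- int n) * (deriv F z / F z)) 0 = l (n - 1)" if "n \<ge> 1" for n
  proof -
    obtain \<rho> where \<rho>: "\<rho> > 0" "\<And>z. z \<in> Z \<Longrightarrow> \<rho> \<le> cmod z" using zero_free_radius by blast
    have fps: "(\<lambda>z. of_nat m + z * (deriv H z / H z)) has_fps_expansion fps_const (of_nat m) + fps_X * Abs_fps l"
      by (intro has_fps_expansion_add has_fps_expansion_mult has_fps_expansion_const has_fps_expansion_fps_X logderiv_fps)
    \<comment> \<open>Multiplying F'/F by z clears its pole, so the residue becomes the n-th Taylor
      coefficient of m + z H'/H.\<close>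
    have "residue (\<lambda>z. z powi (- int n) * (deriv F z / F z)) 0 = residue (\<lambda>z. (of_nat m + z * (deriv H z / H z)) / z ^ Suc n) 0"
    proof (rule residue_cong)
      have "\<forall>\<^sub>F z in at 0. z \<in> ball (0::complex) \<rho> - {0}" using \<rho> by (intro eventually_at_in_open) auto
      then show "\<forall>\<^sub>F z in at 0. z powi (- int n) * (deriv F z / F z) = (of_nat m + z * (deriv H z / H z)) / z ^ Suc n"
      proof eventually_elim
        case (elim z)
        then have z: "z \<noteq> 0" "H z \<noteq> 0" using \<rho>(2)[of z] by (auto simp: Z_def)
        have e: "z * (of_nat m * z ^ (m - 1)) = of_nat m * z ^ m" by (cases m) auto
        have "z * (deriv F z / F z) = (z * (z ^ m * deriv H z) + (z * (of_nat m * z ^ (m - 1))) * H z) / (z ^ m * H z)"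
          unfolding Hz H(2) by (simp add: algebra_simps)
        also have "\<dots> = of_nat m + z * (deriv H z / H z)" unfolding e using z by (simp add: field_simps)
        finally have "of_nat m + z * (deriv H z / H z) = z * (deriv F z / F z)" ..
        then have "(of_nat m + z * (deriv H z / H z)) / z ^ Suc n = (deriv F z / F z) / z ^ n" using z by (simp add: field_simps)
        also have "\<dots> = z powi (- int n) * (deriv F z / F z)" using z by (simp add: power_int_minus divide_inverse mult.commute)
        finally show ?case ..
      qed
    qed simp
    also have "\<dots> = fps_nth (fps_const (of_nat m) + fps_X * Abs_fps l) n"
      by (rule residue_fps_expansion_over_power_at_0[OF fps])
    also have "\<dots> = l (n - 1)" using that by simp
    finally show ?thesis .
  qed
  show "((\<lambda>w. 1 / w ^ n) has_sum (- residue (\<lambda>z. z powi (- int n) * (deriv F z / F z)) 0)) ({z. F z = 0} - {0})" if "n \<ge> 1" for n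
    using has_sum_inverse_zeros[of "n - 1"] that unfolding zeros res[OF that] by (simp add: Z_def)
  have "deriv H has_fps_expansion Abs_fps l * fH"
  proof -
    obtain \<rho> where \<rho>: "\<rho> > 0" "\<And>z. z \<in> Z \<Longrightarrow> \<rho> \<le> cmod z" using zero_free_radius by blast
    have "(\<lambda>z. deriv H z / H z * H z) has_fps_expansion Abs_fps l * fH"
      by (intro has_fps_expansion_mult logderiv_fps Hfps)
    moreover have "\<forall>\<^sub>F z in nhds 0. z \<in> ball (0::complex) \<rho>" using \<rho> by (intro eventually_nhds_in_open) auto
    then have "\<forall>\<^sub>F z in nhds 0. deriv H z / H z * H z = deriv H z"
      by eventually_elim (use \<rho>(2) in \<open>force simp: Z_def\<close>)
    ultimately show ?thesis unfolding has_fps_expansion_def by (auto elim: eventually_elim2)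
  qed
  from fps_expansion_unique_complex[OF has_fps_expansion_deriv[OF Hfps] this]
  have rec: "of_nat (Suc k) * A (Suc k + m) = (\<Sum>i=0..k. l i * A (k - i + m))" for k
    by (metis (no_types, lifting) fps_deriv_nth fps_mult_nth fps_nth_Abs_fps fA sum.cong Suc_eq_plus1)
  show "residue (\<lambda>z. z powi (- int n) * (deriv F z / F z)) 0 = of_nat n * B n"
    if B1: "B 1 = A (1 + m) / A m"
      and B: "\<And>j. j \<ge> 2 \<Longrightarrow> B j = A (j + m) / A m - (\<Sum>l = 1..j - 1. of_nat l / of_nat j * (A (j - l + m) / A m) * B l)"
      and n: "n \<ge> 1" for B n
    unfolding res[OF n] using n
  proof (induction n rule: less_induct)
    case (less n)
    show ?case
    proof (cases "n = 1")
      case True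
      then show ?thesis using rec[of 0] Am B1 by (simp add: field_simps)
    next
      case False
      with less.prems have n2: "n \<ge> 2" by simp
      have "of_nat n * A (n + m) = (\<Sum>i=0..n - 1. l i * A (n - 1 - i + m))"
        using rec[of "n - 1"] n2 by simp
      also have "\<dots> = (\<Sum>i=1..n. l (i - 1) * A (n - i + m))"
        by (rule sum.reindex_bij_witness[of _ "\<lambda>i. i - 1" Suc]) (use n2 in auto)
      \<comment> \<open>The last summand contains the unknown \<open>l (n - 1)\<close>; the
        induction hypothesis covers the others.\<close>
      also have "\<dots> = l (n - 1) * A m + (\<Sum>i=1..n - 1. l (i - 1) * A (n - i + m))"
      proof -
        have "{1..n} = insert n {1..n - 1}" using n2 by auto
        then show ?thesis using n2 by simp
      qed
      also have "(\<Sum>i=1..n - 1. l (i - 1) * A (n - i + m)) = (\<Sum>i=1..n - 1. of_nat i * B i * A (n - i + m))"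
        by (intro sum.cong refl) (use less.IH in auto)
      finally have 1: "l (n - 1) * A m = of_nat n * A (n + m) - (\<Sum>i=1..n - 1. of_nat i * B i * A (n - i + m))"
        by (simp add: algebra_simps)
      have "of_nat n * B n * A m = of_nat n * A (n + m) - (\<Sum>i=1..n - 1. of_nat n * A m * (of_nat i / of_nat n * (A (n - i + m) / A m) * B i))"
        unfolding B[OF n2] using Am n2 by (simp add: algebra_simps sum_distrib_left)
      also have "(\<Sum>i=1..n - 1. of_nat n * A m * (of_nat i / of_nat n * (A (n - i + m) / A m) * B i)) = (\<Sum>i=1..n - 1. of_nat i * B i * A (n - i + m))"
        using Am n2 by (intro sum.cong refl) simp
      finally have "l (n - 1) * A m = (of_nat n * B n) * A m" by (simp only: 1)
      then show ?thesis using Am by simp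
    qed
  qed
qed

section \<open>Orthonormal bases and diagonal operators\<close>

lemma L2D: "f \<in> L2 M \<Longrightarrow> f \<in> borel_measurable M" "f \<in> L2 M \<Longrightarrow> integrable M (\<lambda>x. (cmod (f x))\<^sup>2)"
  by (auto simp: L2_def)

lemma L2I_bound:
  assumes "f \<in> borel_measurable M" "integrable M g" "\<And>x. (cmod (f x))\<^sup>2 \<le> g x"
  shows "f \<in> L2 M"
  unfolding L2_def
proof (intro CollectI conjI Bochner_Integration.integrable_bound[OF assms(2)])
  show "AE x in M. norm ((cmod (f x))\<^sup>2) \<le> norm (g x)" using assms(3) by (force intro!: AE_I2 order.trans[OF _ abs_ge_self])
qed (use assms(1) in auto)

lemma L2_lincomb:
  assumes f: "f \<in> L2 M" and g: "g \<in> L2 M"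
  shows "(\<lambda>x. c * f x + g x) \<in> L2 M"
proof (rule L2I_bound)
  show "integrable M (\<lambda>x. 2 * (cmod c)\<^sup>2 * (cmod (f x))\<^sup>2 + 2 * (cmod (g x))\<^sup>2)"
    using L2D(2)[OF f] L2D(2)[OF g] by auto
  show "(cmod (c * f x + g x))\<^sup>2 \<le> 2 * (cmod c)\<^sup>2 * (cmod (f x))\<^sup>2 + 2 * (cmod (g x))\<^sup>2" for x
  proof -
    have "cmod (c * f x + g x) \<le> cmod c * cmod (f x) + cmod (g x)" by (metis norm_mult norm_triangle_ineq)
    then have "(cmod (c * f x + g x))\<^sup>2 \<le> (cmod c * cmod (f x) + cmod (g x))\<^sup>2" by (intro power_mono) auto
    also have "\<dots> \<le> 2 * (cmod c * cmod (f x))\<^sup>2 + 2 * (cmod (g x))\<^sup>2"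
      using sum_squares_bound[of "cmod c * cmod (f x)" "cmod (g x)"] by (simp add: power2_sum)
    finally show ?thesis by (simp add: power_mult_distrib)
  qed
qed (use L2D(1)[OF f] L2D(1)[OF g] in auto)

lemma L2_zero: "(\<lambda>_. 0) \<in> L2 M" by (simp add: L2_def)

lemma L2_cmult: "f \<in> L2 M \<Longrightarrow> (\<lambda>x. c * f x) \<in> L2 M"
  using L2_lincomb[OF _ L2_zero, of f M c] by simp

lemma L2_diff: "f \<in> L2 M \<Longrightarrow> g \<in> L2 M \<Longrightarrow> (\<lambda>x. f x - g x) \<in> L2 M"
  using L2_lincomb[of g M f "-1"] by simp

lemma L2_sum: "finite S \<Longrightarrow> (\<And>i. i \<in> S \<Longrightarrow> g i \<in> L2 M) \<Longrightarrow> (\<lambda>x. \<Sum>i\<in>S. c i * g i x) \<in> L2 M"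
  by (induction S rule: finite_induct) (auto simp: L2_zero intro: L2_lincomb)

lemma L2_mult_integrable:
  assumes f: "f \<in> L2 M" and g: "g \<in> L2 M"
  shows "integrable M (\<lambda>x. cnj (f x) * g x)"
proof (rule Bochner_Integration.integrable_bound)
  show "integrable M (\<lambda>x. (cmod (f x))\<^sup>2 + (cmod (g x))\<^sup>2)" using L2D(2)[OF f] L2D(2)[OF g] by auto
  have "cmod (cnj (f x) * g x) \<le> (cmod (f x))\<^sup>2 + (cmod (g x))\<^sup>2" for x
  proof -
    have "2 * (cmod (f x) * cmod (g x)) \<le> (cmod (f x))\<^sup>2 + (cmod (g x))\<^sup>2"
      using sum_squares_bound[of "cmod (f x)" "cmod (g x)"] by (simp only: mult.assoc)
    moreover have "0 \<le> cmod (f x) * cmod (g x)" by simp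
    ultimately show ?thesis unfolding norm_mult complex_mod_cnj by linarith
  qed
  then show "AE x in M. norm (cnj (f x) * g x) \<le> norm ((cmod (f x))\<^sup>2 + (cmod (g x))\<^sup>2)"
    by (intro AE_I2) (simp add: order.trans[OF _ abs_ge_self])
  show "(\<lambda>x. cnj (f x) * g x) \<in> borel_measurable M" using L2D(1)[OF f] L2D(1)[OF g]
    by (intro borel_measurable_times borel_measurable_continuous_on[of cnj, unfolded o_def] continuous_intros) auto
qed

lemma L2_inner_lincomb:
  assumes "f \<in> L2 M" "g \<in> L2 M" "h \<in> L2 M"
  shows "L2_inner M h (\<lambda>x. c * f x + g x) = c * L2_inner M h f + L2_inner M h g"
proof -
  have "L2_inner M h (\<lambda>x. c * f x + g x) = (LINT x|M. c * (cnj (h x) * f x) + cnj (h x) * g x)"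
    unfolding L2_inner_def by (simp add: algebra_simps)
  also have "\<dots> = c * L2_inner M h f + L2_inner M h g"
    unfolding L2_inner_def using assms L2_mult_integrable by (subst Bochner_Integration.integral_add) auto
  finally show ?thesis .
qed

lemma L2_inner_cnj: "L2_inner M g f = cnj (L2_inner M f g)"
proof -
  have "cnj (L2_inner M f g) = (LINT x|M. cnj (cnj (f x) * g x))"
    unfolding L2_inner_def by (rule Bochner_Integration.integral_cnj[symmetric])
  then show ?thesis unfolding L2_inner_def by (simp add: mult.commute)
qed

lemma L2_inner_zero: "L2_inner M h (\<lambda>_. 0) = 0" by (simp add: L2_inner_def)

lemma L2_inner_cmult: "L2_inner M h (\<lambda>x. c * f x) = c * L2_inner M h f"
  unfolding L2_inner_def by (simp add: mult.left_commute)

lemma L2_inner_cmult_left: "L2_inner M (\<lambda>x. c * f x) h = cnj c * L2_inner M f h"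
  unfolding L2_inner_def by (simp add: mult.assoc)

lemma L2_inner_diff:
  assumes "f \<in> L2 M" "g \<in> L2 M" "h \<in> L2 M"
  shows "L2_inner M h (\<lambda>x. f x - g x) = L2_inner M h f - L2_inner M h g"
  using L2_inner_lincomb[OF assms(2,1,3), of "-1"] by simp

lemma L2_inner_sum:
  assumes "finite S" "\<And>i. i \<in> S \<Longrightarrow> g i \<in> L2 M" "h \<in> L2 M"
  shows "L2_inner M h (\<lambda>x. \<Sum>i\<in>S. c i * g i x) = (\<Sum>i\<in>S. c i * L2_inner M h (g i))"
  using assms
proof (induction S rule: finite_induct)
  case (insert i S)
  then show ?case using L2_inner_lincomb[of "g i" M "\<lambda>x. \<Sum>i\<in>S. c i * g i x" h "c i"] L2_sum[of S g M c] by simp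
qed (simp add: L2_inner_zero)

lemma L2_norm_sq: "(L2_norm M f)\<^sup>2 = (LINT x|M. (cmod (f x))\<^sup>2)"
  unfolding L2_norm_def by (simp add: integral_nonneg_AE)

lemma L2_norm_nonneg: "0 \<le> L2_norm M f"
  unfolding L2_norm_def by (simp add: integral_nonneg_AE)

lemma L2_inner_self: "L2_inner M f f = of_real ((L2_norm M f)\<^sup>2)"
proof -
  have "L2_inner M f f = (LINT x|M. of_real ((cmod (f x))\<^sup>2))"
    unfolding L2_inner_def complex_norm_square by (simp add: mult.commute)
  also have "\<dots> = of_real (LINT x|M. (cmod (f x))\<^sup>2)" by (rule integral_complex_of_real)
  finally show ?thesis unfolding L2_norm_sq .
qed

lemma L2_cong_AE:
  assumes "AE x in M. f x = g x"
  shows "f \<in> borel_measurable M \<Longrightarrow> g \<in> borel_measurable M \<Longrightarrow> L2_norm M f = L2_norm M g"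
    and "f \<in> borel_measurable M \<Longrightarrow> g \<in> borel_measurable M \<Longrightarrow> h \<in> borel_measurable M \<Longrightarrow> L2_inner M h f = L2_inner M h g"
proof -
  assume [measurable]: "f \<in> borel_measurable M" "g \<in> borel_measurable M"
  show "L2_norm M f = L2_norm M g" unfolding L2_norm_def
    by (intro arg_cong[where f=sqrt] integral_cong_AE) (use assms in \<open>auto elim: eventually_mono\<close>)
next
  assume [measurable]: "f \<in> borel_measurable M" "g \<in> borel_measurable M" "h \<in> borel_measurable M"
  have [measurable]: "(\<lambda>x. cnj (h x)) \<in> borel_measurable M"
    by (intro borel_measurable_continuous_on[of cnj, unfolded o_def] continuous_intros) auto
  show "L2_inner M h f = L2_inner M h g" unfolding L2_inner_def
    by (intro integral_cong_AE) (use assms in \<open>auto elim: eventually_mono\<close>)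
qed

text \<open>Integrates 2xy <= t x^2 + y^2/t and takes t = b/a for the norms a and b; a vanishing
  norm is treated apart. With absolute values inside, it also bounds L1 norms over a finite
  measure.\<close>

lemma L2_Cauchy_Schwarz_abs:
  assumes f: "f \<in> L2 M" and g: "g \<in> L2 M"
  shows "(LINT x|M. cmod (f x) * cmod (g x)) \<le> L2_norm M f * L2_norm M g"
proof -
  define a b where "a = L2_norm M f" and "b = L2_norm M g"
  have ab: "a \<ge> 0" "b \<ge> 0" "a\<^sup>2 = (LINT x|M. (cmod (f x))\<^sup>2)" "b\<^sup>2 = (LINT x|M. (cmod (g x))\<^sup>2)"
    by (simp_all add: a_def b_def L2_norm_nonneg L2_norm_sq)
  have int: "integrable M (\<lambda>x. cmod (f x) * cmod (g x))"
    using integrable_norm[OF L2_mult_integrable[OF f g]] by (simp add: norm_mult)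
  have *: "(LINT x|M. cmod (f x) * cmod (g x)) \<le> (t * a\<^sup>2 + b\<^sup>2 / t) / 2" if t: "t > 0" for t
  proof -
    have "(LINT x|M. cmod (f x) * cmod (g x)) \<le> (LINT x|M. t / 2 * (cmod (f x))\<^sup>2 + 1 / (2 * t) * (cmod (g x))\<^sup>2)"
    proof (rule integral_mono[OF int])
      show "integrable M (\<lambda>x. t / 2 * (cmod (f x))\<^sup>2 + 1 / (2 * t) * (cmod (g x))\<^sup>2)"
        using L2D(2)[OF f] L2D(2)[OF g] by auto
      fix x
      have "0 \<le> (t * cmod (f x) - cmod (g x))\<^sup>2 / (2 * t)" using t by simp
      also have "\<dots> = t / 2 * (cmod (f x))\<^sup>2 + 1 / (2 * t) * (cmod (g x))\<^sup>2 - cmod (f x) * cmod (g x)"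
        using t by (simp add: power2_eq_square field_simps)
      finally show "cmod (f x) * cmod (g x) \<le> t / 2 * (cmod (f x))\<^sup>2 + 1 / (2 * t) * (cmod (g x))\<^sup>2" by simp
    qed
    also have "\<dots> = t / 2 * a\<^sup>2 + 1 / (2 * t) * b\<^sup>2"
      unfolding ab using L2D(2)[OF f] L2D(2)[OF g] by (subst Bochner_Integration.integral_add) auto
    finally show ?thesis using t by (simp add: field_simps)
  qed
  have "(LINT x|M. cmod (f x) * cmod (g x)) \<le> a * b"
  proof (cases "a = 0 \<or> b = 0")
    case True
    have "AE x in M. cmod (f x) * cmod (g x) = 0"
    proof (cases "a = 0")
      case True
      then have "AE x in M. (cmod (f x))\<^sup>2 = 0"
        using integral_nonneg_eq_0_iff_AE[OF L2D(2)[OF f]] ab(3) by simp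
      then show ?thesis by eventually_elim simp
    next
      case False
      then have "AE x in M. (cmod (g x))\<^sup>2 = 0"
        using integral_nonneg_eq_0_iff_AE[OF L2D(2)[OF g]] ab(4) True by simp
      then show ?thesis by eventually_elim simp
    qed
    then have "(LINT x|M. cmod (f x) * cmod (g x)) = 0" by (rule integral_eq_zero_AE)
    then show ?thesis using ab by simp
  next
    case False
    then have p: "a > 0" "b > 0" using ab by auto
    have "(b / a * a\<^sup>2 + b\<^sup>2 / (b / a)) / 2 = a * b" using p by (simp add: power2_eq_square field_simps)
    then show ?thesis using *[of "b / a"] p by simp
  qed
  then show ?thesis by (simp add: a_def b_def)
qed

lemma L2_Cauchy_Schwarz:
  assumes f: "f \<in> L2 M" and g: "g \<in> L2 M"
  shows "cmod (L2_inner M f g) \<le> L2_norm M f * L2_norm M g"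
proof -
  have "cmod (L2_inner M f g) \<le> (LINT x|M. cmod (cnj (f x) * g x))"
    unfolding L2_inner_def by (rule integral_norm_bound)
  also have "\<dots> \<le> L2_norm M f * L2_norm M g"
    using L2_Cauchy_Schwarz_abs[OF f g] by (simp add: norm_mult)
  finally show ?thesis .
qed

section \<open>Orthonormal systems: Bessel, Riesz-Fischer, Parseval\<close>

definition orthonormal :: "'a measure \<Rightarrow> ('a \<Rightarrow> complex) set \<Rightarrow> bool" where
  "orthonormal M E \<longleftrightarrow> E \<subseteq> L2 M \<and> (\<forall>e\<in>E. \<forall>e'\<in>E. L2_inner M e e' = (if e = e' then 1 else 0))"

lemma orthonormal_norm_sum:
  assumes E: "orthonormal M E" and S: "finite S" "S \<subseteq> E"
  shows "(L2_norm M (\<lambda>x. \<Sum>e\<in>S. c e * e x))\<^sup>2 = (\<Sum>e\<in>S. (cmod (c e))\<^sup>2)"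
proof -
  let ?s = "\<lambda>x. \<Sum>e\<in>S. c e * e x"
  have sL: "e \<in> L2 M" if "e \<in> S" for e using E S that by (auto simp: orthonormal_def)
  have s: "?s \<in> L2 M" using S sL by (intro L2_sum) auto
  have e: "L2_inner M e ?s = c e" if "e \<in> S" for e
  proof -
    have "L2_inner M e ?s = (\<Sum>e'\<in>S. c e' * L2_inner M e e')" by (rule L2_inner_sum[OF S(1) sL sL[OF that]])
    also have "\<dots> = (\<Sum>e'\<in>S. if e = e' then c e' else 0)"
    proof (intro sum.cong refl)
      fix e' assume "e' \<in> S"
      then have "L2_inner M e e' = (if e = e' then 1 else 0)" using E S that unfolding orthonormal_def by blast
      then show "c e' * L2_inner M e e' = (if e = e' then c e' else 0)" by simp
    qed
    finally show ?thesis using S that by simp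
  qed
  have "L2_inner M ?s ?s = (\<Sum>e\<in>S. c e * L2_inner M ?s e)" by (rule L2_inner_sum[OF S(1) sL s])
  also have "\<dots> = (\<Sum>e\<in>S. of_real ((cmod (c e))\<^sup>2))"
  proof (intro sum.cong refl)
    fix e' assume "e' \<in> S"
    then have "L2_inner M ?s e' = cnj (c e')" using e L2_inner_cnj[of M ?s e'] by simp
    then show "c e' * L2_inner M ?s e' = of_real ((cmod (c e'))\<^sup>2)" by (simp only: complex_norm_square)
  qed
  finally have "complex_of_real ((L2_norm M ?s)\<^sup>2) = of_real (\<Sum>e\<in>S. (cmod (c e))\<^sup>2)"
    by (simp add: L2_inner_self)
  then show ?thesis by (simp only: of_real_eq_iff)
qed

lemma orthonormal_inner_sum:
  assumes E: "orthonormal M E" and S: "finite S" "S \<subseteq> E" and e: "e \<in> E"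
  shows "L2_inner M e (\<lambda>x. \<Sum>e\<in>S. c e * e x) = (if e \<in> S then c e else 0)"
proof -
  have "L2_inner M e (\<lambda>x. \<Sum>e\<in>S. c e * e x) = (\<Sum>e'\<in>S. c e' * L2_inner M e e')"
    using E S e by (intro L2_inner_sum) (auto simp: orthonormal_def)
  also have "\<dots> = (\<Sum>e'\<in>S. if e = e' then c e' else 0)"
  proof (intro sum.cong refl)
    fix e' assume "e' \<in> S"
    then have "L2_inner M e e' = (if e = e' then 1 else 0)" using E S e unfolding orthonormal_def by blast
    then show "c e' * L2_inner M e e' = (if e = e' then c e' else 0)" by simp
  qed
  finally show ?thesis using S by simp
qed

text \<open>Pythagoras for the projection onto the span of \<open>S\<close>. Its nonnegativity is
  Bessel's inequality, and it measures the error in \<open>Parseval_inner\<close>.\<close>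

lemma orthonormal_residual:
  assumes E: "orthonormal M E" and S: "finite S" "S \<subseteq> E" and f: "f \<in> L2 M"
  shows "(L2_norm M (\<lambda>x. f x - (\<Sum>e\<in>S. L2_inner M e f * e x)))\<^sup>2 = (L2_norm M f)\<^sup>2 - (\<Sum>e\<in>S. (cmod (L2_inner M e f))\<^sup>2)"
proof -
  let ?s = "\<lambda>x. \<Sum>e\<in>S. L2_inner M e f * e x"
  have sL: "e \<in> L2 M" if "e \<in> S" for e using E S that by (auto simp: orthonormal_def)
  have s: "?s \<in> L2 M" using S sL by (intro L2_sum) auto
  have d: "(\<lambda>x. f x - ?s x) \<in> L2 M" by (rule L2_diff[OF f s])
  have fs: "L2_inner M f ?s = of_real (\<Sum>e\<in>S. (cmod (L2_inner M e f))\<^sup>2)"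
  proof -
    have "L2_inner M f ?s = (\<Sum>e\<in>S. L2_inner M e f * L2_inner M f e)" by (rule L2_inner_sum[OF S(1) sL f])
    also have "\<dots> = (\<Sum>e\<in>S. of_real ((cmod (L2_inner M e f))\<^sup>2))"
      by (intro sum.cong refl) (simp only: L2_inner_cnj[of M f] complex_norm_square complex_cnj_cnj)
    finally show ?thesis by simp
  qed
  have "L2_inner M (\<lambda>x. f x - ?s x) (\<lambda>x. f x - ?s x) = L2_inner M (\<lambda>x. f x - ?s x) f - L2_inner M (\<lambda>x. f x - ?s x) ?s"
    by (rule L2_inner_diff[OF f s d])
  also have "L2_inner M (\<lambda>x. f x - ?s x) f = cnj (L2_inner M f f - L2_inner M f ?s)"
    by (subst L2_inner_cnj) (simp only: L2_inner_diff[OF f s f])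
  also have "L2_inner M (\<lambda>x. f x - ?s x) ?s = cnj (L2_inner M ?s f - L2_inner M ?s ?s)"
    by (subst L2_inner_cnj) (simp only: L2_inner_diff[OF f s s])
  also have "L2_inner M ?s f = cnj (L2_inner M f ?s)" by (rule L2_inner_cnj)
  finally have "complex_of_real ((L2_norm M (\<lambda>x. f x - ?s x))\<^sup>2) = of_real ((L2_norm M f)\<^sup>2 - (\<Sum>e\<in>S. (cmod (L2_inner M e f))\<^sup>2))"
    unfolding L2_inner_self fs orthonormal_norm_sum[OF E S] by simp
  then show ?thesis by (simp only: of_real_eq_iff)
qed

lemma Bessel_finite:
  assumes E: "orthonormal M E" and S: "finite S" "S \<subseteq> E" and f: "f \<in> L2 M"
  shows "(\<Sum>e\<in>S. (cmod (L2_inner M e f))\<^sup>2) \<le> (L2_norm M f)\<^sup>2"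
  using orthonormal_residual[OF assms] zero_le_power2[of "L2_norm M (\<lambda>x. f x - (\<Sum>e\<in>S. L2_inner M e f * e x))"] by linarith

lemma Bessel:
  assumes E: "orthonormal M E" and f: "f \<in> L2 M"
  shows "(\<lambda>e. (cmod (L2_inner M e f))\<^sup>2) summable_on E"
    and "infsum (\<lambda>e. (cmod (L2_inner M e f))\<^sup>2) E \<le> (L2_norm M f)\<^sup>2"
proof -
  show s: "(\<lambda>e. (cmod (L2_inner M e f))\<^sup>2) summable_on E"
  proof (rule nonneg_bounded_partial_sums_imp_summable_on)
    show "\<forall>\<^sub>F S in finite_subsets_at_top E. (\<Sum>e\<in>S. (cmod (L2_inner M e f))\<^sup>2) \<le> (L2_norm M f)\<^sup>2"
      unfolding eventually_finite_subsets_at_top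
      by (intro exI[of _ "{}"]) (use Bessel_finite[OF E _ _ f] in auto)
  qed simp
  show "infsum (\<lambda>e. (cmod (L2_inner M e f))\<^sup>2) E \<le> (L2_norm M f)\<^sup>2"
    by (rule infsum_le_finite_sums[OF s]) (use Bessel_finite[OF E _ _ f] in auto)
qed

text \<open>Finite partial sums exhausting the squared coefficients up to 4^(-n) move by at most
  2^(-n) in L2. As the measure is finite, the steps are summable in L1 too, so the sums converge
  almost everywhere; Fatou's lemma shows that the pointwise limit is also the L2 limit.\<close>

lemma Riesz_Fischer:
  assumes "finite_measure M" and E: "orthonormal M E" and c: "(\<lambda>e. (cmod (c e))\<^sup>2) summable_on E"
  shows "\<exists>g\<in>L2 M. (\<forall>e\<in>E. L2_inner M e g = c e) \<and> ((\<lambda>e. (cmod (c e))\<^sup>2) has_sum (L2_norm M g)\<^sup>2) E"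
proof -
  interpret finite_measure M by fact
  have EL: "e \<in> L2 M" if "e \<in> E" for e using E that by (auto simp: orthonormal_def)
  define w where "w e = (cmod (c e))\<^sup>2" for e
  define S where "S = infsum w E"
  have ws: "w summable_on E" unfolding w_def[abs_def] by (rule c)
  have w0: "w e \<ge> 0" for e by (simp add: w_def)
  have fin_le: "sum w F \<le> S" if "finite F" "F \<subseteq> E" for F
    unfolding S_def using that ws w0 by (intro finite_sum_le_infsum) auto
  have "\<exists>F. finite F \<and> F \<subseteq> E \<and> S - (1/4)^n < sum w F" for n :: nat
  proof (rule ccontr)
    assume "\<not> ?thesis"
    then have "S \<le> S - (1/4)^n" unfolding S_def
      by (intro infsum_le_finite_sums[OF ws]) (auto simp: not_less)
    then show False using zero_less_power[of "1/4::real" n] by linarith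
  qed
  then obtain F0 where F0: "\<And>n. finite (F0 n) \<and> F0 n \<subseteq> E \<and> S - (1/4)^n < sum w (F0 n)" by metis
  \<comment> \<open>Unions make the finite sets increasing, so that two partial sums differ by the
    terms of a set difference.\<close>
  define F where "F n = (\<Union>k\<le>n. F0 k)" for n
  have F: "finite (F n)" "F n \<subseteq> E" for n using F0 by (auto simp: F_def)
  have Fmono: "F m \<subseteq> F n" if "m \<le> n" for m n using that by (auto simp: F_def intro: order.trans)
  have Ftail: "S - (1/4)^n < sum w (F n)" for n
  proof -
    have "sum w (F0 n) \<le> sum w (F n)" using F w0 by (intro sum_mono2) (auto simp: F_def)
    then show ?thesis using F0[of n] by linarith
  qed
  define s where "s n = (\<lambda>x. \<Sum>e\<in>F n. c e * e x)" for n
  have sL: "s n \<in> L2 M" for n unfolding s_def using F EL by (intro L2_sum) auto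
  have diff: "(L2_norm M (\<lambda>x. s n x - s m x))\<^sup>2 \<le> (1/4)^m" if "m \<le> n" for m n
  proof -
    have "(\<lambda>x. s n x - s m x) = (\<lambda>x. \<Sum>e\<in>F n - F m. c e * e x)"
      unfolding s_def using F Fmono[OF that] by (auto simp: sum_diff)
    then have "(L2_norm M (\<lambda>x. s n x - s m x))\<^sup>2 = (\<Sum>e\<in>F n - F m. w e)"
      unfolding w_def using orthonormal_norm_sum[OF E, of "F n - F m" c] F(1)[of n] F(2)[of n] by auto
    also have "\<dots> = sum w (F n) - sum w (F m)" using F Fmono[OF that] by (simp add: sum_diff)
    also have "\<dots> \<le> (1/4)^m" using fin_le[OF F(1)[of n] F(2)[of n]] Ftail[of m] by linarith
    finally show ?thesis .
  qed
  have [measurable]: "s n \<in> borel_measurable M" for n using L2D(1)[OF sL] .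
  \<comment> \<open>\<open>lim\<close> is total, so \<open>g\<close> is defined and measurable
    everywhere; convergence is shown next, off a null set.\<close>
  define g where "g x = lim (\<lambda>n. s n x)" for x
  have gm[measurable]: "g \<in> borel_measurable M" unfolding g_def by measurable
  have conv: "AE x in M. (\<lambda>n. s n x) \<longlonglongrightarrow> g x"
  proof -
    have d: "(\<integral>\<^sup>+x. ennreal (cmod (s (Suc n) x - s n x)) \<partial>M) \<le> ennreal (sqrt (measure M (space M)) * (1/2)^n)" for n
    proof -
      have dL: "(\<lambda>x. s (Suc n) x - s n x) \<in> L2 M" by (rule L2_diff[OF sL sL])
      have oneL: "(\<lambda>x. 1) \<in> L2 M" by (simp add: L2_def)
      have i: "integrable M (\<lambda>x. cmod (s (Suc n) x - s n x))"
        using integrable_norm[OF L2_mult_integrable[OF oneL dL]] by simp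
      have "(LINT x|M. cmod (s (Suc n) x - s n x)) \<le> L2_norm M (\<lambda>x. s (Suc n) x - s n x) * L2_norm M (\<lambda>x. 1)"
        using L2_Cauchy_Schwarz_abs[OF dL oneL] by simp
      also have "L2_norm M (\<lambda>x. 1 :: complex) = sqrt (measure M (space M))" by (simp add: L2_norm_def)
      also have "L2_norm M (\<lambda>x. s (Suc n) x - s n x) \<le> (1/2)^n"
      proof (rule power2_le_imp_le)
        show "(L2_norm M (\<lambda>x. s (Suc n) x - s n x))\<^sup>2 \<le> ((1/2)^n)\<^sup>2"
          using diff[of n "Suc n"] by (simp add: power2_eq_square power_mult_distrib[symmetric])
      qed simp
      finally have "(LINT x|M. cmod (s (Suc n) x - s n x)) \<le> sqrt (measure M (space M)) * (1/2)^n"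
        by (simp add: mult.commute mult_right_mono)
      then show ?thesis using i by (subst nn_integral_eq_integral) (auto intro: ennreal_leI)
    qed
    have "(\<integral>\<^sup>+x. (\<Sum>n. ennreal (cmod (s (Suc n) x - s n x))) \<partial>M) = (\<Sum>n. \<integral>\<^sup>+x. ennreal (cmod (s (Suc n) x - s n x)) \<partial>M)"
      by (rule nn_integral_suminf) measurable
    also have "\<dots> \<le> (\<Sum>n. ennreal (sqrt (measure M (space M)) * (1/2)^n))"
      by (intro suminf_le d) auto
    also have "\<dots> < \<infinity>"
      by (subst suminf_ennreal2) (auto intro!: summable_mult simp: summable_geometric)
    finally have fin: "(\<integral>\<^sup>+x. (\<Sum>n. ennreal (cmod (s (Suc n) x - s n x))) \<partial>M) \<noteq> \<infinity>" by simp
    have "AE x in M. (\<Sum>n. ennreal (cmod (s (Suc n) x - s n x))) \<noteq> \<infinity>"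
      by (rule nn_integral_PInf_AE[OF _ fin]) measurable
    then show ?thesis
    proof eventually_elim
      case (elim x)
      then have "(\<Sum>n. ennreal (cmod (s (Suc n) x - s n x))) \<noteq> top" unfolding infinity_ennreal_def .
      then have "summable (\<lambda>n. cmod (s (Suc n) x - s n x))"
        by (rule summable_suminf_not_top[of "\<lambda>n. cmod (s (Suc n) x - s n x)", OF norm_ge_zero])
      then have "summable (\<lambda>n. s (Suc n) x - s n x)" by (rule summable_norm_cancel)
      from summable_LIMSEQ[OF this] obtain L where "(\<lambda>n. s n x - s 0 x) \<longlonglongrightarrow> L"
        unfolding sum_lessThan_telescope[of "\<lambda>n. s n x"] by blast
      from tendsto_add[OF this tendsto_const[of "s 0 x"]] have "convergent (\<lambda>n. s n x)"
        by (auto simp: convergent_def)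
      then show ?case unfolding g_def by (simp add: convergent_LIMSEQ_iff)
    qed
  qed
  have nn: "(\<integral>\<^sup>+x. ennreal ((cmod (s m x - g x))\<^sup>2) \<partial>M) \<le> ennreal ((1/4)^m)" for m
  proof -
    have "(\<integral>\<^sup>+x. ennreal ((cmod (s m x - g x))\<^sup>2) \<partial>M) = (\<integral>\<^sup>+x. liminf (\<lambda>n. ennreal ((cmod (s m x - s n x))\<^sup>2)) \<partial>M)"
    proof (rule nn_integral_cong_AE)
      show "AE x in M. ennreal ((cmod (s m x - g x))\<^sup>2) = liminf (\<lambda>n. ennreal ((cmod (s m x - s n x))\<^sup>2))"
        using conv
      proof eventually_elim
        case (elim x)
        have "(\<lambda>n. ennreal ((cmod (s m x - s n x))\<^sup>2)) \<longlonglongrightarrow> ennreal ((cmod (s m x - g x))\<^sup>2)"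
          by (intro tendsto_ennrealI tendsto_intros elim)
        from lim_imp_Liminf[OF sequentially_bot this] show ?case ..
      qed
    qed
    also have "\<dots> \<le> liminf (\<lambda>n. \<integral>\<^sup>+x. ennreal ((cmod (s m x - s n x))\<^sup>2) \<partial>M)"
      by (rule nn_integral_liminf) measurable
    also have "\<dots> \<le> liminf (\<lambda>n. ennreal ((1/4)^m))"
    proof (rule Liminf_mono)
      have "(\<integral>\<^sup>+x. ennreal ((cmod (s m x - s n x))\<^sup>2) \<partial>M) \<le> ennreal ((1/4)^m)" if "m \<le> n" for n
      proof -
        have "(\<integral>\<^sup>+x. ennreal ((cmod (s m x - s n x))\<^sup>2) \<partial>M) = ennreal ((L2_norm M (\<lambda>x. s n x - s m x))\<^sup>2)"
          unfolding L2_norm_sq using L2D(2)[OF L2_diff[OF sL[of n] sL[of m]]]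
          by (subst nn_integral_eq_integral[symmetric]) (auto simp: norm_minus_commute)
        then show ?thesis using diff[OF that] by (simp add: ennreal_leI)
      qed
      then show "\<forall>\<^sub>F n in sequentially. (\<integral>\<^sup>+x. ennreal ((cmod (s m x - s n x))\<^sup>2) \<partial>M) \<le> ennreal ((1/4)^m)"
        by (rule eventually_sequentiallyI)
    qed
    also have "\<dots> = ennreal ((1/4)^m)" by (simp add: Liminf_const)
    finally show ?thesis .
  qed
  have sg: "(\<lambda>x. s m x - g x) \<in> L2 M" for m
    unfolding L2_def
  proof (intro CollectI conjI integrableI_nonneg)
    show "(\<integral>\<^sup>+x. ennreal ((cmod (s m x - g x))\<^sup>2) \<partial>M) < \<infinity>" using nn[of m] by (auto intro: le_less_trans)
  qed auto
  have sgn: "L2_norm M (\<lambda>x. s m x - g x) \<le> (1/2)^m" for m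
  proof (rule power2_le_imp_le)
    have "ennreal ((L2_norm M (\<lambda>x. s m x - g x))\<^sup>2) = (\<integral>\<^sup>+x. ennreal ((cmod (s m x - g x))\<^sup>2) \<partial>M)"
      unfolding L2_norm_sq using L2D(2)[OF sg[of m]] by (subst nn_integral_eq_integral) auto
    also have "\<dots> \<le> ennreal ((1/4)^m)" by (rule nn)
    finally show "(L2_norm M (\<lambda>x. s m x - g x))\<^sup>2 \<le> ((1/2)^m)\<^sup>2"
      by (simp add: power2_eq_square power_mult_distrib[symmetric])
  qed simp
  have gL: "g \<in> L2 M" using L2_diff[OF sL[of 0] sg[of 0]] by simp
  have gc: "L2_inner M e g = c e" if e: "e \<in> E" for e
  proof -
    have en: "L2_norm M e = 1"
    proof -
      have "L2_inner M e e = 1" using E e by (auto simp: orthonormal_def)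
      then have "complex_of_real ((L2_norm M e)\<^sup>2) = of_real 1" by (simp add: L2_inner_self)
      then have "(L2_norm M e)\<^sup>2 = 1" by (simp only: of_real_eq_iff)
      then show ?thesis using L2_norm_nonneg[of M e] by (simp add: power2_eq_1_iff)
    qed
    have "cmod (c e - L2_inner M e g) \<le> 2 * (1/2)^m" for m
    proof -
      have 1: "cmod (L2_inner M e (\<lambda>x. s m x - g x)) \<le> (1/2)^m"
        using L2_Cauchy_Schwarz[OF EL[OF e] sg[of m]] sgn[of m] en by simp
      \<comment> \<open>If \<open>e\<close> is not yet in \<open>F m\<close>, its squared
        coefficient belongs to the remaining tail, which is below 4^(-m).\<close>
      have 2: "cmod (c e - L2_inner M e (s m)) \<le> (1/2)^m"
      proof (cases "e \<in> F m")
        case True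
        then show ?thesis unfolding s_def using orthonormal_inner_sum[OF E F(1) F(2) e] by simp
      next
        case False
        have "w e + sum w (F m) = sum w (insert e (F m))" using False F by simp
        also have "\<dots> \<le> S" using F e by (intro fin_le) auto
        finally have "w e \<le> (1/4)^m" using Ftail[of m] by linarith
        then have "(cmod (c e))\<^sup>2 \<le> ((1/2)^m)\<^sup>2"
          by (simp add: w_def power2_eq_square power_mult_distrib[symmetric])
        then have "cmod (c e) \<le> (1/2)^m" by (rule power2_le_imp_le) simp
        then show ?thesis unfolding s_def using orthonormal_inner_sum[OF E F(1) F(2) e] False by simp
      qed
      have "c e - L2_inner M e g = (c e - L2_inner M e (s m)) + L2_inner M e (\<lambda>x. s m x - g x)"
        using L2_inner_diff[OF sL gL EL[OF e]] by simp
      then have "cmod (c e - L2_inner M e g) \<le> cmod (c e - L2_inner M e (s m)) + cmod (L2_inner M e (\<lambda>x. s m x - g x))"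
        by (metis norm_triangle_ineq)
      then show ?thesis using 1 2 by simp
    qed
    moreover have "(\<lambda>m. 2 * (1/2)^m) \<longlonglongrightarrow> 2 * (0::real)"
      by (intro tendsto_mult tendsto_const LIMSEQ_power_zero) simp
    ultimately have "cmod (c e - L2_inner M e g) \<le> 0"
      by (intro LIMSEQ_le_const[of "\<lambda>m. 2 * (1/2)^m"]) auto
    then show ?thesis by simp
  qed
  have "(L2_norm M g)\<^sup>2 - S \<le> (1/4)^m" for m
  proof -
    have "(L2_norm M g)\<^sup>2 - S \<le> (L2_norm M g)\<^sup>2 - sum w (F m)" using fin_le[OF F(1) F(2)] by simp
    also have "\<dots> = (L2_norm M (\<lambda>x. g x - s m x))\<^sup>2"
    proof -
      have "s m = (\<lambda>x. \<Sum>e\<in>F m. L2_inner M e g * e x)" "sum w (F m) = (\<Sum>e\<in>F m. (cmod (L2_inner M e g))\<^sup>2)"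
        using F(2)[of m] gc unfolding s_def w_def by (auto intro!: ext sum.cong)
      then show ?thesis using orthonormal_residual[OF E F(1) F(2) gL, of m] by simp
    qed
    also have "L2_norm M (\<lambda>x. g x - s m x) = L2_norm M (\<lambda>x. s m x - g x)"
      by (simp add: L2_norm_def norm_minus_commute)
    also have "(L2_norm M (\<lambda>x. s m x - g x))\<^sup>2 \<le> ((1/2)^m)\<^sup>2"
      using sgn L2_norm_nonneg by (intro power_mono) auto
    finally show ?thesis by (simp add: power2_eq_square power_mult_distrib[symmetric])
  qed
  moreover have "(\<lambda>m. (1/4)^m) \<longlonglongrightarrow> (0::real)" by (rule LIMSEQ_power_zero) simp
  ultimately have "(L2_norm M g)\<^sup>2 - S \<le> 0" by (intro LIMSEQ_le_const[of "\<lambda>m. (1/4)^m"]) auto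
  moreover have "S \<le> (L2_norm M g)\<^sup>2"
  proof -
    have "S = infsum (\<lambda>e. (cmod (L2_inner M e g))\<^sup>2) E" unfolding S_def w_def by (intro infsum_cong) (simp add: gc)
    then show ?thesis using Bessel(2)[OF E gL] by simp
  qed
  ultimately have "(w has_sum (L2_norm M g)\<^sup>2) E" using has_sum_infsum[OF ws] unfolding S_def by simp
  then show ?thesis using gL gc unfolding w_def[abs_def] by blast
qed

lemma orthonormal_basis_orthonormal: "orthonormal_basis M E \<Longrightarrow> orthonormal M E"
  by (auto simp: orthonormal_def orthonormal_basis_def)

lemma orthonormal_basis_unique:
  assumes B: "orthonormal_basis M E" and f: "f \<in> L2 M" and g: "g \<in> L2 M"
    and eq: "\<And>e. e \<in> E \<Longrightarrow> L2_inner M e f = L2_inner M e g"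
  shows "AE x in M. f x = g x"
proof -
  have "L2_inner M e (\<lambda>x. f x - g x) = 0" if e: "e \<in> E" for e
  proof -
    have "e \<in> L2 M" using B e by (auto simp: orthonormal_basis_def)
    then show ?thesis using eq[OF e] by (simp add: L2_inner_diff[OF f g])
  qed
  then have "AE x in M. f x - g x = 0" using B L2_diff[OF f g] unfolding orthonormal_basis_def by blast
  then show ?thesis by eventually_elim simp
qed

text \<open>Riesz-Fischer rebuilds a function from the coefficients of \<open>f\<close>, with the
  norm given by their squares; completeness identifies it with \<open>f\<close>.\<close>

lemma Parseval:
  assumes "finite_measure M" and B: "orthonormal_basis M E" and f: "f \<in> L2 M"
  shows "((\<lambda>e. (cmod (L2_inner M e f))\<^sup>2) has_sum (L2_norm M f)\<^sup>2) E"
proof -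
  have E: "orthonormal M E" by (rule orthonormal_basis_orthonormal[OF B])
  obtain g where g: "g \<in> L2 M" "\<forall>e\<in>E. L2_inner M e g = L2_inner M e f"
    "((\<lambda>e. (cmod (L2_inner M e f))\<^sup>2) has_sum (L2_norm M g)\<^sup>2) E"
    using Riesz_Fischer[OF assms(1) E Bessel(1)[OF E f]] by blast
  have "AE x in M. g x = f x" by (rule orthonormal_basis_unique[OF B g(1) f]) (use g(2) in blast)
  from L2_cong_AE(1)[OF this L2D(1)[OF g(1)] L2D(1)[OF f]] show ?thesis using g(3) by simp
qed

text \<open>A finite partial sum misses the inner product by the pairing of the residual of
  \<open>f\<close> with \<open>g\<close>, which Cauchy-Schwarz and Parseval drive to 0.\<close>

lemma Parseval_inner:
  assumes M: "finite_measure M" and B: "orthonormal_basis M E" and f: "f \<in> L2 M" and g: "g \<in> L2 M"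
  shows "((\<lambda>e. cnj (L2_inner M e f) * L2_inner M e g) has_sum L2_inner M f g) E"
proof -
  have E: "orthonormal M E" by (rule orthonormal_basis_orthonormal[OF B])
  have EL: "e \<in> L2 M" if "e \<in> E" for e using E that by (auto simp: orthonormal_def)
  have bound: "cmod ((\<Sum>e\<in>S. cnj (L2_inner M e f) * L2_inner M e g) - L2_inner M f g)
    \<le> sqrt ((L2_norm M f)\<^sup>2 - (\<Sum>e\<in>S. (cmod (L2_inner M e f))\<^sup>2)) * L2_norm M g"
    if S: "finite S" "S \<subseteq> E" for S
  proof -
    let ?s = "\<lambda>x. \<Sum>e\<in>S. L2_inner M e f * e x"
    have sL: "?s \<in> L2 M" using S EL by (intro L2_sum) auto
    have "L2_inner M g ?s = (\<Sum>e\<in>S. L2_inner M e f * L2_inner M g e)" using S EL by (intro L2_inner_sum g) auto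
    then have "cnj (L2_inner M g ?s) = (\<Sum>e\<in>S. cnj (L2_inner M e f) * L2_inner M e g)"
      by (simp add: L2_inner_cnj[of M g])
    then have "L2_inner M (\<lambda>x. f x - ?s x) g = L2_inner M f g - (\<Sum>e\<in>S. cnj (L2_inner M e f) * L2_inner M e g)"
      using L2_inner_diff[OF f sL g] L2_inner_cnj[of M "\<lambda>x. f x - ?s x" g] L2_inner_cnj[of M f g] by simp
    then have "cmod ((\<Sum>e\<in>S. cnj (L2_inner M e f) * L2_inner M e g) - L2_inner M f g) = cmod (L2_inner M (\<lambda>x. f x - ?s x) g)"
      by (simp add: norm_minus_commute)
    also have "\<dots> \<le> L2_norm M (\<lambda>x. f x - ?s x) * L2_norm M g" by (intro L2_Cauchy_Schwarz L2_diff f sL g)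
    also have "L2_norm M (\<lambda>x. f x - ?s x) = sqrt ((L2_norm M f)\<^sup>2 - (\<Sum>e\<in>S. (cmod (L2_inner M e f))\<^sup>2))"
      unfolding orthonormal_residual[OF E S f, symmetric] by (simp add: L2_norm_nonneg)
    finally show ?thesis .
  qed
  have "(sum (\<lambda>e. (cmod (L2_inner M e f))\<^sup>2) \<longlongrightarrow> (L2_norm M f)\<^sup>2) (finite_subsets_at_top E)"
    using Parseval[OF M B f] unfolding has_sum_def .
  then have "((\<lambda>S. sqrt ((L2_norm M f)\<^sup>2 - (\<Sum>e\<in>S. (cmod (L2_inner M e f))\<^sup>2)) * L2_norm M g)
    \<longlongrightarrow> sqrt ((L2_norm M f)\<^sup>2 - (L2_norm M f)\<^sup>2) * L2_norm M g) (finite_subsets_at_top E)"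
    by (intro tendsto_intros)
  then have lim: "((\<lambda>S. sqrt ((L2_norm M f)\<^sup>2 - (\<Sum>e\<in>S. (cmod (L2_inner M e f))\<^sup>2)) * L2_norm M g) \<longlongrightarrow> 0) (finite_subsets_at_top E)"
    by simp
  show ?thesis unfolding has_sum_def
  proof (rule LIM_zero_cancel, rule Lim_null_comparison[OF _ lim])
    show "\<forall>\<^sub>F S in finite_subsets_at_top E. cmod ((\<Sum>e\<in>S. cnj (L2_inner M e f) * L2_inner M e g) - L2_inner M f g)
      \<le> sqrt ((L2_norm M f)\<^sup>2 - (\<Sum>e\<in>S. (cmod (L2_inner M e f))\<^sup>2)) * L2_norm M g"
      by (rule eventually_finite_subsets_at_top_weakI) (rule bound)
  qed
qed

text \<open>\<open>|A|\<close> multiplies the \<open>e\<close>-th Fourier coefficient by \<open>|\<mu> e|\<close>; the trace in another basis \<open>E'\<close> is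
  \<open>\<Sum>\<^sub>e\<^sub>' \<Sum>\<^sub>e \<mu> e |\<langle>e, e'\<rangle>|\<^sup>2\<close>, and the order of summation may be interchanged.\<close>

lemma diagonal_bounded:
  fixes \<mu> :: "('a \<Rightarrow> complex) \<Rightarrow> real"
  assumes M: "finite_measure M" and E: "orthonormal_basis M E"
    and D: "\<And>f. f \<in> L2 M \<Longrightarrow> D f \<in> L2 M" "\<And>f e. f \<in> L2 M \<Longrightarrow> e \<in> E \<Longrightarrow> L2_inner M e (D f) = of_real (\<mu> e) * L2_inner M e f"
    and K: "\<And>e. e \<in> E \<Longrightarrow> \<bar>\<mu> e\<bar> \<le> K"
  shows "bounded_operator M D"
  unfolding bounded_operator_def
proof (intro conjI ballI allI)
  have EL: "e \<in> L2 M" if "e \<in> E" for e using E that by (auto simp: orthonormal_basis_def)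
  fix f g c assume f: "f \<in> L2 M" and g: "g \<in> L2 M"
  show "AE x in M. D (\<lambda>t. c * f t + g t) x = c * D f x + D g x"
  proof (rule orthonormal_basis_unique[OF E D(1)[OF L2_lincomb[OF f g]] L2_lincomb[OF D(1)[OF f] D(1)[OF g]]])
    fix e assume e: "e \<in> E"
    show "L2_inner M e (D (\<lambda>t. c * f t + g t)) = L2_inner M e (\<lambda>x. c * D f x + D g x)"
      unfolding D(2)[OF L2_lincomb[OF f g] e] L2_inner_lincomb[OF f g EL[OF e]]
        L2_inner_lincomb[OF D(1)[OF f] D(1)[OF g] EL[OF e]] D(2)[OF f e] D(2)[OF g e]
      by (simp add: algebra_simps)
  qed
next
  have "L2_norm M (D f) \<le> max K 0 * L2_norm M f" if f: "f \<in> L2 M" for f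
  proof (rule power2_le_imp_le)
    have "((\<lambda>e. (max K 0)\<^sup>2 * (cmod (L2_inner M e f))\<^sup>2) has_sum (max K 0)\<^sup>2 * (L2_norm M f)\<^sup>2) E"
      by (rule has_sum_cmult_right[OF Parseval[OF M E f]])
    moreover have "(cmod (L2_inner M e (D f)))\<^sup>2 \<le> (max K 0)\<^sup>2 * (cmod (L2_inner M e f))\<^sup>2" if "e \<in> E" for e
    proof -
      have "cmod (L2_inner M e (D f)) = \<bar>\<mu> e\<bar> * cmod (L2_inner M e f)" by (simp add: D(2)[OF f that] norm_mult)
      also have "\<dots> \<le> max K 0 * cmod (L2_inner M e f)" using K[OF that] by (intro mult_right_mono) auto
      finally show ?thesis unfolding power_mult_distrib[symmetric] by (intro power_mono) auto
    qed
    ultimately have "(L2_norm M (D f))\<^sup>2 \<le> (max K 0)\<^sup>2 * (L2_norm M f)\<^sup>2"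
      by (rule has_sum_mono[OF Parseval[OF M E D(1)[OF f]]])
    then show "(L2_norm M (D f))\<^sup>2 \<le> (max K 0 * L2_norm M f)\<^sup>2" by (simp add: power_mult_distrib)
  qed (simp add: L2_norm_nonneg)
  then show "\<exists>C. \<forall>f\<in>L2 M. L2_norm M (D f) \<le> C * L2_norm M f" by blast
qed (rule D(1))

lemma diagonal_trace:
  fixes \<mu> :: "('a \<Rightarrow> complex) \<Rightarrow> real"
  assumes M: "finite_measure M" and E: "orthonormal_basis M E"
    and A: "\<And>f. f \<in> L2 M \<Longrightarrow> A f \<in> L2 M" "\<And>f e. f \<in> L2 M \<Longrightarrow> e \<in> E \<Longrightarrow> L2_inner M e (A f) = of_real (\<mu> e) * L2_inner M e f"
    and \<mu>s: "(\<lambda>e. \<bar>\<mu> e\<bar>) summable_on E"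
  shows "has_trace M A (of_real (infsum \<mu> E))"
proof -
  have EL: "e \<in> L2 M" if "e \<in> E" for e using E that by (auto simp: orthonormal_basis_def)
  define K where "K = infsum (\<lambda>e. \<bar>\<mu> e\<bar>) E"
  have K: "\<bar>\<mu> e\<bar> \<le> K" if "e \<in> E" for e
    using finite_sum_le_infsum[OF \<mu>s, of "{e}"] that by (simp add: K_def)
  have "\<exists>g\<in>L2 M. \<forall>e\<in>E. L2_inner M e g = of_real \<bar>\<mu> e\<bar> * L2_inner M e f" if f: "f \<in> L2 M" for f
  proof -
    have "(\<lambda>e. (cmod (of_real \<bar>\<mu> e\<bar> * L2_inner M e f))\<^sup>2) summable_on E"
    proof -
      have "(\<lambda>e. (cmod (L2_inner M e (A f)))\<^sup>2) summable_on E"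
        using Parseval[OF M E A(1)[OF f]] has_sum_imp_summable by blast
      then show ?thesis
        by (rule summable_on_cong[THEN iffD1, rotated]) (simp add: A(2)[OF f] norm_mult)
    qed
    from Riesz_Fischer[OF M orthonormal_basis_orthonormal[OF E] this] show ?thesis by blast
  qed
  \<comment> \<open>The candidate for |A|, defined through its Fourier coefficients by
    Riesz-Fischer.\<close>
  then obtain B where B: "\<And>f. f \<in> L2 M \<Longrightarrow> B f \<in> L2 M"
      "\<And>f e. f \<in> L2 M \<Longrightarrow> e \<in> E \<Longrightarrow> L2_inner M e (B f) = of_real \<bar>\<mu> e\<bar> * L2_inner M e f" by metis
  have Ab: "bounded_operator M A" by (rule diagonal_bounded[OF M E A K])
  have Bb: "bounded_operator M B" by (rule diagonal_bounded[OF M E B, where K=K]) (simp_all add: K)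
  have Bpos: "Im (L2_inner M f (B f)) = 0 \<and> 0 \<le> Re (L2_inner M f (B f))" if f: "f \<in> L2 M" for f
  proof -
    have "((\<lambda>e. complex_of_real (\<bar>\<mu> e\<bar> * (cmod (L2_inner M e f))\<^sup>2)) has_sum L2_inner M f (B f)) E"
      by (rule has_sum_cong[THEN iffD1, OF _ Parseval_inner[OF M E f B(1)[OF f]]])
        (simp add: B(2)[OF f] complex_norm_square mult_ac del: of_real_power)
    from has_sum_Im[OF this] has_sum_Re[OF this]
    have I: "((\<lambda>_. 0) has_sum Im (L2_inner M f (B f))) E" and R: "((\<lambda>e. \<bar>\<mu> e\<bar> * (cmod (L2_inner M e f))\<^sup>2) has_sum Re (L2_inner M f (B f))) E"
      by (simp_all del: of_real_mult of_real_power)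
    have "Im (L2_inner M f (B f)) = 0" by (rule has_sum_unique[OF I has_sum_0_simp])
    moreover have "0 \<le> Re (L2_inner M f (B f))" by (rule has_sum_nonneg[OF R]) simp
    ultimately show ?thesis by simp
  qed
  have BA: "L2_inner M (B f) (B g) = L2_inner M (A f) (A g)" if f: "f \<in> L2 M" and g: "g \<in> L2 M" for f g
  proof (rule has_sum_unique)
    show "((\<lambda>e. cnj (L2_inner M e (A f)) * L2_inner M e (A g)) has_sum L2_inner M (A f) (A g)) E"
      by (rule Parseval_inner[OF M E A(1)[OF f] A(1)[OF g]])
    show "((\<lambda>e. cnj (L2_inner M e (A f)) * L2_inner M e (A g)) has_sum L2_inner M (B f) (B g)) E"
    proof (rule has_sum_cong[THEN iffD1, OF _ Parseval_inner[OF M E B(1)[OF f] B(1)[OF g]]])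
      fix e assume e: "e \<in> E"
      have "complex_of_real \<bar>\<mu> e\<bar> * of_real \<bar>\<mu> e\<bar> = of_real (\<mu> e) * of_real (\<mu> e)"
        unfolding of_real_mult[symmetric] by (simp only: abs_mult_self_eq)
      then show "cnj (L2_inner M e (B f)) * L2_inner M e (B g) = cnj (L2_inner M e (A f)) * L2_inner M e (A g)"
        unfolding A(2)[OF f e] A(2)[OF g e] B(2)[OF f e] B(2)[OF g e] complex_cnj_mult complex_cnj_complex_of_real
        by (metis (no_types, opaque_lifting) mult.assoc mult.left_commute)
    qed
  qed
  have abs: "is_operator_abs M A B"
    unfolding is_operator_abs_def positive_operator_def using Bb Bpos BA by blast
  have Bs: "(\<lambda>e. L2_inner M e (B e)) summable_on E"
  proof -
    have "(\<lambda>e. complex_of_real \<bar>\<mu> e\<bar>) summable_on E" by (rule summable_on_of_real[OF \<mu>s])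
    moreover have "L2_inner M e (B e) = of_real \<bar>\<mu> e\<bar>" if "e \<in> E" for e
      using B(2)[OF EL[OF that] that] E that by (simp add: orthonormal_basis_def)
    ultimately show ?thesis by (simp cong: summable_on_cong)
  qed
  have tc: "trace_class M A" unfolding trace_class_def using Ab abs E Bs by blast
  have "((\<lambda>e'. L2_inner M e' (A e')) has_sum of_real (infsum \<mu> E)) E'" if E': "orthonormal_basis M E'" for E'
  proof -
    have EL': "e \<in> L2 M" if "e \<in> E'" for e using E' that by (auto simp: orthonormal_basis_def)
    define h where "h = (\<lambda>(e, e'). \<mu> e * (cmod (L2_inner M e e'))\<^sup>2)"
    have row: "((\<lambda>e'. (cmod (L2_inner M e e'))\<^sup>2) has_sum 1) E'" if e: "e \<in> E" for e
    proof -
      have "L2_inner M e e = 1" using E e by (auto simp: orthonormal_basis_def)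
      then have "complex_of_real ((L2_norm M e)\<^sup>2) = of_real 1" by (simp add: L2_inner_self)
      then have "(L2_norm M e)\<^sup>2 = 1" by (simp only: of_real_eq_iff)
      with Parseval[OF M E' EL[OF e]] have "((\<lambda>e'. (cmod (L2_inner M e' e))\<^sup>2) has_sum 1) E'" by simp
      moreover have "cmod (L2_inner M e' e) = cmod (L2_inner M e e')" for e' by (subst L2_inner_cnj) simp
      ultimately show ?thesis by simp
    qed
    have hrow: "((\<lambda>e'. h (e, e')) has_sum \<mu> e) E'" if "e \<in> E" for e
      using has_sum_cmult_right[OF row[OF that], of "\<mu> e"] by (simp add: h_def)
    \<comment> \<open>Since \<open>e\<close> is a unit vector, the row of \<open>e\<close> has
      absolute sum |\<mu> e|; hence the double family is absolutely summable.\<close>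
    have habs: "(\<lambda>x. norm (h x)) summable_on E \<times> E'"
    proof (rule Infinite_Sum.abs_summable_on_Sigma_iff[THEN iffD2], intro conjI ballI)
      have a: "((\<lambda>e'. norm (h (e, e'))) has_sum \<bar>\<mu> e\<bar>) E'" if "e \<in> E" for e
        using has_sum_cmult_right[OF row[OF that], of "\<bar>\<mu> e\<bar>"] by (simp add: h_def abs_mult)
      show "(\<lambda>e'. norm (h (e, e'))) summable_on E'" if "e \<in> E" for e
        using a[OF that] has_sum_imp_summable by blast
      have "infsum (\<lambda>e'. norm (h (e, e'))) E' = \<bar>\<mu> e\<bar>" if "e \<in> E" for e using a[OF that] by (rule infsumI)
      then show "(\<lambda>e. norm (infsum (\<lambda>e'. norm (h (e, e'))) E')) summable_on E"
        using \<mu>s by (simp cong: summable_on_cong)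
    qed
    have hs: "h summable_on E \<times> E'" by (rule Infinite_Sum.abs_summable_summable[OF habs])
    have tot: "(h has_sum infsum \<mu> E) (E \<times> E')"
    proof -
      note H = has_sum_infsum[OF hs]
      have "infsum \<mu> E = infsum h (E \<times> E')" by (rule infsumI[OF has_sum_SigmaD[OF H hrow]])
      then show ?thesis using H by (simp only:)
    qed
    have tot': "((\<lambda>(e', e). h (e, e')) has_sum infsum \<mu> E) (E' \<times> E)"
      using tot has_sum_swap[where f=h and A=E and B=E'] by blast
    \<comment> \<open>The column of e' is the expansion of the diagonal element of \<open>A\<close>
      at e', which is real because all its terms are.\<close>
    have col: "((\<lambda>e. h (e, e')) has_sum Re (L2_inner M e' (A e'))) E \<and> L2_inner M e' (A e') = of_real (Re (L2_inner M e' (A e')))" if e': "e' \<in> E'" for e'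
    proof -
      have "((\<lambda>e. complex_of_real (h (e, e'))) has_sum L2_inner M e' (A e')) E"
        by (rule has_sum_cong[THEN iffD1, OF _ Parseval_inner[OF M E EL'[OF e'] A(1)[OF EL'[OF e']]]])
          (simp add: A(2)[OF EL'[OF e']] h_def complex_norm_square mult_ac del: of_real_power)
      from has_sum_Im[OF this] has_sum_Re[OF this]
      have I: "((\<lambda>_. 0) has_sum Im (L2_inner M e' (A e'))) E" and R: "((\<lambda>e. h (e, e')) has_sum Re (L2_inner M e' (A e'))) E"
        by simp_all
      have "Im (L2_inner M e' (A e')) = 0" by (rule has_sum_unique[OF I has_sum_0_simp])
      then show ?thesis using R by (simp add: complex_eq_iff)
    qed
    have "((\<lambda>e'. Re (L2_inner M e' (A e'))) has_sum infsum \<mu> E) E'"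
      by (rule has_sum_SigmaD[OF tot']) (use col in simp)
    then have "((\<lambda>e'. complex_of_real (Re (L2_inner M e' (A e')))) has_sum of_real (infsum \<mu> E)) E'"
      by (rule has_sum_of_real)
    then show ?thesis using col by (simp cong: has_sum_cong)
  qed
  then show ?thesis unfolding has_trace_def using tc by blast
qed

section \<open>The weighted space\<close>

context sl_coeffs
begin

abbreviation M :: "real measure" where "M \<equiv> weight_measure r a b"

lemma r_meas: "r \<in> borel_measurable (lebesgue_on {a<..<b})"
  using r_int by auto

text \<open>Since r > 0 almost everywhere, the weighted measure and Lebesgue measure on (a,b) have
  the same null sets.\<close>

lemma AE_M_iff: "(AE x in M. P x) \<longleftrightarrow> (AE x in lebesgue. x \<in> {a<..<b} \<longrightarrow> P x)"
proof -
  have "(AE x in M. P x) \<longleftrightarrow> (AE x in lebesgue_on {a<..<b}. 0 < ennreal (r x) \<longrightarrow> P x)"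
    unfolding weight_measure_def using r_meas by (intro AE_density) auto
  also have "\<dots> \<longleftrightarrow> (AE x in lebesgue_on {a<..<b}. P x)"
    using r_pos by (auto elim: eventually_elim2)
  finally show ?thesis by (simp add: AE_lebesgue_on_iff)
qed

lemma meas_M: "f \<in> borel_measurable M \<longleftrightarrow> f \<in> borel_measurable (lebesgue_on {a<..<b})"
  unfolding weight_measure_def by (simp add: measurable_def)

lemma r_nonneg_AE: "AE x in lebesgue_on {a<..<b}. 0 \<le> r x"
  using r_pos by eventually_elim simp

lemma finite_measure_M: "finite_measure M"
proof (rule finite_measureI)
  have "emeasure M (space M) = (\<integral>\<^sup>+x. ennreal (r x) \<partial>lebesgue_on {a<..<b})"
    unfolding weight_measure_def using r_meas by (subst emeasure_density) (auto simp: nn_integral_set_ennreal intro!: nn_integral_cong)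
  also have "\<dots> = ennreal (LINT x|lebesgue_on {a<..<b}. r x)"
    using r_int r_nonneg_AE by (rule nn_integral_eq_integral)
  finally show "emeasure M (space M) \<noteq> \<infinity>" by simp
qed

lemma integrable_M_iff:
  fixes f :: "real \<Rightarrow> complex"
  assumes f: "f \<in> borel_measurable M"
  shows "integrable M f \<longleftrightarrow> (\<lambda>x. of_real (r x) * f x) absolutely_integrable_on {a..b}"
proof -
  have "integrable M f \<longleftrightarrow> integrable (lebesgue_on {a<..<b}) (\<lambda>x. r x *\<^sub>R f x)"
    unfolding weight_measure_def using f r_meas r_nonneg_AE by (intro integrable_density) (auto simp: meas_M)
  also have "\<dots> \<longleftrightarrow> (\<lambda>x. of_real (r x) * f x) absolutely_integrable_on {a<..<b}"
    by (subst integrable_restrict_space) (auto simp: set_integrable_def scaleR_conv_of_real mult.left_commute)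
  also have "\<dots> \<longleftrightarrow> (\<lambda>x. of_real (r x) * f x) absolutely_integrable_on {a..b}"
  proof (rule absolutely_integrable_spike_set_eq)
    show "negligible {x \<in> {a<..<b} - {a..b}. of_real (r x) * f x \<noteq> 0}"
      by (rule negligible_subset[of "{a,b}"]) auto
    show "negligible {x \<in> {a..b} - {a<..<b}. of_real (r x) * f x \<noteq> 0}"
      by (rule negligible_subset[of "{a,b}"]) auto
  qed
  finally show ?thesis .
qed

lemma integral_M:
  fixes f :: "real \<Rightarrow> complex"
  assumes f: "integrable M f"
  shows "(LINT x|M. f x) = integral {a..b} (\<lambda>x. of_real (r x) * f x)"
proof -
  have fm: "f \<in> borel_measurable M" using f by auto
  have abs: "(\<lambda>x. of_real (r x) * f x) absolutely_integrable_on {a..b}" using f integrable_M_iff[OF fm] by blast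
  have abs': "(\<lambda>x. of_real (r x) * f x) absolutely_integrable_on {a<..<b}"
    by (rule set_integrable_subset[OF abs]) auto
  have "(LINT x|M. f x) = (LINT x|lebesgue_on {a<..<b}. r x *\<^sub>R f x)"
    unfolding weight_measure_def using fm r_meas r_nonneg_AE by (intro integral_density) (auto simp: meas_M)
  also have "\<dots> = (LINT x:{a<..<b}|lebesgue. of_real (r x) * f x)"
    unfolding set_lebesgue_integral_def by (subst integral_restrict_space) (auto simp: scaleR_conv_of_real mult.left_commute)
  also have "\<dots> = integral {a<..<b} (\<lambda>x. of_real (r x) * f x)"
    by (rule set_lebesgue_integral_eq_integral(2)[OF abs'])
  also have "\<dots> = integral {a..b} (\<lambda>x. of_real (r x) * f x)"
    by (rule integral_open_interval_real[symmetric])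
  finally show ?thesis .
qed

lemma continuous_meas_M:
  assumes "continuous_on {a..b} g"
  shows "(g :: real \<Rightarrow> complex) \<in> borel_measurable M"
  unfolding meas_M by (rule continuous_imp_measurable_on_sets_lebesgue) (use assms in \<open>auto intro: continuous_on_subset\<close>)

lemma L2I_meas_bounded:
  assumes g: "(g :: real \<Rightarrow> complex) \<in> borel_measurable M" and B: "\<And>x. x \<in> {a<..<b} \<Longrightarrow> cmod (g x) \<le> B"
  shows "g \<in> L2 M"
  unfolding L2_def
proof (intro CollectI conjI g)
  interpret finite_measure M by (rule finite_measure_M)
  show "integrable M (\<lambda>x. (cmod (g x))\<^sup>2)"
  proof (rule Bochner_Integration.integrable_bound)
    show "integrable M (\<lambda>x. B\<^sup>2)" by simp
    have "AE x in M. cmod (g x) \<le> B" unfolding AE_M_iff using B by auto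
    then show "AE x in M. norm ((cmod (g x))\<^sup>2) \<le> norm (B\<^sup>2)"
      by eventually_elim (simp add: power_mono)
  qed (use g in auto)
qed

lemma continuous_L2:
  assumes g: "continuous_on {a..b} g"
  shows "g \<in> L2 M"
proof -
  have "bounded (g ` {a..b})" using g by (intro compact_imp_bounded compact_continuous_image) auto
  then obtain B where "\<forall>y\<in>g ` {a..b}. cmod y \<le> B" unfolding bounded_iff by blast
  then show ?thesis by (intro L2I_meas_bounded[OF continuous_meas_M[OF g], of B]) auto
qed

lemma L2_integrable: "f \<in> L2 M \<Longrightarrow> integrable M f"
  using L2_mult_integrable[of "\<lambda>_. 1" M f] continuous_L2[of "\<lambda>_. 1"] by simp

lemma L2_abs_int:
  assumes "f \<in> L2 M"
  shows "(\<lambda>x. of_real (r x) * f x) absolutely_integrable_on {a..b}"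
  using integrable_M_iff[of f] L2_integrable[OF assms] L2D(1)[OF assms] by blast

lemma L2_inner_M:
  assumes "f \<in> L2 M" "g \<in> L2 M"
  shows "L2_inner M f g = integral {a..b} (\<lambda>x. of_real (r x) * (cnj (f x) * g x))"
  unfolding L2_inner_def by (rule integral_M[OF L2_mult_integrable[OF assms]])

lemma L2_norm_zero_iff:
  assumes f: "f \<in> L2 M"
  shows "L2_norm M f = 0 \<longleftrightarrow> (AE x in lebesgue. x \<in> {a<..<b} \<longrightarrow> f x = 0)"
proof -
  have "L2_norm M f = 0 \<longleftrightarrow> (LINT x|M. (cmod (f x))\<^sup>2) = 0" by (simp add: L2_norm_def)
  also have "\<dots> \<longleftrightarrow> (AE x in M. (cmod (f x))\<^sup>2 = 0)"
    by (rule integral_nonneg_eq_0_iff_AE[OF L2D(2)[OF f]]) simp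
  finally show ?thesis by (simp add: AE_M_iff)
qed

lemma L2_norm_continuous_pos:
  assumes g: "continuous_on {a..b} g" and x: "x \<in> {a..b}" "g x \<noteq> 0"
  shows "L2_norm M g > 0"
proof -
  have "L2_norm M g \<noteq> 0"
    using continuous_AE_zero[OF g _ ab x(1)] x(2) L2_norm_zero_iff[OF continuous_L2[OF g]] by blast
  then show ?thesis using L2_norm_nonneg[of M g] by linarith
qed

text \<open>Integration term by term, with the k-th term dominated by C (|z| D)^k / k! times |r h|,
  exhibits the integral as an everywhere convergent power series in z.\<close>

lemma entire_integral:
  fixes y :: "complex \<Rightarrow> real \<Rightarrow> complex"
  assumes sums: "\<And>z t. t \<in> {a..b} \<Longrightarrow> (\<lambda>k. z ^ k * c k t) sums y z t"
    and c: "\<And>k. continuous_on {a..b} (c k)" and C: "C \<ge> 0" "D \<ge> 0" "\<And>k t. t \<in> {a..b} \<Longrightarrow> cmod (c k t) \<le> C * (D ^ k / fact k)"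
    and h: "(\<lambda>t. of_real (r t) * h t) absolutely_integrable_on {a..b}" and x: "x \<in> {a..b}"
  shows "(\<lambda>z. integral {a..x} (\<lambda>t. of_real (r t) * (y z t * h t))) holomorphic_on UNIV"
proof -
  have hx: "(\<lambda>t. of_real (r t) * h t) absolutely_integrable_on {a..x}" by (rule abs_int_sub(1)[OF h x])
  define f where "f z k t = indicator {a..x} t *\<^sub>R (z ^ k * c k t * (of_real (r t) * h t))" for z k t
  have ch: "(\<lambda>t. c k t * (of_real (r t) * h t)) absolutely_integrable_on {a..x}" for k
    by (rule abs_int_sub(1)[OF absolutely_integrable_mult_bounded[OF h c] x])
  have fi: "integrable lebesgue (f z k)" for z k
  proof -
    have "(\<lambda>t. z ^ k * (c k t * (of_real (r t) * h t))) absolutely_integrable_on {a..x}"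
      using ch by (rule set_integrable_mult_right)
    then show ?thesis by (simp add: f_def[abs_def] set_integrable_def mult.assoc)
  qed
  define g where "g t = indicator {a..x} t * cmod (of_real (r t) * h t)" for t
  have gi: "integrable lebesgue g"
    using set_integrable_norm[OF hx] by (simp add: g_def[abs_def] set_integrable_def)
  have fg: "norm (f z k t) \<le> (C * ((cmod z * D) ^ k / fact k)) * g t" for z k t
  proof (cases "t \<in> {a..x}")
    case True
    then have "cmod (c k t) \<le> C * (D ^ k / fact k)" using x C(3) by auto
    then have "cmod z ^ k * cmod (c k t) * cmod (of_real (r t) * h t) \<le> cmod z ^ k * (C * (D ^ k / fact k)) * cmod (of_real (r t) * h t)"
      by (intro mult_right_mono mult_left_mono) auto
    then show ?thesis using True by (simp add: f_def g_def norm_mult norm_power power_mult_distrib mult_ac)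
  next
    case False then show ?thesis by (simp add: f_def g_def)
  qed
  have es: "summable (\<lambda>k. C * ((cmod z * D) ^ k / fact k))" for z
    using summable_mult[OF summable_exp[of "cmod z * D"], of C] by (simp add: divide_inverse mult.commute)
  have key: "(\<lambda>k. integral {a..x} (\<lambda>t. c k t * (of_real (r t) * h t)) * z ^ k) sums integral {a..x} (\<lambda>t. of_real (r t) * (y z t * h t))" for z
  proof -
    have su: "summable (\<lambda>k. norm (f z k t))" for t
      by (rule summable_comparison_test'[OF summable_mult2[OF es[of z], of "g t"]]) (use fg in auto)
    have si: "summable (\<lambda>k. LINT t|lebesgue. norm (f z k t))"
    proof (rule summable_comparison_test'[OF summable_mult2[OF es[of z], of "LINT t|lebesgue. g t"]])
      fix k
      have "(LINT t|lebesgue. norm (f z k t)) \<le> (LINT t|lebesgue. (C * ((cmod z * D) ^ k / fact k)) * g t)"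
        using fi gi fg by (intro integral_mono) auto
      then show "norm (LINT t|lebesgue. norm (f z k t)) \<le> C * ((cmod z * D) ^ k / fact k) * (LINT t|lebesgue. g t)"
        by (simp add: integral_nonneg_AE)
    qed
    have "(\<lambda>k. LINT t|lebesgue. f z k t) sums (LINT t|lebesgue. (\<Sum>k. f z k t))"
      by (rule sums_integral) (use fi su si in auto)
    moreover have "(LINT t|lebesgue. f z k t) = integral {a..x} (\<lambda>t. c k t * (of_real (r t) * h t)) * z ^ k" for k
    proof -
      have "(LINT t|lebesgue. f z k t) = (LINT t:{a..x}|lebesgue. z ^ k * (c k t * (of_real (r t) * h t)))"
        by (simp only: f_def set_lebesgue_integral_def mult.assoc)
      also have "\<dots> = z ^ k * (LINT t:{a..x}|lebesgue. c k t * (of_real (r t) * h t))" by simp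
      also have "(LINT t:{a..x}|lebesgue. c k t * (of_real (r t) * h t)) = integral {a..x} (\<lambda>t. c k t * (of_real (r t) * h t))"
        by (rule set_lebesgue_integral_eq_integral(2)[OF ch])
      finally show ?thesis by (simp add: mult.commute)
    qed
    moreover have "(LINT t|lebesgue. (\<Sum>k. f z k t)) = integral {a..x} (\<lambda>t. of_real (r t) * (y z t * h t))"
    proof -
      have e: "(\<Sum>k. f z k t) = indicator {a..x} t *\<^sub>R (of_real (r t) * (y z t * h t))" for t
      proof (cases "t \<in> {a..x}")
        case True
        then have "(\<lambda>k. z ^ k * c k t) sums y z t" using x by (intro sums) auto
        from sums_mult2[OF this, of "of_real (r t) * h t"] show ?thesis
          using True by (simp add: f_def sums_iff mult_ac)
      next
        case False then show ?thesis by (simp add: f_def)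
      qed
      have "integrable lebesgue (\<lambda>t. \<Sum>k. f z k t)"
        by (rule integrable_suminf) (use fi su si in auto)
      then have "(\<lambda>t. of_real (r t) * (y z t * h t)) absolutely_integrable_on {a..x}" by (simp add: e set_integrable_def)
      then show ?thesis unfolding e by (simp add: set_lebesgue_integral_eq_integral(2) set_lebesgue_integral_def[symmetric])
    qed
    ultimately show ?thesis by simp
  qed
  have "(\<lambda>z. integral {a..x} (\<lambda>t. of_real (r t) * (y z t * h t))) holomorphic_on ball 0 s" for s
    by (rule power_series_holomorphic[of 0 s "\<lambda>k. integral {a..x} (\<lambda>t. c k t * (of_real (r t) * h t))"]) (use key in simp)
  then have "(\<lambda>z. integral {a..x} (\<lambda>t. of_real (r t) * (y z t * h t))) field_differentiable at z" for z
    by (rule holomorphic_on_imp_differentiable_at[of _ "ball 0 (cmod z + 1)"]) auto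
  then show ?thesis by (simp add: holomorphic_on_def)
qed

end

context sl_fund
begin

lemma entire_sums:
  assumes "\<And>z. (\<lambda>k. z ^ k * c k) sums f (z::complex)"
  shows "f holomorphic_on UNIV"
proof -
  have "f holomorphic_on ball 0 s" for s
    by (rule power_series_holomorphic[of 0 s c]) (use assms in \<open>simp add: mult.commute\<close>)
  then have "f field_differentiable at z" for z
    by (rule holomorphic_on_imp_differentiable_at[of f "ball 0 (cmod z + 1)"]) auto
  then show ?thesis by (simp add: holomorphic_on_def)
qed

lemma fund_series:
  assumes "x \<in> {a..b}"
  shows "(\<lambda>k. z ^ k * sl_iter r a G (\<theta> 0) k x) sums \<theta> z x" "(\<lambda>k. z ^ k * sl_iter1 r a G G1 (\<theta> 0) (\<theta>1 0) k x) sums \<theta>1 z x"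
    "(\<lambda>k. z ^ k * sl_iter r a G (\<phi> 0) k x) sums \<phi> z x" "(\<lambda>k. z ^ k * sl_iter1 r a G G1 (\<phi> 0) (\<phi>1 0) k x) sums \<phi>1 z x"
  using sl_series[OF th(1)[of z] th(1)[of 0] _ _ assms] sl_series[OF ph(1)[of z] ph(1)[of 0] _ _ assms]
  by (simp_all add: th ph)

lemma fund_entire:
  assumes "x \<in> {a..b}"
  shows "(\<lambda>z. \<theta> z x) holomorphic_on UNIV" "(\<lambda>z. \<theta>1 z x) holomorphic_on UNIV"
    "(\<lambda>z. \<phi> z x) holomorphic_on UNIV" "(\<lambda>z. \<phi>1 z x) holomorphic_on UNIV"
  by (rule entire_sums, rule fund_series[OF assms])+

lemma fund_entire_integral:
  assumes h: "(\<lambda>t. of_real (r t) * h t) absolutely_integrable_on {a..b}" and x: "x \<in> {a..b}"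
  shows "(\<lambda>z. integral {a..x} (\<lambda>t. of_real (r t) * (\<theta> z t * h t))) holomorphic_on UNIV"
    "(\<lambda>z. integral {a..x} (\<lambda>t. of_real (r t) * (\<phi> z t * h t))) holomorphic_on UNIV"
proof -
  obtain C D where CD: "C \<ge> 0" "D \<ge> 0" "\<And>k t. t \<in> {a..b} \<Longrightarrow> cmod (sl_iter r a G (\<theta> 0) k t) \<le> C * (D ^ k / fact k)"
    using sl_iter_bound[OF fund_cont(1)[of 0]] by blast
  show "(\<lambda>z. integral {a..x} (\<lambda>t. of_real (r t) * (\<theta> z t * h t))) holomorphic_on UNIV"
    by (rule entire_integral[OF _ _ CD h x], erule fund_series(1), rule sl_iter_continuous[OF fund_cont(1)])
  obtain C D where CD: "C \<ge> 0" "D \<ge> 0" "\<And>k t. t \<in> {a..b} \<Longrightarrow> cmod (sl_iter r a G (\<phi> 0) k t) \<le> C * (D ^ k / fact k)"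
    using sl_iter_bound[OF fund_cont(3)[of 0]] by blast
  show "(\<lambda>z. integral {a..x} (\<lambda>t. of_real (r t) * (\<phi> z t * h t))) holomorphic_on UNIV"
    by (rule entire_integral[OF _ _ CD h x], erule fund_series(3), rule sl_iter_continuous[OF fund_cont(3)])
qed

end

section \<open>The boundary value problem\<close>

locale sl_bvp = sl_fund +
  fixes \<alpha> \<beta> :: real
begin

abbreviation "ca \<equiv> complex_of_real (cos \<alpha>)"
abbreviation "sa \<equiv> complex_of_real (sin \<alpha>)"
abbreviation "cb \<equiv> complex_of_real (cos \<beta>)"
abbreviation "sb \<equiv> complex_of_real (sin \<beta>)"

definition bc :: "(real \<Rightarrow> complex) \<Rightarrow> (real \<Rightarrow> complex) \<Rightarrow> bool" where
  "bc y y1 \<longleftrightarrow> y a * ca + y1 a * sa = 0 \<and> y b * cb - y1 b * sb = 0"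

definition u where "u z x = ca * \<phi> z x - sa * \<theta> z x"
definition u1 where "u1 z x = ca * \<phi>1 z x - sa * \<theta>1 z x"
definition F where "F z = cb * u z b - sb * u1 z b"
definition T where "T = sl_T p q r a b \<alpha> \<beta>"

lemma trig: "ca * ca + sa * sa = 1" "cb * cb + sb * sb = 1"
  by (simp_all only: of_real_mult[symmetric] of_real_add[symmetric] sin_cos_squared_add3 of_real_1)

lemma u_sys: "sl_sys z (\<lambda>_. 0) (u z) (u1 z)"
  using sl_sys_lincomb[OF ph(1) sl_sys_scale[OF th(1), of z "- sa"], of ca]
  by (simp add: u_def[abs_def] u1_def[abs_def])

lemma u_a: "u z a = - sa" "u1 z a = ca"
  by (simp_all add: u_def u1_def th ph)

lemma u_cont: "continuous_on {a..b} (u z)" "continuous_on {a..b} (u1 z)"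
  using sl_sys_continuous[OF u_sys] by auto

text \<open>The condition at \<open>a\<close> leaves the line spanned by (- sin \<alpha>, cos
  \<alpha>), the initial data of \<open>u\<close>; the factor is the component along this unit
  vector.\<close>

lemma bc_a:
  assumes "y a * ca + y1 a * sa = 0"
  shows "\<exists>k. y a = k * u z a \<and> y1 a = k * u1 z a"
proof (intro exI conjI)
  let ?k = "ca * y1 a - sa * y a"
  have 1: "y a * ca = - (y1 a * sa)" using assms by (simp add: eq_neg_iff_add_eq_0)
  have "?k * u z a = (sa * sa) * y a - sa * (y1 a * ca)" by (simp add: u_a algebra_simps)
  also have "sa * (y1 a * ca) = - (ca * (y a * ca))" by (simp add: 1 algebra_simps)
  finally have "?k * u z a = (ca * ca + sa * sa) * y a" by (simp add: algebra_simps)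
  then show "y a = ?k * u z a" by (simp add: trig)
  have "?k * u1 z a = (ca * ca) * y1 a - sa * (y a * ca)" by (simp add: u_a algebra_simps)
  also have "\<dots> = (ca * ca + sa * sa) * y1 a" by (simp add: 1 algebra_simps)
  finally show "y1 a = ?k * u1 z a" by (simp add: trig)
qed

text \<open>The condition at \<open>b\<close> likewise leaves the line spanned by (sin \<beta>, cos
  \<beta>).\<close>

lemma bc_b:
  assumes "y b * cb - y1 b * sb = 0"
  shows "\<exists>k. y b = k * sb \<and> y1 b = k * cb"
proof (intro exI conjI)
  let ?k = "cb * y1 b + sb * y b"
  have 1: "y b * cb = y1 b * sb" using assms by simp
  have "?k * sb = cb * (y1 b * sb) + sb * sb * y b" by (simp add: algebra_simps)
  also have "\<dots> = (cb * cb + sb * sb) * y b" by (simp add: 1[symmetric] algebra_simps)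
  finally show "y b = ?k * sb" by (simp add: trig)
  have "?k * cb = cb * cb * y1 b + sb * (y b * cb)" by (simp add: algebra_simps)
  also have "\<dots> = (cb * cb + sb * sb) * y1 b" by (simp add: 1 algebra_simps)
  finally show "y1 b = ?k * cb" by (simp add: trig)
qed

lemma bc_cnj: "bc y y1 \<Longrightarrow> bc (\<lambda>x. cnj (y x)) (\<lambda>x. cnj (y1 x))"
  unfolding bc_def by (metis complex_cnj_add complex_cnj_complex_of_real complex_cnj_diff complex_cnj_mult complex_cnj_zero_iff)

lemma bc_wronskian:
  assumes "bc y y1" "bc w w1"
  shows "y a * w1 a - y1 a * w a = 0" "y b * w1 b - y1 b * w b = 0"
proof -
  obtain k l where "y a = k * u 0 a" "y1 a = k * u1 0 a" "w a = l * u 0 a" "w1 a = l * u1 0 a"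
    using bc_a assms unfolding bc_def by metis
  then show "y a * w1 a - y1 a * w a = 0" by simp
  obtain k l where "y b = k * sb" "y1 b = k * cb" "w b = l * sb" "w1 b = l * cb"
    using bc_b assms unfolding bc_def by metis
  then show "y b * w1 b - y1 b * w b = 0" by simp
qed

text \<open>Symmetry of the boundary value problem: data on a common line have Wronskian 0 at either
  endpoint, so Lagrange's identity loses its boundary terms.\<close>

lemma lagrange_bc:
  assumes y: "sl_sys z f y y1" "bc y y1" and w: "sl_sys z' g w w1" "bc w w1"
  shows "integral {a..b} (\<lambda>x. of_real (r x) * ((z - z') * (y x * w x) + f x * w x - g x * y x)) = 0"
  using AC_derivD[OF sl_wronskian[OF y(1) w(1)], of b] bc_wronskian[OF y(2) w(2)] ab by simp

lemma u_bc: "F z = 0 \<Longrightarrow> bc (u z) (u1 z)"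
  unfolding bc_def F_def u_a by (simp add: algebra_simps)

lemma u_nonzero: "\<exists>x\<in>{a..b}. u z x \<noteq> 0"
proof (rule ccontr)
  assume "\<not> ?thesis"
  then have 0: "u z x = 0" if "x \<in> {a..b}" for x using that by blast
  have "u1 z a = 0" by (rule sl_sys_zero_source(1)[OF u_sys 0]) (use ab in auto)
  moreover have "u z a = 0" using 0[of a] ab by simp
  ultimately show False using trig by (simp add: u_a)
qed

lemma u_norm_pos: "L2_norm M (u z) > 0"
  using u_nonzero L2_norm_continuous_pos[OF u_cont(1)] by blast

lemma u_L2: "u z \<in> L2 M" by (rule continuous_L2[OF u_cont(1)])

text \<open>The symmetry identity for \<open>u\<close> and its conjugate reads (cnj z - z) ||u||^2 =
  0.\<close>

lemma F_zero_real:
  assumes "F z = 0"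
  shows "z \<in> \<real>"
proof -
  have "integral {a..b} (\<lambda>x. of_real (r x) * ((cnj z - z) * (cnj (u z x) * u z x) + cnj 0 * u z x - 0 * cnj (u z x))) = 0"
    by (rule lagrange_bc[OF sl_sys_cnj[OF u_sys] bc_cnj[OF u_bc[OF assms]] u_sys u_bc[OF assms]])
  also have "(\<lambda>x. of_real (r x) * ((cnj z - z) * (cnj (u z x) * u z x) + cnj 0 * u z x - 0 * cnj (u z x)))
    = (\<lambda>x. (cnj z - z) * (of_real (r x) * (cnj (u z x) * u z x)))" by (rule ext) (simp add: algebra_simps)
  also have "integral {a..b} \<dots> = (cnj z - z) * L2_inner M (u z) (u z)"
    unfolding L2_inner_M[OF u_L2 u_L2] by (rule integral_mult_right)
  finally have "cnj z = z" using u_norm_pos[of z] by (simp add: L2_inner_self)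
  then show ?thesis by (simp add: complex_is_Real_iff complex_eq_iff)
qed

lemma u_real:
  assumes "z \<in> \<real>" "x \<in> {a..b}"
  shows "cnj (u z x) = u z x"
proof -
  have "cnj z = z" using assms(1) by (simp add: Reals_cnj_iff)
  then have "sl_sys z (\<lambda>_. 0) (\<lambda>x. cnj (u z x)) (\<lambda>x. cnj (u1 z x))"
    using sl_sys_cnj[OF u_sys, of z] by simp
  from sl_sys_unique(1)[OF this u_sys _ _ assms(2)] show ?thesis by (simp add: u_a)
qed

lemma u_entire: "x \<in> {a..b} \<Longrightarrow> (\<lambda>z. u z x) holomorphic_on UNIV" "x \<in> {a..b} \<Longrightarrow> (\<lambda>z. u1 z x) holomorphic_on UNIV"
  unfolding u_def u1_def by (intro holomorphic_intros fund_entire; assumption)+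

lemma u_integral_entire:
  assumes h: "(\<lambda>t. of_real (r t) * h t) absolutely_integrable_on {a..b}" and x: "x \<in> {a..b}"
  shows "(\<lambda>z. integral {a..x} (\<lambda>t. of_real (r t) * (u z t * h t))) holomorphic_on UNIV"
proof -
  have i: "(\<lambda>t. of_real (r t) * (k t * h t)) integrable_on {a..x}" if "continuous_on {a..b} k" for k
    using absolutely_integrable_mult_bounded[OF h that] by (intro abs_int_sub(2)[OF _ x]) (simp add: mult.left_commute)
  have "integral {a..x} (\<lambda>t. of_real (r t) * (u z t * h t)) = ca * integral {a..x} (\<lambda>t. of_real (r t) * (\<phi> z t * h t)) - sa * integral {a..x} (\<lambda>t. of_real (r t) * (\<theta> z t * h t))" for z
  proof -
    have "(\<lambda>t. of_real (r t) * (u z t * h t)) = (\<lambda>t. ca * (of_real (r t) * (\<phi> z t * h t)) - sa * (of_real (r t) * (\<theta> z t * h t)))"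
      by (rule ext) (simp add: u_def algebra_simps)
    then show ?thesis using i[OF fund_cont(1)] i[OF fund_cont(3)]
      by (simp add: Henstock_Kurzweil_Integration.integral_diff integrable_on_mult_right)
  qed
  then show ?thesis by (simp, intro holomorphic_intros fund_entire_integral h x)
qed

lemma F_entire: "F holomorphic_on UNIV"
  unfolding F_def[abs_def] using ab by (intro holomorphic_intros u_entire) auto

text \<open>The zero \<open>\<lambda>\<close> is simple, since \<open>k F(z) = (z - \<lambda>) \<integral> r u(\<lambda>) u(z)\<close> and \<open>u(\<lambda>)\<close> is real.\<close>

lemma F_simple:
  assumes "F l = 0"
  shows "deriv F l \<noteq> 0"
proof -
  define J where "J z = integral {a..b} (\<lambda>t. of_real (r t) * (u z t * u l t))" for z
  have l: "l \<in> \<real>" by (rule F_zero_real[OF assms])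
  obtain k where k: "u l b = k * sb" "u1 l b = k * cb"
    using bc_b u_bc[OF assms] unfolding bc_def by blast
  \<comment> \<open>At \<open>b\<close> the eigenfunction has data k (sin \<beta>, cos \<beta>), so
    its Wronskian with u(z) is - k F(z) there; at \<open>a\<close> the two have the same
    data.\<close>
  have kF: "k * F z = (z - l) * J z" for z
  proof -
    have "u l b * u1 z b - u1 l b * u z b = u l a * u1 z a - u1 l a * u z a + integral {a..b} (\<lambda>x. of_real (r x) * ((l - z) * (u l x * u z x) + 0 * u z x - 0 * u l x))"
      by (rule AC_derivD[OF sl_wronskian[OF u_sys u_sys]]) (use ab in simp)
    also have "(\<lambda>x. of_real (r x) * ((l - z) * (u l x * u z x) + 0 * u z x - 0 * u l x)) = (\<lambda>x. (l - z) * (of_real (r x) * (u z x * u l x)))"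
      by (rule ext) (simp add: algebra_simps)
    also have "integral {a..b} \<dots> = (l - z) * J z" unfolding J_def by (rule integral_mult_right)
    finally show ?thesis by (simp add: u_a k F_def algebra_simps)
  qed
  have "J holomorphic_on UNIV" unfolding J_def[abs_def]
    using ab by (intro u_integral_entire abs_int_r_mult u_cont) auto
  then have dJ: "(J has_field_derivative deriv J l) (at l)" by (auto intro!: holomorphic_derivI[of _ UNIV])
  have dF: "(F has_field_derivative deriv F l) (at l)" using F_entire by (auto intro!: holomorphic_derivI[of _ UNIV])
  have "((\<lambda>z. k * F z) has_field_derivative k * deriv F l) (at l)" using dF by (rule DERIV_cmult)
  moreover have "((\<lambda>z. (z - l) * J z) has_field_derivative J l) (at l)" using dJ by (auto intro!: derivative_eq_intros)
  ultimately have "k * deriv F l = J l" unfolding kF using DERIV_unique by blast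
  moreover have "J l = L2_inner M (u l) (u l)"
    unfolding J_def L2_inner_M[OF u_L2 u_L2] using u_real[OF l] by (intro Henstock_Kurzweil_Integration.integral_cong) simp
  ultimately show ?thesis using u_norm_pos[of l] by (auto simp: L2_inner_self)
qed

lemma F_growth: "\<exists>C K. K \<ge> 0 \<and> (\<forall>z. cmod z \<ge> 1 \<longrightarrow> cmod (F z) \<le> C * exp (K * sqrt (cmod z)))"
proof -
  obtain K where K: "K \<ge> 0" "\<And>z y y1 x. sl_sys z (\<lambda>_. 0) y y1 \<Longrightarrow> cmod (y a) \<le> 1 \<Longrightarrow> cmod (y1 a) \<le> 1 \<Longrightarrow> cmod z \<ge> 1 \<Longrightarrow> x \<in> {a..b} \<Longrightarrow>
     cmod (y x) \<le> exp (K * sqrt (cmod z)) \<and> cmod (y1 x) \<le> exp (K * sqrt (cmod z))"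
    using sl_growth by metis
  have "cmod (F z) \<le> 2 * exp (K * sqrt (cmod z))" if z: "cmod z \<ge> 1" for z
  proof -
    have b: "cmod (u z b) \<le> exp (K * sqrt (cmod z))" "cmod (u1 z b) \<le> exp (K * sqrt (cmod z))"
      using K(2)[OF u_sys _ _ z, of b] ab by (auto simp: u_a abs_cos_le_one abs_sin_le_one)
    have "cmod (F z) \<le> cmod cb * cmod (u z b) + cmod sb * cmod (u1 z b)"
      unfolding F_def by (rule order.trans[OF norm_triangle_ineq4]) (simp add: norm_mult)
    also have "\<dots> \<le> 1 * exp (K * sqrt (cmod z)) + 1 * exp (K * sqrt (cmod z))"
      using b by (intro add_mono mult_mono) (auto simp: abs_cos_le_one abs_sin_le_one)
    finally show ?thesis by simp
  qed
  then show ?thesis using K(1) by blast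
qed

section \<open>The graph of T and its eigenspaces\<close>

text \<open>The operator's definition picks a quasi-derivative for the maximal domain and again for
  the boundary conditions. Both are continuous, so agreement almost everywhere extends to the
  endpoints.\<close>

lemma quasi_deriv_unique:
  assumes "sl_sys z f y y1" "has_quasi_deriv p a b y y2" "x \<in> {a..b}"
  shows "y1 x = y2 x"
proof -
  have A: "AC_deriv a b y (\<lambda>x. y1 x / of_real (p x))" using assms(1) by (simp add: sl_sys_def)
  obtain g where B: "AC_deriv a b y (\<lambda>x. y2 x / of_real (p x))" "AC_deriv a b y2 g"
    using assms(2) unfolding has_quasi_deriv_iff by blast
  have "AE x in lebesgue. x \<in> {a<..<b} \<longrightarrow> y1 x - y2 x = 0"
    using AC_deriv_unique[OF A B(1)] p_pos[unfolded AE_lebesgue_on_iff] by eventually_elim auto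
  moreover have "continuous_on {a..b} (\<lambda>x. y1 x - y2 x)"
    by (intro continuous_intros sl_sys_continuous(2)[OF assms(1)] AC_deriv_continuous_on[OF B(2)])
  ultimately have "y1 x - y2 x = 0" using continuous_AE_zero ab assms(3) by blast
  then show ?thesis by simp
qed

lemma T_iff: "(g, f) \<in> T \<longleftrightarrow> (\<forall>x. x \<notin> {a..b} \<longrightarrow> g x = 0) \<and> f \<in> L2 M \<and> (\<exists>g1. sl_sys 0 f g g1 \<and> bc g g1)"
proof
  assume "(g, f) \<in> T"
  then obtain g1 g2 where g: "\<forall>x. x \<notin> {a..b} \<longrightarrow> g x = 0" "f \<in> L2 M"
      "has_quasi_deriv p a b g g1" "AE x in lebesgue_on {a<..<b}. f x = sl_tau q r g g1 x"
      "has_quasi_deriv p a b g g2" "g a * ca + g2 a * sa = 0" "g b * cb - g2 b * sb = 0"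
    unfolding T_def sl_T_def sl_Tmax_def by auto
  have s: "sl_sys 0 f g g1" unfolding sl_sys_iff using g(3,4) by (auto elim: eventually_mono)
  have "bc g g1" unfolding bc_def using quasi_deriv_unique[OF s g(5), of a] quasi_deriv_unique[OF s g(5), of b] g(6,7) ab by simp
  then show "(\<forall>x. x \<notin> {a..b} \<longrightarrow> g x = 0) \<and> f \<in> L2 M \<and> (\<exists>g1. sl_sys 0 f g g1 \<and> bc g g1)" using g s by blast
next
  assume A: "(\<forall>x. x \<notin> {a..b} \<longrightarrow> g x = 0) \<and> f \<in> L2 M \<and> (\<exists>g1. sl_sys 0 f g g1 \<and> bc g g1)"
  then obtain g1 where g: "sl_sys 0 f g g1" "bc g g1" by blast
  have "g \<in> L2 M" by (rule continuous_L2[OF sl_sys_continuous(1)[OF g(1)]])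
  moreover have "has_quasi_deriv p a b g g1" "AE x in lebesgue_on {a<..<b}. f x = sl_tau q r g g1 x"
    using g(1) unfolding sl_sys_iff by (auto elim: eventually_mono)
  ultimately show "(g, f) \<in> T"
    using A g(2) unfolding T_def sl_T_def sl_Tmax_def bc_def by blast
qed

text \<open>Domain elements are represented by functions that vanish outside [a,b], so the
  eigenfunction is cut off in the same way.\<close>

definition e0 where "e0 z x = (if x \<in> {a..b} then u z x else 0)"

lemma eigenspace_iff: "g \<in> eigenspace T z \<longleftrightarrow> (\<forall>x. x \<notin> {a..b} \<longrightarrow> g x = 0) \<and> (\<exists>g1. sl_sys z (\<lambda>_. 0) g g1 \<and> bc g g1)"
proof -
  have s: "sl_sys z (\<lambda>_. 0) g g1 \<longleftrightarrow> sl_sys 0 (\<lambda>x. z * g x) g g1" for g1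
    using sl_sys_shift[of z "\<lambda>_. 0" g g1 0] by simp
  have "(\<lambda>x. z * g x) \<in> L2 M" if "sl_sys z (\<lambda>_. 0) g g1" for g1
    by (intro L2_cmult continuous_L2 sl_sys_continuous(1)[OF that])
  then show ?thesis unfolding eigenspace_def mem_Collect_eq T_iff using s by blast
qed

text \<open>The condition at \<open>a\<close> makes every eigenfunction a multiple k u(z), and the
  condition at \<open>b\<close> then reads k F(z) = 0.\<close>

lemma eigenspace_eq: "eigenspace T z = (if F z = 0 then range (\<lambda>k x. k * e0 z x) else {\<lambda>_. 0})"
proof -
  have zero_in: "(\<lambda>x. k * e0 z x) \<in> eigenspace T z" if "F z = 0 \<or> k = 0" for k
  proof -
    have 1: "sl_sys z (\<lambda>_. 0) (\<lambda>x. k * u z x) (\<lambda>x. k * u1 z x)" using sl_sys_scale[OF u_sys, of z k] by simp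
    have "sl_sys z (\<lambda>_. 0) (\<lambda>x. k * e0 z x) (\<lambda>x. k * u1 z x)"
      by (rule sl_sys_cong[OF 1]) (auto simp: e0_def)
    moreover have "bc (\<lambda>x. k * e0 z x) (\<lambda>x. k * u1 z x)"
    proof (cases "k = 0")
      case False
      then have "bc (u z) (u1 z)" using that u_bc by blast
      then show ?thesis using ab unfolding bc_def e0_def
        by (simp add: mult.assoc flip: distrib_left right_diff_distrib)
    qed (simp add: bc_def)
    ultimately show ?thesis unfolding eigenspace_iff by (auto simp: e0_def)
  qed
  have sub: "\<exists>k. g = (\<lambda>x. k * e0 z x) \<and> (F z \<noteq> 0 \<longrightarrow> k = 0)" if gE: "g \<in> eigenspace T z" for g
  proof -
    obtain g1 where g: "\<forall>x. x \<notin> {a..b} \<longrightarrow> g x = 0" "sl_sys z (\<lambda>_. 0) g g1" "bc g g1"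
      using gE unfolding eigenspace_iff by blast
    obtain k where k: "g a = k * u z a" "g1 a = k * u1 z a" using bc_a g(3) unfolding bc_def by blast
    have 1: "sl_sys z (\<lambda>_. 0) (\<lambda>x. k * u z x) (\<lambda>x. k * u1 z x)" using sl_sys_scale[OF u_sys, of z k] by simp
    note e = sl_sys_unique[OF g(2) 1 k]
    have "g = (\<lambda>x. k * e0 z x)" using e(1) g(1) by (auto simp: e0_def)
    moreover have "k * F z = 0" using g(3) e[of b] ab unfolding bc_def F_def by (simp add: algebra_simps)
    ultimately show ?thesis by auto
  qed
  show ?thesis
  proof (cases "F z = 0")
    case True
    have "eigenspace T z \<subseteq> range (\<lambda>k x. k * e0 z x)"
    proof
      fix g assume "g \<in> eigenspace T z"
      then obtain k where "g = (\<lambda>x. k * e0 z x)" using sub by blast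
      then show "g \<in> range (\<lambda>k x. k * e0 z x)" by (rule range_eqI)
    qed
    moreover have "range (\<lambda>k x. k * e0 z x) \<subseteq> eigenspace T z" using zero_in True by blast
    ultimately show ?thesis using True by auto
  next
    case False
    then have "eigenspace T z \<subseteq> {\<lambda>_. 0}" using sub by fastforce
    moreover have "(\<lambda>_. 0) \<in> eigenspace T z" using zero_in[of 0] by simp
    ultimately show ?thesis using False by auto
  qed
qed

lemma e0_nonzero: "e0 z \<noteq> (\<lambda>_. 0)"
proof
  assume z: "e0 z = (\<lambda>_. 0)"
  obtain x where "x \<in> {a..b}" "u z x \<noteq> 0" using u_nonzero by blast
  then show False using fun_cong[OF z, of x] by (simp add: e0_def)
qed

lemma eigenvalues_eq: "eigenvalues T = {z. F z = 0}"
proof -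
  have "z \<in> eigenvalues T \<longleftrightarrow> F z = 0" for z
  proof
    assume "z \<in> eigenvalues T"
    then show "F z = 0" unfolding eigenvalues_def eigenspace_eq by (auto split: if_splits)
  next
    assume F: "F z = 0"
    have "e0 z \<in> range (\<lambda>k x. k * e0 z x)" by (rule range_eqI[of _ _ 1]) simp
    then have "e0 z \<in> eigenspace T z" using F by (simp add: eigenspace_eq)
    then show "z \<in> eigenvalues T" unfolding eigenvalues_def using e0_nonzero by blast
  qed
  then show ?thesis by blast
qed

lemma multiplicity_eq: "multiplicity_of T z = (if F z = 0 then 1 else 0)"
proof -
  \<comment> \<open>The vector space meant by the multiplicity: complex functions with pointwise
    scaling. The eigenspace is the span of one nonzero vector or of none.\<close>
  interpret vs: vector_space "\<lambda>(c::complex) (g::real \<Rightarrow> complex) x. c * g x"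
    by unfold_locales (auto simp: fun_eq_iff algebra_simps)
  have e0: "e0 z \<noteq> 0" using e0_nonzero by (auto simp: zero_fun_def)
  have "vs.dim (eigenspace T z) = (if F z = 0 then 1 else 0)"
  proof (cases "F z = 0")
    case True
    then have "eigenspace T z = vs.span {e0 z}" by (simp add: eigenspace_eq vs.span_singleton)
    then show ?thesis using vs.dim_span_eq_card_independent[of "{e0 z}"] e0 True by simp
  next
    case False
    then have "eigenspace T z = vs.span {}" by (simp add: eigenspace_eq zero_fun_def)
    then show ?thesis using vs.dim_span_eq_card_independent[OF vs.independent_empty] False by simp
  qed
  then show ?thesis unfolding multiplicity_of_def .
qed

end

section \<open>Resolvent and completeness of the eigenfunctions\<close>

context sl_coeffs
begin

text \<open>Cauchy-Schwarz against the constant 1, which lies in L2 because r is integrable.\<close>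

lemma L1_bound:
  assumes f: "f \<in> L2 M"
  shows "integral {a..b} (\<lambda>t. cmod (of_real (r t) * f t)) \<le> L2_norm M (\<lambda>_. 1) * L2_norm M f"
proof -
  define h where "h t = complex_of_real (cmod (f t))" for t
  have oneL: "(\<lambda>_. 1) \<in> L2 M" by (intro continuous_L2 continuous_intros)
  have hL: "h \<in> L2 M" using f unfolding L2_def h_def by auto
  have nh: "L2_norm M h = L2_norm M f" by (simp add: L2_norm_def h_def)
  have abs: "(\<lambda>t. cmod (of_real (r t) * f t)) absolutely_integrable_on {a..b}"
    by (rule set_integrable_norm[OF L2_abs_int[OF f]])
  then have int: "(\<lambda>t. cmod (of_real (r t) * f t)) integrable_on {a..b}"
    by (rule set_lebesgue_integral_eq_integral(1))
  have c: "complex_of_real (integral {a..b} (\<lambda>t. cmod (of_real (r t) * f t))) = integral {a..b} (\<lambda>t. complex_of_real (cmod (of_real (r t) * f t)))"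
    using integral_linear[OF int bounded_linear_of_real[where 'a=complex]] by (simp add: o_def)
  have "AE t in lebesgue. t \<in> {a<..<b} \<longrightarrow> complex_of_real (cmod (of_real (r t) * f t)) = of_real (r t) * (cnj 1 * h t)"
    using r_pos[unfolded AE_lebesgue_on_iff] by eventually_elim (auto simp: h_def norm_mult)
  from absolutely_integrable_cong_AE(2)[OF cabs[OF abs] this, of b]
  have "integral {a..b} (\<lambda>t. complex_of_real (cmod (of_real (r t) * f t))) = L2_inner M (\<lambda>_. 1) h"
    by (simp add: L2_inner_M[OF oneL hL])
  with c have "complex_of_real (integral {a..b} (\<lambda>t. cmod (of_real (r t) * f t))) = L2_inner M (\<lambda>_. 1) h" by simp
  then have "\<bar>integral {a..b} (\<lambda>t. cmod (of_real (r t) * f t))\<bar> = cmod (L2_inner M (\<lambda>_. 1) h)" by (metis norm_of_real)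
  then show ?thesis using L2_Cauchy_Schwarz[OF oneL hL] by (simp add: nh)
qed

lemma integral_L2_bound:
  assumes f: "f \<in> L2 M" and k: "continuous_on {a..b} k" "\<And>t. t \<in> {a..b} \<Longrightarrow> cmod (k t) \<le> K" "K \<ge> 0" and x: "x \<in> {a..b}"
  shows "cmod (integral {a..x} (\<lambda>t. of_real (r t) * (k t * f t))) \<le> K * (L2_norm M (\<lambda>_. 1) * L2_norm M f)"
proof -
  have abs: "(\<lambda>t. cmod (of_real (r t) * f t)) absolutely_integrable_on {a..b}"
    by (rule set_integrable_norm[OF L2_abs_int[OF f]])
  have absx: "(\<lambda>t. cmod (of_real (r t) * f t)) absolutely_integrable_on {a..x}"
    using absolutely_integrable_on_subinterval[OF abs, of a x] x by auto
  have int: "(\<lambda>t. cmod (of_real (r t) * f t)) integrable_on {a..x}" "(\<lambda>t. cmod (of_real (r t) * f t)) integrable_on {a..b}"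
    using abs absx by (auto intro: set_lebesgue_integral_eq_integral(1))
  have ki: "(\<lambda>t. of_real (r t) * (k t * f t)) integrable_on {a..x}"
    using abs_int_sub(2)[OF absolutely_integrable_mult_bounded[OF L2_abs_int[OF f] k(1)] x] by (simp add: mult.left_commute)
  have "cmod (integral {a..x} (\<lambda>t. of_real (r t) * (k t * f t))) \<le> integral {a..x} (\<lambda>t. K * cmod (of_real (r t) * f t))"
  proof (rule integral_norm_bound_integral[OF ki])
    show "(\<lambda>t. K * cmod (of_real (r t) * f t)) integrable_on {a..x}" by (rule integrable_on_mult_right[OF int(1)])
    fix t assume "t \<in> {a..x}"
    then have "cmod (k t) * cmod (of_real (r t) * f t) \<le> K * cmod (of_real (r t) * f t)" using k x by (intro mult_right_mono) auto
    then show "cmod (of_real (r t) * (k t * f t)) \<le> K * cmod (of_real (r t) * f t)" by (simp add: norm_mult mult_ac)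
  qed
  also have "\<dots> = K * integral {a..x} (\<lambda>t. cmod (of_real (r t) * f t))" by (rule integral_mult_right)
  also have "\<dots> \<le> K * integral {a..b} (\<lambda>t. cmod (of_real (r t) * f t))"
    using k(3) x int by (intro mult_left_mono integral_subset_le) auto
  also have "\<dots> \<le> K * (L2_norm M (\<lambda>_. 1) * L2_norm M f)" by (intro mult_left_mono L1_bound f k)
  finally show ?thesis .
qed

end

section \<open>The resolvent\<close>

context sl_bvp
begin

text \<open>\<open>w\<close> solves the equation with source f and zero data at \<open>a\<close>, so
  it satisfies the condition there; \<open>\<Phi>\<close> is its defect in the condition at
  \<open>b\<close>. Subtracting the multiple of \<open>u\<close> that repairs the defect gives
  \<open>res\<close>, which is (T - z)^(-1) f whenever F z is nonzero.\<close>

definition w where "w z f = green z \<theta> \<phi> f"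
definition w1 where "w1 z f = green z \<theta>1 \<phi>1 f"
definition \<Phi> where "\<Phi> z f = cb * w z f b - sb * w1 z f b"
definition res where "res z f x = w z f x - \<Phi> z f / F z * u z x"
definition res1 where "res1 z f x = w1 z f x - \<Phi> z f / F z * u1 z x"

lemma w_sys: "f \<in> L2 M \<Longrightarrow> sl_sys z f (w z f) (w1 z f)"
  unfolding w_def w1_def by (intro sl_sys_green L2_abs_int)

lemma res_sys:
  assumes f: "f \<in> L2 M"
  shows "sl_sys z f (res z f) (res1 z f)"
  using sl_sys_lincomb[OF u_sys w_sys[OF f], of z "- \<Phi> z f / F z"]
  by (simp add: res_def[abs_def] res1_def[abs_def])

lemma res_bc:
  assumes "F z \<noteq> 0"
  shows "bc (res z f) (res1 z f)"
proof -
  have "res z f a * ca + res1 z f a * sa = 0"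
    by (simp add: res_def res1_def w_def w1_def green_a u_a)
  moreover have "res z f b * cb - res1 z f b * sb = \<Phi> z f - \<Phi> z f / F z * F z"
  proof -
    define k where "k = \<Phi> z f / F z"
    have "res z f b * cb - res1 z f b * sb = (cb * w z f b - sb * w1 z f b) - k * (cb * u z b - sb * u1 z b)"
      unfolding res_def res1_def k_def[symmetric] by (simp add: algebra_simps)
    then show ?thesis unfolding \<Phi>_def[symmetric] F_def[symmetric] k_def .
  qed
  ultimately show ?thesis using assms by (simp add: bc_def)
qed

text \<open>The difference of two solutions is a multiple k u(z) with k F(z) = 0.\<close>

lemma bc_unique:
  assumes y: "sl_sys z f y y1" "bc y y1" and v: "sl_sys z f v v1" "bc v v1" and "F z \<noteq> 0" and x: "x \<in> {a..b}"
  shows "y x = v x"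
proof -
  define d where "d x = (- 1) * v x + y x" for x
  define d1 where "d1 x = (- 1) * v1 x + y1 x" for x
  have d: "sl_sys z (\<lambda>_. 0) d d1"
    using sl_sys_lincomb[OF v(1) y(1), of "-1"] by (simp add: d_def[abs_def] d1_def[abs_def])
  have "d a * ca + d1 a * sa = (y a * ca + y1 a * sa) - (v a * ca + v1 a * sa)"
    "d b * cb - d1 b * sb = (y b * cb - y1 b * sb) - (v b * cb - v1 b * sb)"
    unfolding d_def d1_def by (simp_all add: algebra_simps)
  then have bcd: "bc d d1" using y(2) v(2) unfolding bc_def by simp
  obtain k where k: "d a = k * u z a" "d1 a = k * u1 z a" using bc_a bcd unfolding bc_def by blast
  have 1: "sl_sys z (\<lambda>_. 0) (\<lambda>x. k * u z x) (\<lambda>x. k * u1 z x)" using sl_sys_scale[OF u_sys, of z k] by simp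
  note e = sl_sys_unique[OF d 1 k]
  have "k * F z = 0" using bcd e[of b] ab unfolding bc_def F_def by (simp add: algebra_simps)
  then have "d x = 0" using e(1)[OF x] \<open>F z \<noteq> 0\<close> by simp
  then show ?thesis by (simp add: d_def)
qed

text \<open>Both sides solve the same boundary value problem, so uniqueness replaces a computation
  with the formula for \<open>res\<close>.\<close>

lemma res_lin:
  assumes f: "f \<in> L2 M" and g: "g \<in> L2 M" and "F z \<noteq> 0" and x: "x \<in> {a..b}"
  shows "res z (\<lambda>t. c * f t + g t) x = c * res z f x + res z g x"
proof (rule bc_unique[OF res_sys[OF L2_lincomb[OF f g]] res_bc[OF assms(3)] _ _ assms(3) x])
  show "sl_sys z (\<lambda>t. c * f t + g t) (\<lambda>x. c * res z f x + res z g x) (\<lambda>x. c * res1 z f x + res1 z g x)"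
    by (rule sl_sys_lincomb[OF res_sys[OF f] res_sys[OF g]])
  have "bc (res z f) (res1 z f)" "bc (res z g) (res1 z g)" by (rule res_bc[OF assms(3)])+
  then have 1: "res z f a * ca + res1 z f a * sa = 0" "res z f b * cb - res1 z f b * sb = 0"
    "res z g a * ca + res1 z g a * sa = 0" "res z g b * cb - res1 z g b * sb = 0" unfolding bc_def by auto
  have "(c * res z f a + res z g a) * ca + (c * res1 z f a + res1 z g a) * sa = c * (res z f a * ca + res1 z f a * sa) + (res z g a * ca + res1 z g a * sa)"
    "(c * res z f b + res z g b) * cb - (c * res1 z f b + res1 z g b) * sb = c * (res z f b * cb - res1 z f b * sb) + (res z g b * cb - res1 z g b * sb)"
    by (simp_all add: algebra_simps)
  then show "bc (\<lambda>x. c * res z f x + res z g x) (\<lambda>x. c * res1 z f x + res1 z g x)"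
    unfolding bc_def 1 by simp
qed

text \<open>A bound from L2 into the supremum norm at z = 0; it later converts the L2 estimate for
  the resolvent at z into a pointwise one.\<close>

lemma res0_bound: "\<exists>C\<ge>0. \<forall>f\<in>L2 M. \<forall>x\<in>{a..b}. cmod (res 0 f x) \<le> C * L2_norm M f"
proof -
  obtain K where K: "K \<ge> 0" "\<forall>x\<in>{a..b}. cmod (\<theta> 0 x) \<le> K \<and> cmod (\<theta>1 0 x) \<le> K \<and> cmod (\<phi> 0 x) \<le> K \<and> cmod (\<phi>1 0 x) \<le> K"
    using fund_bound by blast
  define D where "D = L2_norm M (\<lambda>_. 1 :: complex)"
  have D: "D \<ge> 0" by (simp add: D_def L2_norm_nonneg)
  have gb: "cmod (green 0 v1 v2 f x) \<le> 2 * K^2 * D * L2_norm M f"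
    if f: "f \<in> L2 M" and x: "x \<in> {a..b}" and v: "cmod (v1 0 x) \<le> K" "cmod (v2 0 x) \<le> K" for f x v1 v2
  proof -
    have I: "cmod (integral {a..x} (\<lambda>t. of_real (r t) * (\<phi> 0 t * f t))) \<le> K * (D * L2_norm M f)"
      "cmod (integral {a..x} (\<lambda>t. of_real (r t) * (\<theta> 0 t * f t))) \<le> K * (D * L2_norm M f)"
      unfolding D_def using K by (intro integral_L2_bound f fund_cont x; simp)+
    have "cmod (green 0 v1 v2 f x) \<le> cmod (v1 0 x) * cmod (integral {a..x} (\<lambda>t. of_real (r t) * (\<phi> 0 t * f t)))
       + cmod (v2 0 x) * cmod (integral {a..x} (\<lambda>t. of_real (r t) * (\<theta> 0 t * f t)))"
      unfolding green_def by (rule order.trans[OF norm_triangle_ineq4]) (simp add: norm_mult)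
    also have "\<dots> \<le> K * (K * (D * L2_norm M f)) + K * (K * (D * L2_norm M f))"
      using I v K by (intro add_mono mult_mono) auto
    finally show ?thesis by (simp add: power2_eq_square algebra_simps)
  qed
  define B where "B = 2 * K^2 * D"
  have B: "B \<ge> 0" using D by (simp add: B_def)
  have "cmod (res 0 f x) \<le> (B + 2 * B / cmod (F 0) * (2 * K)) * L2_norm M f" if f: "f \<in> L2 M" and x: "x \<in> {a..b}" for f x
  proof -
    have w: "cmod (w 0 f y) \<le> B * L2_norm M f" "cmod (w1 0 f y) \<le> B * L2_norm M f" if "y \<in> {a..b}" for y
      unfolding w_def w1_def B_def using K that by (auto intro!: gb f)
    have "cmod (\<Phi> 0 f) \<le> cmod cb * cmod (w 0 f b) + cmod sb * cmod (w1 0 f b)"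
      unfolding \<Phi>_def by (rule order.trans[OF norm_triangle_ineq4]) (simp add: norm_mult)
    also have "\<dots> \<le> 1 * (B * L2_norm M f) + 1 * (B * L2_norm M f)"
      using w[of b] ab by (intro add_mono mult_mono) (auto simp: abs_cos_le_one abs_sin_le_one)
    finally have Ph: "cmod (\<Phi> 0 f) \<le> 2 * B * L2_norm M f" by simp
    have "cmod (u 0 x) \<le> cmod ca * cmod (\<phi> 0 x) + cmod sa * cmod (\<theta> 0 x)"
      unfolding u_def by (rule order.trans[OF norm_triangle_ineq4]) (simp add: norm_mult)
    also have "\<dots> \<le> 1 * K + 1 * K"
      using K x by (intro add_mono mult_mono) (auto simp: abs_cos_le_one abs_sin_le_one)
    finally have ub: "cmod (u 0 x) \<le> 2 * K" by simp
    have "cmod (res 0 f x) \<le> cmod (w 0 f x) + cmod (\<Phi> 0 f) / cmod (F 0) * cmod (u 0 x)"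
      unfolding res_def by (rule order.trans[OF norm_triangle_ineq4]) (simp add: norm_mult norm_divide)
    also have "\<dots> \<le> B * L2_norm M f + (2 * B * L2_norm M f) / cmod (F 0) * (2 * K)"
      using w(1)[OF x] Ph ub B L2_norm_nonneg[of M f] by (intro add_mono mult_mono divide_right_mono) auto
    finally show ?thesis by (simp add: algebra_simps)
  qed
  moreover have "B + 2 * B / cmod (F 0) * (2 * K) \<ge> 0" using B K by simp
  ultimately show ?thesis by blast
qed

lemma res_cont: "f \<in> L2 M \<Longrightarrow> continuous_on {a..b} (res z f)"
  by (rule sl_sys_continuous(1)[OF res_sys])

lemma res_L2: "f \<in> L2 M \<Longrightarrow> res z f \<in> L2 M"
  by (rule continuous_L2[OF res_cont])

text \<open>Lagrange's identity for the solution y and its conjugate gives 2 |Im z| ||y||^2 <= 2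
  ||f|| ||y||, the bound familiar from self-adjoint operators.\<close>

lemma resolvent_norm:
  assumes f: "f \<in> L2 M" and z: "Im z \<noteq> 0"
  shows "\<bar>Im z\<bar> * L2_norm M (res z f) \<le> L2_norm M f"
proof -
  let ?y = "res z f"
  have Fz: "F z \<noteq> 0" using F_zero_real[of z] z by (auto simp: complex_is_Real_iff)
  note y = res_L2[OF f, of z]
  have i: "(\<lambda>x. of_real (r x) * (cnj (g x) * h x)) integrable_on {a..b}" if "g \<in> L2 M" "h \<in> L2 M" for g h
    using L2_mult_integrable[OF that] integrable_M_iff[of "\<lambda>x. cnj (g x) * h x"]
    by (intro set_lebesgue_integral_eq_integral(1)) auto
  have "integral {a..b} (\<lambda>x. of_real (r x) * ((cnj z - z) * (cnj (?y x) * ?y x) + cnj (f x) * ?y x - f x * cnj (?y x))) = 0"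
    by (rule lagrange_bc[OF sl_sys_cnj[OF res_sys[OF f]] bc_cnj[OF res_bc[OF Fz]] res_sys[OF f] res_bc[OF Fz]])
  also have "(\<lambda>x. of_real (r x) * ((cnj z - z) * (cnj (?y x) * ?y x) + cnj (f x) * ?y x - f x * cnj (?y x)))
    = (\<lambda>x. ((cnj z - z) * (of_real (r x) * (cnj (?y x) * ?y x)) + of_real (r x) * (cnj (f x) * ?y x)) - of_real (r x) * (cnj (?y x) * f x))"
    by (rule ext) (simp add: algebra_simps)
  also have "integral {a..b} \<dots> = ((cnj z - z) * L2_inner M ?y ?y + L2_inner M f ?y) - L2_inner M ?y f"
    unfolding L2_inner_M[OF y y] L2_inner_M[OF f y] L2_inner_M[OF y f]
    using i[OF y y] i[OF f y] i[OF y f]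
    by (simp add: Henstock_Kurzweil_Integration.integral_diff Henstock_Kurzweil_Integration.integral_add integrable_on_mult_right integrable_add)
  finally have "(cnj z - z) * L2_inner M ?y ?y = L2_inner M ?y f - L2_inner M f ?y" by (simp add: algebra_simps eq_neg_iff_add_eq_0)
  then have "cmod ((cnj z - z) * L2_inner M ?y ?y) \<le> cmod (L2_inner M ?y f) + cmod (L2_inner M f ?y)"
    using norm_triangle_ineq4 by metis
  also have "\<dots> \<le> L2_norm M ?y * L2_norm M f + L2_norm M f * L2_norm M ?y"
    by (intro add_mono L2_Cauchy_Schwarz f y)
  also have "cmod ((cnj z - z) * L2_inner M ?y ?y) = 2 * \<bar>Im z\<bar> * (L2_norm M ?y)\<^sup>2"
  proof -
    have "cnj z - z = - (of_real (2 * Im z) * \<i>)" by (simp add: complex_eq_iff)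
    then have "cmod (cnj z - z) = 2 * \<bar>Im z\<bar>" by (simp add: norm_mult)
    then show ?thesis by (simp add: norm_mult L2_inner_self norm_power)
  qed
  finally have *: "\<bar>Im z\<bar> * (L2_norm M ?y)\<^sup>2 \<le> L2_norm M f * L2_norm M ?y" by simp
  show ?thesis
  proof (cases "L2_norm M ?y = 0")
    case True
    then show ?thesis using L2_norm_nonneg[of M f] by simp
  next
    case False
    then have "L2_norm M ?y > 0" using L2_norm_nonneg[of M ?y] by linarith
    moreover from * have "(\<bar>Im z\<bar> * L2_norm M ?y) * L2_norm M ?y \<le> L2_norm M f * L2_norm M ?y"
      by (simp add: power2_eq_square mult.assoc)
    ultimately show ?thesis by simp
  qed
qed

text \<open>The Wronskians of u(z) with \<theta>(z) and \<phi>(z) are constant; at \<open>a\<close>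
  they are cos \<alpha> and sin \<alpha>, which are not both 0.\<close>

lemma u_b_nonzero: "u z b \<noteq> 0 \<or> u1 z b \<noteq> 0"
proof (rule ccontr)
  assume "\<not> ?thesis"
  then have 0: "u z b = 0" "u1 z b = 0" by auto
  have "\<theta> z b * u1 z b - \<theta>1 z b * u z b = \<theta> z a * u1 z a - \<theta>1 z a * u z a"
    by (rule AC_deriv_zero[OF sl_wronskian[OF th(1) u_sys]]) (use ab in auto)
  moreover have "\<phi> z b * u1 z b - \<phi>1 z b * u z b = \<phi> z a * u1 z a - \<phi>1 z a * u z a"
    by (rule AC_deriv_zero[OF sl_wronskian[OF ph(1) u_sys]]) (use ab in auto)
  ultimately have "ca = 0" "sa = 0" using 0 by (simp_all add: th ph u_a)
  then show False using trig(1) by simp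
qed

lemma w_entire:
  assumes f: "f \<in> L2 M" and x: "x \<in> {a..b}"
  shows "(\<lambda>z. w z f x) holomorphic_on UNIV" "(\<lambda>z. w1 z f x) holomorphic_on UNIV"
  unfolding w_def w1_def green_def by (intro holomorphic_intros fund_entire fund_entire_integral L2_abs_int f x)+

text \<open>Lagrange's identity for u(l) and w(l) makes the defect at \<open>b\<close> a multiple of
  <u(l), f>. Orthogonality thus removes the pole of the resolvent at the eigenvalue.\<close>

lemma \<Phi>_zero:
  assumes f: "f \<in> L2 M" and orth: "L2_inner M (u l) f = 0" and l: "F l = 0"
  shows "\<Phi> l f = 0"
proof -
  have lR: "l \<in> \<real>" by (rule F_zero_real[OF l])
  obtain k where k: "u l b = k * sb" "u1 l b = k * cb" using bc_b u_bc[OF l] unfolding bc_def by blast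
  have "k \<noteq> 0" using u_b_nonzero[of l] k by auto
  have "u l b * w1 l f b - u1 l b * w l f b = u l a * w1 l f a - u1 l a * w l f a
     + integral {a..b} (\<lambda>x. of_real (r x) * ((l - l) * (u l x * w l f x) + 0 * w l f x - f x * u l x))"
    by (rule AC_derivD[OF sl_wronskian[OF u_sys w_sys[OF f]]]) (use ab in simp)
  also have "integral {a..b} (\<lambda>x. of_real (r x) * ((l - l) * (u l x * w l f x) + 0 * w l f x - f x * u l x))
    = integral {a..b} (\<lambda>x. (- 1) * (of_real (r x) * (cnj (u l x) * f x)))"
    using u_real[OF lR] by (intro Henstock_Kurzweil_Integration.integral_cong) (simp add: mult_ac)
  also have "\<dots> = (- 1) * L2_inner M (u l) f" unfolding L2_inner_M[OF u_L2 f] by (rule integral_mult_right)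
  finally have "k * sb * w1 l f b - k * cb * w l f b = 0" by (simp only: orth k) (simp add: w_def w1_def green_a)
  moreover have "k * \<Phi> l f = - (k * sb * w1 l f b - k * cb * w l f b)" by (simp add: \<Phi>_def algebra_simps)
  ultimately have "k * \<Phi> l f = 0" by (metis minus_zero)
  then show ?thesis using \<open>k \<noteq> 0\<close> by simp
qed

text \<open>If \<open>f\<close> is orthogonal to all eigenfunctions, \<open>z \<mapsto> (T - z)\<^sup>-\<^sup>1 f\<close> is entire. It is \<open>O(|z| / |Im z|)\<close>;
  multiplying by \<open>z\<^sup>2 - R\<^sup>2\<close>, of modulus \<open>2R |Im z|\<close> on the circle \<open>|z| = R\<close>, shows that it is bounded,
  hence constant, which forces \<open>f = 0\<close>.\<close>

lemma eigenfunctions_complete: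
  assumes f: "f \<in> L2 M" and orth: "\<And>l. F l = 0 \<Longrightarrow> L2_inner M (u l) f = 0" and F0: "F 0 \<noteq> 0"
  shows "AE x in M. f x = 0"
proof -
  obtain C where C: "C \<ge> 0" "\<And>f x. f \<in> L2 M \<Longrightarrow> x \<in> {a..b} \<Longrightarrow> cmod (res 0 f x) \<le> C * L2_norm M f"
    using res0_bound by blast
  \<comment> \<open>Resolvent identity: the solution y at z solves the problem at 0 with source z y
    + f, so its values are controlled by L2 norms.\<close>
  have rb: "cmod (res z f x) \<le> C * (cmod z * (L2_norm M f / \<bar>Im z\<bar>) + L2_norm M f)" if z: "Im z \<noteq> 0" and x: "x \<in> {a..b}" for z x
  proof -
    have Fz: "F z \<noteq> 0" using F_zero_real[of z] z by (auto simp: complex_is_Real_iff)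
    note y = res_L2[OF f, of z]
    have s: "sl_sys 0 (\<lambda>x. z * res z f x + f x) (res z f) (res1 z f)"
      using res_sys[OF f, of z] sl_sys_shift[of z f "res z f" "res1 z f" 0] by simp
    have "res z f x = res 0 (\<lambda>x. z * res z f x + f x) x"
      by (rule bc_unique[OF s res_bc[OF Fz] res_sys[OF L2_lincomb[OF y f]] res_bc[OF F0] F0 x])
    also have "\<dots> = z * res 0 (res z f) x + res 0 f x" by (rule res_lin[OF y f F0 x])
    finally have "cmod (res z f x) = cmod (z * res 0 (res z f) x + res 0 f x)" by (rule arg_cong)
    also have "\<dots> \<le> cmod z * cmod (res 0 (res z f) x) + cmod (res 0 f x)" by (metis norm_mult norm_triangle_ineq)
    also have "\<dots> \<le> cmod z * (C * L2_norm M (res z f)) + C * L2_norm M f"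
      by (intro add_mono mult_left_mono C(2) f y x norm_ge_zero)
    also have "\<dots> \<le> cmod z * (C * (L2_norm M f / \<bar>Im z\<bar>)) + C * L2_norm M f"
      using resolvent_norm[OF f z] z C(1) by (intro add_mono mult_left_mono) (simp_all add: pos_le_divide_eq mult.commute)
    finally show ?thesis by (simp add: algebra_simps)
  qed
  have const: "res \<i> f x = res 0 f x" if x: "x \<in> {a..b}" for x
  proof -
    \<comment> \<open>F times the resolvent value at \<open>x\<close>: entire in z, and zero
      wherever F is, so that the quotient is entire.\<close>
    define N where "N z = F z * w z f x - \<Phi> z f * u z x" for z
    have "N holomorphic_on UNIV" unfolding N_def[abs_def] \<Phi>_def
      using ab by (intro holomorphic_intros F_entire w_entire u_entire f x) auto
    moreover have "N l = 0 \<and> deriv F l \<noteq> 0" if "F l = 0" for l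
      using \<Phi>_zero[OF f orth[OF that] that] F_simple[OF that] that by (simp add: N_def)
    ultimately obtain Y where Y: "Y holomorphic_on UNIV" "\<And>z. N z = F z * Y z"
      using entire_quotient[OF F_entire] by metis
    have Yres: "Y z = res z f x" if "F z \<noteq> 0" for z
      using Y(2)[of z] that by (simp add: N_def res_def field_simps)
    have bound: "cmod (Y z0) \<le> 16 / 3 * (C * L2_norm M f)" for z0
    proof -
      \<comment> \<open>A radius of at least 2 |z0| keeps |z0^2 - t^2| above (3/4) t^2, and with the
        bound 4 t^2 on the circle this produces the constant 16/3. The maximum with 1 excludes t =
        0.\<close>
      define t where "t = max (2 * cmod z0) 1"
      have t: "t \<ge> 1" "cmod z0 \<le> t / 2" by (auto simp: t_def)
      have "cmod ((z0^2 - of_real (t^2)) * Y z0) \<le> 4 * t^2 * (C * L2_norm M f)"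
      proof (rule holomorphic_max_bound[of "\<lambda>z. (z^2 - of_real (t^2)) * Y z" t])
        show "(\<lambda>z. (z\<^sup>2 - of_real (t\<^sup>2)) * Y z) holomorphic_on UNIV" by (intro holomorphic_intros Y)
        fix z assume zt: "cmod z = t"
        have z2: "z^2 - of_real (t^2) = 2 * \<i> * of_real (Im z) * z"
        proof -
          have "complex_of_real (t^2) = z * cnj z" by (simp add: zt[symmetric] complex_norm_square del: of_real_power)
          then have "z^2 - of_real (t^2) = z * (z - cnj z)" by (simp add: power2_eq_square algebra_simps)
          also have "z - cnj z = 2 * \<i> * of_real (Im z)" by (simp add: complex_eq_iff)
          finally show ?thesis by (simp add: mult_ac)
        qed
        have n: "cmod ((z^2 - of_real (t^2)) * Y z) = 2 * \<bar>Im z\<bar> * t * cmod (Y z)"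
          unfolding z2 by (simp add: norm_mult zt)
        show "cmod ((z^2 - of_real (t^2)) * Y z) \<le> 4 * t^2 * (C * L2_norm M f)"
        proof (cases "Im z = 0")
          \<comment> \<open>On the real axis, where the resolvent bound says nothing, the multiplier
            vanishes.\<close>
          case True
          then show ?thesis unfolding n using C t L2_norm_nonneg[of M f] by simp
        next
          case False
          then have Fz: "F z \<noteq> 0" using F_zero_real[of z] by (auto simp: complex_is_Real_iff)
          have Imt: "\<bar>Im z\<bar> \<le> t" using abs_Im_le_cmod[of z] zt by simp
          have "2 * \<bar>Im z\<bar> * t * cmod (Y z) \<le> 2 * \<bar>Im z\<bar> * t * (C * (t * (L2_norm M f / \<bar>Im z\<bar>) + L2_norm M f))"
            using rb[OF False x] t unfolding Yres[OF Fz] zt by (intro mult_left_mono) auto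
          also have "\<dots> = 2 * t * (C * L2_norm M f) * (t + \<bar>Im z\<bar>)" using False by (simp add: field_simps)
          also have "\<dots> \<le> 2 * t * (C * L2_norm M f) * (t + t)"
            using Imt t C L2_norm_nonneg[of M f] by (intro mult_left_mono) auto
          finally show ?thesis unfolding n by (simp add: power2_eq_square algebra_simps)
        qed
      qed (use t in auto)
      moreover have "3 / 4 * t^2 \<le> cmod (z0^2 - of_real (t^2))"
      proof -
        have "cmod z0 ^ 2 \<le> (t/2)^2" using t by (intro power_mono) auto
        moreover have "t^2 - cmod z0 ^ 2 \<le> cmod (of_real (t^2) - z0^2)"
          using norm_triangle_ineq2[of "complex_of_real (t^2)" "z0^2"] by (simp add: norm_power)
        ultimately show ?thesis by (simp add: norm_minus_commute power2_eq_square)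
      qed
      then have "3 / 4 * t^2 * cmod (Y z0) \<le> cmod ((z0^2 - of_real (t^2)) * Y z0)"
        unfolding norm_mult by (intro mult_right_mono) auto
      ultimately have "3 / 4 * t^2 * cmod (Y z0) \<le> 4 * t^2 * (C * L2_norm M f)" by linarith
      then have "t^2 * cmod (Y z0) \<le> t^2 * (16 / 3 * (C * L2_norm M f))" by simp
      then show ?thesis using t by (simp add: mult_le_cancel_left_pos del: mult_le_cancel_left)
    qed
    have "bounded (range Y)" unfolding bounded_iff using bound by blast
    then have "Y constant_on UNIV" by (rule Liouville_theorem[OF Y(1)])
    then have "Y \<i> = Y 0" unfolding constant_on_def by auto
    moreover have "F \<i> \<noteq> 0" using F_zero_real[of \<i>] by (auto simp: complex_is_Real_iff)
    ultimately show ?thesis using Yres F0 by simp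
  qed
  \<comment> \<open>Rewritten at parameter 0, the two coinciding solutions have sources differing by
    \<i> times the solution. So that solution vanishes, and with it its source f.\<close>
  have s1: "sl_sys 0 (\<lambda>x. \<i> * res \<i> f x + f x) (res \<i> f) (res1 \<i> f)"
    using res_sys[OF f, of \<i>] sl_sys_shift[of \<i> f "res \<i> f" "res1 \<i> f" 0] by simp
  have "sl_sys 0 (\<lambda>x. (- 1) * f x + (\<i> * res \<i> f x + f x)) (\<lambda>x. (- 1) * res 0 f x + res \<i> f x) (\<lambda>x. (- 1) * res1 0 f x + res1 \<i> f x)"
    by (rule sl_sys_lincomb[OF res_sys[OF f] s1])
  from sl_sys_zero_source(2)[OF this] const
  have "AE x in lebesgue. x \<in> {a<..<b} \<longrightarrow> \<i> * res \<i> f x = 0" by simp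
  then have "AE x in lebesgue. x \<in> {a<..<b} \<longrightarrow> res \<i> f x = 0" by eventually_elim simp
  then have "res \<i> f x = 0" if "x \<in> {a..b}" for x
    using continuous_AE_zero[OF res_cont[OF f] _ ab that] by blast
  from sl_sys_zero_source(2)[OF res_sys[OF f] this] show ?thesis unfolding AE_M_iff .
qed

end

section \<open>The inverse operator\<close>

context sl_bvp
begin

text \<open>Extension by zero outside [a,b] makes the solution of the boundary value problem unique
  as a function on the line, on which the definite description in \<open>op_inverse\<close>
  relies.\<close>

lemma T_inverse_ex1:
  assumes F0: "F 0 \<noteq> 0" and f: "f \<in> L2 M"
  shows "\<exists>!g. (g, f) \<in> T"
proof -
  define g where "g x = (if x \<in> {a..b} then res 0 f x else 0)" for x
  have s: "sl_sys 0 f g (res1 0 f)" by (rule sl_sys_cong[OF res_sys[OF f]]) (auto simp: g_def)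
  have bcg: "bc g (res1 0 f)" using res_bc[OF F0, of f] ab by (simp add: bc_def g_def)
  have "(g, f) \<in> T" unfolding T_iff using s bcg f by (auto simp: g_def)
  moreover have "h = g" if hT: "(h, f) \<in> T" for h
  proof
    fix x
    obtain h1 where h: "\<forall>x. x \<notin> {a..b} \<longrightarrow> h x = 0" "sl_sys 0 f h h1" "bc h h1" using hT unfolding T_iff by blast
    show "h x = g x"
    proof (cases "x \<in> {a..b}")
      case True
      then show ?thesis by (rule bc_unique[OF h(2,3) s bcg F0])
    next
      case False
      then show ?thesis using h(1) by (auto simp: g_def)
    qed
  qed
  ultimately show ?thesis by blast
qed

lemma T_L2: "(g, f) \<in> T \<Longrightarrow> g \<in> L2 M"
  unfolding T_iff using continuous_L2 sl_sys_continuous(1) by blast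

lemma u_inner_integral:
  assumes l: "F l = 0" and g: "g \<in> L2 M"
  shows "L2_inner M (u l) g = integral {a..b} (\<lambda>x. of_real (r x) * (u l x * g x))"
  unfolding L2_inner_M[OF u_L2 g] using u_real[OF F_zero_real[OF l]]
  by (intro Henstock_Kurzweil_Integration.integral_cong) simp

text \<open>Symmetry tested against an eigenfunction. Read backwards, the inverse divides the
  Fourier coefficient by the eigenvalue.\<close>

lemma u_inner_T:
  assumes l: "F l = 0" and gf: "(g, f) \<in> T"
  shows "l * L2_inner M (u l) g = L2_inner M (u l) f"
proof -
  obtain g1 where g: "f \<in> L2 M" "sl_sys 0 f g g1" "bc g g1" using gf unfolding T_iff by blast
  note gL = T_L2[OF gf]
  have i: "(\<lambda>x. of_real (r x) * (u l x * h x)) integrable_on {a..b}" if "h \<in> L2 M" for h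
    using absolutely_integrable_mult_bounded[OF L2_abs_int[OF that] u_cont(1)[of l]] ab
    by (intro set_lebesgue_integral_eq_integral(1)) (simp add: mult.left_commute)
  have "integral {a..b} (\<lambda>x. of_real (r x) * ((l - 0) * (u l x * g x) + 0 * g x - f x * u l x)) = 0"
    by (rule lagrange_bc[OF u_sys u_bc[OF l] g(2,3)])
  also have "(\<lambda>x. of_real (r x) * ((l - 0) * (u l x * g x) + 0 * g x - f x * u l x))
    = (\<lambda>x. l * (of_real (r x) * (u l x * g x)) - of_real (r x) * (u l x * f x))"
    by (rule ext) (simp add: algebra_simps)
  also have "integral {a..b} \<dots> = l * L2_inner M (u l) g - L2_inner M (u l) f"
    unfolding u_inner_integral[OF l gL] u_inner_integral[OF l g(1)]
    using i[OF gL] i[OF g(1)] by (simp add: Henstock_Kurzweil_Integration.integral_diff integrable_on_mult_right)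
  finally show ?thesis by simp
qed

lemma u_orthogonal:
  assumes l: "F l = 0" "F k = 0" "l \<noteq> k"
  shows "L2_inner M (u l) (u k) = 0"
proof -
  have "integral {a..b} (\<lambda>x. of_real (r x) * ((l - k) * (u l x * u k x) + 0 * u k x - 0 * u l x)) = 0"
    by (rule lagrange_bc[OF u_sys u_bc[OF l(1)] u_sys u_bc[OF l(2)]])
  also have "(\<lambda>x. of_real (r x) * ((l - k) * (u l x * u k x) + 0 * u k x - 0 * u l x))
    = (\<lambda>x. (l - k) * (of_real (r x) * (u l x * u k x)))" by (rule ext) (simp add: algebra_simps)
  also have "integral {a..b} \<dots> = (l - k) * L2_inner M (u l) (u k)"
    unfolding u_inner_integral[OF l(1) u_L2] by (rule integral_mult_right)
  finally show ?thesis using l(3) by simp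
qed

text \<open>Normalised without the cut-off of \<open>e0\<close>: as an element of L2 it is
  determined by its values on (a,b).\<close>

definition en where "en l x = of_real (1 / L2_norm M (u l)) * u l x"

lemma en_inner: "L2_inner M (en l) f = of_real (1 / L2_norm M (u l)) * L2_inner M (u l) f"
  unfolding en_def[abs_def] L2_inner_cmult_left by simp

lemma en_L2: "en l \<in> L2 M"
  unfolding en_def[abs_def] by (intro L2_cmult u_L2)

lemma en_orthonormal:
  assumes "F l = 0" "F k = 0"
  shows "L2_inner M (en l) (en k) = (if l = k then 1 else 0)"
proof -
  have e: "L2_inner M (en l) (en k) = of_real (1 / L2_norm M (u l)) * (of_real (1 / L2_norm M (u k)) * L2_inner M (u l) (u k))"
    unfolding en_inner by (simp only: en_def[abs_def] L2_inner_cmult)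
  show ?thesis
  proof (cases "l = k")
    case True
    then show ?thesis unfolding e using u_norm_pos[of l] by (simp add: L2_inner_self power2_eq_square)
  next
    case False
    then show ?thesis unfolding e by (simp add: u_orthogonal[OF assms])
  qed
qed

text \<open>Lets sums over the basis, a set of functions, be reindexed by eigenvalues: a common
  function would have inner product 1 with itself, distinct eigenvalues give 0.\<close>

lemma en_inj: "inj_on en {z. F z = 0}"
proof (rule inj_onI)
  fix l k assume lk: "l \<in> {z. F z = 0}" "k \<in> {z. F z = 0}" "en l = en k"
  then have "L2_inner M (en l) (en k) = 1" using en_orthonormal[of l l] by simp
  then show "l = k" using en_orthonormal[of l k] lk(1,2) by (simp split: if_splits)
qed

lemma en_basis:
  assumes F0: "F 0 \<noteq> 0"
  shows "orthonormal_basis M (en ` {z. F z = 0})"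
  unfolding orthonormal_basis_def
proof (intro conjI ballI impI)
  show "en ` {z. F z = 0} \<subseteq> L2 M" using en_L2 by blast
next
  fix e e' assume "e \<in> en ` {z. F z = 0}" "e' \<in> en ` {z. F z = 0}"
  then obtain l k where lk: "e = en l" "F l = 0" "e' = en k" "F k = 0" by blast
  have "en l = en k \<longleftrightarrow> l = k" using inj_on_eq_iff[OF en_inj] lk by simp
  then show "L2_inner M e e' = (if e = e' then 1 else 0)" using en_orthonormal[OF lk(2,4)] lk(1,3) by simp
next
  fix f assume f: "f \<in> L2 M" and orth: "\<forall>e\<in>en ` {z. F z = 0}. L2_inner M e f = 0"
  show "AE x in M. f x = 0"
  proof (rule eigenfunctions_complete[OF f _ F0])
    fix l assume "F l = 0"
    then have "L2_inner M (en l) f = 0" using orth by blast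
    then show "L2_inner M (u l) f = 0" unfolding en_inner using u_norm_pos[of l] by simp
  qed
qed

lemma inverse_trace:
  assumes F0: "F 0 \<noteq> 0" and s: "(\<lambda>l. 1 / cmod l) summable_on {z. F z = 0}"
  shows "has_trace M (op_inverse T) (infsum (\<lambda>l. 1 / l) {z. F z = 0})"
proof -
  let ?Z = "{z. F z = 0}"
  have real: "1 / l = complex_of_real (Re (1 / l))" if "l \<in> ?Z" for l
  proof -
    have "1 / l \<in> \<real>" using F_zero_real[of l] that by simp
    then show ?thesis by (metis of_real_Re)
  qed
  \<comment> \<open>\<open>diagonal_trace\<close> attaches the diagonal entry to the basis function,
    so the eigenvalue is recovered by inverting \<open>en\<close>.\<close>
  define \<mu> where "\<mu> e = Re (1 / inv_into ?Z en e)" for e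
  have \<mu>: "\<mu> (en l) = Re (1 / l)" if "l \<in> ?Z" for l
    by (simp only: \<mu>_def inv_into_f_f[OF en_inj that])
  have inv: "(op_inverse T f, f) \<in> T" if "f \<in> L2 M" for f
    unfolding op_inverse_def by (rule theI'[OF T_inverse_ex1[OF F0 that]])
  have "(\<lambda>l. 1 / l) summable_on ?Z"
    by (rule Infinite_Sum.abs_summable_summable) (use s in \<open>simp add: norm_divide\<close>)
  then have Res: "(\<lambda>l. Re (1 / l)) summable_on ?Z" using has_sum_Re unfolding summable_on_def by blast
  have "has_trace M (op_inverse T) (of_real (infsum \<mu> (en ` ?Z)))"
  proof (rule diagonal_trace[OF finite_measure_M en_basis[OF F0]])
    fix f assume f: "f \<in> L2 M"
    show "op_inverse T f \<in> L2 M" by (rule T_L2[OF inv[OF f]])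
    fix e assume "e \<in> en ` ?Z"
    then obtain l where l: "e = en l" "F l = 0" by blast
    then have "l \<noteq> 0" using F0 by auto
    have "L2_inner M (u l) (op_inverse T f) = 1 / l * L2_inner M (u l) f"
      using u_inner_T[OF l(2) inv[OF f]] \<open>l \<noteq> 0\<close> by (simp add: field_simps)
    then show "L2_inner M e (op_inverse T f) = of_real (\<mu> e) * L2_inner M e f"
      using real[of l] l(2) unfolding l(1) en_inner by (simp add: \<mu>)
  next
    have "(\<lambda>l. \<bar>\<mu> (en l)\<bar>) summable_on ?Z"
    proof (rule summable_on_cong[THEN iffD1, OF _ s])
      fix l assume l: "l \<in> ?Z"
      have "cmod (1 / l) = \<bar>Re (1 / l)\<bar>" by (subst real[OF l]) (rule norm_of_real)
      then show "1 / cmod l = \<bar>\<mu> (en l)\<bar>" unfolding \<mu>[OF l] by (simp add: norm_divide)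
    qed
    then show "(\<lambda>e. \<bar>\<mu> e\<bar>) summable_on en ` ?Z"
      unfolding summable_on_reindex[OF en_inj] by (simp add: o_def)
  qed
  also have "infsum \<mu> (en ` ?Z) = infsum (\<lambda>l. Re (1 / l)) ?Z"
    unfolding infsum_reindex[OF en_inj] using \<mu> by (intro infsum_cong) simp
  also have "complex_of_real \<dots> = infsum (\<lambda>l. complex_of_real (Re (1 / l))) ?Z"
    by (rule infsumI[OF has_sum_of_real[OF has_sum_infsum[OF Res]], symmetric])
  also have "\<dots> = infsum (\<lambda>l. 1 / l) ?Z" by (intro infsum_cong real[symmetric])
  finally show ?thesis .
qed

end

theorem theorem4p2:
  fixes a b \<alpha> \<beta> :: real
    and p q r :: "real \<Rightarrow> real"
    and \<theta> \<theta>1 \<phi> \<phi>1 :: "complex \<Rightarrow> real \<Rightarrow> complex"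
    and F :: "complex \<Rightarrow> complex"
    and G G1 :: "real \<Rightarrow> real \<Rightarrow> complex"
    and A B :: "nat \<Rightarrow> complex"
    and T :: "((real \<Rightarrow> complex) \<times> (real \<Rightarrow> complex)) set"
    and m0 :: nat
  assumes "a < b"
    and "p \<in> borel_measurable (lebesgue_on {a<..<b})"
    and "q \<in> borel_measurable (lebesgue_on {a<..<b})"
    and "r \<in> borel_measurable (lebesgue_on {a<..<b})"
    and "AE x in lebesgue_on {a<..<b}. r x > 0"
    and "integrable (lebesgue_on {a<..<b}) r"
    and "AE x in lebesgue_on {a<..<b}. p x > 0"
    and "integrable (lebesgue_on {a<..<b}) (\<lambda>x. 1 / p x)"
    and "integrable (lebesgue_on {a<..<b}) q"
    and "\<alpha> \<in> {0..<pi}" and "\<beta> \<in> {0..<pi}"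
    and T_def: "T = sl_T p q r a b \<alpha> \<beta>"
    and m0_def: "m0 = multiplicity_of T 0"
    and theta: "\<And>z. sl_solution p q r a b z (\<theta> z) (\<theta>1 z) \<and> \<theta> z a = 1 \<and> \<theta>1 z a = 0"
    and phi: "\<And>z. sl_solution p q r a b z (\<phi> z) (\<phi>1 z) \<and> \<phi> z a = 0 \<and> \<phi>1 z a = 1"
    and F_def: "\<And>z. F z =
          cos (complex_of_real \<alpha>) *
            (- sin (complex_of_real \<beta>) * \<phi>1 z b + cos (complex_of_real \<beta>) * \<phi> z b)
        - sin (complex_of_real \<alpha>) *
            (- sin (complex_of_real \<beta>) * \<theta>1 z b + cos (complex_of_real \<beta>) * \<theta> z b)"
    and G_def: "G = sl_kernel (\<theta> 0) (\<phi> 0) (\<theta> 0) (\<phi> 0)"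
    and G1_def: "G1 = sl_kernel (\<theta> 0) (\<phi> 0) (\<theta>1 0) (\<phi>1 0)"
    and A_def: "\<And>k. A k =
          cos (complex_of_real \<alpha>) *
            (cos (complex_of_real \<beta>) * sl_iter r a G (\<phi> 0) k b
             - sin (complex_of_real \<beta>) * sl_iter1 r a G G1 (\<phi> 0) (\<phi>1 0) k b)
        - sin (complex_of_real \<alpha>) *
            (cos (complex_of_real \<beta>) * sl_iter r a G (\<theta> 0) k b
             - sin (complex_of_real \<beta>) * sl_iter1 r a G G1 (\<theta> 0) (\<theta>1 0) k b)"
    and B_1: "B 1 = A (1 + m0) / A m0"
    and B_rec: "\<And>j. j \<ge> 2 \<Longrightarrow> B j = A (j + m0) / A m0
          - (\<Sum>l = 1..j - 1. of_nat l / of_nat j * (A (j - l + m0) / A m0) * B l)"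
  shows "m0 \<in> {0, 1} \<and> A m0 \<noteq> 0 \<and>
    (\<forall>n::nat. n \<ge> 1 \<longrightarrow>
        zeta_term (of_nat n) T summable_on (eigenvalues T - {0}) \<and>
        spectral_zeta (of_nat n) T = - residue (\<lambda>z. z powi (- int n) * (deriv F z / F z)) 0 \<and>
        - residue (\<lambda>z. z powi (- int n) * (deriv F z / F z)) 0 = - of_nat n * B n) \<and>
    (0 \<notin> eigenvalues T \<longrightarrow>
        (\<forall>f \<in> L2 (weight_measure r a b). \<exists>!g. (g, f) \<in> T) \<and>
        has_trace (weight_measure r a b) (op_inverse T) (spectral_zeta 1 T) \<and>
        spectral_zeta 1 T = - (A 1 / A 0))"
proof -
  interpret sl_coeffs p q r a b
    by (rule sl_coeffs.intro) (fact assms)+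
  have th: "sl_sys z (\<lambda>_. 0) (\<theta> z) (\<theta>1 z)" "\<theta> z a = 1" "\<theta>1 z a = 0" for z
    using theta[of z] by (simp_all add: sl_solution_iff)
  have ph: "sl_sys z (\<lambda>_. 0) (\<phi> z) (\<phi>1 z)" "\<phi> z a = 0" "\<phi>1 z a = 1" for z
    using phi[of z] by (simp_all add: sl_solution_iff)
  interpret S: sl_bvp p q r a b \<theta> \<theta>1 \<phi> \<phi>1 \<alpha> \<beta>
    by unfold_locales (fact th ph)+
  have T: "T = S.T" unfolding T_def S.T_def ..
  have FS: "F = S.F"
    by (rule ext) (simp add: F_def S.F_def S.u_def S.u1_def cos_of_real sin_of_real algebra_simps)
  have GS: "G = S.G" "G1 = S.G1" unfolding G_def G1_def S.G_def S.G1_def by (rule refl)+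
  \<comment> \<open>The coefficients \<open>A\<close> are the boundary combinations at
    \<open>b\<close> of those of \<phi> and \<theta>, whose series converge for every z.\<close>
  have Fser: "(\<lambda>k. A k * z ^ k) sums S.F z" for z
  proof -
    have b: "b \<in> {a..b}" using \<open>a < b\<close> by simp
    have p: "(\<lambda>k. z ^ k * sl_iter r a G (\<phi> 0) k b) sums \<phi> z b" "(\<lambda>k. z ^ k * sl_iter1 r a G G1 (\<phi> 0) (\<phi>1 0) k b) sums \<phi>1 z b"
      unfolding GS using S.sl_series[OF S.ph(1) S.ph(1) _ _ b] by (simp_all add: S.ph)
    have t: "(\<lambda>k. z ^ k * sl_iter r a G (\<theta> 0) k b) sums \<theta> z b" "(\<lambda>k. z ^ k * sl_iter1 r a G G1 (\<theta> 0) (\<theta>1 0) k b) sums \<theta>1 z b"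
      unfolding GS using S.sl_series[OF S.th(1) S.th(1) _ _ b] by (simp_all add: S.th)
    have "(\<lambda>k. cos (complex_of_real \<alpha>) * (cos (complex_of_real \<beta>) * (z ^ k * sl_iter r a G (\<phi> 0) k b) - sin (complex_of_real \<beta>) * (z ^ k * sl_iter1 r a G G1 (\<phi> 0) (\<phi>1 0) k b))
       - sin (complex_of_real \<alpha>) * (cos (complex_of_real \<beta>) * (z ^ k * sl_iter r a G (\<theta> 0) k b) - sin (complex_of_real \<beta>) * (z ^ k * sl_iter1 r a G G1 (\<theta> 0) (\<theta>1 0) k b)))
      sums (cos (complex_of_real \<alpha>) * (cos (complex_of_real \<beta>) * \<phi> z b - sin (complex_of_real \<beta>) * \<phi>1 z b)
       - sin (complex_of_real \<alpha>) * (cos (complex_of_real \<beta>) * \<theta> z b - sin (complex_of_real \<beta>) * \<theta>1 z b))"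
      by (intro sums_diff sums_mult p t)
    moreover have "(\<lambda>k. cos (complex_of_real \<alpha>) * (cos (complex_of_real \<beta>) * (z ^ k * sl_iter r a G (\<phi> 0) k b) - sin (complex_of_real \<beta>) * (z ^ k * sl_iter1 r a G G1 (\<phi> 0) (\<phi>1 0) k b))
       - sin (complex_of_real \<alpha>) * (cos (complex_of_real \<beta>) * (z ^ k * sl_iter r a G (\<theta> 0) k b) - sin (complex_of_real \<beta>) * (z ^ k * sl_iter1 r a G G1 (\<theta> 0) (\<theta>1 0) k b)))
      = (\<lambda>k. A k * z ^ k)"
      by (rule ext) (simp add: A_def algebra_simps)
    moreover have "cos (complex_of_real \<alpha>) * (cos (complex_of_real \<beta>) * \<phi> z b - sin (complex_of_real \<beta>) * \<phi>1 z b)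
       - sin (complex_of_real \<alpha>) * (cos (complex_of_real \<beta>) * \<theta> z b - sin (complex_of_real \<beta>) * \<theta>1 z b) = S.F z"
      unfolding FS[symmetric] F_def by simp
    ultimately show ?thesis by simp
  qed
  obtain C K where K: "K \<ge> 0" "\<And>z. cmod z \<ge> 1 \<Longrightarrow> cmod (S.F z) \<le> C * exp (K * sqrt (cmod z))"
    using S.F_growth by blast
  \<comment> \<open>The multiplicity of 0 is the order of the zero of F at 0, the form of shift that
    \<open>entire_power_sums\<close> expects.\<close>
  have m0: "m0 = (if S.F 0 = 0 then 1 else 0)" unfolding m0_def T by (rule S.multiplicity_eq)
  note sums = entire_power_sums[OF Fser K(2) K(1) S.F_simple m0]
  have Am0: "A m0 \<noteq> 0" by (rule sums(2))
  have summ: "(\<lambda>w. 1 / cmod w) summable_on ({z. S.F z = 0} - {0})" by (rule sums(3))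
  have hs: "((\<lambda>w. 1 / w ^ n) has_sum (- residue (\<lambda>z. z powi (- int n) * (deriv S.F z / S.F z)) 0)) ({z. S.F z = 0} - {0})"
    if "n \<ge> 1" for n
    by (rule sums(4)) (use that in auto)
  have ev: "eigenvalues T = {z. S.F z = 0}" unfolding T by (rule S.eigenvalues_eq)
  \<comment> \<open>Every nonzero eigenvalue has multiplicity 1, and for a natural exponent the
    complex power is the ordinary one.\<close>
  have zt: "zeta_term (of_nat n) T z = 1 / z ^ n" if "z \<in> eigenvalues T - {0}" for n z
    using that unfolding ev
    by (simp add: zeta_term_def T S.multiplicity_eq powr_minus powr_nat' inverse_eq_divide)
  have zeta: "(zeta_term (of_nat n) T has_sum (- residue (\<lambda>z. z powi (- int n) * (deriv F z / F z)) 0)) (eigenvalues T - {0})"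
    if "n \<ge> 1" for n
  proof -
    have "((\<lambda>w. 1 / w ^ n) has_sum (- residue (\<lambda>z. z powi (- int n) * (deriv F z / F z)) 0)) (eigenvalues T - {0})"
      unfolding FS ev by (rule hs[OF that])
    then show ?thesis by (rule has_sum_cong[THEN iffD2, rotated]) (rule zt)
  qed
  have res: "residue (\<lambda>z. z powi (- int n) * (deriv F z / F z)) 0 = of_nat n * B n" if "n \<ge> 1" for n
    unfolding FS by (rule sums(5)) (use B_1 B_rec that in auto)
  have sz: "spectral_zeta (of_nat n) T = - residue (\<lambda>z. z powi (- int n) * (deriv F z / F z)) 0" if "n \<ge> 1" for n
    unfolding spectral_zeta_def by (rule infsumI[OF zeta[OF that]])
  have inv: "(\<forall>f\<in>L2 M. \<exists>!g. (g, f) \<in> T) \<and> has_trace M (op_inverse T) (spectral_zeta 1 T) \<and> spectral_zeta 1 T = - (A 1 / A 0)"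
    if "0 \<notin> eigenvalues T"
  proof -
    have F0: "S.F 0 \<noteq> 0" using that by (simp add: ev)
    then have Z: "{z. S.F z = 0} - {0} = {z. S.F z = 0}" by auto
    have "spectral_zeta 1 T = infsum (\<lambda>l. 1 / l) {z. S.F z = 0}"
      unfolding spectral_zeta_def using zt[of _ 1] by (intro infsum_cong_neutral) (simp_all add: ev Z)
    moreover have "has_trace M (op_inverse T) (infsum (\<lambda>l. 1 / l) {z. S.F z = 0})"
      unfolding T using S.inverse_trace[OF F0] summ by (simp only: Z)
    \<comment> \<open>If 0 is not an eigenvalue the shift is 0, so the case n = 1 of the recursion
      gives A 1 / A 0.\<close>
    moreover have "spectral_zeta 1 T = - (A 1 / A 0)"
      using sz[of 1] res[of 1] B_1 m0 F0 by simp
    ultimately show ?thesis using S.T_inverse_ex1[OF F0] unfolding T by simp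
  qed
  have m01: "m0 \<in> {0, 1}" using m0 by simp
  show ?thesis
  proof (intro conjI allI impI)
    fix n :: nat assume n: "n \<ge> 1"
    show "zeta_term (of_nat n) T summable_on (eigenvalues T - {0})" by (rule has_sum_imp_summable[OF zeta[OF n]])
    show "- residue (\<lambda>z. z powi (- int n) * (deriv F z / F z)) 0 = - of_nat n * B n" by (simp only: res[OF n] mult_minus_left)
  qed (use m01 Am0 sz inv in blast)+
qed

end
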